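(* Let $\mathcal{C}$ be the monoidal category of finite dimensional complex $\mathfrak{sl}_2$-modules. For $\mu\in\mathbb{C}\setminus\mathbb{Z}$, let $\mathcal{N}_1(\mu)$ be the additive closure of all simple highest weight $\mathfrak{sl}_2$-modules $L(\lambda)$ such that $\lambda-\mu\in\mathbb{Z}$, viewed as a $\mathcal{C}$-module category via tensoring over $\mathbb{C}$. Let $\mu_1,\mu_2\in\mathbb{C}\setminus\mathbb{Z}$. Then $\mathcal{N}_1(\mu_1)$ and $\mathcal{N}_1(\mu_2)$ are equivalent as $\mathcal{C}$-module categories if and only if $\mu_2\in\pm\mu_1+\mathbb{Z}$.
   Context: Everything is over $\mathbb{C}$. $\mathcal{C}$ is the monoidal category (under $\otimes_{\mathbb{C}}$) of finite dimensional $\mathfrak{sl}_2$-modules. For $\lambda\in\mathbb{C}$, $L(\lambda)$ is the simple highest weight $\mathfrak{sl}_2$-module whose highest weight ($h$-eigenvalue) is $\lambda$. The additive closure of a set of modules is the full subcategory of modules isomorphic to direct summands of finite direct sums of them. *)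

theory Defs
  imports "HOL-Analysis.Analysis" "HOL-Library.Function_Algebras" "HOL-Library.Nat_Bijection"
begin

section \<open>Linear, monoidal and module categories\<close>

text \<open>
  Hom-sets of distinct pairs of objects are required to be disjoint (see
  \<open>linear_category\<close> below), so that composition, addition and functors can act on
  bare arrows.
\<close>

record ('o, 'a) category =
  Obj :: "'o set"
  Hom :: "'o \<Rightarrow> 'o \<Rightarrow> 'a set"
  Idn :: "'o \<Rightarrow> 'a"
  Comp :: "'a \<Rightarrow> 'a \<Rightarrow> 'a"  (infixr "\<cdot>\<index>" 70)
  Add :: "'a \<Rightarrow> 'a \<Rightarrow> 'a"  (infixl "\<oplus>\<index>" 65)
  Scale :: "complex \<Rightarrow> 'a \<Rightarrow> 'a"  (infixr "\<star>\<index>" 72)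

record ('o, 'a) monoidal_category = "('o, 'a) category" +
  Unit :: 'o
  TensO :: "'o \<Rightarrow> 'o \<Rightarrow> 'o"  (infixl "\<odot>\<index>" 75)
  TensA :: "'a \<Rightarrow> 'a \<Rightarrow> 'a"  (infixl "\<otimes>\<index>" 75)
  Assoc :: "'o \<Rightarrow> 'o \<Rightarrow> 'o \<Rightarrow> 'a"
  LUnit :: "'o \<Rightarrow> 'a"
  RUnit :: "'o \<Rightarrow> 'a"

text \<open>
  In a module category with objects \<open>'p\<close> and arrows \<open>'b\<close> over a monoidal category with objects
  \<open>'o\<close> and arrows \<open>'a\<close>, \<open>MAssoc X Y m\<close> is the associator from \<open>(X \<otimes> Y) \<otimes> m\<close> to
  \<open>X \<otimes> (Y \<otimes> m)\<close>, and \<open>MUnit m\<close> the unitor from \<open>\<one> \<otimes> m\<close> to \<open>m\<close>.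
\<close>

record ('o, 'a, 'p, 'b) module_category = "('p, 'b) category" +
  ActO :: "'o \<Rightarrow> 'p \<Rightarrow> 'p"  (infixr "\<triangleright>\<index>" 74)
  ActA :: "'a \<Rightarrow> 'b \<Rightarrow> 'b"  (infixr "\<rhd>\<index>" 74)
  MAssoc :: "'o \<Rightarrow> 'o \<Rightarrow> 'p \<Rightarrow> 'b"
  MUnit :: "'p \<Rightarrow> 'b"

definition iso_arrows :: "('o, 'a, 'z) category_scheme \<Rightarrow> 'o \<Rightarrow> 'o \<Rightarrow> 'a set" where
  "iso_arrows C a b =
    {f \<in> Hom C a b. \<exists>g \<in> Hom C b a. g \<cdot>\<^bsub>C\<^esub> f = Idn C a \<and> f \<cdot>\<^bsub>C\<^esub> g = Idn C b}"

locale linear_category =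
  fixes C :: "('o, 'a, 'z) category_scheme" (structure)
  assumes Hom_disjoint:
      "\<lbrakk>f \<in> Hom C a b; f \<in> Hom C a' b'; {a, b, a', b'} \<subseteq> Obj C\<rbrakk> \<Longrightarrow> a = a' \<and> b = b'"
    and Id_in: "a \<in> Obj C \<Longrightarrow> Idn C a \<in> Hom C a a"
    and Comp_in: "\<lbrakk>f \<in> Hom C a b; g \<in> Hom C b c; {a, b, c} \<subseteq> Obj C\<rbrakk> \<Longrightarrow> g \<cdot> f \<in> Hom C a c"
    and Comp_Id: "\<lbrakk>f \<in> Hom C a b; {a, b} \<subseteq> Obj C\<rbrakk> \<Longrightarrow> f \<cdot> Idn C a = f"
    and Id_Comp: "\<lbrakk>f \<in> Hom C a b; {a, b} \<subseteq> Obj C\<rbrakk> \<Longrightarrow> Idn C b \<cdot> f = f"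
    and Comp_assoc: "\<lbrakk>f \<in> Hom C a b; g \<in> Hom C b c; h \<in> Hom C c d; {a, b, c, d} \<subseteq> Obj C\<rbrakk>
      \<Longrightarrow> (h \<cdot> g) \<cdot> f = h \<cdot> (g \<cdot> f)"
    and Add_in: "\<lbrakk>f \<in> Hom C a b; g \<in> Hom C a b; {a, b} \<subseteq> Obj C\<rbrakk> \<Longrightarrow> f \<oplus> g \<in> Hom C a b"
    and Add_assoc: "\<lbrakk>f \<in> Hom C a b; g \<in> Hom C a b; h \<in> Hom C a b; {a, b} \<subseteq> Obj C\<rbrakk>
      \<Longrightarrow> (f \<oplus> g) \<oplus> h = f \<oplus> (g \<oplus> h)"
    and Add_commute: "\<lbrakk>f \<in> Hom C a b; g \<in> Hom C a b; {a, b} \<subseteq> Obj C\<rbrakk> \<Longrightarrow> f \<oplus> g = g \<oplus> f"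
    and Add_zero_minus: "{a, b} \<subseteq> Obj C \<Longrightarrow>
      \<exists>z \<in> Hom C a b. \<forall>f \<in> Hom C a b. z \<oplus> f = f \<and> (\<exists>g \<in> Hom C a b. f \<oplus> g = z)"
    and Scale_in: "\<lbrakk>f \<in> Hom C a b; {a, b} \<subseteq> Obj C\<rbrakk> \<Longrightarrow> x \<star> f \<in> Hom C a b"
    and Scale_Add: "\<lbrakk>f \<in> Hom C a b; g \<in> Hom C a b; {a, b} \<subseteq> Obj C\<rbrakk>
      \<Longrightarrow> x \<star> (f \<oplus> g) = x \<star> f \<oplus> x \<star> g"
    and add_Scale: "\<lbrakk>f \<in> Hom C a b; {a, b} \<subseteq> Obj C\<rbrakk> \<Longrightarrow> (x + y) \<star> f = x \<star> f \<oplus> y \<star> f"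
    and mult_Scale: "\<lbrakk>f \<in> Hom C a b; {a, b} \<subseteq> Obj C\<rbrakk> \<Longrightarrow> (x * y) \<star> f = x \<star> (y \<star> f)"
    and one_Scale: "\<lbrakk>f \<in> Hom C a b; {a, b} \<subseteq> Obj C\<rbrakk> \<Longrightarrow> 1 \<star> f = f"
    and Comp_Add: "\<lbrakk>f \<in> Hom C a b; f' \<in> Hom C a b; g \<in> Hom C b c; {a, b, c} \<subseteq> Obj C\<rbrakk>
      \<Longrightarrow> g \<cdot> (f \<oplus> f') = g \<cdot> f \<oplus> g \<cdot> f'"
    and Add_Comp: "\<lbrakk>f \<in> Hom C a b; g \<in> Hom C b c; g' \<in> Hom C b c; {a, b, c} \<subseteq> Obj C\<rbrakk>
      \<Longrightarrow> (g \<oplus> g') \<cdot> f = g \<cdot> f \<oplus> g' \<cdot> f"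
    and Comp_Scale: "\<lbrakk>f \<in> Hom C a b; g \<in> Hom C b c; {a, b, c} \<subseteq> Obj C\<rbrakk>
      \<Longrightarrow> g \<cdot> (x \<star> f) = x \<star> (g \<cdot> f)"
    and Scale_Comp: "\<lbrakk>f \<in> Hom C a b; g \<in> Hom C b c; {a, b, c} \<subseteq> Obj C\<rbrakk>
      \<Longrightarrow> (x \<star> g) \<cdot> f = x \<star> (g \<cdot> f)"

definition linear_functor ::
  "('o, 'a, 'z) category_scheme \<Rightarrow> ('p, 'b, 'y) category_scheme \<Rightarrow> ('o \<Rightarrow> 'p) \<Rightarrow> ('a \<Rightarrow> 'b) \<Rightarrow> bool"
  where
  "linear_functor C D Fo Fa \<longleftrightarrow>
    (\<forall>a \<in> Obj C. Fo a \<in> Obj D \<and> Fa (Idn C a) = Idn D (Fo a)) \<and>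
    (\<forall>a \<in> Obj C. \<forall>b \<in> Obj C. \<forall>f \<in> Hom C a b. Fa f \<in> Hom D (Fo a) (Fo b) \<and>
      (\<forall>x. Fa (x \<star>\<^bsub>C\<^esub> f) = x \<star>\<^bsub>D\<^esub> Fa f) \<and>
      (\<forall>g \<in> Hom C a b. Fa (f \<oplus>\<^bsub>C\<^esub> g) = Fa f \<oplus>\<^bsub>D\<^esub> Fa g) \<and>
      (\<forall>c \<in> Obj C. \<forall>g \<in> Hom C b c. Fa (g \<cdot>\<^bsub>C\<^esub> f) = Fa g \<cdot>\<^bsub>D\<^esub> Fa f))"

definition natural_iso ::
  "('o, 'a, 'z) category_scheme \<Rightarrow> ('p, 'b, 'y) category_scheme \<Rightarrow>
    ('o \<Rightarrow> 'p) \<Rightarrow> ('a \<Rightarrow> 'b) \<Rightarrow> ('o \<Rightarrow> 'p) \<Rightarrow> ('a \<Rightarrow> 'b) \<Rightarrow> ('o \<Rightarrow> 'b) \<Rightarrow> bool"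
  where
  "natural_iso C D Fo Fa Go Ga \<eta> \<longleftrightarrow>
    (\<forall>a \<in> Obj C. \<eta> a \<in> iso_arrows D (Fo a) (Go a)) \<and>
    (\<forall>a \<in> Obj C. \<forall>b \<in> Obj C. \<forall>f \<in> Hom C a b. \<eta> b \<cdot>\<^bsub>D\<^esub> Fa f = Ga f \<cdot>\<^bsub>D\<^esub> \<eta> a)"

definition equivalence_functor ::
  "('o, 'a, 'z) category_scheme \<Rightarrow> ('p, 'b, 'y) category_scheme \<Rightarrow> ('o \<Rightarrow> 'p) \<Rightarrow> ('a \<Rightarrow> 'b) \<Rightarrow> bool"
  where
  "equivalence_functor C D Fo Fa \<longleftrightarrow> linear_functor C D Fo Fa \<and>
    (\<exists>Go Ga \<eta> \<epsilon>. linear_functor D C Go Ga \<and>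
      natural_iso C C id id (Go \<circ> Fo) (Ga \<circ> Fa) \<eta> \<and>
      natural_iso D D (Fo \<circ> Go) (Fa \<circ> Ga) id id \<epsilon>)"

locale monoidal_linear_category = linear_category C
  for C :: "('o, 'a, 'z) monoidal_category_scheme" (structure) +
  assumes Unit_in: "Unit C \<in> Obj C"
    and TensO_in: "\<lbrakk>X \<in> Obj C; Y \<in> Obj C\<rbrakk> \<Longrightarrow> X \<odot> Y \<in> Obj C"
    and TensA_in: "\<lbrakk>f \<in> Hom C X X'; g \<in> Hom C Y Y'; {X, X', Y, Y'} \<subseteq> Obj C\<rbrakk>
      \<Longrightarrow> f \<otimes> g \<in> Hom C (X \<odot> Y) (X' \<odot> Y')"
    and TensA_Id: "\<lbrakk>X \<in> Obj C; Y \<in> Obj C\<rbrakk> \<Longrightarrow> Idn C X \<otimes> Idn C Y = Idn C (X \<odot> Y)"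
    and TensA_Comp: "\<lbrakk>f \<in> Hom C X X'; f' \<in> Hom C X' X''; g \<in> Hom C Y Y'; g' \<in> Hom C Y' Y'';
        {X, X', X'', Y, Y', Y''} \<subseteq> Obj C\<rbrakk>
      \<Longrightarrow> (f' \<cdot> f) \<otimes> (g' \<cdot> g) = (f' \<otimes> g') \<cdot> (f \<otimes> g)"
    and TensA_Add_left: "\<lbrakk>f \<in> Hom C X X'; f' \<in> Hom C X X'; g \<in> Hom C Y Y'; {X, X', Y, Y'} \<subseteq> Obj C\<rbrakk>
      \<Longrightarrow> (f \<oplus> f') \<otimes> g = (f \<otimes> g) \<oplus> (f' \<otimes> g)"
    and TensA_Add_right: "\<lbrakk>f \<in> Hom C X X'; g \<in> Hom C Y Y'; g' \<in> Hom C Y Y'; {X, X', Y, Y'} \<subseteq> Obj C\<rbrakk>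
      \<Longrightarrow> f \<otimes> (g \<oplus> g') = (f \<otimes> g) \<oplus> (f \<otimes> g')"
    and TensA_Scale_left: "\<lbrakk>f \<in> Hom C X X'; g \<in> Hom C Y Y'; {X, X', Y, Y'} \<subseteq> Obj C\<rbrakk>
      \<Longrightarrow> (x \<star> f) \<otimes> g = x \<star> (f \<otimes> g)"
    and TensA_Scale_right: "\<lbrakk>f \<in> Hom C X X'; g \<in> Hom C Y Y'; {X, X', Y, Y'} \<subseteq> Obj C\<rbrakk>
      \<Longrightarrow> f \<otimes> (x \<star> g) = x \<star> (f \<otimes> g)"
    and Assoc_iso: "\<lbrakk>X \<in> Obj C; Y \<in> Obj C; Z \<in> Obj C\<rbrakk>
      \<Longrightarrow> Assoc C X Y Z \<in> iso_arrows C ((X \<odot> Y) \<odot> Z) (X \<odot> (Y \<odot> Z))"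
    and Assoc_natural: "\<lbrakk>f \<in> Hom C X X'; g \<in> Hom C Y Y'; h \<in> Hom C Z Z';
        {X, X', Y, Y', Z, Z'} \<subseteq> Obj C\<rbrakk>
      \<Longrightarrow> Assoc C X' Y' Z' \<cdot> ((f \<otimes> g) \<otimes> h) = (f \<otimes> (g \<otimes> h)) \<cdot> Assoc C X Y Z"
    and LUnit_iso: "X \<in> Obj C \<Longrightarrow> LUnit C X \<in> iso_arrows C (Unit C \<odot> X) X"
    and LUnit_natural: "\<lbrakk>f \<in> Hom C X Y; {X, Y} \<subseteq> Obj C\<rbrakk>
      \<Longrightarrow> LUnit C Y \<cdot> (Idn C (Unit C) \<otimes> f) = f \<cdot> LUnit C X"
    and RUnit_iso: "X \<in> Obj C \<Longrightarrow> RUnit C X \<in> iso_arrows C (X \<odot> Unit C) X"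
    and RUnit_natural: "\<lbrakk>f \<in> Hom C X Y; {X, Y} \<subseteq> Obj C\<rbrakk>
      \<Longrightarrow> RUnit C Y \<cdot> (f \<otimes> Idn C (Unit C)) = f \<cdot> RUnit C X"
    and pentagon: "\<lbrakk>W \<in> Obj C; X \<in> Obj C; Y \<in> Obj C; Z \<in> Obj C\<rbrakk> \<Longrightarrow>
      (Idn C W \<otimes> Assoc C X Y Z) \<cdot> Assoc C W (X \<odot> Y) Z \<cdot> (Assoc C W X Y \<otimes> Idn C Z)
      = Assoc C W X (Y \<odot> Z) \<cdot> Assoc C (W \<odot> X) Y Z"
    and triangle: "\<lbrakk>X \<in> Obj C; Y \<in> Obj C\<rbrakk> \<Longrightarrow>
      (Idn C X \<otimes> LUnit C Y) \<cdot> Assoc C X (Unit C) Y = RUnit C X \<otimes> Idn C Y"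

locale linear_module_category = C: monoidal_linear_category C + M: linear_category M
  for C :: "('o, 'a, 'z) monoidal_category_scheme"
    and M :: "('o, 'a, 'p, 'b, 'y) module_category_scheme" (structure) +
  assumes ActO_in: "\<lbrakk>X \<in> Obj C; m \<in> Obj M\<rbrakk> \<Longrightarrow> X \<triangleright> m \<in> Obj M"
    and ActA_in: "\<lbrakk>f \<in> Hom C X X'; p \<in> Hom M m m'; {X, X'} \<subseteq> Obj C; {m, m'} \<subseteq> Obj M\<rbrakk>
      \<Longrightarrow> f \<rhd> p \<in> Hom M (X \<triangleright> m) (X' \<triangleright> m')"
    and ActA_Id: "\<lbrakk>X \<in> Obj C; m \<in> Obj M\<rbrakk> \<Longrightarrow> Idn C X \<rhd> Idn M m = Idn M (X \<triangleright> m)"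
    and ActA_Comp: "\<lbrakk>f \<in> Hom C X X'; f' \<in> Hom C X' X''; p \<in> Hom M m m'; p' \<in> Hom M m' m'';
        {X, X', X''} \<subseteq> Obj C; {m, m', m''} \<subseteq> Obj M\<rbrakk>
      \<Longrightarrow> (f' \<cdot>\<^bsub>C\<^esub> f) \<rhd> (p' \<cdot> p) = (f' \<rhd> p') \<cdot> (f \<rhd> p)"
    and ActA_Add_left: "\<lbrakk>f \<in> Hom C X X'; f' \<in> Hom C X X'; p \<in> Hom M m m';
        {X, X'} \<subseteq> Obj C; {m, m'} \<subseteq> Obj M\<rbrakk>
      \<Longrightarrow> (f \<oplus>\<^bsub>C\<^esub> f') \<rhd> p = (f \<rhd> p) \<oplus> (f' \<rhd> p)"
    and ActA_Add_right: "\<lbrakk>f \<in> Hom C X X'; p \<in> Hom M m m'; p' \<in> Hom M m m';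
        {X, X'} \<subseteq> Obj C; {m, m'} \<subseteq> Obj M\<rbrakk>
      \<Longrightarrow> f \<rhd> (p \<oplus> p') = (f \<rhd> p) \<oplus> (f \<rhd> p')"
    and ActA_Scale_left: "\<lbrakk>f \<in> Hom C X X'; p \<in> Hom M m m'; {X, X'} \<subseteq> Obj C; {m, m'} \<subseteq> Obj M\<rbrakk>
      \<Longrightarrow> (x \<star>\<^bsub>C\<^esub> f) \<rhd> p = x \<star> (f \<rhd> p)"
    and ActA_Scale_right: "\<lbrakk>f \<in> Hom C X X'; p \<in> Hom M m m'; {X, X'} \<subseteq> Obj C; {m, m'} \<subseteq> Obj M\<rbrakk>
      \<Longrightarrow> f \<rhd> (x \<star> p) = x \<star> (f \<rhd> p)"
    and MAssoc_iso: "\<lbrakk>X \<in> Obj C; Y \<in> Obj C; m \<in> Obj M\<rbrakk>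
      \<Longrightarrow> MAssoc M X Y m \<in> iso_arrows M ((X \<odot>\<^bsub>C\<^esub> Y) \<triangleright> m) (X \<triangleright> Y \<triangleright> m)"
    and MAssoc_natural: "\<lbrakk>f \<in> Hom C X X'; g \<in> Hom C Y Y'; p \<in> Hom M m m';
        {X, X', Y, Y'} \<subseteq> Obj C; {m, m'} \<subseteq> Obj M\<rbrakk>
      \<Longrightarrow> MAssoc M X' Y' m' \<cdot> ((f \<otimes>\<^bsub>C\<^esub> g) \<rhd> p) = (f \<rhd> g \<rhd> p) \<cdot> MAssoc M X Y m"
    and MUnit_iso: "m \<in> Obj M \<Longrightarrow> MUnit M m \<in> iso_arrows M (Unit C \<triangleright> m) m"
    and MUnit_natural: "\<lbrakk>p \<in> Hom M m n; {m, n} \<subseteq> Obj M\<rbrakk>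
      \<Longrightarrow> MUnit M n \<cdot> (Idn C (Unit C) \<rhd> p) = p \<cdot> MUnit M m"
    and module_pentagon: "\<lbrakk>X \<in> Obj C; Y \<in> Obj C; Z \<in> Obj C; m \<in> Obj M\<rbrakk> \<Longrightarrow>
      (Idn C X \<rhd> MAssoc M Y Z m) \<cdot> MAssoc M X (Y \<odot>\<^bsub>C\<^esub> Z) m \<cdot> (Assoc C X Y Z \<rhd> Idn M m)
      = MAssoc M X Y (Z \<triangleright> m) \<cdot> MAssoc M (X \<odot>\<^bsub>C\<^esub> Y) Z m"
    and module_triangle: "\<lbrakk>X \<in> Obj C; m \<in> Obj M\<rbrakk> \<Longrightarrow>
      (Idn C X \<rhd> MUnit M m) \<cdot> MAssoc M X (Unit C) m = RUnit C X \<rhd> Idn M m"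

text \<open>The structure isomorphism \<open>s X m\<close> goes from \<open>F (X \<otimes> m)\<close> to \<open>X \<otimes> F m\<close>.\<close>

definition module_functor ::
  "('o, 'a, 'z) monoidal_category_scheme \<Rightarrow>
    ('o, 'a, 'p, 'b, 'y) module_category_scheme \<Rightarrow> ('o, 'a, 'q, 'c, 'x) module_category_scheme \<Rightarrow>
    ('p \<Rightarrow> 'q) \<Rightarrow> ('b \<Rightarrow> 'c) \<Rightarrow> ('o \<Rightarrow> 'p \<Rightarrow> 'c) \<Rightarrow> bool"
  where
  "module_functor C M N Fo Fa s \<longleftrightarrow>
    linear_functor M N Fo Fa \<and>
    (\<forall>X \<in> Obj C. \<forall>m \<in> Obj M. s X m \<in> iso_arrows N (Fo (X \<triangleright>\<^bsub>M\<^esub> m)) (X \<triangleright>\<^bsub>N\<^esub> Fo m)) \<and>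
    (\<forall>X \<in> Obj C. \<forall>Y \<in> Obj C. \<forall>m \<in> Obj M. \<forall>n \<in> Obj M. \<forall>f \<in> Hom C X Y. \<forall>g \<in> Hom M m n.
      s Y n \<cdot>\<^bsub>N\<^esub> Fa (f \<rhd>\<^bsub>M\<^esub> g) = (f \<rhd>\<^bsub>N\<^esub> Fa g) \<cdot>\<^bsub>N\<^esub> s X m) \<and>
    (\<forall>X \<in> Obj C. \<forall>Y \<in> Obj C. \<forall>m \<in> Obj M.
      (Idn C X \<rhd>\<^bsub>N\<^esub> s Y m) \<cdot>\<^bsub>N\<^esub> s X (Y \<triangleright>\<^bsub>M\<^esub> m) \<cdot>\<^bsub>N\<^esub> Fa (MAssoc M X Y m)
      = MAssoc N X Y (Fo m) \<cdot>\<^bsub>N\<^esub> s (X \<odot>\<^bsub>C\<^esub> Y) m) \<and>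
    (\<forall>m \<in> Obj M. MUnit N (Fo m) \<cdot>\<^bsub>N\<^esub> s (Unit C) m = Fa (MUnit M m))"

definition module_equivalent ::
  "('o, 'a, 'z) monoidal_category_scheme \<Rightarrow>
    ('o, 'a, 'p, 'b, 'y) module_category_scheme \<Rightarrow> ('o, 'a, 'q, 'c, 'x) module_category_scheme \<Rightarrow> bool"
  where
  "module_equivalent C M N \<longleftrightarrow>
    linear_module_category C M \<and> linear_module_category C N \<and>
    (\<exists>Fo Fa s. module_functor C M N Fo Fa s \<and> equivalence_functor M N Fo Fa)"


section \<open>Vector spaces and their tensor products\<close>

text \<open>
  All vector spaces are subspaces of the space of complex sequences, which contains a copy of every
  complex vector space of at most countable dimension.  Pairing the indices identifies the
  (injective) image of \<open>V \<otimes> W\<close> in the space of double sequences with a space of sequences again,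
  so that this universe is closed under tensor products.
\<close>

type_synonym cseq = "nat \<Rightarrow> complex"

definition cscale :: "complex \<Rightarrow> cseq \<Rightarrow> cseq" where
  "cscale c v = (\<lambda>n. c * v n)"

global_interpretation cs: vector_space cscale
  by unfold_locales (auto simp: cscale_def fun_eq_iff algebra_simps)

definition linear_on :: "cseq set \<Rightarrow> (cseq \<Rightarrow> cseq) \<Rightarrow> bool" where
  "linear_on V T \<longleftrightarrow>
    (\<forall>v \<in> V. \<forall>w \<in> V. T (v + w) = T v + T w) \<and> (\<forall>c. \<forall>v \<in> V. T (cscale c v) = cscale c (T v))"

definition tensor :: "cseq \<Rightarrow> cseq \<Rightarrow> cseq" where
  "tensor v w = (\<lambda>n. case prod_decode n of (i, j) \<Rightarrow> v i * w j)"

definition tensor_space :: "cseq set \<Rightarrow> cseq set \<Rightarrow> cseq set" where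
  "tensor_space V W = cs.span {tensor v w | v w. v \<in> V \<and> w \<in> W}"

definition tensor_map ::
  "cseq set \<Rightarrow> cseq set \<Rightarrow> (cseq \<Rightarrow> cseq) \<Rightarrow> (cseq \<Rightarrow> cseq) \<Rightarrow> cseq \<Rightarrow> cseq"
  where
  "tensor_map V W A B = (THE T. linear_on (tensor_space V W) T \<and>
    (\<forall>v \<in> V. \<forall>w \<in> W. T (tensor v w) = tensor (A v) (B w)) \<and>
    (\<forall>x. x \<notin> tensor_space V W \<longrightarrow> T x = 0))"


section \<open>Modules over \<open>sl\<^sub>2\<close>\<close>

definition sl2 :: "(complex^2^2) set" where
  "sl2 = {x. trace x = 0}"

definition mscale :: "complex \<Rightarrow> complex^2^2 \<Rightarrow> complex^2^2" where
  "mscale c x = (\<chi> i j. c * x $ i $ j)"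

definition sl2_e :: "complex^2^2" where
  "sl2_e = vector [vector [0, 1], vector [0, 0]]"

definition sl2_h :: "complex^2^2" where
  "sl2_h = vector [vector [1, 0], vector [0, -1]]"

record sl2_module =
  car :: "cseq set"
  act :: "complex^2^2 \<Rightarrow> cseq \<Rightarrow> cseq"

definition sl2_modules :: "sl2_module set" where
  "sl2_modules = {M. cs.subspace (car M) \<and>
    (\<forall>x \<in> sl2. linear_on (car M) (act M x) \<and> act M x ` car M \<subseteq> car M) \<and>
    (\<forall>v \<in> car M. \<forall>x \<in> sl2.
      (\<forall>c. act M (mscale c x) v = cscale c (act M x v)) \<and>
      (\<forall>y \<in> sl2. act M (x + y) v = act M x v + act M y v \<and>
        act M (x ** y - y ** x) v = act M x (act M y v) - act M y (act M x v)))}"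

definition finite_dimensional :: "sl2_module \<Rightarrow> bool" where
  "finite_dimensional M \<longleftrightarrow> (\<exists>B. finite B \<and> car M = cs.span B)"

text \<open>Arrows carry their source and target, and vanish outside the source.\<close>

record sl2_arrow =
  src :: sl2_module
  tgt :: sl2_module
  fn :: "cseq \<Rightarrow> cseq"

definition sl2_Hom :: "sl2_module \<Rightarrow> sl2_module \<Rightarrow> sl2_arrow set" where
  "sl2_Hom M N = {f. src f = M \<and> tgt f = N \<and>
    linear_on (car M) (fn f) \<and> fn f ` car M \<subseteq> car N \<and>
    (\<forall>x \<in> sl2. \<forall>v \<in> car M. fn f (act M x v) = act N x (fn f v)) \<and>
    (\<forall>v. v \<notin> car M \<longrightarrow> fn f v = 0)}"

definition sl2_arr :: "sl2_module \<Rightarrow> sl2_module \<Rightarrow> (cseq \<Rightarrow> cseq) \<Rightarrow> sl2_arrow" where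
  "sl2_arr M N T = \<lparr>src = M, tgt = N, fn = (\<lambda>v. if v \<in> car M then T v else 0)\<rparr>"

definition sl2_cat :: "sl2_module set \<Rightarrow> (sl2_module, sl2_arrow) category" where
  "sl2_cat S = \<lparr>
    Obj = S,
    Hom = sl2_Hom,
    Idn = (\<lambda>M. sl2_arr M M id),
    Comp = (\<lambda>g f. sl2_arr (src f) (tgt g) (fn g \<circ> fn f)),
    Add = (\<lambda>f g. sl2_arr (src f) (tgt f) (\<lambda>v. fn f v + fn g v)),
    Scale = (\<lambda>c f. sl2_arr (src f) (tgt f) (\<lambda>v. cscale c (fn f v)))\<rparr>"

definition sl2_unit_vector :: cseq where
  "sl2_unit_vector = (\<lambda>n. if n = 0 then 1 else 0)"

definition sl2_trivial :: sl2_module where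
  "sl2_trivial = \<lparr>car = cs.span {sl2_unit_vector}, act = (\<lambda>x v. 0)\<rparr>"

definition sl2_tensor :: "sl2_module \<Rightarrow> sl2_module \<Rightarrow> sl2_module" where
  "sl2_tensor M N = \<lparr>
    car = tensor_space (car M) (car N),
    act = (\<lambda>x t. tensor_map (car M) (car N) (act M x) id t + tensor_map (car M) (car N) id (act N x) t)\<rparr>"

definition sl2_tensor_arr :: "sl2_arrow \<Rightarrow> sl2_arrow \<Rightarrow> sl2_arrow" where
  "sl2_tensor_arr f g = sl2_arr (sl2_tensor (src f) (src g)) (sl2_tensor (tgt f) (tgt g))
    (tensor_map (car (src f)) (car (src g)) (fn f) (fn g))"

text \<open>
  The underlying map of the associator is the reindexing that sends \<open>(u \<otimes> v) \<otimes> w\<close> to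
  \<open>u \<otimes> (v \<otimes> w)\<close>; those of the unitors send \<open>\<one> \<otimes> v\<close> and \<open>v \<otimes> \<one>\<close> to \<open>v\<close>.
\<close>

definition sl2_assoc :: "sl2_module \<Rightarrow> sl2_module \<Rightarrow> sl2_module \<Rightarrow> sl2_arrow" where
  "sl2_assoc K M N =
    sl2_arr (sl2_tensor (sl2_tensor K M) N) (sl2_tensor K (sl2_tensor M N))
      (\<lambda>t n. case prod_decode n of (i, m) \<Rightarrow> case prod_decode m of (j, k) \<Rightarrow>
        t (prod_encode (prod_encode (i, j), k)))"

definition sl2_lunit :: "sl2_module \<Rightarrow> sl2_arrow" where
  "sl2_lunit M = sl2_arr (sl2_tensor sl2_trivial M) M (\<lambda>t n. t (prod_encode (0, n)))"

definition sl2_runit :: "sl2_module \<Rightarrow> sl2_arrow" where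
  "sl2_runit M = sl2_arr (sl2_tensor M sl2_trivial) M (\<lambda>t n. t (prod_encode (n, 0)))"

definition fd_sl2 :: "(sl2_module, sl2_arrow) monoidal_category" where
  "fd_sl2 = category.extend (sl2_cat {M \<in> sl2_modules. finite_dimensional M})
    (monoidal_category.fields sl2_trivial sl2_tensor sl2_tensor_arr sl2_assoc sl2_lunit sl2_runit)"

text \<open>The full subcategory of modules on a class \<open>S\<close> of objects, acted on by tensoring.\<close>

definition sl2_module_cat ::
  "sl2_module set \<Rightarrow> (sl2_module, sl2_arrow, sl2_module, sl2_arrow) module_category"
  where
  "sl2_module_cat S = category.extend (sl2_cat S)
    (module_category.fields sl2_tensor sl2_tensor_arr sl2_assoc sl2_lunit)"


section \<open>Simple highest weight modules and additive closures\<close>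

definition submodule :: "cseq set \<Rightarrow> sl2_module \<Rightarrow> bool" where
  "submodule W M \<longleftrightarrow> W \<subseteq> car M \<and> cs.subspace W \<and> (\<forall>x \<in> sl2. act M x ` W \<subseteq> W)"

definition simple_module :: "sl2_module \<Rightarrow> bool" where
  "simple_module M \<longleftrightarrow> M \<in> sl2_modules \<and> car M \<noteq> {0} \<and>
    (\<forall>W. submodule W M \<longrightarrow> W = {0} \<or> W = car M)"

definition highest_weight_module :: "complex \<Rightarrow> sl2_module \<Rightarrow> bool" where
  "highest_weight_module \<nu> M \<longleftrightarrow> M \<in> sl2_modules \<and>
    (\<exists>v \<in> car M. v \<noteq> 0 \<and> act M sl2_e v = 0 \<and> act M sl2_h v = cscale \<nu> v \<and>
      (\<forall>W. submodule W M \<and> v \<in> W \<longrightarrow> W = car M))"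

text \<open>The isomorphism class of \<open>L(\<nu>)\<close>.\<close>

definition is_L :: "complex \<Rightarrow> sl2_module \<Rightarrow> bool" where
  "is_L \<nu> M \<longleftrightarrow> simple_module M \<and> highest_weight_module \<nu> M"

definition isomorphic :: "sl2_module \<Rightarrow> sl2_module \<Rightarrow> bool" where
  "isomorphic M N \<longleftrightarrow> (\<exists>f \<in> sl2_Hom M N. bij_betw (fn f) (car M) (car N))"

definition internal_direct_sum :: "sl2_module \<Rightarrow> nat \<Rightarrow> (nat \<Rightarrow> cseq set) \<Rightarrow> bool" where
  "internal_direct_sum N n W \<longleftrightarrow> (\<forall>i<n. submodule (W i) N) \<and>
    (\<forall>v \<in> car N. \<exists>!w. w \<in> (\<Pi>\<^sub>E i\<in>{..<n}. W i) \<and> v = (\<Sum>i<n. w i))"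

definition direct_summand :: "cseq set \<Rightarrow> sl2_module \<Rightarrow> bool" where
  "direct_summand U N \<longleftrightarrow> (\<exists>W. W 0 = U \<and> internal_direct_sum N 2 W)"

text \<open>
  External finite direct sums of modules in \<open>S\<close> are, up to isomorphism, the internal direct sums of
  submodules isomorphic to modules in \<open>S\<close>; the empty sum contributes the zero module.
\<close>

definition additive_closure :: "sl2_module set \<Rightarrow> sl2_module set" where
  "additive_closure S = {M \<in> sl2_modules. \<exists>N \<in> sl2_modules. \<exists>n W U.
    internal_direct_sum N n W \<and> (\<forall>i<n. \<exists>L \<in> S. isomorphic L (N\<lparr>car := W i\<rparr>)) \<and>
    direct_summand U N \<and> isomorphic M (N\<lparr>car := U\<rparr>)}"

definition N1 :: "complex \<Rightarrow> (sl2_module, sl2_arrow, sl2_module, sl2_arrow) module_category" where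
  "N1 \<mu> = sl2_module_cat (additive_closure {L. \<exists>\<nu>. is_L \<nu> L \<and> \<nu> - \<mu> \<in> \<int>})"

end

theory Submission
 imports Defs "HOL-Computational_Algebra.Fundamental_Theorem_Algebra"
begin

text \<open>
  For \<open>\<mu>\<close> not an integer, a module lies in the additive closure iff it is a finite sum of Verma modules:
  it is spanned by \<open>f\<^sup>k b\<close> for finitely many highest weight vectors \<open>b\<close> with weights in \<open>\<mu> + \<int>\<close>.

  An equivalence from \<open>\<mu>\<close> to \<open>- \<mu>\<close> is given by the module of weight-finite sequences \<open>t\<close> with \<open>t\<^sub>0 = 0\<close> and
  \<open>e t\<^sub>n\<^sub>+\<^sub>1 = t\<^sub>n\<close>, which is \<open>Hom(U[e\<^sup>-\<^sup>1]/U, M)\<close>, with the action twisted by the Chevalley involution.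
  Its compatibility with \<open>X \<otimes> _\<close> is the Weyl element on \<open>X\<close> followed by the expansion of
  \<open>(e \<otimes> 1 + 1 \<otimes> e)\<^sup>-\<^sup>n\<close> in powers of the nilpotent \<open>e \<otimes> 1\<close>.

  Conversely, let \<open>V = \<complex>\<^sup>2\<close> and \<open>L\<close> a Verma module.  \<open>End(V \<otimes> L)\<close> is spanned by the identity and
  \<open>\<Omega> = h \<otimes> h + 2 e \<otimes> f + 2 f \<otimes> e\<close>, which has partial trace zero over \<open>V\<close> and satisfies \<open>\<Omega>\<^sup>2 + 2 \<Omega> = c\<close> for the
  Casimir scalar \<open>c = \<mu> (\<mu> + 2)\<close> of \<open>L\<close>.  A module functor preserves partial traces, so an equivalence must
  match the two operators \<open>\<Omega>\<close>, hence the Casimir scalars, which determine \<open>\<mu> + 1\<close> up to sign.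
\<close>


section \<open>Linear algebra in the space of sequences\<close>

text \<open>The Chevalley twist turns highest weight modules into lowest weight modules, which lie
  outside both categories. Sequences divisible by \<open>e\<close> form a lowest weight module
  first, so the twist returns a highest weight module, with the highest weight \<open>\<nu>\<close>
  reflected to \<open>- \<nu> - 2\<close>. On the finite-dimensional factor the twist is compensated
  by the Weyl element, which is polynomial in \<open>e\<close> and \<open>f\<close>, hence natural,
  and group-like, hence compatible with tensor products; otherwise the action would be preserved
  only up to an automorphism of the acting category. Non-integrality enters through the scalars
  \<open>(k + 1) (w - k)\<close> by which \<open>e\<close> undoes \<open>f\<close>: they never
  vanish. In the converse the image of a Verma module is not known to be a Verma module; full
  faithfulness only shows that it is nonzero with scalar Casimir. This suffices: if
  \<open>x \<Omega> + y\<close> corresponds to \<open>\<Omega>\<close>, the trace gives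
  \<open>y = 0\<close> and the quadratic relation leaves \<open>x = 0\<close> or
  \<open>x = 1\<close>, where \<open>x = 0\<close> would force an integral weight.\<close>

text \<open>
  Higher-order matching tends to eta-expand terms of type \<^typ>\<open>cseq\<close>; these rules undo the damage
  that the pointwise simplification rules for functions then do.
\<close>

lemma cseq_fold [simp]:
 fixes v w :: cseq
 shows "(%n. v n + w n) = v + w" "(%n. v n - w n) = v - w" "(%n. - v n) = - v"
  "(\<lambda>n. 0 :: complex) = 0"
 by (simp_all add: fun_eq_iff)

lemma cscale_apply: "cscale c v n = c * v n"
 by (simp add: cscale_def)

lemma sum_apply_fun: "(\<Sum>i\<in>I. g i) n = (\<Sum>i\<in>I. g i n)" for g :: "'a => 'b => 'c::comm_monoid_add"
 by (induction I rule: infinite_finite_induct) auto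

lemma linear_onI:
 assumes "!!v w. v \<in> V ==> w \<in> V ==> T (v + w) = T v + T w"
  and "!!c v. v \<in> V ==> T (cscale c v) = cscale c (T v)"
 shows "linear_on V T"
 using assms by (simp add: linear_on_def)

lemma linear_on_add: "linear_on V T ==> v \<in> V ==> w \<in> V ==> T (v + w) = T v + T w"
 by (simp add: linear_on_def)

lemma linear_on_scale: "linear_on V T ==> v \<in> V ==> T (cscale c v) = cscale c (T v)"
 by (simp add: linear_on_def)

lemma linear_on_0:
 assumes "linear_on V T" "cs.subspace V"
 shows "T 0 = 0"
 using linear_on_scale[OF assms(1) cs.subspace_0[OF assms(2)], of 0] by simp

lemma linear_on_minus: "linear_on V T ==> v \<in> V ==> T (- v) = - T v"
 using linear_on_scale[of V T v "-1"] by simp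

lemma linear_on_diff:
 assumes "linear_on V T" "cs.subspace V" "v \<in> V" "w \<in> V"
 shows "T (v - w) = T v - T w"
 using linear_on_add[of V T v "- w"] linear_on_minus[of V T w] cs.subspace_neg[of V w] assms by simp

lemma linear_on_sum:
 assumes "linear_on V T" "cs.subspace V" "!!i. i \<in> I ==> g i \<in> V"
 shows "T (\<Sum>i\<in>I. g i) = (\<Sum>i\<in>I. T (g i))"
 using assms(3)
proof (induction I rule: infinite_finite_induct)
 case (insert x F)
 have "T (\<Sum>i\<in>insert x F. g i) = T (g x + (\<Sum>i\<in>F. g i))" using insert.hyps by (simp only: sum.insert not_False_eq_True)
 also have "... = T (g x) + T (\<Sum>i\<in>F. g i)"
  by (rule linear_on_add[OF assms(1)]) (use insert.prems in \<open>auto intro!: cs.subspace_sum[OF assms(2)]\<close>)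
 also have "... = (\<Sum>i\<in>insert x F. T (g i))" using insert by (simp only: sum.insert not_False_eq_True) simp
 finally show ?case .
qed (simp_all add: linear_on_0[OF assms(1,2)])

lemma linear_on_subset: "linear_on V T ==> W \<subseteq> V ==> linear_on W T"
 unfolding linear_on_def by blast

lemma linear_on_cong: "(!!v. v \<in> V ==> T v = T' v) ==> cs.subspace V ==> linear_on V T ==> linear_on V T'"
 by (auto simp: linear_on_def cs.subspace_add cs.subspace_scale)

lemma linear_on_id: "linear_on V id" "linear_on V (%v. v)"
 by (auto simp: linear_on_def)

lemma linear_on_const_0: "linear_on V (\<lambda>v. 0)"
 by (auto simp: linear_on_def)

lemma linear_on_comp:
 assumes "linear_on V T" "linear_on W S" "T ` V \<subseteq> W"
 shows "linear_on V (S \<circ> T)" "linear_on V (%v. S (T v))"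
 using assms by (auto simp: linear_on_def image_subset_iff)

lemma linear_on_plus: "linear_on V T ==> linear_on V S ==> linear_on V (%v. T v + S v)"
 by (auto simp: linear_on_def cs.scale_right_distrib)

lemma linear_on_uminus: "linear_on V T ==> linear_on V (%v. - T v)"
 by (auto simp: linear_on_def)

lemma linear_on_minus_fun: "linear_on V T ==> linear_on V S ==> linear_on V (%v. T v - S v)"
 by (auto simp: linear_on_def cs.scale_right_diff_distrib)

lemma linear_on_cscale: "linear_on V T ==> linear_on V (%v. cscale c (T v))"
 by (auto simp: linear_on_def cs.scale_right_distrib mult.commute)

lemma linear_on_sum_fun: "(!!i. i \<in> I ==> linear_on V (T i)) ==> linear_on V (%v. \<Sum>i\<in>I. T i v)"
 by (auto simp: linear_on_def sum.distrib cs.scale_sum_right)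

lemma linear_on_funpow:
 assumes "linear_on V T" "T ` V \<subseteq> V"
 shows "linear_on V (T ^^ n)"
proof (induction n)
 case (Suc n)
 have "(T ^^ n) ` V \<subseteq> V" using assms(2) by (induction n) auto
 then show ?case using linear_on_comp(1)[OF Suc assms(1)] by (simp only: funpow.simps)
qed (simp add: linear_on_id)

lemma funpow_in: "T ` V \<subseteq> V ==> v \<in> V ==> (T ^^ n) v \<in> V"
 by (induction n) auto

lemma linear_on_kernel_subspace:
 assumes "linear_on V T" "cs.subspace V"
 shows "cs.subspace {v \<in> V. T v = 0}"
 using assms linear_on_0[OF assms]
 by (auto simp: cs.subspace_def linear_on_def)

lemma linear_on_image_subspace:
 assumes "linear_on V T" "cs.subspace V"
 shows "cs.subspace (T ` V)"
proof (rule cs.subspaceI)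
 show "0 \<in> T ` V" using linear_on_0[OF assms] cs.subspace_0[OF assms(2)] by force
next
 fix x y assume "x \<in> T ` V" "y \<in> T ` V"
 then obtain a b where ab: "a \<in> V" "b \<in> V" "x = T a" "y = T b" by auto
 then have "x + y = T (a + b)" by (simp add: linear_on_add[OF assms(1)])
 then show "x + y \<in> T ` V" using ab cs.subspace_add[OF assms(2)] by blast
next
 fix c x assume "x \<in> T ` V"
 then obtain a where ab: "a \<in> V" "x = T a" by auto
 then have "cscale c x = T (cscale c a)" by (simp add: linear_on_scale[OF assms(1)])
 then show "cscale c x \<in> T ` V" using ab cs.subspace_scale[OF assms(2)] by blast
qed

lemma linear_on_vimage_subspace:
 assumes "linear_on V T" "cs.subspace V" "cs.subspace W"
 shows "cs.subspace {v \<in> V. T v \<in> W}"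
 using assms linear_on_0[OF assms(1,2)]
 by (auto simp: cs.subspace_def linear_on_def)

lemma linear_on_equalizer_subspace:
 assumes "linear_on V T" "linear_on V S" "cs.subspace V"
 shows "cs.subspace {v \<in> V. T v = S v}"
 using assms linear_on_0[OF assms(1,3)] linear_on_0[OF assms(2,3)]
 by (auto simp: cs.subspace_def linear_on_def)

lemma span_sub: "S \<subseteq> V ==> cs.subspace V ==> cs.span S \<subseteq> V"
 by (rule cs.span_minimal)

lemma linear_on_eq_on_span:
 assumes "linear_on V T" "linear_on V S" "cs.subspace V" "B \<subseteq> V"
  and "!!b. b \<in> B ==> T b = S b" and "v \<in> cs.span B"
 shows "T v = S v"
 using span_sub[OF _ linear_on_equalizer_subspace[OF assms(1-3)], of B] assms(4-6) by auto

lemma linear_on_span_image: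
 assumes "linear_on V T" "cs.subspace V" "B \<subseteq> V"
 shows "T ` cs.span B = cs.span (T ` B)"
proof
 have "cs.span B \<subseteq> {v \<in> V. T v \<in> cs.span (T ` B)}"
  by (rule span_sub)
   (use assms in \<open>auto intro: cs.span_base linear_on_vimage_subspace\<close>)
 then show "T ` cs.span B \<subseteq> cs.span (T ` B)" by auto
next
 have B: "cs.span B \<subseteq> V" using assms span_sub by blast
 show "cs.span (T ` B) \<subseteq> T ` cs.span B"
  by (rule span_sub)
   (use assms B in \<open>auto intro: cs.span_base linear_on_image_subspace[OF linear_on_subset]\<close>)
qed

lemma linear_on_inj:
 assumes "linear_on V T" "cs.subspace V" "!!v. v \<in> V ==> T v = 0 ==> v = 0"
 shows "inj_on T V"
proof (rule inj_onI)
 fix x y assume *: "x \<in> V" "y \<in> V" "T x = T y"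
 then have "T (x - y) = 0" using linear_on_diff[OF assms(1,2)] by simp
 then show "x = y" using assms(3)[of "x - y"] * cs.subspace_diff[OF assms(2)] by simp
qed

section \<open>Tensor products\<close>

definition trow :: "cseq => nat => cseq" where
 "trow t i = (%j. t (prod_encode (i, j)))"

definition tcol :: "cseq => nat => cseq" where
 "tcol t j = (%i. t (prod_encode (i, j)))"

text \<open>The operator \<open>1 \<otimes> B\<close> without bases: a sequence indexed by pairs is
  a matrix, and the rows of an element of \<open>V \<otimes> W\<close> lie in \<open>W\<close>
  (\<open>trow_in\<close>), so \<open>B\<close> can act row by row. \<open>map_cols\<close> does the
  same for the left factor.\<close>

definition map_rows :: "(cseq => cseq) => cseq => cseq" where
 "map_rows B t = (%n. case prod_decode n of (i, j) => B (trow t i) j)"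

definition map_cols :: "(cseq => cseq) => cseq => cseq" where
 "map_cols A t = (%n. case prod_decode n of (i, j) => A (tcol t j) i)"

lemma cseq_pair_ext: "(!!i j. s (prod_encode (i, j)) = t (prod_encode (i, j))) ==> s = t" for s t :: cseq
proof (rule ext)
 fix n assume *: "!!i j. s (prod_encode (i, j)) = t (prod_encode (i, j))"
 show "s n = t n" using *[of "fst (prod_decode n)" "snd (prod_decode n)"] by simp
qed

lemma tensor_encode [simp]: "tensor v w (prod_encode (i, j)) = v i * w j"
 by (simp add: tensor_def)

lemma tensor_add_left: "tensor (v + v') w = tensor v w + tensor v' w"
 and tensor_add_right: "tensor v (w + w') = tensor v w + tensor v w'"
 and tensor_scale_left: "tensor (cscale c v) w = cscale c (tensor v w)"
 and tensor_scale_right: "tensor v (cscale c w) = cscale c (tensor v w)"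
 and tensor_diff_left: "tensor (v - v') w = tensor v w - tensor v' w"
 and tensor_diff_right: "tensor v (w - w') = tensor v w - tensor v w'"
 and tensor_0_left [simp]: "tensor 0 w = 0"
 and tensor_0_right [simp]: "tensor v 0 = 0"
 and tensor_minus_left: "tensor (- v) w = - tensor v w"
 and tensor_minus_right: "tensor v (- w) = - tensor v w"
 by (auto intro!: cseq_pair_ext simp: cscale_def algebra_simps)

lemma tensor_sum_left: "tensor (\<Sum>i\<in>I. g i) w = (\<Sum>i\<in>I. tensor (g i) w)"
 by (rule cseq_pair_ext) (simp add: sum_apply_fun sum_distrib_right)

lemma tensor_sum_right: "tensor v (\<Sum>i\<in>I. g i) = (\<Sum>i\<in>I. tensor v (g i))"
 by (rule cseq_pair_ext) (simp add: sum_apply_fun sum_distrib_left)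

lemma subspace_tensor_space [simp, intro]: "cs.subspace (tensor_space V W)"
 by (simp add: tensor_space_def)

lemma tensor_in [intro, simp]: "v \<in> V ==> w \<in> W ==> tensor v w \<in> tensor_space V W"
 by (auto simp: tensor_space_def intro!: cs.span_base)

lemma tensor_space_subset:
 assumes "!!v w. v \<in> V ==> w \<in> W ==> tensor v w \<in> S" "cs.subspace S"
 shows "tensor_space V W \<subseteq> S"
 unfolding tensor_space_def using assms by (intro span_sub) auto

lemma tensor_ext:
 assumes "t \<in> tensor_space V W" "linear_on (tensor_space V W) T" "linear_on (tensor_space V W) S"
  and "!!v w. v \<in> V ==> w \<in> W ==> T (tensor v w) = S (tensor v w)"
 shows "T t = S t"
 using tensor_space_subset[OF _ linear_on_equalizer_subspace[OF assms(2,3)], of V W] assms by auto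

lemma trow_add: "trow (s + t) i = trow s i + trow t i"
 and trow_scale: "trow (cscale c t) i = cscale c (trow t i)"
 and trow_tensor: "trow (tensor v w) i = cscale (v i) w"
 and tcol_add: "tcol (s + t) j = tcol s j + tcol t j"
 and tcol_scale: "tcol (cscale c t) j = cscale c (tcol t j)"
 and tcol_tensor: "tcol (tensor v w) j = cscale (w j) v"
 by (auto simp: trow_def tcol_def cscale_def fun_eq_iff)

lemma trow_in:
 assumes "cs.subspace W" "t \<in> tensor_space V W"
 shows "trow t i \<in> W"
proof -
 have "tensor_space V W \<subseteq> {t. trow t i \<in> W}"
 proof (rule tensor_space_subset)
  have "trow 0 i = 0" using trow_scale[of 0 0 i] by simp
  then show "cs.subspace {t. trow t i \<in> W}"
   using assms(1) by (intro cs.subspaceI)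
    (simp_all add: trow_add trow_scale cs.subspace_0 cs.subspace_add cs.subspace_scale)
 qed (use assms(1) in \<open>simp add: trow_tensor cs.subspace_scale\<close>)
 then show ?thesis using assms by auto
qed

lemma tcol_in:
 assumes "cs.subspace V" "t \<in> tensor_space V W"
 shows "tcol t j \<in> V"
proof -
 have "tensor_space V W \<subseteq> {t. tcol t j \<in> V}"
 proof (rule tensor_space_subset)
  have "tcol 0 j = 0" using tcol_scale[of 0 0 j] by simp
  then show "cs.subspace {t. tcol t j \<in> V}"
   using assms(1) by (intro cs.subspaceI)
    (simp_all add: tcol_add tcol_scale cs.subspace_0 cs.subspace_add cs.subspace_scale)
 qed (use assms(1) in \<open>simp add: tcol_tensor cs.subspace_scale\<close>)
 then show ?thesis using assms by auto
qed

lemma linear_on_map_rows: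
 assumes "linear_on W B" "cs.subspace W"
 shows "linear_on (tensor_space V W) (map_rows B)"
 using assms trow_in[OF assms(2)]
 by (auto intro!: linear_onI cseq_pair_ext
   simp: map_rows_def trow_add trow_scale linear_on_add[OF assms(1)] linear_on_scale[OF assms(1)] cscale_apply)

lemma linear_on_map_cols:
 assumes "linear_on V A" "cs.subspace V"
 shows "linear_on (tensor_space V W) (map_cols A)"
 using assms tcol_in[OF assms(2)]
 by (auto intro!: linear_onI cseq_pair_ext
   simp: map_cols_def tcol_add tcol_scale linear_on_add[OF assms(1)] linear_on_scale[OF assms(1)] cscale_apply)

lemma map_rows_tensor: "linear_on W B ==> w \<in> W ==> map_rows B (tensor v w) = tensor v (B w)"
 by (rule cseq_pair_ext) (simp add: map_rows_def trow_tensor linear_on_scale cscale_apply)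

lemma map_cols_tensor: "linear_on V A ==> v \<in> V ==> map_cols A (tensor v w) = tensor (A v) w"
 by (rule cseq_pair_ext) (simp add: map_cols_def tcol_tensor linear_on_scale cscale_apply)

locale tensor_pair =
 fixes V W :: "cseq set"
 assumes subspace_left [simp, intro]: "cs.subspace V" and subspace_right [simp, intro]: "cs.subspace W"
begin

text \<open>Discharges the definite description in \<open>tensor_map\<close>: existence by letting
  \<open>B\<close> act on rows and then \<open>A\<close> on columns, uniqueness because pure tensors
  span.\<close>

lemma tensor_map_unique:
 assumes "linear_on V A" "linear_on W B"
 shows "\<exists>!T. linear_on (tensor_space V W) T &
  (\<forall>v \<in> V. \<forall>w \<in> W. T (tensor v w) = tensor (A v) (B w)) &
  (\<forall>x. x \<notin> tensor_space V W \<longrightarrow> T x = 0)"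
proof (rule ex1I)
 let ?T = "\<lambda>t. if t \<in> tensor_space V W then map_cols A (map_rows B t) else 0"
 \<comment> \<open>\<open>B\<close> may lead out of \<open>W\<close>, so only the left factor is
   controlled; that is all \<open>map_cols A\<close> requires afterwards.\<close>
 have rows: "map_rows B ` tensor_space V W \<subseteq> tensor_space V UNIV"
 proof -
  have "tensor_space V W \<subseteq> {t \<in> tensor_space V W. map_rows B t \<in> tensor_space V UNIV}"
   by (rule tensor_space_subset)
    (auto simp: map_rows_tensor[OF assms(2)] intro!: linear_on_vimage_subspace linear_on_map_rows assms)
  then show ?thesis by auto
 qed
 have "linear_on (tensor_space V W) (%t. map_cols A (map_rows B t))"
  by (rule linear_on_comp(2)[OF linear_on_map_rows linear_on_map_cols rows]) (auto intro: assms)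
 then have lin: "linear_on (tensor_space V W) ?T"
  by (rule linear_on_cong[rotated 2]) auto
 have tens: "\<forall>v \<in> V. \<forall>w \<in> W. ?T (tensor v w) = tensor (A v) (B w)"
  by (auto simp: map_rows_tensor[OF assms(2)] map_cols_tensor[OF assms(1)])
 show "linear_on (tensor_space V W) ?T & (\<forall>v \<in> V. \<forall>w \<in> W. ?T (tensor v w) = tensor (A v) (B w)) &
   (\<forall>x. x \<notin> tensor_space V W \<longrightarrow> ?T x = 0)"
  using lin tens by auto
 fix T assume T: "linear_on (tensor_space V W) T &
   (\<forall>v \<in> V. \<forall>w \<in> W. T (tensor v w) = tensor (A v) (B w)) &
   (\<forall>x. x \<notin> tensor_space V W \<longrightarrow> T x = 0)"
 show "T = ?T"
 proof
  fix t show "T t = ?T t"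
  proof (cases "t \<in> tensor_space V W")
   case True
   show ?thesis
    by (rule tensor_ext[OF True]) (use T lin tens in auto)
  qed (use T in auto)
 qed
qed

lemma
 assumes "linear_on V A" "linear_on W B"
 shows linear_on_tensor_map: "linear_on (tensor_space V W) (tensor_map V W A B)"
  and tensor_map_tensor: "v \<in> V ==> w \<in> W ==> tensor_map V W A B (tensor v w) = tensor (A v) (B w)"
  and tensor_map_outside: "x \<notin> tensor_space V W ==> tensor_map V W A B x = 0"
 using theI'[OF tensor_map_unique[OF assms]] unfolding tensor_map_def[symmetric] by auto

lemma tensor_map_in:
 assumes "linear_on V A" "linear_on W B" "A ` V \<subseteq> V'" "B ` W \<subseteq> W'" "t \<in> tensor_space V W"
 shows "tensor_map V W A B t \<in> tensor_space V' W'"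
proof -
 have "tensor_space V W \<subseteq> {t \<in> tensor_space V W. tensor_map V W A B t \<in> tensor_space V' W'}"
  by (rule tensor_space_subset)
   (use assms in \<open>auto simp: tensor_map_tensor intro!: linear_on_vimage_subspace linear_on_tensor_map\<close>)
 then show ?thesis using assms(5) by auto
qed

lemma tensor_map_eqI:
 assumes "linear_on V A" "linear_on W B" "linear_on (tensor_space V W) T" "t \<in> tensor_space V W"
  and "!!v w. v \<in> V ==> w \<in> W ==> T (tensor v w) = tensor (A v) (B w)"
 shows "tensor_map V W A B t = T t"
 by (rule tensor_ext[OF assms(4) linear_on_tensor_map[OF assms(1,2)] assms(3)])
  (simp add: assms tensor_map_tensor)

lemma tensor_map_id: "t \<in> tensor_space V W ==> tensor_map V W id id t = t"
 using tensor_map_eqI[OF linear_on_id(1) linear_on_id(1) linear_on_id(1)] by simp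

end

lemma tensor_map_cong:
 assumes "cs.subspace V" "cs.subspace W" "linear_on V A" "linear_on W B"
  "!!v. v \<in> V ==> A v = A' v" "!!w. w \<in> W ==> B w = B' w"
 shows "tensor_map V W A B = tensor_map V W A' B'"
 unfolding tensor_map_def using assms by auto

lemma tensor_map_comp:
 assumes "cs.subspace V" "cs.subspace W" "cs.subspace V'" "cs.subspace W'"
  "linear_on V A" "linear_on W B" "linear_on V' A'" "linear_on W' B'" "A ` V \<subseteq> V'" "B ` W \<subseteq> W'"
  "t \<in> tensor_space V W"
 shows "tensor_map V' W' A' B' (tensor_map V W A B t) = tensor_map V W (A' \<circ> A) (B' \<circ> B) t"
proof -
 interpret T: tensor_pair V W using assms by unfold_locales
 interpret T': tensor_pair V' W' using assms by unfold_locales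
 have "tensor_map V W (A' \<circ> A) (B' \<circ> B) t = (%t. tensor_map V' W' A' B' (tensor_map V W A B t)) t"
 proof (rule T.tensor_map_eqI)
  show "linear_on (tensor_space V W) (%t. tensor_map V' W' A' B' (tensor_map V W A B t))"
   using assms by (intro linear_on_comp(2)[OF T.linear_on_tensor_map T'.linear_on_tensor_map])
    (auto intro!: T.tensor_map_in)
  fix v w assume "v \<in> V" "w \<in> W"
  then show "tensor_map V' W' A' B' (tensor_map V W A B (tensor v w)) = tensor ((A' \<circ> A) v) ((B' \<circ> B) w)"
   using assms by (simp add: T.tensor_map_tensor image_subset_iff T'.tensor_map_tensor)
 qed (use assms in \<open>auto intro: linear_on_comp\<close>)
 then show ?thesis by simp
qed

lemma linear_on_tensor_left:
 assumes "linear_on (tensor_space V W) T" "w \<in> W"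
 shows "linear_on V (%v. T (tensor v w))"
 using assms by (auto intro!: linear_onI simp: tensor_add_left tensor_scale_left linear_on_add linear_on_scale)

lemma linear_on_tensor_right:
 assumes "linear_on (tensor_space V W) T" "v \<in> V"
 shows "linear_on W (%w. T (tensor v w))"
 using assms by (auto intro!: linear_onI simp: tensor_add_right tensor_scale_right linear_on_add linear_on_scale)

lemma tensor_ext_left:
 assumes "t \<in> tensor_space (tensor_space U V) W" "linear_on (tensor_space (tensor_space U V) W) T"
  "linear_on (tensor_space (tensor_space U V) W) S"
  and "!!u v w. u \<in> U ==> v \<in> V ==> w \<in> W ==> T (tensor (tensor u v) w) = S (tensor (tensor u v) w)"
 shows "T t = S t"
proof (rule tensor_ext[OF assms(1-3)])
 fix x w assume "x \<in> tensor_space U V" "w \<in> W"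
 then show "T (tensor x w) = S (tensor x w)"
  using tensor_ext[of x U V "%v. T (tensor v w)" "%v. S (tensor v w)"]
   linear_on_tensor_left[OF assms(2)] linear_on_tensor_left[OF assms(3)] assms(4) by simp
qed

lemma tensor_ext_right:
 assumes "t \<in> tensor_space U (tensor_space V W)" "linear_on (tensor_space U (tensor_space V W)) T"
  "linear_on (tensor_space U (tensor_space V W)) S"
  and "!!u v w. u \<in> U ==> v \<in> V ==> w \<in> W ==> T (tensor u (tensor v w)) = S (tensor u (tensor v w))"
 shows "T t = S t"
proof (rule tensor_ext[OF assms(1-3)])
 fix u x assume "x \<in> tensor_space V W" "u \<in> U"
 then show "T (tensor u x) = S (tensor u x)"
  using tensor_ext[of x V W "%v. T (tensor u v)" "%v. S (tensor u v)"]
   linear_on_tensor_right[OF assms(2)] linear_on_tensor_right[OF assms(3)] assms(4) by simp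
qed

lemma tensor_ext_left2:
 assumes "t \<in> tensor_space (tensor_space (tensor_space U V) W) Z"
  "linear_on (tensor_space (tensor_space (tensor_space U V) W) Z) T"
  "linear_on (tensor_space (tensor_space (tensor_space U V) W) Z) S"
  and "!!u v w z. u \<in> U ==> v \<in> V ==> w \<in> W ==> z \<in> Z ==>
   T (tensor (tensor (tensor u v) w) z) = S (tensor (tensor (tensor u v) w) z)"
 shows "T t = S t"
proof (rule tensor_ext[OF assms(1-3)])
 fix x z assume "x \<in> tensor_space (tensor_space U V) W" "z \<in> Z"
 then show "T (tensor x z) = S (tensor x z)"
  using tensor_ext_left[of x U V W "%v. T (tensor v z)" "%v. S (tensor v z)"]
   linear_on_tensor_left[OF assms(2)] linear_on_tensor_left[OF assms(3)] assms(4) by simp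
qed

section \<open>Modules and triples\<close>

definition sl2_f :: "complex^2^2" where
 "sl2_f = vector [vector [0, 0], vector [1, 0]]"

lemma matrix2_eq_iff: "x = y \<longleftrightarrow> x $ 1 $ 1 = y $ 1 $ 1 & x $ 1 $ 2 = y $ 1 $ 2 & x $ 2 $ 1 = y $ 2 $ 1 & x $ 2 $ 2 = y $ 2 $ 2"
 for x y :: "'a^2^2"
 by (auto simp: vec_eq_iff forall_2)

lemma sl2_iff: "x \<in> sl2 \<longleftrightarrow> x $ 2 $ 2 = - x $ 1 $ 1"
 by (auto simp: sl2_def trace_def sum_2 eq_neg_iff_add_eq_0 add.commute)

lemma sl2_basis_in [simp]: "sl2_e \<in> sl2" "sl2_h \<in> sl2" "sl2_f \<in> sl2"
 by (simp_all add: sl2_iff sl2_e_def sl2_h_def sl2_f_def)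

lemma sl2_nth:
 "sl2_e $ 1 $ 1 = 0" "sl2_e $ 1 $ 2 = 1" "sl2_e $ 2 $ 1 = 0" "sl2_e $ 2 $ 2 = 0"
 "sl2_h $ 1 $ 1 = 1" "sl2_h $ 1 $ 2 = 0" "sl2_h $ 2 $ 1 = 0" "sl2_h $ 2 $ 2 = - 1"
 "sl2_f $ 1 $ 1 = 0" "sl2_f $ 1 $ 2 = 0" "sl2_f $ 2 $ 1 = 1" "sl2_f $ 2 $ 2 = 0"
 by (simp_all add: sl2_e_def sl2_h_def sl2_f_def)

lemma mscale_nth: "mscale c x $ i $ j = c * x $ i $ j"
 by (simp add: mscale_def)

lemma sl2_closed: "x \<in> sl2 ==> y \<in> sl2 ==> x + y \<in> sl2" "x \<in> sl2 ==> mscale c x \<in> sl2"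
 "x \<in> sl2 ==> y \<in> sl2 ==> x ** y - y ** x \<in> sl2"
 by (auto simp: sl2_iff mscale_nth matrix_matrix_mult_def sum_2 algebra_simps)

lemma sl2_brackets:
 "sl2_e ** sl2_f - sl2_f ** sl2_e = sl2_h"
 "sl2_h ** sl2_e - sl2_e ** sl2_h = mscale 2 sl2_e"
 "sl2_h ** sl2_f - sl2_f ** sl2_h = mscale (-2) sl2_f"
 by (simp_all add: matrix2_eq_iff mscale_nth matrix_matrix_mult_def sum_2 sl2_nth)

lemma sl2_decompose:
 "x \<in> sl2 ==> x = (mscale (x $ 1 $ 1) sl2_h + mscale (x $ 1 $ 2) sl2_e) + mscale (x $ 2 $ 1) sl2_f"
 by (simp add: matrix2_eq_iff mscale_nth sl2_nth sl2_iff)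

text \<open>An sl2-triple on a carrier, detached from the module record. The same lemmas then serve
  submodules, spaces of sequences and triples with \<open>e\<close> and \<open>f\<close>
  exchanged.\<close>

locale sl2_rep =
 fixes V :: "cseq set" and e h f :: "cseq => cseq"
 assumes subspace_V [simp, intro]: "cs.subspace V"
  and linear_e [simp, intro]: "linear_on V e" and linear_h [simp, intro]: "linear_on V h"
  and linear_f [simp, intro]: "linear_on V f"
  and e_in [simp, intro]: "v \<in> V ==> e v \<in> V" and h_in [simp, intro]: "v \<in> V ==> h v \<in> V"
  and f_in [simp, intro]: "v \<in> V ==> f v \<in> V"
  and h_e: "v \<in> V ==> h (e v) = e (h v) + cscale 2 (e v)"
  and h_f: "v \<in> V ==> h (f v) = f (h v) - cscale 2 (f v)"
  and e_f: "v \<in> V ==> e (f v) = f (e v) + h v"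

lemma sl2_module_subspace: "M \<in> sl2_modules ==> cs.subspace (car M)"
 and sl2_module_linear: "M \<in> sl2_modules ==> x \<in> sl2 ==> linear_on (car M) (act M x)"
 and sl2_module_in: "M \<in> sl2_modules ==> x \<in> sl2 ==> v \<in> car M ==> act M x v \<in> car M"
 and sl2_module_scale: "M \<in> sl2_modules ==> x \<in> sl2 ==> v \<in> car M ==> act M (mscale c x) v = cscale c (act M x v)"
 and sl2_module_add: "M \<in> sl2_modules ==> x \<in> sl2 ==> y \<in> sl2 ==> v \<in> car M ==>
  act M (x + y) v = act M x v + act M y v"
 and sl2_module_bracket: "M \<in> sl2_modules ==> x \<in> sl2 ==> y \<in> sl2 ==> v \<in> car M ==>
  act M (x ** y - y ** x) v = act M x (act M y v) - act M y (act M x v)"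
 unfolding sl2_modules_def by blast+

lemma sl2_module_rep:
 assumes M: "M \<in> sl2_modules"
 shows "sl2_rep (car M) (act M sl2_e) (act M sl2_h) (act M sl2_f)"
proof
 fix v assume v: "v \<in> car M"
 show "act M sl2_h (act M sl2_e v) = act M sl2_e (act M sl2_h v) + cscale 2 (act M sl2_e v)"
  using sl2_module_bracket[OF M _ _ v, of sl2_h sl2_e] sl2_module_scale[OF M _ v, of sl2_e 2]
  by (simp add: sl2_brackets algebra_simps)
 show "act M sl2_h (act M sl2_f v) = act M sl2_f (act M sl2_h v) - cscale 2 (act M sl2_f v)"
  using sl2_module_bracket[OF M _ _ v, of sl2_h sl2_f] sl2_module_scale[OF M _ v, of sl2_f "-2"]
  by (simp add: sl2_brackets algebra_simps)
 show "act M sl2_e (act M sl2_f v) = act M sl2_f (act M sl2_e v) + act M sl2_h v"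
  using sl2_module_bracket[OF M _ _ v, of sl2_e sl2_f]
  by (simp add: sl2_brackets algebra_simps)
qed (auto simp: sl2_module_subspace[OF M] sl2_module_linear[OF M] sl2_module_in[OF M])

lemma sl2_module_act:
 assumes M: "M \<in> sl2_modules" and x: "x \<in> sl2" and v: "v \<in> car M"
 shows "act M x v = cscale (x $ 1 $ 1) (act M sl2_h v) + cscale (x $ 1 $ 2) (act M sl2_e v) +
  cscale (x $ 2 $ 1) (act M sl2_f v)"
proof -
 have "act M x v = act M ((mscale (x $ 1 $ 1) sl2_h + mscale (x $ 1 $ 2) sl2_e) + mscale (x $ 2 $ 1) sl2_f) v"
  using sl2_decompose[OF x] by simp
 then show ?thesis
  by (simp only: sl2_module_add[OF M _ _ v] sl2_module_scale[OF M _ v] sl2_closed sl2_basis_in)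
qed

text \<open>Converse of \<open>sl2_module_rep\<close>: the entries \<open>x $ 1 $ 1\<close>,
  \<open>x $ 1 $ 2\<close> and \<open>x $ 2 $ 1\<close> are the coordinates of a traceless matrix in
  the basis \<open>h\<close>, \<open>e\<close>, \<open>f\<close>, so a triple determines the whole
  action.\<close>

definition mk_module :: "cseq set => (cseq => cseq) => (cseq => cseq) => (cseq => cseq) => sl2_module" where
 "mk_module V e h f = \<lparr>car = V, act = (%x v. cscale (x $ 1 $ 1) (h v) + cscale (x $ 1 $ 2) (e v) +
  cscale (x $ 2 $ 1) (f v))\<rparr>"

lemma mk_module_simps [simp]: "car (mk_module V e h f) = V" "act (mk_module V e h f) sl2_e = e"
 "act (mk_module V e h f) sl2_h = h" "act (mk_module V e h f) sl2_f = f"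
 by (simp_all add: mk_module_def sl2_nth)

lemma (in sl2_rep) mk_module_in: "mk_module V e h f \<in> sl2_modules"
proof -
 have "linear_on V (%v. cscale (x $ 1 $ 1) (h v) + cscale (x $ 1 $ 2) (e v) + cscale (x $ 2 $ 1) (f v))"
  for x :: "complex^2^2"
  by (intro linear_on_plus linear_on_cscale linear_e linear_h linear_f)
 moreover have "cscale (x $ 1 $ 1) (h v) + cscale (x $ 1 $ 2) (e v) + cscale (x $ 2 $ 1) (f v) \<in> V" if "v \<in> V"
  for x :: "complex^2^2" and v
  using that by (intro cs.subspace_add cs.subspace_scale) auto
 moreover have lin: "T (cscale a u + cscale b v + cscale c w) = cscale a (T u) + cscale b (T v) + cscale c (T w)"
  if "linear_on V T" "u \<in> V" "v \<in> V" "w \<in> V" for T a b c u v w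
  using that(2-4) by (simp add: linear_on_add[OF that(1)] linear_on_scale[OF that(1)] cs.subspace_add cs.subspace_scale)
 have "act (mk_module V e h f) (x ** y - y ** x) v =
   act (mk_module V e h f) x (act (mk_module V e h f) y v) - act (mk_module V e h f) y (act (mk_module V e h f) x v)"
  if "x \<in> sl2" "y \<in> sl2" "v \<in> V" for x y v
  using that
  by (simp add: mk_module_def lin h_e h_f e_f sl2_iff matrix_matrix_mult_def sum_2)
   (simp add: fun_eq_iff cscale_def algebra_simps)
 ultimately show ?thesis
  unfolding sl2_modules_def
  by (auto simp: mk_module_def mscale_nth) (simp_all add: fun_eq_iff cscale_def algebra_simps)
qed

section \<open>Arrows\<close>

text \<open>Source and target are read off from the arrow itself, so that equations between
  composites can be simplified without carrying the objects along.\<close>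

definition arr :: "sl2_arrow => bool" where
 "arr f \<longleftrightarrow> src f \<in> sl2_modules & tgt f \<in> sl2_modules & f \<in> sl2_Hom (src f) (tgt f)"

lemma Hom_iff_arr: "M \<in> sl2_modules ==> N \<in> sl2_modules ==> f \<in> sl2_Hom M N \<longleftrightarrow> arr f & src f = M & tgt f = N"
 by (auto simp: arr_def sl2_Hom_def)

lemma arr_src [simp]: "arr f ==> src f \<in> sl2_modules"
 and arr_tgt [simp]: "arr f ==> tgt f \<in> sl2_modules"
 and arr_linear: "arr f ==> linear_on (car (src f)) (fn f)"
 and arr_in: "arr f ==> v \<in> car (src f) ==> fn f v \<in> car (tgt f)"
 and arr_act: "arr f ==> x \<in> sl2 ==> v \<in> car (src f) ==> fn f (act (src f) x v) = act (tgt f) x (fn f v)"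
 and arr_outside: "arr f ==> v \<notin> car (src f) ==> fn f v = 0"
 by (auto simp: arr_def sl2_Hom_def)

lemma arr_in' [simp]: "arr f ==> src f = M ==> tgt f = N ==> v \<in> car M ==> fn f v \<in> car N"
 using arr_in by auto

lemma arr_ext:
 assumes "arr f" "arr g" "src f = src g" "tgt f = tgt g" "!!v. v \<in> car (src g) ==> fn f v = fn g v"
 shows "f = g"
proof (rule sl2_arrow.equality)
 show "fn f = fn g"
 proof
  fix v show "fn f v = fn g v"
   using assms arr_outside[of f v] arr_outside[of g v] by (cases "v \<in> car (src g)") auto
 qed
qed (use assms in auto)

lemma sl2_arr_sel [simp]: "src (sl2_arr M N T) = M" "tgt (sl2_arr M N T) = N"
 "v \<in> car M ==> fn (sl2_arr M N T) v = T v"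
 by (simp_all add: sl2_arr_def)

lemma arr_sl2_arrI:
 assumes M: "M \<in> sl2_modules" and N: "N \<in> sl2_modules" and lin: "linear_on (car M) T"
  and into: "!!v. v \<in> car M ==> T v \<in> car N"
  and act: "!!x v. x \<in> sl2 ==> v \<in> car M ==> T (act M x v) = act N x (T v)"
 shows "arr (sl2_arr M N T)"
 unfolding arr_def sl2_Hom_def sl2_arr_def
 using assms linear_on_cong[OF _ sl2_module_subspace[OF M] lin] sl2_module_in[OF M] by auto

text \<open>\<open>sl2_h\<close> is the commutator of \<open>sl2_e\<close> and \<open>sl2_f\<close>,
  so compatibility with these two propagates to the whole Lie algebra.\<close>

lemma arr_sl2_arrI2:
 assumes M: "M \<in> sl2_modules" and N: "N \<in> sl2_modules" and lin: "linear_on (car M) T"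
  and into: "!!v. v \<in> car M ==> T v \<in> car N"
  and e: "!!v. v \<in> car M ==> T (act M sl2_e v) = act N sl2_e (T v)"
  and f: "!!v. v \<in> car M ==> T (act M sl2_f v) = act N sl2_f (T v)"
 shows "arr (sl2_arr M N T)"
proof (rule arr_sl2_arrI[OF M N lin into])
 interpret M: sl2_rep "car M" "act M sl2_e" "act M sl2_h" "act M sl2_f" by (rule sl2_module_rep[OF M])
 interpret N: sl2_rep "car N" "act N sl2_e" "act N sl2_h" "act N sl2_f" by (rule sl2_module_rep[OF N])
 fix x v assume x: "x \<in> sl2" and v: "v \<in> car M"
 have "T (act M sl2_h v) = T (act M sl2_e (act M sl2_f v) - act M sl2_f (act M sl2_e v))"
  using M.e_f[OF v] by simp
 also have "... = act N sl2_e (act N sl2_f (T v)) - act N sl2_f (act N sl2_e (T v))"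
  using v by (simp add: linear_on_diff[OF lin] e f)
 also have "... = act N sl2_h (T v)"
  using N.e_f[OF into[OF v]] by simp
 finally have h: "T (act M sl2_h v) = act N sl2_h (T v)" .
 show "T (act M x v) = act N x (T v)"
  using v into[OF v] by (simp add: sl2_module_act[OF M x] sl2_module_act[OF N x] linear_on_add[OF lin]
    linear_on_scale[OF lin] cs.subspace_add cs.subspace_scale e f h)
qed

definition sl2_id :: "sl2_module => sl2_arrow" where
 "sl2_id M = sl2_arr M M id"

definition sl2_comp :: "sl2_arrow => sl2_arrow => sl2_arrow" where
 "sl2_comp g f = sl2_arr (src f) (tgt g) (fn g \<circ> fn f)"

definition sl2_add :: "sl2_arrow => sl2_arrow => sl2_arrow" where
 "sl2_add f g = sl2_arr (src f) (tgt f) (%v. fn f v + fn g v)"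

definition sl2_scale :: "complex => sl2_arrow => sl2_arrow" where
 "sl2_scale c f = sl2_arr (src f) (tgt f) (%v. cscale c (fn f v))"

lemma src_tgt_ops [simp]:
 "src (sl2_id M) = M" "tgt (sl2_id M) = M" "src (sl2_comp g f) = src f" "tgt (sl2_comp g f) = tgt g"
 "src (sl2_add f g) = src f" "tgt (sl2_add f g) = tgt f" "src (sl2_scale c f) = src f" "tgt (sl2_scale c f) = tgt f"
 by (simp_all add: sl2_id_def sl2_comp_def sl2_add_def sl2_scale_def)

lemma fn_ops [simp]:
 "v \<in> car M ==> fn (sl2_id M) v = v"
 "v \<in> car (src f) ==> fn (sl2_comp g f) v = fn g (fn f v)"
 "v \<in> car (src f) ==> fn (sl2_add f g) v = fn f v + fn g v"
 "v \<in> car (src f) ==> fn (sl2_scale c f) v = cscale c (fn f v)"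
 by (simp_all add: sl2_id_def sl2_comp_def sl2_add_def sl2_scale_def)

lemma arr_id [simp]: "M \<in> sl2_modules ==> arr (sl2_id M)"
 unfolding sl2_id_def by (rule arr_sl2_arrI) (auto simp: linear_on_id)

lemma arr_comp [simp]:
 assumes "arr f" "arr g" "src g = tgt f"
 shows "arr (sl2_comp g f)"
 unfolding sl2_comp_def
proof (rule arr_sl2_arrI)
 show "linear_on (car (src f)) (fn g \<circ> fn f)"
  using assms by (intro linear_on_comp(1)[OF arr_linear arr_linear]) (auto intro: arr_in)
 fix x v assume "x \<in> sl2" "v \<in> car (src f)"
 then show "(fn g \<circ> fn f) (act (src f) x v) = act (tgt g) x ((fn g \<circ> fn f) v)"
  using assms arr_act[of g x "fn f v"] by (simp add: arr_act[OF assms(1)])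
qed (use assms in auto)

lemma arr_add [simp]:
 assumes "arr f" "arr g" "src g = src f" "tgt g = tgt f"
 shows "arr (sl2_add f g)"
 unfolding sl2_add_def
proof (rule arr_sl2_arrI)
 show "linear_on (car (src f)) (%v. fn f v + fn g v)"
  using assms arr_linear[of f] arr_linear[of g] by (intro linear_on_plus) auto
 fix x v assume "x \<in> sl2" "v \<in> car (src f)"
 then show "fn f (act (src f) x v) + fn g (act (src f) x v) = act (tgt f) x (fn f v + fn g v)"
  using assms arr_act[OF assms(1)] arr_act[OF assms(2)] linear_on_add[OF sl2_module_linear[of "tgt f" x]]
  by simp
qed (use assms in \<open>auto intro: cs.subspace_add simp: sl2_module_subspace\<close>)

lemma arr_scale [simp]:
 assumes "arr f"
 shows "arr (sl2_scale c f)"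
 unfolding sl2_scale_def
proof (rule arr_sl2_arrI)
 show "linear_on (car (src f)) (%v. cscale c (fn f v))"
  using assms arr_linear[of f] by (intro linear_on_cscale) auto
 fix x v assume "x \<in> sl2" "v \<in> car (src f)"
 then show "cscale c (fn f (act (src f) x v)) = act (tgt f) x (cscale c (fn f v))"
  using assms arr_act[OF assms(1)] linear_on_scale[OF sl2_module_linear[of "tgt f" x]]
  by simp
qed (use assms in \<open>auto intro: cs.subspace_scale simp: sl2_module_subspace\<close>)

lemma arr_cscale: "arr f ==> v \<in> car (src f) ==> fn f (cscale c v) = cscale c (fn f v)"
 and arr_plus: "arr f ==> v \<in> car (src f) ==> w \<in> car (src f) ==> fn f (v + w) = fn f v + fn f w"
 using arr_linear linear_on_scale linear_on_add by blast+

lemma arr_0: "arr f ==> fn f 0 = 0"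
 using linear_on_0[OF arr_linear sl2_module_subspace[OF arr_src]] by blast

lemma sl2_cat_sel [simp]: "Obj (sl2_cat S) = S" "Hom (sl2_cat S) = sl2_Hom" "Idn (sl2_cat S) = sl2_id"
 "Comp (sl2_cat S) = sl2_comp" "Add (sl2_cat S) = sl2_add" "Scale (sl2_cat S) = sl2_scale"
 by (auto simp: sl2_cat_def sl2_id_def sl2_comp_def sl2_add_def sl2_scale_def fun_eq_iff)

text \<open>Formulated for any record extension with the standard basic fields, because
  \<open>fd_sl2\<close> and every \<open>sl2_module_cat S\<close> are such extensions.\<close>

lemma sl2_linear_category:
 fixes C :: "(sl2_module, sl2_arrow, 'z) category_scheme"
 assumes S: "Obj C \<subseteq> sl2_modules" and sel: "Hom C = sl2_Hom" "Idn C = sl2_id" "Comp C = sl2_comp"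
  "Add C = sl2_add" "Scale C = sl2_scale"
 shows "linear_category C"
proof -
 have [simp]: "M \<in> Obj C ==> M \<in> sl2_modules" for M using S by auto
 show ?thesis
 proof (unfold_locales, unfold sel)
  fix a b :: sl2_module assume ab: "{a, b} \<subseteq> Obj C"
  let ?z = "sl2_arr a b (\<lambda>v. 0)"
  have sub: "cs.subspace (car a)" "cs.subspace (car b)" using ab by (simp_all add: sl2_module_subspace)
  have z: "arr ?z"
   using ab sub linear_on_0[OF sl2_module_linear[of b] sub(2)]
   by (intro arr_sl2_arrI) (auto intro: linear_on_const_0 cs.subspace_0)
  show "\<exists>z\<in>sl2_Hom a b. \<forall>f\<in>sl2_Hom a b. sl2_add z f = f & (\<exists>g\<in>sl2_Hom a b. sl2_add f g = z)"
  proof (rule bexI[of _ ?z], intro ballI conjI)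
   fix f assume f: "f \<in> sl2_Hom a b"
   then have f': "arr f" "src f = a" "tgt f = b" using ab by (simp_all add: Hom_iff_arr)
   show "sl2_add ?z f = f" by (rule arr_ext) (simp_all add: f' z)
   show "\<exists>g\<in>sl2_Hom a b. sl2_add f g = ?z"
    using ab by (intro bexI[of _ "sl2_scale (-1) f"] arr_ext) (simp_all add: f' z Hom_iff_arr)
  qed (use ab z in \<open>simp add: Hom_iff_arr\<close>)
 qed (auto simp: Hom_iff_arr arr_cscale arr_plus cs.scale_right_distrib cs.scale_left_distrib add.assoc add.commute
    intro!: arr_ext)
qed

lemma iso_arrowsI:
 fixes C :: "(sl2_module, sl2_arrow, 'z) category_scheme"
 assumes S: "M \<in> sl2_modules" "N \<in> sl2_modules" and sel: "Hom C = sl2_Hom" "Idn C = sl2_id" "Comp C = sl2_comp"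
  and f: "arr f" "src f = M" "tgt f = N" and g: "arr g" "src g = N" "tgt g = M"
  and gf: "!!v. v \<in> car M ==> fn g (fn f v) = v" and fg: "!!v. v \<in> car N ==> fn f (fn g v) = v"
 shows "f \<in> iso_arrows C M N"
proof -
 have "sl2_comp g f = sl2_id M" "sl2_comp f g = sl2_id N"
  by (auto intro!: arr_ext simp: assms)
 then show ?thesis unfolding iso_arrows_def sel using assms by (auto simp: Hom_iff_arr intro!: exI[of _ g])
qed

text \<open>The set-theoretic inverse of an equivariant linear bijection is again linear and
  equivariant, as one sees after applying the bijection to both sides.\<close>

lemma iso_arrows_bij:
 fixes C :: "(sl2_module, sl2_arrow, 'z) category_scheme"
 assumes S: "M \<in> sl2_modules" "N \<in> sl2_modules" and sel: "Hom C = sl2_Hom" "Idn C = sl2_id" "Comp C = sl2_comp"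
  and f: "arr f" "src f = M" "tgt f = N" and bij: "bij_betw (fn f) (car M) (car N)"
 shows "f \<in> iso_arrows C M N"
proof -
 let ?T = "inv_into (car M) (fn f)"
 have inv: "?T (fn f v) = v" if "v \<in> car M" for v
  using bij_betw_inv_into_left[OF bij that] .
 have inv': "fn f (?T v) = v" "?T v \<in> car M" if "v \<in> car N" for v
  using bij_betw_inv_into_right[OF bij that] bij_betw_apply[OF bij_betw_inv_into[OF bij] that] by auto
 have sub: "cs.subspace (car M)" "cs.subspace (car N)" using S by (simp_all add: sl2_module_subspace)
 have eqI: "?T w = v" if "v \<in> car M" "fn f v = w" for v w using inv that by auto
 have arr: "arr (sl2_arr N M ?T)"
 proof (rule arr_sl2_arrI[OF S(2,1)])
  show "linear_on (car N) ?T"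
   by (rule linear_onI; rule eqI)
    (auto simp: inv' arr_plus arr_cscale f sub cs.subspace_add cs.subspace_scale)
  show "?T (act N x v) = act M x (?T v)" if "x \<in> sl2" "v \<in> car N" for x v
   using that arr_act[OF f(1) that(1), of "?T v"]
   by (intro eqI) (auto simp: inv' f sl2_module_in S)
 qed (simp add: inv')
 show ?thesis
  by (rule iso_arrowsI[OF S sel f arr]) (auto simp: inv inv' f)
qed

section \<open>Tensor products of modules\<close>

lemma car_tensor [simp]: "car (sl2_tensor M N) = tensor_space (car M) (car N)"
 by (simp add: sl2_tensor_def)

lemma
 assumes M: "M \<in> sl2_modules" and N: "N \<in> sl2_modules" and x: "x \<in> sl2"
 shows act_tensor [simp]: "v \<in> car M ==> w \<in> car N ==>
   act (sl2_tensor M N) x (tensor v w) = tensor (act M x v) w + tensor v (act N x w)"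
  and linear_act_tensor: "linear_on (tensor_space (car M) (car N)) (act (sl2_tensor M N) x)"
  and act_tensor_in: "t \<in> tensor_space (car M) (car N) ==> act (sl2_tensor M N) x t \<in> tensor_space (car M) (car N)"
proof -
 interpret tensor_pair "car M" "car N" using M N by unfold_locales (auto simp: sl2_module_subspace)
 have lin: "linear_on (car M) (act M x)" "linear_on (car N) (act N x)"
  using M N x by (auto simp: sl2_module_linear)
 show "v \<in> car M ==> w \<in> car N ==>
   act (sl2_tensor M N) x (tensor v w) = tensor (act M x v) w + tensor v (act N x w)"
  by (simp add: sl2_tensor_def tensor_map_tensor lin linear_on_id)
 show "linear_on (tensor_space (car M) (car N)) (act (sl2_tensor M N) x)"
  unfolding sl2_tensor_def by (auto intro!: linear_on_plus linear_on_tensor_map simp: lin linear_on_id)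
 have "act M x ` car M \<subseteq> car M" "act N x ` car N \<subseteq> car N" using sl2_module_in[OF _ x] M N by auto
 then show "t \<in> tensor_space (car M) (car N) ==> act (sl2_tensor M N) x t \<in> tensor_space (car M) (car N)"
  unfolding sl2_tensor_def
  by (auto intro!: cs.subspace_add tensor_map_in simp: lin linear_on_id)
qed

lemma sl2_tensor_in [simp]:
 assumes M: "M \<in> sl2_modules" and N: "N \<in> sl2_modules"
 shows "sl2_tensor M N \<in> sl2_modules"
proof -
 let ?T = "sl2_tensor M N"
 note lin = linear_act_tensor[OF M N] and into = act_tensor_in[OF M N]
 have "act ?T (mscale c x) t = cscale c (act ?T x t)" if "x \<in> sl2" "t \<in> tensor_space (car M) (car N)" for c x t
  by (rule tensor_ext[OF that(2) lin linear_on_cscale[OF lin]])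
   (use that M N in \<open>auto simp: sl2_closed sl2_module_scale tensor_scale_left tensor_scale_right cs.scale_right_distrib\<close>)
 moreover have "act ?T (x + y) t = act ?T x t + act ?T y t"
  if "x \<in> sl2" "y \<in> sl2" "t \<in> tensor_space (car M) (car N)" for x y t
  by (rule tensor_ext[OF that(3) lin linear_on_plus[OF lin lin]])
   (use that M N in \<open>auto simp: sl2_closed sl2_module_add tensor_add_left tensor_add_right\<close>)
 moreover have "act ?T (x ** y - y ** x) t = act ?T x (act ?T y t) - act ?T y (act ?T x t)"
  if xy: "x \<in> sl2" "y \<in> sl2" and t: "t \<in> tensor_space (car M) (car N)" for x y t
 proof (rule tensor_ext[OF t lin linear_on_minus_fun])
  show "linear_on (tensor_space (car M) (car N)) (%t. act ?T x (act ?T y t))"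
   "linear_on (tensor_space (car M) (car N)) (%t. act ?T y (act ?T x t))"
   by (rule linear_on_comp(2)[OF lin lin]; use xy into in auto)+
  fix v w assume "v \<in> car M" "w \<in> car N"
  then show "act ?T (x ** y - y ** x) (tensor v w) = act ?T x (act ?T y (tensor v w)) - act ?T y (act ?T x (tensor v w))"
   using xy M N
   by (simp add: sl2_closed sl2_module_in sl2_module_bracket linear_on_add[OF lin] tensor_diff_left tensor_diff_right)
 qed (use xy in \<open>auto simp: sl2_closed\<close>)
 ultimately show ?thesis
  unfolding sl2_modules_def[of] using lin into by auto
qed

lemma arr_ext_tensor:
 assumes "arr f" "arr g" "src f = sl2_tensor M N" "src g = sl2_tensor M N" "tgt f = tgt g"
  "!!v w. v \<in> car M ==> w \<in> car N ==> fn f (tensor v w) = fn g (tensor v w)"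
 shows "f = g"
proof (rule arr_ext)
 fix t assume "t \<in> car (src g)"
 then show "fn f t = fn g t"
  using arr_linear[OF assms(1)] arr_linear[OF assms(2)] assms(3-6) by (auto intro: tensor_ext)
qed (use assms in auto)

lemma arr_ext_left:
 assumes "arr f" "arr g" "src f = sl2_tensor (sl2_tensor K M) N" "src g = sl2_tensor (sl2_tensor K M) N" "tgt f = tgt g"
  "!!u v w. u \<in> car K ==> v \<in> car M ==> w \<in> car N ==> fn f (tensor (tensor u v) w) = fn g (tensor (tensor u v) w)"
 shows "f = g"
proof (rule arr_ext)
 fix t assume "t \<in> car (src g)"
 then show "fn f t = fn g t"
  using arr_linear[OF assms(1)] arr_linear[OF assms(2)] assms(3-6) by (auto intro: tensor_ext_left)
qed (use assms in auto)

lemma arr_ext_left2: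
 assumes "arr f" "arr g" "src f = sl2_tensor (sl2_tensor (sl2_tensor K M) N) P"
  "src g = sl2_tensor (sl2_tensor (sl2_tensor K M) N) P" "tgt f = tgt g"
  "!!u v w z. u \<in> car K ==> v \<in> car M ==> w \<in> car N ==> z \<in> car P ==>
   fn f (tensor (tensor (tensor u v) w) z) = fn g (tensor (tensor (tensor u v) w) z)"
 shows "f = g"
proof (rule arr_ext)
 fix t assume "t \<in> car (src g)"
 then show "fn f t = fn g t"
  using arr_linear[OF assms(1)] arr_linear[OF assms(2)] assms(3-6) by (auto intro: tensor_ext_left2)
qed (use assms in auto)

lemma src_tgt_tensor_arr [simp]: "src (sl2_tensor_arr f g) = sl2_tensor (src f) (src g)"
 "tgt (sl2_tensor_arr f g) = sl2_tensor (tgt f) (tgt g)"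
 by (simp_all add: sl2_tensor_arr_def)

lemma
 assumes f: "arr f" and g: "arr g"
 shows fn_tensor_arr [simp]: "v \<in> car (src f) ==> w \<in> car (src g) ==>
   fn (sl2_tensor_arr f g) (tensor v w) = tensor (fn f v) (fn g w)"
  and arr_tensor_arr [simp]: "arr (sl2_tensor_arr f g)"
proof -
 interpret tensor_pair "car (src f)" "car (src g)" using f g by unfold_locales (auto simp: sl2_module_subspace)
 note lin = arr_linear[OF f] arr_linear[OF g]
 show *: "v \<in> car (src f) ==> w \<in> car (src g) ==>
   fn (sl2_tensor_arr f g) (tensor v w) = tensor (fn f v) (fn g w)" for v w
  by (simp add: sl2_tensor_arr_def tensor_map_tensor lin)
 let ?T = "tensor_map (car (src f)) (car (src g)) (fn f) (fn g)"
 show "arr (sl2_tensor_arr f g)"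
  unfolding sl2_tensor_arr_def
 proof (rule arr_sl2_arrI)
  show lin': "linear_on (car (sl2_tensor (src f) (src g))) ?T"
   by (simp add: linear_on_tensor_map lin)
  show into: "?T t \<in> car (sl2_tensor (tgt f) (tgt g))" if "t \<in> car (sl2_tensor (src f) (src g))" for t
   using that f g by (auto intro!: tensor_map_in lin)
  fix x t assume x: "x \<in> sl2" and t: "t \<in> car (sl2_tensor (src f) (src g))"
  note la = linear_act_tensor[OF _ _ x, of "src f" "src g"] linear_act_tensor[OF _ _ x, of "tgt f" "tgt g"]
  show "?T (act (sl2_tensor (src f) (src g)) x t) = act (sl2_tensor (tgt f) (tgt g)) x (?T t)"
  proof (rule tensor_ext[OF t[unfolded car_tensor]])
   show "linear_on (tensor_space (car (src f)) (car (src g))) (%t. ?T (act (sl2_tensor (src f) (src g)) x t))"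
    by (rule linear_on_comp(2)[OF la(1) lin'[unfolded car_tensor]]) (use f g x act_tensor_in in auto)
   show "linear_on (tensor_space (car (src f)) (car (src g))) (%t. act (sl2_tensor (tgt f) (tgt g)) x (?T t))"
    by (rule linear_on_comp(2)[OF lin'[unfolded car_tensor] la(2)]) (use f g into in auto)
   fix v w assume "v \<in> car (src f)" "w \<in> car (src g)"
   then show "?T (act (sl2_tensor (src f) (src g)) x (tensor v w)) = act (sl2_tensor (tgt f) (tgt g)) x (?T (tensor v w))"
    using f g x by (simp add: linear_on_add[OF lin'] sl2_module_in tensor_map_tensor lin arr_act)
  qed
 qed (use f g in auto)
qed

section \<open>The monoidal category and its module categories\<close>

lemma tensor_space_left_subset:
 assumes "!!u v w. u \<in> U ==> v \<in> V ==> w \<in> W ==> tensor (tensor u v) w \<in> S" "cs.subspace S"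
 shows "tensor_space (tensor_space U V) W \<subseteq> S"
proof (rule tensor_space_subset[OF _ assms(2)])
 fix t w assume t: "t \<in> tensor_space U V" and w: "w \<in> W"
 have "cs.subspace {t. tensor t w \<in> S}"
  using assms(2) by (intro cs.subspaceI)
   (simp_all add: tensor_add_left tensor_scale_left cs.subspace_0 cs.subspace_add cs.subspace_scale)
 then have "tensor_space U V \<subseteq> {t. tensor t w \<in> S}"
  using assms(1) w by (intro tensor_space_subset) auto
 then show "tensor t w \<in> S" using t by auto
qed

lemma tensor_space_right_subset:
 assumes "!!u v w. u \<in> U ==> v \<in> V ==> w \<in> W ==> tensor u (tensor v w) \<in> S" "cs.subspace S"
 shows "tensor_space U (tensor_space V W) \<subseteq> S"
proof (rule tensor_space_subset[OF _ assms(2)])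
 fix t u assume t: "t \<in> tensor_space V W" and u: "u \<in> U"
 have "cs.subspace {t. tensor u t \<in> S}"
  using assms(2) by (intro cs.subspaceI)
   (simp_all add: tensor_add_right tensor_scale_right cs.subspace_0 cs.subspace_add cs.subspace_scale)
 then have "tensor_space V W \<subseteq> {t. tensor u t \<in> S}"
  using assms(1) u by (intro tensor_space_subset) auto
 then show "tensor u t \<in> S" using t by auto
qed

lemma arr_tensorI:
 assumes M: "M \<in> sl2_modules" and N: "N \<in> sl2_modules" and P: "P \<in> sl2_modules"
  and lin: "linear_on (tensor_space (car M) (car N)) T"
  and into: "!!v w. v \<in> car M ==> w \<in> car N ==> T (tensor v w) \<in> car P"
  and act: "!!x v w. x \<in> sl2 ==> v \<in> car M ==> w \<in> car N ==>
   T (tensor (act M x v) w + tensor v (act N x w)) = act P x (T (tensor v w))"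
 shows "arr (sl2_arr (sl2_tensor M N) P T)"
proof -
 have sub: "cs.subspace (car P)" by (rule sl2_module_subspace[OF P])
 have into': "tensor_space (car M) (car N) \<subseteq> {t \<in> tensor_space (car M) (car N). T t \<in> car P}"
  by (rule tensor_space_subset) (auto simp: into intro: linear_on_vimage_subspace lin sub)
 show ?thesis
 proof (rule arr_sl2_arrI)
  fix x t assume x: "x \<in> sl2" and t: "t \<in> car (sl2_tensor M N)"
  note la = linear_act_tensor[OF M N x] sl2_module_linear[OF P x]
  show "T (act (sl2_tensor M N) x t) = act P x (T t)"
   by (rule tensor_ext[OF t[unfolded car_tensor] linear_on_comp(2)[OF la(1) lin] linear_on_comp(2)[OF lin la(2)]])
    (use into' act_tensor_in[OF M N x] act x M N in auto)
 qed (use assms into' in auto)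
qed

lemma arr_tensorI_left:
 assumes K: "K \<in> sl2_modules" and M: "M \<in> sl2_modules" and N: "N \<in> sl2_modules" and P: "P \<in> sl2_modules"
  and lin: "linear_on (tensor_space (tensor_space (car K) (car M)) (car N)) T"
  and into: "!!u v w. u \<in> car K ==> v \<in> car M ==> w \<in> car N ==> T (tensor (tensor u v) w) \<in> car P"
  and act: "!!x u v w. x \<in> sl2 ==> u \<in> car K ==> v \<in> car M ==> w \<in> car N ==>
   T (act (sl2_tensor (sl2_tensor K M) N) x (tensor (tensor u v) w)) = act P x (T (tensor (tensor u v) w))"
 shows "arr (sl2_arr (sl2_tensor (sl2_tensor K M) N) P T)"
proof -
 let ?S = "tensor_space (tensor_space (car K) (car M)) (car N)"
 have sub: "cs.subspace (car P)" by (rule sl2_module_subspace[OF P])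
 have into': "?S \<subseteq> {t \<in> ?S. T t \<in> car P}"
  by (rule tensor_space_left_subset) (auto simp: into intro: linear_on_vimage_subspace lin sub)
 have KM: "sl2_tensor K M \<in> sl2_modules" using K M by simp
 show ?thesis
 proof (rule arr_sl2_arrI)
  fix x t assume x: "x \<in> sl2" and t: "t \<in> car (sl2_tensor (sl2_tensor K M) N)"
  note la = linear_act_tensor[OF KM N x, unfolded car_tensor] sl2_module_linear[OF P x]
  show "T (act (sl2_tensor (sl2_tensor K M) N) x t) = act P x (T t)"
   by (rule tensor_ext_left[OF t[unfolded car_tensor] linear_on_comp(2)[OF la(1) lin] linear_on_comp(2)[OF lin la(2)]])
    (use into' act_tensor_in[OF KM N x] act x in auto)
 qed (use assms into' in auto)
qed

lemma arr_tensorI_right: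
 assumes K: "K \<in> sl2_modules" and M: "M \<in> sl2_modules" and N: "N \<in> sl2_modules" and P: "P \<in> sl2_modules"
  and lin: "linear_on (tensor_space (car K) (tensor_space (car M) (car N))) T"
  and into: "!!u v w. u \<in> car K ==> v \<in> car M ==> w \<in> car N ==> T (tensor u (tensor v w)) \<in> car P"
  and act: "!!x u v w. x \<in> sl2 ==> u \<in> car K ==> v \<in> car M ==> w \<in> car N ==>
   T (act (sl2_tensor K (sl2_tensor M N)) x (tensor u (tensor v w))) = act P x (T (tensor u (tensor v w)))"
 shows "arr (sl2_arr (sl2_tensor K (sl2_tensor M N)) P T)"
proof -
 let ?S = "tensor_space (car K) (tensor_space (car M) (car N))"
 have sub: "cs.subspace (car P)" by (rule sl2_module_subspace[OF P])
 have into': "?S \<subseteq> {t \<in> ?S. T t \<in> car P}"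
  by (rule tensor_space_right_subset) (auto simp: into intro: linear_on_vimage_subspace lin sub)
 have MN: "sl2_tensor M N \<in> sl2_modules" using M N by simp
 show ?thesis
 proof (rule arr_sl2_arrI)
  fix x t assume x: "x \<in> sl2" and t: "t \<in> car (sl2_tensor K (sl2_tensor M N))"
  note la = linear_act_tensor[OF K MN x, unfolded car_tensor] sl2_module_linear[OF P x]
  show "T (act (sl2_tensor K (sl2_tensor M N)) x t) = act P x (T t)"
   by (rule tensor_ext_right[OF t[unfolded car_tensor] linear_on_comp(2)[OF la(1) lin] linear_on_comp(2)[OF lin la(2)]])
    (use into' act_tensor_in[OF K MN x] act x in auto)
 qed (use assms into' in auto)
qed

definition assoc_map :: "cseq => cseq" where
 "assoc_map t = (%n. case prod_decode n of (i, m) => case prod_decode m of (j, k) =>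
  t (prod_encode (prod_encode (i, j), k)))"

definition assoc_inv_map :: "cseq => cseq" where
 "assoc_inv_map t = (%n. case prod_decode n of (m, k) => case prod_decode m of (i, j) =>
  t (prod_encode (i, prod_encode (j, k))))"

lemma linear_on_assoc: "linear_on V assoc_map" "linear_on V assoc_inv_map"
 by (auto intro!: linear_onI simp: assoc_map_def assoc_inv_map_def fun_eq_iff cscale_def split: prod.split)

lemma assoc_map_tensor [simp]: "assoc_map (tensor (tensor u v) w) = tensor u (tensor v w)"
proof (rule cseq_pair_ext)
 fix i m show "assoc_map (tensor (tensor u v) w) (prod_encode (i, m)) = tensor u (tensor v w) (prod_encode (i, m))"
  by (cases "prod_decode m") (simp add: assoc_map_def tensor_def mult.assoc)
qed

lemma assoc_inv_map_tensor [simp]: "assoc_inv_map (tensor u (tensor v w)) = tensor (tensor u v) w"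
proof (rule cseq_pair_ext)
 fix m k show "assoc_inv_map (tensor u (tensor v w)) (prod_encode (m, k)) = tensor (tensor u v) w (prod_encode (m, k))"
  by (cases "prod_decode m") (simp add: assoc_inv_map_def tensor_def mult.assoc)
qed

lemma assoc_inverse [simp]: "assoc_inv_map (assoc_map t) = t" "assoc_map (assoc_inv_map t) = t"
proof -
 show "assoc_inv_map (assoc_map t) = t"
 proof (rule cseq_pair_ext)
  fix m k show "assoc_inv_map (assoc_map t) (prod_encode (m, k)) = t (prod_encode (m, k))"
   using prod_decode_inverse[of m] by (cases "prod_decode m") (simp add: assoc_inv_map_def assoc_map_def)
 qed
 show "assoc_map (assoc_inv_map t) = t"
 proof (rule cseq_pair_ext)
  fix i m show "assoc_map (assoc_inv_map t) (prod_encode (i, m)) = t (prod_encode (i, m))"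
   using prod_decode_inverse[of m] by (cases "prod_decode m") (simp add: assoc_inv_map_def assoc_map_def)
 qed
qed

lemma assoc_map_add: "assoc_map (s + t) = assoc_map s + assoc_map t"
 and assoc_inv_map_add: "assoc_inv_map (s + t) = assoc_inv_map s + assoc_inv_map t"
 using linear_on_assoc[of UNIV] by (simp_all add: linear_on_def)

lemma sl2_assoc_eq: "sl2_assoc K M N = sl2_arr (sl2_tensor (sl2_tensor K M) N) (sl2_tensor K (sl2_tensor M N)) assoc_map"
 by (simp add: sl2_assoc_def assoc_map_def[abs_def])

definition sl2_assoc_inv :: "sl2_module => sl2_module => sl2_module => sl2_arrow" where
 "sl2_assoc_inv K M N = sl2_arr (sl2_tensor K (sl2_tensor M N)) (sl2_tensor (sl2_tensor K M) N) assoc_inv_map"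

lemma src_tgt_assoc [simp]:
 "src (sl2_assoc K M N) = sl2_tensor (sl2_tensor K M) N" "tgt (sl2_assoc K M N) = sl2_tensor K (sl2_tensor M N)"
 "src (sl2_assoc_inv K M N) = sl2_tensor K (sl2_tensor M N)" "tgt (sl2_assoc_inv K M N) = sl2_tensor (sl2_tensor K M) N"
 by (simp_all add: sl2_assoc_eq sl2_assoc_inv_def)

lemma fn_assoc:
 "t \<in> tensor_space (tensor_space (car K) (car M)) (car N) ==> fn (sl2_assoc K M N) t = assoc_map t"
 "t \<in> tensor_space (car K) (tensor_space (car M) (car N)) ==> fn (sl2_assoc_inv K M N) t = assoc_inv_map t"
 by (simp_all add: sl2_assoc_eq sl2_assoc_inv_def)

lemma fn_assoc_tensor [simp]:
 "u \<in> car K ==> v \<in> car M ==> w \<in> car N ==> fn (sl2_assoc K M N) (tensor (tensor u v) w) = tensor u (tensor v w)"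
 "u \<in> car K ==> v \<in> car M ==> w \<in> car N ==> fn (sl2_assoc_inv K M N) (tensor u (tensor v w)) = tensor (tensor u v) w"
 by (simp_all add: fn_assoc)

lemma arr_assoc [simp]:
 assumes K: "K \<in> sl2_modules" and M: "M \<in> sl2_modules" and N: "N \<in> sl2_modules"
 shows "arr (sl2_assoc K M N)" "arr (sl2_assoc_inv K M N)"
 unfolding sl2_assoc_eq sl2_assoc_inv_def
 using assms sl2_module_in[OF K] sl2_module_in[OF M] sl2_module_in[OF N]
 by (intro arr_tensorI_left arr_tensorI_right linear_on_assoc;
   simp add: assoc_map_add assoc_inv_map_add tensor_add_left tensor_add_right add.assoc)+

lemma sl2_trivial_in [simp]: "sl2_trivial \<in> sl2_modules"
 by (auto simp: sl2_modules_def sl2_trivial_def linear_on_def cs.span_zero cs.span_scale cs.span_add)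

lemma car_trivial_iff: "a \<in> car sl2_trivial \<longleftrightarrow> a = cscale (a 0) sl2_unit_vector"
proof
 assume "a \<in> car sl2_trivial"
 then obtain c where "a = cscale c sl2_unit_vector" by (auto simp: sl2_trivial_def cs.span_singleton)
 then show "a = cscale (a 0) sl2_unit_vector" by (simp add: cscale_def sl2_unit_vector_def)
next
 assume "a = cscale (a 0) sl2_unit_vector"
 then show "a \<in> car sl2_trivial" by (metis sl2_trivial_def sl2_module.select_convs(1) cs.span_base cs.span_scale insertI1)
qed

lemma unit_vector_in [simp]: "sl2_unit_vector \<in> car sl2_trivial"
 by (simp add: sl2_trivial_def cs.span_base)

lemma act_trivial [simp]: "act sl2_trivial x v = 0"
 by (simp add: sl2_trivial_def)

lemma src_tgt_unitors [simp]:
 "src (sl2_lunit M) = sl2_tensor sl2_trivial M" "tgt (sl2_lunit M) = M"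
 "src (sl2_runit M) = sl2_tensor M sl2_trivial" "tgt (sl2_runit M) = M"
 by (simp_all add: sl2_lunit_def sl2_runit_def)

lemma fn_unitors [simp]:
 "a \<in> car sl2_trivial ==> v \<in> car M ==> fn (sl2_lunit M) (tensor a v) = cscale (a 0) v"
 "a \<in> car sl2_trivial ==> v \<in> car M ==> fn (sl2_runit M) (tensor v a) = cscale (a 0) v"
 by (simp_all add: sl2_lunit_def sl2_runit_def cscale_def mult.commute)

lemma arr_unitors [simp]:
 assumes M: "M \<in> sl2_modules"
 shows "arr (sl2_lunit M)" "arr (sl2_runit M)"
 unfolding sl2_lunit_def sl2_runit_def
proof -
 note lin = linear_on_scale[OF sl2_module_linear[OF M]]
 have eq: "(%n. a 0 * v n) = cscale (a 0) v" "(%n. v n * a 0) = cscale (a 0) v" for a v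
  by (simp_all add: cscale_def mult.commute)
 show "arr (sl2_arr (sl2_tensor sl2_trivial M) M (%t n. t (prod_encode (0, n))))"
  by (rule arr_tensorI)
   (auto simp: M eq lin sl2_module_subspace cs.subspace_scale intro!: linear_onI, auto simp: fun_eq_iff cscale_def)
 show "arr (sl2_arr (sl2_tensor M sl2_trivial) M (%t n. t (prod_encode (n, 0))))"
  by (rule arr_tensorI)
   (auto simp: M eq lin sl2_module_subspace cs.subspace_scale intro!: linear_onI, auto simp: fun_eq_iff cscale_def)
qed

lemma unitors_iso:
 fixes C :: "(sl2_module, sl2_arrow, 'z) category_scheme"
 assumes M: "M \<in> sl2_modules" and sel: "Hom C = sl2_Hom" "Idn C = sl2_id" "Comp C = sl2_comp"
 shows "sl2_lunit M \<in> iso_arrows C (sl2_tensor sl2_trivial M) M"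
  and "sl2_runit M \<in> iso_arrows C (sl2_tensor M sl2_trivial) M"
proof -
 let ?u = sl2_unit_vector
 have u0: "?u 0 = 1" by (simp add: sl2_unit_vector_def)
 have l: "arr (sl2_arr M (sl2_tensor sl2_trivial M) (%v. tensor ?u v))" (is "arr ?l")
  by (rule arr_sl2_arrI) (auto simp: M tensor_add_right tensor_scale_right intro!: linear_onI)
 have r: "arr (sl2_arr M (sl2_tensor M sl2_trivial) (%v. tensor v ?u))" (is "arr ?r")
  by (rule arr_sl2_arrI) (auto simp: M tensor_add_left tensor_scale_left intro!: linear_onI)
 have ten: "tensor ?u (cscale (a 0) v) = tensor a v" "tensor (cscale (a 0) v) ?u = tensor v a"
  if "a \<in> car sl2_trivial" for a v
  using that car_trivial_iff[of a] by (metis tensor_scale_left tensor_scale_right)+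
 have "sl2_comp ?l (sl2_lunit M) = sl2_id (sl2_tensor sl2_trivial M)"
  by (rule arr_ext_tensor) (use M l in \<open>auto simp: ten sl2_module_subspace cs.subspace_scale\<close>)
 then have l': "fn ?l (fn (sl2_lunit M) t) = t" if "t \<in> tensor_space (car sl2_trivial) (car M)" for t
  using fn_ops(2)[of t "sl2_lunit M" ?l] that by simp
 show "sl2_lunit M \<in> iso_arrows C (sl2_tensor sl2_trivial M) M"
  by (rule iso_arrowsI[OF _ _ sel _ _ _ l]) (use M l' u0 in auto)
 have "sl2_comp ?r (sl2_runit M) = sl2_id (sl2_tensor M sl2_trivial)"
  by (rule arr_ext_tensor) (use M r in \<open>auto simp: ten sl2_module_subspace cs.subspace_scale\<close>)
 then have r': "fn ?r (fn (sl2_runit M) t) = t" if "t \<in> tensor_space (car M) (car sl2_trivial)" for t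
  using fn_ops(2)[of t "sl2_runit M" ?r] that by simp
 show "sl2_runit M \<in> iso_arrows C (sl2_tensor M sl2_trivial) M"
  by (rule iso_arrowsI[OF _ _ sel _ _ _ r]) (use M r' u0 in auto)
qed

lemma assoc_in_tensor_space:
 "t \<in> tensor_space (tensor_space U V) W ==> assoc_map t \<in> tensor_space U (tensor_space V W)"
 "t \<in> tensor_space U (tensor_space V W) ==> assoc_inv_map t \<in> tensor_space (tensor_space U V) W"
proof -
 have "tensor_space (tensor_space U V) W \<subseteq>
   {t \<in> tensor_space (tensor_space U V) W. assoc_map t \<in> tensor_space U (tensor_space V W)}"
  by (rule tensor_space_left_subset) (auto intro!: linear_on_vimage_subspace linear_on_assoc)
 moreover have "tensor_space U (tensor_space V W) \<subseteq>
   {t \<in> tensor_space U (tensor_space V W). assoc_inv_map t \<in> tensor_space (tensor_space U V) W}"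
  by (rule tensor_space_right_subset) (auto intro!: linear_on_vimage_subspace linear_on_assoc)
 ultimately show
  "t \<in> tensor_space (tensor_space U V) W ==> assoc_map t \<in> tensor_space U (tensor_space V W)"
  "t \<in> tensor_space U (tensor_space V W) ==> assoc_inv_map t \<in> tensor_space (tensor_space U V) W"
  by auto
qed

lemma assoc_iso:
 fixes C :: "(sl2_module, sl2_arrow, 'z) category_scheme"
 assumes M: "K \<in> sl2_modules" "M \<in> sl2_modules" "N \<in> sl2_modules"
  and sel: "Hom C = sl2_Hom" "Idn C = sl2_id" "Comp C = sl2_comp"
 shows "sl2_assoc K M N \<in> iso_arrows C (sl2_tensor (sl2_tensor K M) N) (sl2_tensor K (sl2_tensor M N))"
 by (rule iso_arrowsI[OF _ _ sel, where g = "sl2_assoc_inv K M N"])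
  (use M in \<open>auto simp: fn_assoc assoc_in_tensor_space\<close>)

lemma tensor_in_span:
 assumes "v \<in> cs.span B" "w \<in> cs.span C"
 shows "tensor v w \<in> cs.span {tensor b c | b c. b \<in> B & c \<in> C}" (is "_ \<in> cs.span ?S")
proof -
 have 1: "tensor v c \<in> cs.span ?S" if "c \<in> C" for c
 proof -
  have "cs.subspace {v. tensor v c \<in> cs.span ?S}"
   by (intro cs.subspaceI)
    (simp_all add: tensor_add_left tensor_scale_left cs.span_zero cs.span_add cs.span_scale)
  then have "cs.span B \<subseteq> {v. tensor v c \<in> cs.span ?S}"
   using that by (intro span_sub) (auto intro!: cs.span_base)
  then show ?thesis using assms(1) by auto
 qed
 have "cs.subspace {w. tensor v w \<in> cs.span ?S}"
  by (intro cs.subspaceI)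
   (simp_all add: tensor_add_right tensor_scale_right cs.span_zero cs.span_add cs.span_scale)
 then have "cs.span C \<subseteq> {w. tensor v w \<in> cs.span ?S}"
  using 1 by (intro span_sub) auto
 then show ?thesis using assms(2) by auto
qed

lemma finite_dimensional_tensor:
 assumes "finite_dimensional M" "finite_dimensional N"
 shows "finite_dimensional (sl2_tensor M N)"
proof -
 obtain B C where BC: "finite B" "car M = cs.span B" "finite C" "car N = cs.span C"
  using assms unfolding finite_dimensional_def by auto
 let ?S = "{tensor b c | b c. b \<in> B & c \<in> C}"
 have "finite ?S" using finite_image_set2[of "%b. b \<in> B" "%c. c \<in> C" tensor] BC by simp
 moreover have "tensor_space (car M) (car N) = cs.span ?S"
 proof
  show "tensor_space (car M) (car N) \<subseteq> cs.span ?S"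
   by (rule tensor_space_subset) (auto simp: BC tensor_in_span)
  show "cs.span ?S \<subseteq> tensor_space (car M) (car N)"
   by (rule span_sub) (auto simp: BC cs.span_base)
 qed
 ultimately show ?thesis unfolding finite_dimensional_def by auto
qed

lemma finite_dimensional_trivial [simp]: "finite_dimensional sl2_trivial"
 unfolding finite_dimensional_def sl2_trivial_def by (intro exI[of _ "{sl2_unit_vector}"]) simp

lemma fd_sl2_sel [simp]:
 "Obj fd_sl2 = {M \<in> sl2_modules. finite_dimensional M}" "Hom fd_sl2 = sl2_Hom" "Idn fd_sl2 = sl2_id"
 "Comp fd_sl2 = sl2_comp" "Add fd_sl2 = sl2_add" "Scale fd_sl2 = sl2_scale"
 "Unit fd_sl2 = sl2_trivial" "TensO fd_sl2 = sl2_tensor" "TensA fd_sl2 = sl2_tensor_arr"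
 "Assoc fd_sl2 = sl2_assoc" "LUnit fd_sl2 = sl2_lunit" "RUnit fd_sl2 = sl2_runit"
 using sl2_cat_sel by (simp_all add: fd_sl2_def category.defs monoidal_category.defs)

lemma sl2_module_cat_sel [simp]:
 "Obj (sl2_module_cat S) = S" "Hom (sl2_module_cat S) = sl2_Hom" "Idn (sl2_module_cat S) = sl2_id"
 "Comp (sl2_module_cat S) = sl2_comp" "Add (sl2_module_cat S) = sl2_add" "Scale (sl2_module_cat S) = sl2_scale"
 "ActO (sl2_module_cat S) = sl2_tensor" "ActA (sl2_module_cat S) = sl2_tensor_arr"
 "MAssoc (sl2_module_cat S) = sl2_assoc" "MUnit (sl2_module_cat S) = sl2_lunit"
 using sl2_cat_sel by (simp_all add: sl2_module_cat_def category.defs module_category.defs)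

lemma sl2_module_scale_in: "M \<in> sl2_modules ==> v \<in> car M ==> cscale c v \<in> car M"
 and sl2_module_add_in: "M \<in> sl2_modules ==> v \<in> car M ==> w \<in> car M ==> v + w \<in> car M"
 by (simp_all add: sl2_module_subspace cs.subspace_scale cs.subspace_add)

text \<open>On pure tensors an associator only moves brackets, and the two unitors multiply by the
  same coordinate of the trivial factor; pure tensors determine arrows.\<close>

lemma sl2_coherence:
 assumes "K \<in> sl2_modules" "M \<in> sl2_modules" "N \<in> sl2_modules" "P \<in> sl2_modules"
 shows "sl2_comp (sl2_tensor_arr (sl2_id K) (sl2_assoc M N P))
   (sl2_comp (sl2_assoc K (sl2_tensor M N) P) (sl2_tensor_arr (sl2_assoc K M N) (sl2_id P)))
  = sl2_comp (sl2_assoc K M (sl2_tensor N P)) (sl2_assoc (sl2_tensor K M) N P)"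
  and "sl2_comp (sl2_tensor_arr (sl2_id K) (sl2_lunit M)) (sl2_assoc K sl2_trivial M)
   = sl2_tensor_arr (sl2_runit K) (sl2_id M)"
proof -
 show "sl2_comp (sl2_tensor_arr (sl2_id K) (sl2_assoc M N P))
   (sl2_comp (sl2_assoc K (sl2_tensor M N) P) (sl2_tensor_arr (sl2_assoc K M N) (sl2_id P)))
  = sl2_comp (sl2_assoc K M (sl2_tensor N P)) (sl2_assoc (sl2_tensor K M) N P)"
  by (rule arr_ext_left2[of _ _ K M N P]) (use assms in simp_all)
 show "sl2_comp (sl2_tensor_arr (sl2_id K) (sl2_lunit M)) (sl2_assoc K sl2_trivial M)
   = sl2_tensor_arr (sl2_runit K) (sl2_id M)"
  by (rule arr_ext_left[of _ _ K sl2_trivial M])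
   (use assms in \<open>simp_all add: tensor_scale_left tensor_scale_right\<close>)
qed

lemma sl2_naturality:
 assumes "arr f" "arr g" "arr h"
 shows "sl2_comp (sl2_assoc (tgt f) (tgt g) (tgt h)) (sl2_tensor_arr (sl2_tensor_arr f g) h)
   = sl2_comp (sl2_tensor_arr f (sl2_tensor_arr g h)) (sl2_assoc (src f) (src g) (src h))"
  and "sl2_comp (sl2_lunit (tgt f)) (sl2_tensor_arr (sl2_id sl2_trivial) f) = sl2_comp f (sl2_lunit (src f))"
  and "sl2_comp (sl2_runit (tgt f)) (sl2_tensor_arr f (sl2_id sl2_trivial)) = sl2_comp f (sl2_runit (src f))"
proof -
 show "sl2_comp (sl2_assoc (tgt f) (tgt g) (tgt h)) (sl2_tensor_arr (sl2_tensor_arr f g) h)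
   = sl2_comp (sl2_tensor_arr f (sl2_tensor_arr g h)) (sl2_assoc (src f) (src g) (src h))"
  by (rule arr_ext_left[of _ _ "src f" "src g" "src h"]) (use assms in simp_all)
 show "sl2_comp (sl2_lunit (tgt f)) (sl2_tensor_arr (sl2_id sl2_trivial) f) = sl2_comp f (sl2_lunit (src f))"
  by (rule arr_ext_tensor[of _ _ sl2_trivial "src f"]) (use assms in \<open>simp_all add: arr_cscale\<close>)
 show "sl2_comp (sl2_runit (tgt f)) (sl2_tensor_arr f (sl2_id sl2_trivial)) = sl2_comp f (sl2_runit (src f))"
  by (rule arr_ext_tensor[of _ _ "src f" sl2_trivial]) (use assms in \<open>simp_all add: arr_cscale\<close>)
qed

lemma sl2_tensor_arr_id:
 "M \<in> sl2_modules ==> N \<in> sl2_modules ==> sl2_tensor_arr (sl2_id M) (sl2_id N) = sl2_id (sl2_tensor M N)"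
 by (rule arr_ext_tensor[of _ _ M N]) simp_all

lemma sl2_tensor_arr_functorial:
 assumes "arr f" "arr g"
 shows "arr f' ==> arr g' ==> src f' = tgt f ==> src g' = tgt g ==>
   sl2_tensor_arr (sl2_comp f' f) (sl2_comp g' g) = sl2_comp (sl2_tensor_arr f' g') (sl2_tensor_arr f g)"
  and "arr f' ==> src f' = src f ==> tgt f' = tgt f ==>
   sl2_tensor_arr (sl2_add f f') g = sl2_add (sl2_tensor_arr f g) (sl2_tensor_arr f' g)"
  and "arr g' ==> src g' = src g ==> tgt g' = tgt g ==>
   sl2_tensor_arr f (sl2_add g g') = sl2_add (sl2_tensor_arr f g) (sl2_tensor_arr f g')"
  and "sl2_tensor_arr (sl2_scale c f) g = sl2_scale c (sl2_tensor_arr f g)"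
  and "sl2_tensor_arr f (sl2_scale c g) = sl2_scale c (sl2_tensor_arr f g)"
 by (rule arr_ext_tensor[of _ _ "src f" "src g"],
   use assms in \<open>simp_all add: tensor_add_left tensor_add_right tensor_scale_left tensor_scale_right\<close>)+

interpretation fd: linear_category fd_sl2
 by (rule sl2_linear_category) auto

lemma fd_monoidal: "monoidal_linear_category fd_sl2"
 by unfold_locales
  (auto simp: Hom_iff_arr finite_dimensional_tensor sl2_tensor_arr_id sl2_tensor_arr_functorial sl2_coherence sl2_naturality
   intro: assoc_iso unitors_iso)

text \<open>Action, associator and unitor are the tensor product and its own constraints, so each
  axiom is the corresponding monoidal fact; what remains to be supplied is closure of
  \<open>S\<close> under tensoring.\<close>

lemma sl2_linear_module_category:
 assumes S: "S \<subseteq> sl2_modules"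
  and closed: "!!X M. X \<in> sl2_modules ==> finite_dimensional X ==> M \<in> S ==> sl2_tensor X M \<in> S"
 shows "linear_module_category fd_sl2 (sl2_module_cat S)"
proof -
 interpret monoidal_linear_category fd_sl2 by (rule fd_monoidal)
 interpret M: linear_category "sl2_module_cat S" by (rule sl2_linear_category) (use S in auto)
 have [simp]: "M \<in> S ==> M \<in> sl2_modules" for M using S by auto
 show ?thesis
  by unfold_locales
   (auto simp: Hom_iff_arr closed sl2_tensor_arr_id sl2_tensor_arr_functorial sl2_coherence sl2_naturality
    intro: assoc_iso unitors_iso)
qed

section \<open>Weights and highest weight vectors\<close>

definition wt_space :: "cseq set => (cseq => cseq) => complex => cseq set" where
 "wt_space V h w = {v \<in> V. h v = cscale w v}"

text \<open>Diagonalisability of \<open>h\<close> with eigenvalues in \<open>P\<close>, phrased as a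
  spanning condition, which is convenient for spans and tensor products.\<close>

definition weighted :: "complex set => cseq set => (cseq => cseq) => bool" where
 "weighted P V h \<longleftrightarrow> V \<subseteq> cs.span (\<Union>w\<in>P. wt_space V h w)"

definition locally_nilpotent :: "cseq set => (cseq => cseq) => bool" where
 "locally_nilpotent V T \<longleftrightarrow> (\<forall>v\<in>V. \<exists>n. (T ^^ n) v = 0)"

definition coset :: "complex => complex set" where
 "coset mu = {\<nu>. \<nu> - mu \<in> \<int>}"

text \<open>On a highest weight vector of weight \<open>w\<close>, the operator \<open>e\<^sup>n f\<^sup>n\<close> is this scalar.\<close>

definition ef_scalar :: "nat => complex => complex" where
 "ef_scalar n w = (\<Prod>j<n. of_nat (Suc j) * (w - of_nat j))"

text \<open>The bad weights for \<open>e^n f^n\<close> on highest weight vectors are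
  \<open>0, ..., n - 1\<close>; a non-integral coset avoids all of them, for every
  \<open>n\<close>.\<close>

lemma ef_scalar_nonzero: "(!!j. j < n ==> w ~= of_nat j) ==> ef_scalar n w ~= 0"
 by (simp add: ef_scalar_def del: of_nat_Suc)

lemma coset_shift: "\<nu> \<in> coset mu ==> k \<in> \<int> ==> \<nu> + k \<in> coset mu" "\<nu> \<in> coset mu ==> k \<in> \<int> ==> \<nu> - k \<in> coset mu"
 unfolding coset_def mem_Collect_eq
 by (metis Ints_add add_diff_eq add.commute) (metis Ints_diff diff_diff_eq diff_diff_eq2 add.commute)

lemma coset_nonint: "mu \<notin> \<int> ==> \<nu> \<in> coset mu ==> \<nu> \<notin> \<int>"
 unfolding coset_def mem_Collect_eq by (metis Ints_diff diff_diff_eq2 add_diff_cancel_left')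

lemma coset_eq: "\<nu> \<in> coset mu ==> coset \<nu> = coset mu"
proof -
 assume "\<nu> \<in> coset mu"
 then have "\<nu> - mu \<in> \<int>" by (simp add: coset_def)
 then have "x - \<nu> \<in> \<int> \<longleftrightarrow> x - mu \<in> \<int>" for x
  using Ints_add[of "x - \<nu>" "\<nu> - mu"] Ints_diff[of "x - mu" "\<nu> - mu"] by auto
 then show ?thesis by (simp add: coset_def)
qed

lemma wt_space_in: "v \<in> wt_space V h w ==> v \<in> V"
 by (simp add: wt_space_def)

lemma wt_space_subspace:
 assumes "linear_on V h" "cs.subspace V"
 shows "cs.subspace (wt_space V h w)"
 unfolding wt_space_def
 by (rule linear_on_equalizer_subspace) (use assms in \<open>auto intro!: linear_on_cscale linear_on_id\<close>)

text \<open>Separation of eigenvalues modulo an \<open>h\<close>-stable \<open>W\<close>. With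
  \<open>W = {0}\<close> it gives independence of eigenvectors, with a submodule it shows that
  weight components stay inside, and in general it replaces arguments in the quotient
  \<open>V / W\<close>.\<close>

lemma weight_components:
 assumes lin: "linear_on V h" and V: "cs.subspace V" and W: "cs.subspace W" "W \<subseteq> V" "h ` W \<subseteq> W"
  and S: "finite S" "inj_on w S" "!!i. i \<in> S ==> u i \<in> V"
  and eig: "!!i. i \<in> S ==> h (u i) - cscale (w i) (u i) \<in> W"
  and sum: "(\<Sum>i\<in>S. u i) \<in> W" and i: "i \<in> S"
 shows "u i \<in> W"
 using S eig sum i
proof (induction S arbitrary: u i rule: finite_induct)
 case (insert j S)
 \<comment> \<open>Applying \<open>h - w j\<close> to the sum scales the \<open>i\<close>-th term by
   \<open>w i - w j\<close> modulo \<open>W\<close>; this removes the term \<open>j\<close> and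
   leaves a sum over \<open>S\<close>.\<close>
 let ?u' = "%i. cscale (w i - w j) (u i)"
 let ?s = "\<Sum>i\<in>insert j S. u i"
 have uV: "!!i. i \<in> insert j S ==> u i \<in> V" using insert by auto
 have hs: "h ?s = (\<Sum>i\<in>insert j S. h (u i))"
  by (rule linear_on_sum[OF lin V]) (use insert in auto)
 have "(\<Sum>i\<in>S. ?u' i) = (\<Sum>i\<in>insert j S. ?u' i)"
  using insert.hyps by simp
 also have "... = (\<Sum>i\<in>insert j S. h (u i) - cscale (w j) (u i) - (h (u i) - cscale (w i) (u i)))"
  by (rule sum.cong) (auto simp: cs.scale_left_diff_distrib)
 also have "... = h ?s - cscale (w j) ?s - (\<Sum>i\<in>insert j S. h (u i) - cscale (w i) (u i))"
  by (simp only: sum_subtractf hs cs.scale_sum_right)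
 also have "... \<in> W"
 proof -
  have "h ?s \<in> W" using W(3) insert.prems(4) by blast
  moreover have "(\<Sum>i\<in>insert j S. h (u i) - cscale (w i) (u i)) \<in> W"
   by (rule cs.subspace_sum[OF W(1)]) (rule insert.prems(3))
  ultimately show ?thesis using insert.prems(4)
   by (intro cs.subspace_diff[OF W(1)] cs.subspace_scale[OF W(1)])
 qed
 finally have s': "(\<Sum>i\<in>S. ?u' i) \<in> W" .
 have "u k \<in> W" if k: "k \<in> S" for k
 proof -
  have "?u' k \<in> W"
  proof (rule insert.IH[OF _ _ _ s' k])
   show "inj_on w S" using insert.prems(1) by (rule inj_on_subset) auto
   fix i assume i: "i \<in> S"
   then show "?u' i \<in> V" using uV by (auto intro: cs.subspace_scale[OF V])
   have "h (?u' i) - cscale (w i) (?u' i) = cscale (w i - w j) (h (u i) - cscale (w i) (u i))"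
    using i uV by (simp add: linear_on_scale[OF lin] cs.scale_right_diff_distrib mult.commute)
   then show "h (?u' i) - cscale (w i) (?u' i) \<in> W"
    using insert.prems(3) i by (auto intro: cs.subspace_scale[OF W(1)])
  qed
  then have "cscale (inverse (w k - w j)) (?u' k) \<in> W" by (rule cs.subspace_scale[OF W(1)])
  moreover have "w k ~= w j" using insert.prems(1) insert.hyps(2) k by (auto simp: inj_on_def)
  ultimately show ?thesis by simp
 qed
 then have S_in: "(\<Sum>i\<in>S. u i) \<in> W" by (intro cs.subspace_sum W(1)) auto
 have "u j = ?s - (\<Sum>i\<in>S. u i)" using insert.hyps by simp
 then have "u j \<in> W" using insert.prems(4) S_in by (simp only: cs.subspace_diff[OF W(1)])
 then show ?case using insert.prems(5) \<open>!!k. k \<in> S ==> u k \<in> W\<close> by auto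
qed simp

lemma weighted_decompose:
 assumes lin: "linear_on V h" and V: "cs.subspace V" and P: "weighted P V h" and v: "v \<in> V"
 obtains S u where "finite S" "S \<subseteq> P" "!!w. u w \<in> wt_space V h w" "v = (\<Sum>w\<in>S. u w)"
proof -
 \<comment> \<open>The family is required to vanish outside \<open>S\<close>, so that two
   decompositions can be added over the union of their supports.\<close>
 let ?D = "{v. \<exists>S u. finite S & S \<subseteq> P & (\<forall>w. u w \<in> wt_space V h w) & (\<forall>w. w \<notin> S \<longrightarrow> u w = 0) &
  v = (\<Sum>w\<in>S. u w)}"
 note sub = wt_space_subspace[OF lin V]
 have "cs.subspace ?D"
 proof (rule cs.subspaceI)
  show "0 \<in> ?D"
   by (rule CollectI, rule exI[of _ "{}"], rule exI[of _ "\<lambda>w. 0"]) (simp add: cs.subspace_0[OF sub])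
 next
  fix x y assume "x \<in> ?D" "y \<in> ?D"
  then obtain S u T t where S: "finite S" "S \<subseteq> P" "\<forall>w. u w \<in> wt_space V h w" "\<forall>w. w \<notin> S \<longrightarrow> u w = 0"
    "x = (\<Sum>w\<in>S. u w)" and T: "finite T" "T \<subseteq> P" "\<forall>w. t w \<in> wt_space V h w" "\<forall>w. w \<notin> T \<longrightarrow> t w = 0"
    "y = (\<Sum>w\<in>T. t w)" by blast
  have "x = (\<Sum>w\<in>S \<union> T. u w)" "y = (\<Sum>w\<in>S \<union> T. t w)"
   unfolding S(5) T(5) using S T by (auto intro!: sum.mono_neutral_left)
  then have "x + y = (\<Sum>w\<in>S \<union> T. u w + t w)" by (simp only: sum.distrib)
  then show "x + y \<in> ?D"
   using S T by (intro CollectI exI[of _ "S \<union> T"] exI[of _ "%w. u w + t w"])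
    (auto intro: cs.subspace_add[OF sub])
 next
  fix c x assume "x \<in> ?D"
  then obtain S u where S: "finite S" "S \<subseteq> P" "\<forall>w. u w \<in> wt_space V h w" "\<forall>w. w \<notin> S \<longrightarrow> u w = 0"
    "x = (\<Sum>w\<in>S. u w)" by blast
  then show "cscale c x \<in> ?D"
   by (intro CollectI exI[of _ S] exI[of _ "%w. cscale c (u w)"])
    (auto intro: cs.subspace_scale[OF sub] simp: cs.scale_sum_right)
 qed
 moreover have "x \<in> ?D" if "w \<in> P" "x \<in> wt_space V h w" for w x
  using that by (intro CollectI exI[of _ "{w}"] exI[of _ "%w'. if w' = w then x else 0"])
   (auto simp: cs.subspace_0[OF sub])
 ultimately have "cs.span (\<Union>w\<in>P. wt_space V h w) \<subseteq> ?D"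
  by (intro span_sub) auto
 then show ?thesis using that P v unfolding weighted_def by blast
qed

lemma weighted_subspace:
 assumes lin: "linear_on V h" and V: "cs.subspace V" and P: "weighted P V h"
  and W: "cs.subspace W" "W \<subseteq> V" "h ` W \<subseteq> W"
 shows "weighted P W h"
 unfolding weighted_def
proof
 fix v assume v: "v \<in> W"
 then obtain S u where S: "finite S" "S \<subseteq> P" "!!w. u w \<in> wt_space V h w" "v = (\<Sum>w\<in>S. u w)"
  using weighted_decompose[OF lin V P, of v] W(2) by blast
 have "u w \<in> W" if "w \<in> S" for w
  by (rule weight_components[OF lin V W S(1), where w = id])
   (use S that v in \<open>auto simp: wt_space_def cs.subspace_0[OF W(1)]\<close>)
 then have "u w \<in> (\<Union>w\<in>P. wt_space W h w)" if "w \<in> S" for w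
  using S that by (auto simp: wt_space_def)
 then show "v \<in> cs.span (\<Union>w\<in>P. wt_space W h w)"
  unfolding S(4) by (intro cs.span_sum cs.span_base) auto
qed

context sl2_rep
begin

lemma pow_in [simp, intro]: "v \<in> V ==> (e ^^ k) v \<in> V" "v \<in> V ==> (f ^^ k) v \<in> V"
 by (auto intro!: funpow_in)

lemma linear_pow [simp, intro]: "linear_on V (e ^^ k)" "linear_on V (f ^^ k)"
 by (auto intro!: linear_on_funpow)

lemma sums_in [simp, intro]: "v \<in> V ==> w \<in> V ==> v + w \<in> V" "v \<in> V ==> w \<in> V ==> v - w \<in> V"
 "v \<in> V ==> cscale c v \<in> V" "0 \<in> V" "v \<in> V ==> - v \<in> V"
 by (simp_all add: cs.subspace_add cs.subspace_diff cs.subspace_scale cs.subspace_0 cs.subspace_neg)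

lemmas lin_simps = linear_on_add[OF linear_e] linear_on_add[OF linear_f] linear_on_add[OF linear_h]
 linear_on_diff[OF linear_e subspace_V] linear_on_diff[OF linear_f subspace_V] linear_on_diff[OF linear_h subspace_V]
 linear_on_scale[OF linear_e] linear_on_scale[OF linear_f] linear_on_scale[OF linear_h]
 linear_on_minus[OF linear_e] linear_on_minus[OF linear_f] linear_on_minus[OF linear_h]
 linear_on_add[OF linear_pow(1)] linear_on_add[OF linear_pow(2)]
 linear_on_diff[OF linear_pow(1) subspace_V] linear_on_diff[OF linear_pow(2) subspace_V]
 linear_on_scale[OF linear_pow(1)] linear_on_scale[OF linear_pow(2)]

lemma zero_simps [simp]: "e 0 = 0" "f 0 = 0" "h 0 = 0" "(e ^^ k) 0 = 0" "(f ^^ k) 0 = 0"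
 using linear_on_0[OF _ subspace_V] by auto

text \<open>A symmetry of the relations: every statement about \<open>e\<close> thereby yields one
  about \<open>f\<close>.\<close>

lemma dual: "sl2_rep V f (%v. - h v) e"
 by unfold_locales (auto simp: lin_simps h_e h_f e_f intro!: linear_on_uminus)

lemma h_f_pow: "v \<in> V ==> h ((f ^^ k) v) = (f ^^ k) (h v) - cscale (2 * of_nat k) ((f ^^ k) v)"
proof (induction k)
 case (Suc k)
 have "h ((f ^^ Suc k) v) = f (h ((f ^^ k) v)) - cscale 2 ((f ^^ Suc k) v)"
  using Suc.prems by (simp add: h_f)
 also have "f (h ((f ^^ k) v)) = (f ^^ Suc k) (h v) - cscale (2 * of_nat k) ((f ^^ Suc k) v)"
  using Suc by (simp add: lin_simps)
 also have "... - cscale 2 ((f ^^ Suc k) v) = (f ^^ Suc k) (h v) - cscale (2 * of_nat (Suc k)) ((f ^^ Suc k) v)"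
  by (simp add: fun_eq_iff cscale_def algebra_simps)
 finally show ?case .
qed simp

lemma h_e_pow: "v \<in> V ==> h ((e ^^ k) v) = (e ^^ k) (h v) + cscale (2 * of_nat k) ((e ^^ k) v)"
proof (induction k)
 case (Suc k)
 have "h ((e ^^ Suc k) v) = e (h ((e ^^ k) v)) + cscale 2 ((e ^^ Suc k) v)"
  using Suc.prems by (simp add: h_e)
 also have "e (h ((e ^^ k) v)) = (e ^^ Suc k) (h v) + cscale (2 * of_nat k) ((e ^^ Suc k) v)"
  using Suc by (simp add: lin_simps)
 also have "... + cscale 2 ((e ^^ Suc k) v) = (e ^^ Suc k) (h v) + cscale (2 * of_nat (Suc k)) ((e ^^ Suc k) v)"
  by (simp add: fun_eq_iff cscale_def algebra_simps)
 finally show ?case .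
qed simp

text \<open>The identity \<open>[e, f^(k+1)] = (k + 1) f^k (h - k)\<close>, kept for arbitrary
  vectors because it is also applied to vectors that are weight vectors only modulo a
  subspace.\<close>

lemma e_f_pow: "v \<in> V ==> e ((f ^^ Suc k) v) =
  (f ^^ Suc k) (e v) + cscale (of_nat (Suc k)) ((f ^^ k) (h v - cscale (of_nat k) v))"
proof (induction k)
 case (Suc k)
 have "e ((f ^^ Suc (Suc k)) v) = f (e ((f ^^ Suc k) v)) + h ((f ^^ Suc k) v)"
  using Suc.prems by (simp add: e_f)
 also have "f (e ((f ^^ Suc k) v)) =
   (f ^^ Suc (Suc k)) (e v) + cscale (of_nat (Suc k)) ((f ^^ Suc k) (h v - cscale (of_nat k) v))"
  using Suc by (simp add: lin_simps del: of_nat_Suc)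
 also have "h ((f ^^ Suc k) v) = (f ^^ Suc k) (h v) - cscale (2 * of_nat (Suc k)) ((f ^^ Suc k) v)"
  using Suc.prems by (rule h_f_pow)
 finally show ?case using Suc.prems
  by (simp only: lin_simps h_in sums_in pow_in) (simp add: fun_eq_iff cscale_def algebra_simps)
qed (simp add: e_f)

lemma wt_space_pow:
 assumes "v \<in> wt_space V h w"
 shows "(f ^^ k) v \<in> wt_space V h (w - 2 * of_nat k)" "(e ^^ k) v \<in> wt_space V h (w + 2 * of_nat k)"
 using assms
 by (auto simp: wt_space_def h_f_pow h_e_pow lin_simps cs.scale_left_diff_distrib cs.scale_left_distrib)

lemma wt_space_step:
 assumes "v \<in> wt_space V h w"
 shows "f v \<in> wt_space V h (w - 2)" "e v \<in> wt_space V h (w + 2)"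
 using wt_space_pow[OF assms, of 1] by simp_all

lemma wt_space_closed: "cs.subspace (wt_space V h w)"
 by (rule wt_space_subspace) auto

lemma e_f_pow_hw:
 assumes "v \<in> wt_space V h w" "e v = 0"
 shows "e ((f ^^ Suc k) v) = cscale (of_nat (Suc k) * (w - of_nat k)) ((f ^^ k) v)"
proof -
 have v: "v \<in> V" "h v = cscale w v" using assms(1) by (auto simp: wt_space_def)
 have "h v - cscale (of_nat k) v = cscale (w - of_nat k) v" by (simp add: v(2) cs.scale_left_diff_distrib)
 then show ?thesis
  unfolding e_f_pow[OF v(1)] using v assms(2) by (simp add: lin_simps del: of_nat_Suc funpow.simps)
qed

lemma e_pow_f_pow_hw:
 assumes "v \<in> wt_space V h w" "e v = 0"
 shows "(e ^^ n) ((f ^^ n) v) = cscale (ef_scalar n w) v"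
proof (induction n)
 case (Suc n)
 have v: "v \<in> V" using assms(1) by (rule wt_space_in)
 have "(e ^^ Suc n) ((f ^^ Suc n) v) = (e ^^ n) (e ((f ^^ Suc n) v))" by (simp only: funpow_Suc_right o_apply)
 also have "... = cscale (of_nat (Suc n) * (w - of_nat n)) ((e ^^ n) ((f ^^ n) v))"
  using v by (simp only: e_f_pow_hw[OF assms] lin_simps pow_in)
 also have "... = cscale (ef_scalar (Suc n) w) v"
  using Suc.IH by (simp add: ef_scalar_def mult.commute)
 finally show ?case .
qed (simp add: ef_scalar_def)

lemma kernel_subspace: "cs.subspace {v \<in> V. e v = 0}" "cs.subspace {v \<in> V. (e ^^ n) v = 0}"
 by (auto intro: linear_on_kernel_subspace)

lemma kernel_h: "v \<in> V ==> e v = 0 ==> e (h v) = 0"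
 using h_e[of v] by simp

text \<open>Each \<open>e\<close> cancels one \<open>f\<close>, and a surplus \<open>e\<close> meets
  the kernel. Since \<open>v\<close> need not be a weight vector, the induction passes to
  \<open>h v - j v\<close>, which stays in the kernel by \<open>kernel_h\<close>.\<close>

lemma e_pow_f_pow_kernel:
 assumes "v \<in> V" "e v = 0" "j < n"
 shows "(e ^^ n) ((f ^^ j) v) = 0"
 using assms
proof (induction j arbitrary: n v)
 case 0
 then show ?case by (cases n) (simp_all add: funpow_swap1)
next
 case (Suc j)
 then obtain m where m: "n = Suc m" "j < m" by (cases n) auto
 have "(e ^^ n) ((f ^^ Suc j) v) = (e ^^ m) (e ((f ^^ Suc j) v))"
  unfolding m(1) by (simp only: funpow_Suc_right o_apply)
 also have "e ((f ^^ Suc j) v) = cscale (of_nat (Suc j)) ((f ^^ j) (h v - cscale (of_nat j) v))"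
  using Suc.prems by (simp only: e_f_pow) (simp del: of_nat_Suc)
 also have "(e ^^ m) ... = cscale (of_nat (Suc j)) ((e ^^ m) ((f ^^ j) (h v - cscale (of_nat j) v)))"
  using Suc.prems by (simp add: lin_simps del: of_nat_Suc)
 also have "(e ^^ m) ((f ^^ j) (h v - cscale (of_nat j) v)) = 0"
  using Suc.prems m by (intro Suc.IH) (auto simp: lin_simps kernel_h)
 finally show ?case by simp
qed

text \<open>The kernel of \<open>e\<close> is stable under \<open>h\<close>, so \<open>v\<close>
  splits into weight vectors inside it, and on each of them \<open>e^n f^n\<close> is the nonzero
  scalar \<open>ef_scalar n w\<close>.\<close>

lemma e_pow_f_pow_inj:
 assumes P: "weighted P V h" and nonint: "!!w. w \<in> P ==> w \<notin> \<nat>"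
  and v: "v \<in> V" "e v = 0" "(e ^^ n) ((f ^^ n) v) = 0"
 shows "v = 0"
proof -
 let ?K = "{v \<in> V. e v = 0}"
 have K: "h ` ?K \<subseteq> ?K" using kernel_h by auto
 obtain S u where S: "finite S" "S \<subseteq> P" "!!w. u w \<in> wt_space ?K h w" "v = (\<Sum>w\<in>S. u w)"
  using weighted_decompose[OF linear_on_subset[OF linear_h] kernel_subspace(1)
    weighted_subspace[OF linear_h subspace_V P kernel_subspace(1) _ K], of v] v by blast
 have u: "u w \<in> wt_space V h w" "e (u w) = 0" "u w \<in> V" for w
  using S(3)[of w] by (auto simp: wt_space_def)
 have "(e ^^ n) ((f ^^ n) v) = (\<Sum>w\<in>S. (e ^^ n) ((f ^^ n) (u w)))"
  unfolding S(4) using u by (simp add: linear_on_sum[OF linear_pow(1) subspace_V] linear_on_sum[OF linear_pow(2) subspace_V])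
 also have "... = (\<Sum>w\<in>S. cscale (ef_scalar n w) (u w))"
  using e_pow_f_pow_hw[OF u(1,2)] by simp
 finally have sum0: "(\<Sum>w\<in>S. cscale (ef_scalar n w) (u w)) = 0" using v(3) by simp
 have "u w = 0" if "w \<in> S" for w
 proof -
  have "cscale (ef_scalar n w) (u w) \<in> {0}"
   by (rule weight_components[OF linear_h subspace_V, where S = S and w = id])
    (use S u that sum0 in \<open>auto simp: lin_simps wt_space_def mult.commute\<close>)
  moreover have "ef_scalar n w ~= 0"
   using S(2) that nonint[of w] by (intro ef_scalar_nonzero) auto
  ultimately show ?thesis by simp
 qed
 then show ?thesis using S(4) by simp
qed

lemma weight_vector_decompose:
 assumes nonint: "!!w. w \<in> P ==> w \<notin> \<nat>" and shift: "!!w. w \<in> P ==> w + 2 \<in> P"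
 shows "w \<in> P ==> v \<in> wt_space V h w ==> (e ^^ n) v = 0 ==>
  v \<in> cs.span {(f ^^ k) u | k u w. w \<in> P & u \<in> wt_space V h w & e u = 0}"
proof (induction n arbitrary: v)
 case (Suc n)
 have shifts: "w + 2 * of_nat k \<in> P" for k
 proof (induction k)
  case (Suc k)
  then show ?case using shift[of "w + 2 * of_nat k"] by (simp add: algebra_simps)
 qed (use Suc.prems in simp)
 define u where "u = (e ^^ n) v"
 define c where "c = ef_scalar n (w + 2 * of_nat n)"
 have c: "c ~= 0"
  unfolding c_def using nonint[OF shifts[of n]] by (intro ef_scalar_nonzero) auto
 have u: "u \<in> wt_space V h (w + 2 * of_nat n)" "e u = 0"
  using wt_space_pow(2)[OF Suc.prems(2)] Suc.prems(3) by (simp_all add: u_def)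
 have v: "v \<in> V" "u \<in> V" using Suc.prems(2) u(1) by (simp_all add: wt_space_in)
 \<comment> \<open>\<open>u = e^n v\<close> is a highest weight vector with
   \<open>e^n f^n u = c u\<close>, so this correction is killed by \<open>e^n\<close> and the
   induction on \<open>n\<close> applies.\<close>
 let ?v = "v - cscale (inverse c) ((f ^^ n) u)"
 have "(f ^^ n) u \<in> wt_space V h w"
  using wt_space_pow(1)[OF u(1), of n] by simp
 then have "?v \<in> wt_space V h w"
  using Suc.prems(2) by (intro cs.subspace_diff cs.subspace_scale wt_space_closed)
 moreover have "(e ^^ n) ?v = 0"
  using e_pow_f_pow_hw[OF u, of n] v c
  by (simp add: lin_simps c_def[symmetric]) (simp add: u_def)
 ultimately have "?v \<in> cs.span {(f ^^ k) u | k u w. w \<in> P & u \<in> wt_space V h w & e u = 0}"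
  using Suc.prems(1) by (intro Suc.IH)
 moreover have "(f ^^ n) u \<in> cs.span {(f ^^ k) u | k u w. w \<in> P & u \<in> wt_space V h w & e u = 0}"
  using u shifts by (intro cs.span_base) blast
 ultimately have "?v + cscale (inverse c) ((f ^^ n) u) \<in> cs.span {(f ^^ k) u | k u w. w \<in> P & u \<in> wt_space V h w & e u = 0}"
  by (intro cs.span_add cs.span_scale)
 then show ?case by simp
qed (simp add: cs.span_zero)

lemma decompose:
 assumes nonint: "!!w. w \<in> P ==> w \<notin> \<nat>" and shift: "!!w. w \<in> P ==> w + 2 \<in> P"
  and P: "weighted P V h" and nil: "locally_nilpotent V e"
 shows "V \<subseteq> cs.span {(f ^^ k) u | k u w. w \<in> P & u \<in> wt_space V h w & e u = 0}" (is "_ \<subseteq> cs.span ?S")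
proof -
 have "cs.span (\<Union>w\<in>P. wt_space V h w) \<subseteq> cs.span ?S"
 proof (rule cs.span_minimal)
  show "(\<Union>w\<in>P. wt_space V h w) \<subseteq> cs.span ?S"
   using nil weight_vector_decompose[OF nonint shift] wt_space_in
   unfolding locally_nilpotent_def by blast
 qed auto
 then show ?thesis using P unfolding weighted_def by blast
qed

text \<open>Finitely many highest weight vectors whose \<open>f\<close>-strings span. Independence
  of \<open>B\<close> is stated separately where wanted, so that the notion survives homomorphic
  images and direct summands, where generators may collapse.\<close>

definition hw_generated :: "complex set => cseq set => bool" where
 "hw_generated P B \<longleftrightarrow> finite B & B \<subseteq> V & (\<forall>b\<in>B. e b = 0 & (\<exists>w\<in>P. h b = cscale w b)) &
  V \<subseteq> cs.span {(f ^^ k) b | k b. b \<in> B}"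

lemma hw_generatedD:
 assumes "hw_generated P B"
 shows "finite B" "B \<subseteq> V" "V \<subseteq> cs.span {(f ^^ k) b | k b. b \<in> B}" "b \<in> B ==> b \<in> V" "b \<in> B ==> e b = 0"
  "b \<in> B ==> \<exists>w\<in>P. b \<in> wt_space V h w"
 using assms unfolding hw_generated_def wt_space_def by (simp_all add: subset_eq)

lemma hw_generated_weighted:
 assumes B: "hw_generated P B" and shift: "!!w. w \<in> P ==> w - 2 \<in> P"
 shows "weighted P V h"
proof -
 have "(f ^^ k) b \<in> (\<Union>w\<in>P. wt_space V h w)" if b: "b \<in> B" for k b
 proof -
  obtain w where w: "w \<in> P" "b \<in> wt_space V h w" using hw_generatedD(6)[OF B b] by auto
  have "w - 2 * of_nat k \<in> P" for k
  proof (induction k)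
   case (Suc k)
   then show ?case using shift[of "w - 2 * of_nat k"] by (simp add: algebra_simps)
  qed (use w in simp)
  then show ?thesis using wt_space_pow(1)[OF w(2)] by blast
 qed
 then have "cs.span {(f ^^ k) b | k b. b \<in> B} \<subseteq> cs.span (\<Union>w\<in>P. wt_space V h w)"
  by (intro cs.span_mono) auto
 then show ?thesis using hw_generatedD(3)[OF B] unfolding weighted_def by (rule order.trans[rotated])
qed

lemma locally_nilpotent_subspace: "cs.subspace {v \<in> V. \<exists>n. (e ^^ n) v = 0}"
proof (rule cs.subspaceI)
 have mono: "(e ^^ (n + m)) v = 0" if "(e ^^ n) v = 0" for n m v
  using that by (simp add: add.commute[of n] funpow_add)
 fix x y assume xy: "x \<in> {v \<in> V. \<exists>n. (e ^^ n) v = 0}" "y \<in> {v \<in> V. \<exists>n. (e ^^ n) v = 0}"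
 then obtain n m where "(e ^^ n) x = 0" "(e ^^ m) y = 0" by auto
 then have "(e ^^ (n + m)) x = 0" "(e ^^ (n + m)) y = 0" using mono[of n x m] mono[of m y n] by (simp_all add: add.commute)
 then have "(e ^^ (n + m)) (x + y) = 0" using xy by (simp add: lin_simps)
 then show "x + y \<in> {v \<in> V. \<exists>n. (e ^^ n) v = 0}" using xy by blast
qed (auto simp: lin_simps)

lemma hw_generated_nilpotent:
 assumes B: "hw_generated P B"
 shows "locally_nilpotent V e"
proof -
 have "(e ^^ Suc k) ((f ^^ k) b) = 0" if "b \<in> B" for k b
  using hw_generatedD(4,5)[OF B that] by (intro e_pow_f_pow_kernel) auto
 then have "cs.span {(f ^^ k) b | k b. b \<in> B} \<subseteq> {v \<in> V. \<exists>n. (e ^^ n) v = 0}"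
  using hw_generatedD(4)[OF B] by (intro span_sub[OF _ locally_nilpotent_subspace])
   (auto simp del: funpow.simps)
 then show ?thesis using hw_generatedD(3)[OF B] unfolding locally_nilpotent_def by auto
qed

text \<open>Terms are grouped by the power of \<open>f\<close>, not by generator: the coefficients
  \<open>u k\<close> then lie in the kernel of \<open>e\<close> whenever \<open>B\<close> does,
  which is the form that \<open>f_pow_expansion_top\<close> can peel off.\<close>

lemma hw_generated_expand:
 assumes "V \<subseteq> cs.span {(f ^^ k) b | k b. b \<in> B}" "B \<subseteq> V" "v \<in> V"
 obtains K u where "!!k. u k \<in> cs.span B" "v = (\<Sum>k<K. (f ^^ k) (u k))"
proof -
 let ?D = "{v. \<exists>K u. (\<forall>k. u k \<in> cs.span B) & (\<forall>k\<ge>K. u k = 0) & v = (\<Sum>k<K. (f ^^ k) (u k))}"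
 have BV: "cs.span B \<subseteq> V" using assms(2) by (rule span_sub) auto
 have "cs.subspace ?D"
 proof (rule cs.subspaceI)
  show "0 \<in> ?D" by (rule CollectI, rule exI[of _ 0], rule exI[of _ "\<lambda>k. 0"]) (simp add: cs.span_zero)
 next
  fix x y assume "x \<in> ?D" "y \<in> ?D"
  then obtain K u L t where K: "\<forall>k. u k \<in> cs.span B" "\<forall>k\<ge>K. u k = 0" "x = (\<Sum>k<K. (f ^^ k) (u k))"
   and L: "\<forall>k. t k \<in> cs.span B" "\<forall>k\<ge>L. t k = 0" "y = (\<Sum>k<L. (f ^^ k) (t k))" by blast
  have ut: "u k \<in> V" "t k \<in> V" for k using K(1) L(1) BV by auto
  have "x = (\<Sum>k<max K L. (f ^^ k) (u k))" "y = (\<Sum>k<max K L. (f ^^ k) (t k))"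
   unfolding K(3) L(3) using K L by (auto intro!: sum.mono_neutral_left)
  then have "x + y = (\<Sum>k<max K L. (f ^^ k) (u k) + (f ^^ k) (t k))" by (simp only: sum.distrib)
  also have "... = (\<Sum>k<max K L. (f ^^ k) (u k + t k))"
   using ut by (intro sum.cong) (auto simp: lin_simps)
  finally show "x + y \<in> ?D"
   using K L by (intro CollectI exI[of _ "max K L"] exI[of _ "%k. u k + t k"]) (auto intro: cs.span_add)
 next
  fix c x assume "x \<in> ?D"
  then obtain K u where K: "\<forall>k. u k \<in> cs.span B" "\<forall>k\<ge>K. u k = 0" "x = (\<Sum>k<K. (f ^^ k) (u k))" by blast
  have "u k \<in> V" for k using K(1) BV by auto
  then have "cscale c x = (\<Sum>k<K. (f ^^ k) (cscale c (u k)))"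
   unfolding K(3) cs.scale_sum_right by (intro sum.cong) (auto simp: lin_simps)
  then show "cscale c x \<in> ?D"
   using K by (intro CollectI exI[of _ K] exI[of _ "%k. cscale c (u k)"]) (auto intro: cs.span_scale)
 qed
 moreover have "(f ^^ k) b \<in> ?D" if "b \<in> B" for k b
 proof -
  let ?u = "\<lambda>j. if j = k then b else 0"
  have "(\<Sum>j<Suc k. (f ^^ j) (?u j)) = (\<Sum>j\<in>{k}. (f ^^ j) (?u j))"
   by (rule sum.mono_neutral_right) auto
  then show ?thesis
   using that by (intro CollectI exI[of _ "Suc k"] exI[of _ ?u]) (auto simp: cs.span_base cs.span_zero)
 qed
 ultimately have "cs.span {(f ^^ k) b | k b. b \<in> B} \<subseteq> ?D"
  by (intro span_sub) auto
 then show ?thesis using that assms by blast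
qed

text \<open>Applying \<open>e\<^sup>K\<close> isolates the top coefficient.\<close>

lemma f_pow_expansion_top:
 assumes P: "weighted P V h" and nonint: "!!w. w \<in> P ==> w \<notin> \<nat>"
  and u: "!!k. k \<le> K ==> u k \<in> V" "!!k. k \<le> K ==> e (u k) = 0"
  and zero: "(e ^^ K) (\<Sum>k<Suc K. (f ^^ k) (u k)) = 0"
 shows "u K = 0"
proof -
 have "(e ^^ K) (\<Sum>k<Suc K. (f ^^ k) (u k)) = (\<Sum>k<Suc K. (e ^^ K) ((f ^^ k) (u k)))"
  by (rule linear_on_sum[OF linear_pow(1) subspace_V]) (use u in auto)
 also have "... = (e ^^ K) ((f ^^ K) (u K))"
  using u by (simp add: e_pow_f_pow_kernel)
 finally show ?thesis using zero e_pow_f_pow_inj[OF P nonint, of "u K" K] u by simp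
qed

text \<open>Peeling off the top coefficient repeatedly: if no weight is a natural number, the spaces
  \<open>f^k (ker e)\<close> are independent and \<open>f^k\<close> is injective on the
  kernel.\<close>

lemma f_pow_expansion_unique:
 assumes P: "weighted P V h" and nonint: "!!w. w \<in> P ==> w \<notin> \<nat>"
 shows "(!!k. k < K ==> u k \<in> V & e (u k) = 0) ==> (\<Sum>k<K. (f ^^ k) (u k)) = 0 ==> k < K ==> u k = 0"
proof (induction K arbitrary: k)
 case (Suc K)
 have top: "u K = 0"
  by (rule f_pow_expansion_top[OF P nonint, of K u]) (use Suc.prems in auto)
 have "(\<Sum>k<K. (f ^^ k) (u k)) = 0" using Suc.prems(2) by (simp add: top)
 then have "u j = 0" if "j < K" for j using Suc.IH[of j] Suc.prems(1) that by (simp add: less_Suc_eq)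
 then show ?case using top Suc.prems(3) by (auto simp: less_Suc_eq)
qed simp

text \<open>An expansion killed by \<open>e^r\<close> has no terms with \<open>k \<ge> r\<close>.
  The resulting finiteness of the kernel of \<open>e^r\<close> is what later controls tensoring with
  a finite-dimensional module.\<close>

lemma hw_generated_kernel_pow:
 assumes B: "hw_generated P B" and P: "weighted P V h" and nonint: "!!w. w \<in> P ==> w \<notin> \<nat>"
  and v: "v \<in> V" "(e ^^ r) v = 0"
 shows "v \<in> cs.span {(f ^^ k) b | k b. k < r & b \<in> B}" (is "v \<in> cs.span ?S")
proof -
 have BV: "B \<subseteq> V" "!!b. b \<in> B ==> e b = 0" using hw_generatedD[OF B] by auto
 have sB: "cs.span B \<subseteq> {v \<in> V. e v = 0}"
  by (rule span_sub[OF _ kernel_subspace(1)]) (use BV in auto)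
 obtain K u where u: "!!k. u k \<in> cs.span B" "v = (\<Sum>k<K. (f ^^ k) (u k))"
  using hw_generated_expand[OF hw_generatedD(3)[OF B] BV(1) v(1)] by metis
 have mem: "(\<Sum>k<K. (f ^^ k) (u k)) \<in> cs.span ?S" if "K \<le> r" for K
 proof (rule cs.span_sum)
  fix k assume k: "k \<in> {..<K}"
  have "(f ^^ k) ` cs.span B = cs.span ((f ^^ k) ` B)"
   by (rule linear_on_span_image) (use BV in auto)
  also have "... \<subseteq> cs.span ?S" by (rule cs.span_mono) (use that k order_less_le_trans in blast)
  finally show "(f ^^ k) (u k) \<in> cs.span ?S" using u(1) by blast
 qed
 have "(\<Sum>k<K. (f ^^ k) (u k)) \<in> cs.span ?S" if "(e ^^ r) (\<Sum>k<K. (f ^^ k) (u k)) = 0" for K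
  using that
 proof (induction K)
  case (Suc K)
  show ?case
  proof (cases "Suc K \<le> r")
   case False
   \<comment> \<open>For \<open>K \<ge> r\<close> the vanishing of \<open>e^r\<close> passes to
     \<open>e^K\<close>, which detects the top coefficient.\<close>
   then have "(e ^^ K) x = (e ^^ (K - r)) ((e ^^ r) x)" for x
    by (metis funpow_add o_apply le_add_diff_inverse2 not_less_eq_eq)
   then have "u K = 0"
    using Suc.prems sB u(1) by (intro f_pow_expansion_top[OF P nonint, of K u]) auto
   then show ?thesis using Suc by simp
  qed (rule mem)
 qed (simp add: cs.span_zero)
 then show ?thesis using u(2) v(2) by simp
qed

lemma hw_generated_kernel:
 assumes "hw_generated P B" "weighted P V h" "!!w. w \<in> P ==> w \<notin> \<nat>" "v \<in> V" "e v = 0"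
 shows "v \<in> cs.span B"
proof -
 have "{(f ^^ k) b | k b. k < 1 & b \<in> B} = B" by auto
 then show ?thesis using hw_generated_kernel_pow[OF assms(1-4), of 1] assms(5) by simp
qed

text \<open>\<open>decompose\<close> reaches every vector through \<open>f\<close>-strings of kernel
  vectors, so a weight basis of the kernel of \<open>e\<close> generates; it is finite because the
  kernel lies in a finite span.\<close>

lemma hw_generatedI:
 assumes nonint: "!!w. w \<in> P ==> w \<notin> \<nat>" and shift: "!!w. w \<in> P ==> w + 2 \<in> P"
  and P: "weighted P V h" and nil: "locally_nilpotent V e"
  and C: "finite C" "{v \<in> V. e v = 0} \<subseteq> cs.span C"
 obtains B where "hw_generated P B" "cs.independent B"
proof -
 let ?K = "{v \<in> V. e v = 0}"
 let ?S = "\<Union>w\<in>P. wt_space ?K h w"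
 have K: "?K \<subseteq> cs.span ?S"
  using weighted_subspace[OF linear_h subspace_V P kernel_subspace(1)] kernel_h
  unfolding weighted_def by auto
 obtain B where B: "B \<subseteq> ?S" "cs.independent B" "?S \<subseteq> cs.span B"
  using cs.maximal_independent_subset[of ?S] by blast
 have BK: "B \<subseteq> ?K" using B(1) by (auto simp: wt_space_def)
 have "finite B" using cs.independent_span_bound[OF C(1) B(2)] BK C(2) by blast
 moreover have "\<forall>b\<in>B. e b = 0 & (\<exists>w\<in>P. h b = cscale w b)" using B(1) by (auto simp: wt_space_def)
 moreover have "V \<subseteq> cs.span {(f ^^ k) b | k b. b \<in> B}"
 proof -
  have "(f ^^ k) u \<in> cs.span {(f ^^ k) b | k b. b \<in> B}" if "u \<in> V" "e u = 0" for k u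
  proof -
   have "u \<in> cs.span B" using that K cs.span_minimal[OF B(3) cs.subspace_span] by blast
   then have "(f ^^ k) u \<in> cs.span ((f ^^ k) ` B)"
    using linear_on_span_image[OF linear_pow(2) subspace_V, of B k] BK by auto
   also have "... \<subseteq> cs.span {(f ^^ k) b | k b. b \<in> B}" by (rule cs.span_mono) auto
   finally show ?thesis .
  qed
  then have "cs.span {(f ^^ k) u | k u w. w \<in> P & u \<in> wt_space V h w & e u = 0}
    \<subseteq> cs.span {(f ^^ k) b | k b. b \<in> B}"
   by (intro cs.span_minimal) (auto dest: wt_space_in)
  then show ?thesis using decompose[OF nonint shift P nil] by blast
 qed
 ultimately show ?thesis using that B(2) BK unfolding hw_generated_def by blast
qed

end

section \<open>Finite-dimensional modules\<close>

text \<open>Indexed by numbers instead of vectors, so that a repeated value already counts as a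
  relation, with coefficients \<open>1\<close> and \<open>- 1\<close>.\<close>

lemma finite_span_dependent_family:
 fixes g :: "nat => cseq"
 assumes "finite B" "!!i. g i \<in> cs.span B"
 obtains n c where "\<exists>i<n. c i ~= 0" "(\<Sum>i<n. cscale (c i) (g i)) = 0"
proof -
 define n where "n = Suc (card B)"
 show ?thesis
 proof (cases "inj_on g {..<n}")
  case True
  have "cs.dependent (g ` {..<n})"
  proof (rule ccontr)
   assume "cs.independent (g ` {..<n})"
   then have "card (g ` {..<n}) \<le> card B"
    using cs.independent_span_bound[OF assms(1), of "g ` {..<n}"] assms(2) by blast
   then show False using card_image[OF True] by (simp add: n_def)
  qed
  then obtain u where u: "\<exists>v\<in>g ` {..<n}. u v ~= 0" "(\<Sum>v\<in>g ` {..<n}. cscale (u v) v) = 0"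
   by (subst (asm) cs.dependent_finite) auto
  show ?thesis
   by (rule that[of n "u \<circ> g"]) (use u in \<open>auto simp: sum.reindex[OF True]\<close>)
 next
  case False
  then obtain i j where ij: "i < n" "j < n" "i ~= j" "g i = g j" by (auto simp: inj_on_def)
  define c where "c k = (if k = i then 1 else if k = j then - 1 else 0 :: complex)" for k
  have "(\<Sum>k<n. cscale (c k) (g k)) = (\<Sum>k<n. (if k = i then g i else 0) + (if k = j then - g j else 0))"
   using ij(3) by (intro sum.cong) (auto simp: c_def)
  also have "... = g i - g j" using ij by (simp add: sum.distrib)
  also have "... = 0" using ij by simp
  finally have "(\<Sum>k<n. cscale (c k) (g k)) = 0" .
  moreover have "\<exists>i<n. c i ~= 0" using ij by (intro exI[of _ i]) (simp add: c_def)
  ultimately show ?thesis using that[of n c] by blast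
 qed
qed

lemma degree_linear_factor: "q ~= 0 ==> degree ([:- a, 1:] * q) = Suc (degree q)" for a :: complex
 using degree_mult_eq[of "[:- a, 1:]" q] by (simp del: mult_pCons_left)

definition operator_poly :: "(cseq => cseq) => complex poly => cseq => cseq" where
 "operator_poly T p v = (\<Sum>i\<le>degree p. cscale (coeff p i) ((T ^^ i) v))"

lemma operator_poly_linear_factor:
 assumes T: "linear_on V T" "T ` V \<subseteq> V" "cs.subspace V" and v: "v \<in> V" and q: "q ~= 0"
 shows "operator_poly T ([:- a, 1:] * q) v = operator_poly T q (T v - cscale a v)"
proof -
 let ?d = "degree q"
 let ?c = "coeff q"
 have deg: "degree ([:- a, 1:] * q) = Suc ?d" using q by (rule degree_linear_factor)
 have coeff: "coeff ([:- a, 1:] * q) i = (case i of 0 => 0 | Suc j => ?c j) - a * ?c i" for i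
  by (simp add: coeff_pCons split: nat.split)
 have pow: "(T ^^ i) (T v - cscale a v) = (T ^^ Suc i) v - cscale a ((T ^^ i) v)" for i
 proof -
  have "T v \<in> V" "cscale a v \<in> V" using T v by (auto simp: cs.subspace_scale)
  then show ?thesis
   using linear_on_diff[OF linear_on_funpow[OF T(1,2)] T(3)] linear_on_scale[OF linear_on_funpow[OF T(1,2)] v]
   by (simp add: funpow_swap1)
 qed
 have "operator_poly T ([:- a, 1:] * q) v =
   (\<Sum>i\<le>Suc ?d. cscale (case i of 0 => 0 | Suc j => ?c j) ((T ^^ i) v)) - (\<Sum>i\<le>Suc ?d. cscale (a * ?c i) ((T ^^ i) v))"
  unfolding operator_poly_def deg coeff by (simp only: cs.scale_left_diff_distrib sum_subtractf)
 also have "(\<Sum>i\<le>Suc ?d. cscale (case i of 0 => 0 | Suc j => ?c j) ((T ^^ i) v)) =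
   (\<Sum>i\<le>?d. cscale (?c i) ((T ^^ Suc i) v))"
  by (subst sum.atMost_Suc_shift) simp
 also have "(\<Sum>i\<le>Suc ?d. cscale (a * ?c i) ((T ^^ i) v)) = (\<Sum>i\<le>?d. cscale (a * ?c i) ((T ^^ i) v))"
  by (simp add: coeff_eq_0)
 also have "(\<Sum>i\<le>?d. cscale (?c i) ((T ^^ Suc i) v)) - ... = operator_poly T q (T v - cscale a v)"
  unfolding operator_poly_def pow sum_subtractf[symmetric]
  by (intro sum.cong refl) (simp add: cs.scale_right_diff_distrib mult.commute)
 finally show ?thesis .
qed

text \<open>An eigenvector in the quotient \<open>V / K\<close> without forming it. Some nonzero
  polynomial in \<open>T\<close> kills \<open>v\<close>; splitting off one root at a time, either
  the new vector drops into \<open>K\<close>, which exhibits an eigenvector, or the degree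
  falls.\<close>

lemma eigenvector_modulo:
 assumes T: "linear_on V T" "T ` V \<subseteq> V" "cs.subspace V"
  and B: "finite B" "V \<subseteq> cs.span B" and K: "cs.subspace K" and v: "v \<in> V" "v \<notin> K"
 obtains w a where "w \<in> V" "w \<notin> K" "T w - cscale a w \<in> K"
proof -
 have *: "\<exists>w a. w \<in> V & w \<notin> K & T w - cscale a w \<in> K"
  if "p ~= 0" "operator_poly T p v \<in> K" "v \<in> V" "v \<notin> K" for p v
  using that
 proof (induction "degree p" arbitrary: p v)
  case 0
  then obtain c where c: "p = [:c:]" "c ~= 0" by (metis degree_eq_zeroE pCons_0_0)
  then have "cscale c v \<in> K" using 0 by (simp add: operator_poly_def)
  then have "cscale (inverse c) (cscale c v) \<in> K" by (rule cs.subspace_scale[OF K])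
  then show ?case using c 0 by simp
 next
  case (Suc d)
  have "\<exists>x. poly p x = 0" by (rule alg_closed_imp_poly_has_root) (use Suc(2) in simp)
  then obtain a q where q: "p = [:- a, 1:] * q" by (auto simp: poly_eq_0_iff_dvd elim: dvdE)
  then have "q ~= 0" using Suc.prems(1) by auto
  then have q0: "q ~= 0" "degree q = d" using Suc(2) degree_linear_factor[of q a] q by simp_all
  let ?w = "T v - cscale a v"
  have w: "?w \<in> V" using T Suc.prems by (auto intro!: cs.subspace_diff cs.subspace_scale)
  show ?case
  proof (cases "?w \<in> K")
   case False
   have "operator_poly T q ?w \<in> K"
    using Suc.prems(2) operator_poly_linear_factor[OF T Suc.prems(3) q0(1), of a] q by simp
   then show ?thesis using Suc.hyps(1)[of q ?w] q0 w False by simp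
  qed (use Suc.prems in blast)
 qed
 have "(T ^^ i) v \<in> cs.span B" for i using funpow_in[OF T(2) v(1)] B by blast
 then obtain n c where nc: "\<exists>i<n. c i ~= 0" "(\<Sum>i<n. cscale (c i) ((T ^^ i) v)) = 0"
  using finite_span_dependent_family[OF B(1), of "%i. (T ^^ i) v"] by metis
 define p where "p = (\<Sum>i<n. monom (c i) i)"
 have coeff: "coeff p i = (if i < n then c i else 0)" for i
  by (simp add: p_def coeff_sum)
 have p0: "p ~= 0" using nc(1) coeff by (metis coeff_0)
 have deg: "degree p < n"
  using coeff[of "degree p"] p0 by (metis leading_coeff_0_iff)
 have "operator_poly T p v = (\<Sum>i<n. cscale (coeff p i) ((T ^^ i) v))"
  unfolding operator_poly_def by (rule sum.mono_neutral_left) (use deg in \<open>auto simp: coeff_eq_0\<close>)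
 also have "... = 0" using nc(2) by (simp add: coeff)
 finally have "operator_poly T p v \<in> K" using cs.subspace_0[OF K] by simp
 then show ?thesis using *[OF p0 _ v] that by blast
qed

context sl2_rep
begin

text \<open>Otherwise take an eigenvector \<open>w\<close> of \<open>h\<close> modulo the space of
  \<open>e\<close>-nilpotent vectors. The vectors \<open>e^i w\<close> have distinct eigenvalues
  \<open>a + 2 i\<close> modulo that space, so a linear relation puts some \<open>e^i w\<close>, and
  with it \<open>w\<close>, into the space.\<close>

lemma fd_locally_nilpotent:
 assumes B: "finite B" "V \<subseteq> cs.span B"
 shows "locally_nilpotent V e"
proof (rule ccontr)
 let ?K = "{v \<in> V. \<exists>n. (e ^^ n) v = 0}"
 have K: "cs.subspace ?K" by (rule locally_nilpotent_subspace)
 have eK: "e v \<in> ?K ==> v \<in> ?K" if "v \<in> V" for v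
 proof -
  assume "e v \<in> ?K"
  then obtain n where "(e ^^ n) (e v) = 0" by auto
  then have "(e ^^ Suc n) v = 0" by (simp add: funpow_swap1)
  then show "v \<in> ?K" using that by blast
 qed
 have Ke: "e v \<in> ?K" if v: "v \<in> ?K" for v
 proof -
  obtain n where "(e ^^ n) v = 0" using v by auto
  then have "(e ^^ n) (e v) = 0" using funpow_swap1[of e n v] by simp
  then show ?thesis using v by auto
 qed
 have hK: "h ` ?K \<subseteq> ?K"
 proof
  fix x assume "x \<in> h ` ?K"
  then obtain v n where v: "v \<in> V" "x = h v" "(e ^^ n) v = 0" by auto
  then show "x \<in> ?K" using h_e_pow[OF v(1), of n] by auto
 qed
 assume "\<not> locally_nilpotent V e"
 then obtain v where "v \<in> V" "v \<notin> ?K" by (auto simp: locally_nilpotent_def)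
 then obtain w a where w: "w \<in> V" "w \<notin> ?K" "h w - cscale a w \<in> ?K"
  using eigenvector_modulo[of V h B ?K v] B K by (metis (no_types, lifting) h_in image_subsetI linear_h subspace_V)
 have eig: "h ((e ^^ i) w) - cscale (a + 2 * of_nat i) ((e ^^ i) w) \<in> ?K" for i
 proof -
  have "h ((e ^^ i) w) - cscale (a + 2 * of_nat i) ((e ^^ i) w) = (e ^^ i) (h w - cscale a w)"
   using w(1) by (simp add: h_e_pow lin_simps cs.scale_left_distrib)
  moreover have "(e ^^ i) x \<in> ?K" if "x \<in> ?K" for x
   using that by (induction i) (use Ke in auto)
  ultimately show ?thesis using w(3) by simp
 qed
 have "(e ^^ i) w \<in> cs.span B" for i using B w(1) by blast
 then obtain n c where nc: "\<exists>i<n. c i ~= 0" "(\<Sum>i<n. cscale (c i) ((e ^^ i) w)) = 0"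
  using finite_span_dependent_family[OF B(1), of "%i. (e ^^ i) w"] by metis
 then obtain i where i: "i < n" "c i ~= 0" by auto
 have "cscale (c i) ((e ^^ i) w) \<in> ?K"
 proof (rule weight_components[OF linear_h subspace_V K _ hK, where S = "{..<n}" and w = "%i. a + 2 * of_nat i"])
  fix j
  have "h (cscale (c j) ((e ^^ j) w)) - cscale (a + 2 * of_nat j) (cscale (c j) ((e ^^ j) w)) =
    cscale (c j) (h ((e ^^ j) w) - cscale (a + 2 * of_nat j) ((e ^^ j) w))"
   using w(1) by (simp add: lin_simps cs.scale_right_diff_distrib mult.commute)
  then show "h (cscale (c j) ((e ^^ j) w)) - cscale (a + 2 * of_nat j) (cscale (c j) ((e ^^ j) w)) \<in> ?K"
   using cs.subspace_scale[OF K eig[of j]] by (simp only:)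
 qed (use nc i w(1) in \<open>auto simp: inj_on_def\<close>)
 then have "cscale (inverse (c i)) (cscale (c i) ((e ^^ i) w)) \<in> ?K" by (rule cs.subspace_scale[OF K])
 then have "(e ^^ i) w \<in> ?K" using i by simp
 then have "w \<in> ?K"
 proof (induction i)
  case (Suc i)
  then show ?case using eK[of "(e ^^ i) w"] w(1) by simp
 qed simp
 then show False using w(2) by simp
qed

lemma fd_nilpotent:
 assumes B: "finite B" "V = cs.span B"
 obtains N where "!!v. v \<in> V ==> (e ^^ N) v = 0"
proof -
 have "\<forall>b\<in>B. \<exists>n. (e ^^ n) b = 0"
  using fd_locally_nilpotent[of B] B cs.span_superset[of B] unfolding locally_nilpotent_def by auto
 then obtain n where n: "!!b. b \<in> B ==> (e ^^ n b) b = 0" by metis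
 define N where "N = Max (insert 0 (n ` B))"
 have "(e ^^ N) b = 0" if "b \<in> B" for b
 proof -
  have "n b \<le> N" using that B(1) by (auto simp: N_def)
  then have "(e ^^ N) b = (e ^^ (N - n b)) ((e ^^ n b) b)" by (metis funpow_add o_apply le_add_diff_inverse2)
  then show ?thesis using n[OF that] by simp
 qed
 then have "cs.span B \<subseteq> {v \<in> V. (e ^^ N) v = 0}"
  using cs.span_superset[of B] B by (intro span_sub kernel_subspace) auto
 then show ?thesis using that[of N] B by blast
qed

text \<open>Induction on the nilpotency of \<open>z\<close>: its top part is a multiple of
  \<open>f^n u\<close> for a highest weight vector \<open>u\<close> of weight
  \<open>l + 2 + 2 n\<close>, and \<open>e f^(n+1) u\<close> is \<open>f^n u\<close> times
  \<open>(n + 1) (l + 2 + n)\<close>, which is nonzero.\<close>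

lemma e_surj_weight:
 "w = of_nat l ==> z \<in> wt_space V h (w + 2) ==> (e ^^ n) z = 0 ==> \<exists>x\<in>wt_space V h w. e x = z"
proof (induction n arbitrary: z)
 case 0
 then show ?case by (intro bexI[of _ 0]) (auto simp: cs.subspace_0 wt_space_closed)
next
 case (Suc n)
 define u where "u = (e ^^ n) z"
 define m where "m = w + 2 + 2 * of_nat n"
 have m: "m = of_nat (l + 2 + 2 * n)" using Suc.prems by (simp add: m_def)
 have u: "u \<in> wt_space V h m" "e u = 0"
  using wt_space_pow(2)[OF Suc.prems(2)] Suc.prems(3) by (simp_all add: u_def m_def)
 have inV: "u \<in> V" "z \<in> V" using u(1) Suc.prems(2) by (auto dest: wt_space_in)
 have c: "ef_scalar n m ~= 0"
  unfolding m by (rule ef_scalar_nonzero) (simp only: of_nat_eq_iff)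
 let ?z = "z - cscale (inverse (ef_scalar n m)) ((f ^^ n) u)"
 have "(f ^^ n) u \<in> wt_space V h (w + 2)"
  using wt_space_pow(1)[OF u(1), of n] by (simp add: m_def)
 then have z: "?z \<in> wt_space V h (w + 2)"
  using Suc.prems(2) by (intro cs.subspace_diff cs.subspace_scale wt_space_closed)
 have "(e ^^ n) ?z = 0"
  using e_pow_f_pow_hw[OF u, of n] inV c by (simp add: lin_simps) (simp add: u_def)
 then obtain x where x: "x \<in> wt_space V h w" "e x = ?z" using Suc.IH[OF Suc.prems(1) z] by blast
 define d where "d = of_nat (Suc n) * (m - of_nat n)"
 have "d = of_nat (Suc n * (l + 2 + n))" unfolding d_def m by (simp add: algebra_simps)
 then have d: "d ~= 0" by (simp only: of_nat_eq_0_iff) simp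
 have ed: "e ((f ^^ Suc n) u) = cscale d ((f ^^ n) u)"
  unfolding d_def by (rule e_f_pow_hw[OF u])
 let ?y = "x + cscale (inverse (ef_scalar n m) * inverse d) ((f ^^ Suc n) u)"
 have "(f ^^ Suc n) u \<in> wt_space V h w"
  using wt_space_pow(1)[OF u(1), of "Suc n"] by (simp add: m_def algebra_simps del: funpow.simps)
 then have "?y \<in> wt_space V h w"
  using x(1) by (intro cs.subspace_add cs.subspace_scale wt_space_closed)
 moreover have "e ?y = z"
  using x inV ed d by (simp add: lin_simps wt_space_in del: funpow.simps)
 ultimately show ?case by blast
qed

text \<open>
  Complete reducibility is bypassed: a vector that is a generalised highest weight vector modulo the
  sum \<open>Y\<close> of the integral weight spaces can be corrected by an element of \<open>Y\<close> to a true weight vector.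
\<close>

lemma fd_weighted:
 assumes B: "finite B" "V = cs.span B"
 shows "weighted \<int> V h"
proof (rule ccontr)
 assume nw: "\<not> weighted \<int> V h"
 define Y where "Y = cs.span (\<Union>w\<in>\<int>. wt_space V h w)"
 have YV: "Y \<subseteq> V" unfolding Y_def by (rule span_sub) (auto dest: wt_space_in)
 have Y: "cs.subspace Y" by (simp add: Y_def)
 have Yw: "wt_space V h w \<subseteq> Y" if "w \<in> \<int>" for w
  unfolding Y_def using that by (auto intro: cs.span_base)
 have stable: "T ` Y \<subseteq> Y" if T: "linear_on V T" "!!v w. w \<in> \<int> ==> v \<in> wt_space V h w ==> T v \<in> Y" for T
 proof -
  have "Y \<subseteq> {v \<in> V. T v \<in> Y}"
   by (subst Y_def, rule span_sub)
    (use T YV in \<open>auto intro!: linear_on_vimage_subspace simp: Y dest: wt_space_in\<close>)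
  then show ?thesis by auto
 qed
 have eY: "e ` Y \<subseteq> Y" and fY: "f ` Y \<subseteq> Y" and hY: "h ` Y \<subseteq> Y"
 proof (rule_tac [!] stable)
  fix v w :: cseq
  fix w assume vw: "w \<in> \<int>" "v \<in> wt_space V h w"
  show "e v \<in> Y" using wt_space_step(2)[OF vw(2)] Yw[of "w + 2"] vw(1) by auto
  show "f v \<in> Y" using wt_space_step(1)[OF vw(2)] Yw[of "w - 2"] vw(1) by auto
  show "h v \<in> Y" using vw Yw[of w] by (auto simp: wt_space_def intro!: cs.subspace_scale[OF Y])
 qed auto
 have hfY: "(f ^^ k) v \<in> Y" if "v \<in> Y" for k v by (rule funpow_in[OF fY that])
 have Ydec: "\<exists>S u. finite S & S \<subseteq> \<int> & (\<forall>w. u w \<in> wt_space V h w) & y = (\<Sum>w\<in>S. u w)" if y: "y \<in> Y" for y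
 proof -
  have "weighted \<int> Y h"
   unfolding weighted_def
  proof
   fix y assume "y \<in> Y"
   moreover have "wt_space V h w \<subseteq> wt_space Y h w" if "w \<in> \<int>" for w
    using Yw[OF that] by (auto simp: wt_space_def)
   ultimately show "y \<in> cs.span (\<Union>w\<in>\<int>. wt_space Y h w)"
    unfolding Y_def using cs.span_mono[of "\<Union>w\<in>\<int>. wt_space V h w" "\<Union>w\<in>\<int>. wt_space Y h w"]
    by (auto simp: Y_def)
  qed
  then obtain S u where "finite S" "S \<subseteq> \<int>" "!!w. u w \<in> wt_space Y h w" "y = (\<Sum>w\<in>S. u w)"
   using weighted_decompose[OF linear_on_subset[OF linear_h YV] Y _ y] by metis
  then show ?thesis using YV by (intro exI[of _ S] exI[of _ u]) (auto simp: wt_space_def)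
 qed
 obtain v0 where v0: "v0 \<in> V" "v0 \<notin> Y" using nw unfolding weighted_def Y_def by auto
 obtain v1 a1 where v1: "v1 \<in> V" "v1 \<notin> Y" "h v1 - cscale a1 v1 \<in> Y"
  using eigenvector_modulo[OF linear_h image_subsetI[OF h_in] subspace_V B(1) equalityD1[OF B(2)] Y v0] by metis
 obtain N where N: "!!v. v \<in> V ==> (e ^^ N) v = 0" using fd_nilpotent[OF B] by metis
 interpret dual: sl2_rep V f "%v. - h v" e by (rule dual)
 obtain N' where N': "!!v. v \<in> V ==> (f ^^ N') v = 0" using dual.fd_nilpotent[OF B] by metis
 \<comment> \<open>The last power of \<open>e\<close> that keeps \<open>v1\<close> outside
   \<open>Y\<close> yields a highest weight vector modulo \<open>Y\<close>.\<close>
 define n where "n = (LEAST n. (e ^^ n) v1 \<in> Y)"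
 have n: "(e ^^ n) v1 \<in> Y" "!!m. m < n ==> (e ^^ m) v1 \<notin> Y"
  unfolding n_def using LeastI[of "%n. (e ^^ n) v1 \<in> Y" N] N[OF v1(1)] cs.subspace_0[OF Y]
  by (auto dest: not_less_Least)
 then obtain n' where n': "n = Suc n'" using v1(2) by (cases n) auto
 define v a where "v = (e ^^ n') v1" and "a = a1 + 2 * of_nat n'"
 have v: "v \<in> V" "v \<notin> Y" "e v \<in> Y" using v1 n n' by (auto simp: v_def)
 have "h v - cscale a v = (e ^^ n') (h v1 - cscale a1 v1)"
  using v1(1) by (simp add: v_def a_def h_e_pow lin_simps cs.scale_left_distrib)
 then have hv: "h v - cscale a v \<in> Y" using funpow_in[OF eY v1(3)] by simp
 obtain l where a: "a = of_nat l"
 proof -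
  \<comment> \<open>\<open>f^l v\<close> is the last vector of the string outside \<open>Y\<close>.
    Modulo \<open>Y\<close> the commutator formula for \<open>e f^(l+1) v\<close> leaves only
    \<open>(l + 1) (a - l) f^l v\<close>, so \<open>a = l\<close>.\<close>
  define m where "m = (LEAST m. (f ^^ m) v \<in> Y)"
  have m: "(f ^^ m) v \<in> Y" "!!k. k < m ==> (f ^^ k) v \<notin> Y"
   unfolding m_def using LeastI[of "%m. (f ^^ m) v \<in> Y" N'] N'[OF v(1)] cs.subspace_0[OF Y]
   by (auto dest: not_less_Least)
  then obtain l where l: "m = Suc l" using v(2) by (cases m) auto
  have "cscale (of_nat (Suc l) * (a - of_nat l)) ((f ^^ l) v) =
    e ((f ^^ Suc l) v) - (f ^^ Suc l) (e v) - cscale (of_nat (Suc l)) ((f ^^ l) (h v - cscale a v))"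
   using v(1) by (simp only: e_f_pow lin_simps h_in sums_in) (simp add: fun_eq_iff cscale_def algebra_simps)
  also have "... \<in> Y"
  proof (intro cs.subspace_diff[OF Y] cs.subspace_scale[OF Y])
   show "e ((f ^^ Suc l) v) \<in> Y" using m(1) l eY by blast
  qed (use hfY v(3) hv in blast)+
  finally have "cscale (of_nat (Suc l) * (a - of_nat l)) ((f ^^ l) v) \<in> Y" .
  then have "cscale (inverse (of_nat (Suc l) * (a - of_nat l))) (cscale (of_nat (Suc l) * (a - of_nat l)) ((f ^^ l) v)) \<in> Y"
   by (rule cs.subspace_scale[OF Y])
  moreover have "(f ^^ l) v \<notin> Y" using m(2)[of l] l by simp
  ultimately have "of_nat (Suc l) * (a - of_nat l) = 0"
   by (metis cs.scale_scale left_inverse cs.scale_one)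
  then show ?thesis using that[of l] by (simp del: of_nat_Suc)
 qed
 have aZ: "a \<in> \<int>" using a by simp
 obtain v' where v': "v' \<in> V" "v' \<notin> Y" "e v' \<in> Y" "h v' - cscale a v' \<in> wt_space V h a"
 proof -
  obtain S y where S: "finite S" "S \<subseteq> \<int>" "!!w. y w \<in> wt_space V h w" "h v - cscale a v = (\<Sum>w\<in>S. y w)"
   using Ydec[OF hv] by blast
  \<comment> \<open>On the part of weight \<open>w\<close> the operator \<open>h - a\<close> is the
    nonzero scalar \<open>w - a\<close>, so \<open>c\<close> accounts for every component of
    \<open>(h - a) v\<close> except the one of weight \<open>a\<close>.\<close>
  define c where "c = (\<Sum>w\<in>S - {a}. cscale (inverse (w - a)) (y w))"
  have yV: "y w \<in> V" "h (y w) = cscale w (y w)" for w using S(3)[of w] by (auto simp: wt_space_def)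
  have yY: "y w \<in> Y" if "w \<in> S" for w using S(2,3) Yw that by blast
  have cY: "c \<in> Y" unfolding c_def using yY by (intro cs.subspace_sum[OF Y] cs.subspace_scale[OF Y]) auto
  have "h c = (\<Sum>w\<in>S - {a}. cscale (inverse (w - a) * w) (y w))"
   unfolding c_def by (subst linear_on_sum[OF linear_h subspace_V]) (use yV in \<open>auto simp: lin_simps\<close>)
  then have "h c - cscale a c = (\<Sum>w\<in>S - {a}. cscale (inverse (w - a) * w) (y w) - cscale (a * inverse (w - a)) (y w))"
   unfolding c_def by (simp add: cs.scale_sum_right sum_subtractf)
  also have "... = (\<Sum>w\<in>S - {a}. y w)"
  proof (rule sum.cong)
   fix w assume "w \<in> S - {a}"
   then have "inverse (w - a) * w - a * inverse (w - a) = 1"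
    by (simp add: left_diff_distrib[symmetric] mult.commute[of "inverse _"])
   then show "cscale (inverse (w - a) * w) (y w) - cscale (a * inverse (w - a)) (y w) = y w"
    by (simp add: cs.scale_left_diff_distrib[symmetric])
  qed simp
  finally have hc: "h c - cscale a c = (\<Sum>w\<in>S - {a}. y w)" .
  have cV: "c \<in> V" using cY YV by auto
  have "h (v - c) - cscale a (v - c) = (h v - cscale a v) - (h c - cscale a c)"
   using v(1) cV by (simp add: lin_simps cs.scale_right_diff_distrib)
  also have "... = (if a \<in> S then y a else 0)"
   unfolding hc S(4) using S(1) by (simp add: sum_diff1)
  also have "... \<in> wt_space V h a"
   using S(3)[of a] cs.subspace_0[OF wt_space_closed] by simp
  finally have h: "h (v - c) - cscale a (v - c) \<in> wt_space V h a" .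
  show ?thesis
  proof (rule that[OF _ _ _ h])
   show "v - c \<in> V" using v(1) cV by simp
   show "v - c \<notin> Y" using v(2) cY cs.subspace_add[OF Y, of "v - c" c] by auto
   show "e (v - c) \<in> Y" using v(1,3) cV cY eY by (auto simp: lin_simps intro!: cs.subspace_diff[OF Y])
  qed
 qed
 define y where "y = h v' - cscale a v'"
 have y: "y \<in> V" "h y = cscale a y" using v'(4) by (auto simp: y_def wt_space_def)
 have hv': "h v' = cscale a v' + y" by (simp add: y_def)
 have ez: "h (e v') - cscale (a + 2) (e v') = e y"
  using v'(1) y(1) by (simp add: h_e hv' lin_simps cs.scale_left_distrib)
 have hey: "h (e y) - cscale (a + 2) (e y) = 0"
  using y by (simp add: h_e lin_simps cs.scale_left_distrib)
 have z: "e v' \<in> wt_space V h (a + 2)"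
 proof -
  obtain S u where S: "finite S" "S \<subseteq> \<int>" "!!w. u w \<in> wt_space V h w" "e v' = (\<Sum>w\<in>S. u w)"
   using Ydec[OF v'(3)] by blast
  have u: "u w \<in> V" "h (u w) = cscale w (u w)" for w using S(3)[of w] by (auto simp: wt_space_def)
  \<comment> \<open>\<open>e v'\<close> is a sum of integral weight vectors, on which
    \<open>D\<close> acts diagonally; since \<open>D\<close> applied twice gives zero, only the
    weight \<open>a + 2\<close> can occur.\<close>
  define D where "D x = h x - cscale (a + 2) x" for x
  have D: "linear_on V D" unfolding D_def by (intro linear_on_minus_fun linear_on_cscale linear_on_id) auto
  have Du: "D (cscale c (u w)) = cscale (c * (w - (a + 2))) (u w)" for c w
   using u by (simp add: D_def lin_simps) (simp add: fun_eq_iff cscale_def algebra_simps)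
  have "D (\<Sum>w\<in>S. u w) = (\<Sum>w\<in>S. cscale (w - (a + 2)) (u w))"
   using Du[of 1] u by (simp add: linear_on_sum[OF D subspace_V])
  then have "D (D (\<Sum>w\<in>S. u w)) = (\<Sum>w\<in>S. cscale ((w - (a + 2)) * (w - (a + 2))) (u w))"
   using Du u by (simp add: linear_on_sum[OF D subspace_V])
  moreover have "D (D (\<Sum>w\<in>S. u w)) = 0" unfolding S(4)[symmetric] using ez hey by (simp add: D_def)
  ultimately have s0: "(\<Sum>w\<in>S. cscale ((w - (a + 2)) * (w - (a + 2))) (u w)) = 0" by simp
  have "u w = 0" if w: "w \<in> S" "w ~= a + 2" for w
  proof -
   have "cscale ((w - (a + 2)) * (w - (a + 2))) (u w) \<in> {0}"
    by (rule weight_components[OF linear_h subspace_V, where S = S and w = id])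
     (use S u w s0 in \<open>auto simp: lin_simps mult.commute\<close>)
   then show ?thesis using w(2) by simp
  qed
  then have "e v' = (\<Sum>w\<in>S. if w = a + 2 then u w else 0)" unfolding S(4) by (intro sum.cong) auto
  also have "... = (if a + 2 \<in> S then u (a + 2) else 0)" using S(1) by simp
  also have "... \<in> wt_space V h (a + 2)" using S(3) cs.subspace_0[OF wt_space_closed] by auto
  finally show ?thesis .
 qed
 then have ey: "e y = 0" using ez by (simp add: wt_space_def)
 \<comment> \<open>\<open>x\<close> has the integral weight \<open>a\<close>, hence lies in
   \<open>Y\<close>; subtracting it makes \<open>v'\<close> a true kernel vector of \<open>e\<close>
   without changing its class modulo \<open>Y\<close>.\<close>
 obtain x where x: "x \<in> wt_space V h a" "e x = e v'"
  using e_surj_weight[OF a z N] v'(1) by auto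
 have xV: "x \<in> V" "h x = cscale a x" using x(1) by (auto simp: wt_space_def)
 define v'' where "v'' = v' - x"
 have v'': "v'' \<in> V" "e v'' = 0" "h v'' = cscale a v'' + y"
  using v'(1) x xV by (simp_all add: v''_def lin_simps hv' cs.scale_right_diff_distrib)
 have yw: "y \<in> wt_space V h a" using v'(4) by (simp add: y_def)
 \<comment> \<open>Beyond \<open>l\<close> the scalars \<open>(k + 1) (a - k)\<close> are nonzero
   because \<open>a = l\<close>, so the vanishing of a high power of \<open>f\<close> on
   \<open>u\<close> descends to \<open>f^(l+1)\<close>.\<close>
 have down: "u = 0 \<or> (f ^^ Suc l) u = 0"
  if u: "u \<in> V" "!!k. k > l ==> e ((f ^^ Suc k) u) = cscale (of_nat (Suc k) * (a - of_nat k)) ((f ^^ k) u)" for u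
 proof -
  have "(f ^^ Suc l) u = 0" if "(f ^^ (Suc l + k)) u = 0" for k
   using that
  proof (induction k)
   case (Suc k)
   have "cscale (of_nat (Suc (Suc l + k)) * (a - of_nat (Suc l + k))) ((f ^^ (Suc l + k)) u) = 0"
    using Suc.prems u(2)[of "Suc l + k"] by simp
   moreover have "of_nat (Suc (Suc l + k)) * (a - of_nat (Suc l + k)) ~= (0 :: complex)"
    unfolding a by (simp only: mult_eq_0_iff of_nat_eq_0_iff right_minus_eq of_nat_eq_iff) simp
   ultimately show ?case using Suc.IH by (simp del: of_nat_Suc of_nat_add)
  qed simp
  moreover have "(f ^^ (Suc l + N')) u = 0"
   using N'[OF pow_in(2)[OF u(1), of "Suc l"]] by (metis add.commute funpow_add o_apply)
  ultimately show ?thesis by blast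
 qed
 have fy: "(f ^^ Suc l) y = 0"
  using down[OF y(1) e_f_pow_hw[OF yw ey]] by auto
 have fy': "(f ^^ k) y = 0" if "k > l" for k
 proof -
  have "(f ^^ k) y = (f ^^ (k - Suc l)) ((f ^^ Suc l) y)"
   using that by (metis Suc_leI funpow_add o_apply le_add_diff_inverse2)
  then show ?thesis using fy by simp
 qed
 have ef: "e ((f ^^ Suc k) v'') = cscale (of_nat (Suc k) * (a - of_nat k)) ((f ^^ k) v'') + cscale (of_nat (Suc k)) ((f ^^ k) y)" for k
  using v'' y(1) by (simp only: e_f_pow lin_simps h_in sums_in zero_simps) (simp add: fun_eq_iff cscale_def algebra_simps)
 have "(f ^^ Suc l) v'' = 0"
  using down[OF v''(1)] ef fy' by auto
 \<comment> \<open>At \<open>k = l\<close> the scalar \<open>a - l\<close> vanishes and only the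
   contribution of \<open>y\<close>, the defect of \<open>v''\<close> from being a weight vector,
   remains; \<open>e^l f^l\<close> then shows \<open>y = 0\<close>.\<close>
 then have "(f ^^ l) y = 0" using ef[of l] a by (simp del: of_nat_Suc)
 then have "cscale (ef_scalar l a) y = 0" using e_pow_f_pow_hw[OF yw ey, of l] by simp
 moreover have "ef_scalar l a ~= 0" unfolding a by (rule ef_scalar_nonzero) simp
 ultimately have "y = 0" by simp
 then have "v'' \<in> wt_space V h a" using v'' by (simp add: wt_space_def)
 then have "v'' + x \<in> Y" using x(1) Yw[OF aZ] by (intro cs.subspace_add[OF Y]) auto
 then show False using v'(2) by (simp add: v''_def)
qed

end

section \<open>The additive closure of the simple highest weight modules\<close>

text \<open>Working description of the objects of \<open>N1 mu\<close>; for non-integral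
  \<open>mu\<close> the two are identified by \<open>Obj_N1\<close>. The zero module arises from the
  empty \<open>B\<close>.\<close>

definition verma_sum :: "complex => sl2_module => bool" where
 "verma_sum mu M \<longleftrightarrow> M \<in> sl2_modules &
  (\<exists>B. sl2_rep.hw_generated (car M) (act M sl2_e) (act M sl2_h) (act M sl2_f) (coset mu) B)"

lemma coset_not_Nats: "mu \<notin> \<int> ==> w \<in> coset mu ==> w \<notin> \<nat>"
 using coset_nonint Nats_subset_Ints by blast

lemma verma_sum_in: "verma_sum mu M ==> M \<in> sl2_modules"
 by (simp add: verma_sum_def)

lemma verma_sum_weighted: "verma_sum mu M ==> weighted (coset mu) (car M) (act M sl2_h)"
 unfolding verma_sum_def using sl2_rep.hw_generated_weighted[OF sl2_module_rep] coset_shift(2)[of _ mu 2] by auto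

lemma verma_sum_nilpotent: "verma_sum mu M ==> locally_nilpotent (car M) (act M sl2_e)"
 unfolding verma_sum_def using sl2_rep.hw_generated_nilpotent[OF sl2_module_rep] by auto

lemma verma_sum_kernel_pow:
 assumes mu: "mu \<notin> \<int>" and M: "verma_sum mu M"
 obtains C where "finite C" "C \<subseteq> car M" "{v \<in> car M. (act M sl2_e ^^ r) v = 0} \<subseteq> cs.span C"
proof -
 interpret sl2_rep "car M" "act M sl2_e" "act M sl2_h" "act M sl2_f"
  by (rule sl2_module_rep[OF verma_sum_in[OF M]])
 obtain B where B: "hw_generated (coset mu) B" using M by (auto simp: verma_sum_def)
 let ?C = "{(act M sl2_f ^^ k) b | k b. k < r & b \<in> B}"
 have "finite ?C" using finite_image_set2[of "%k. k < r" "%b. b \<in> B"] hw_generatedD(1)[OF B] by simp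
 moreover have "?C \<subseteq> car M" using hw_generatedD(4)[OF B] by auto
 moreover have "{v \<in> car M. (act M sl2_e ^^ r) v = 0} \<subseteq> cs.span ?C"
  using hw_generated_kernel_pow[OF B verma_sum_weighted[OF M] coset_not_Nats[OF mu]] by auto
 ultimately show ?thesis using that by blast
qed

lemma verma_sumI:
 assumes mu: "mu \<notin> \<int>" and M: "M \<in> sl2_modules" and w: "weighted (coset mu) (car M) (act M sl2_h)"
  and n: "locally_nilpotent (car M) (act M sl2_e)"
  and C: "finite C" "{v \<in> car M. act M sl2_e v = 0} \<subseteq> cs.span C"
 shows "verma_sum mu M"
 using sl2_rep.hw_generatedI[OF sl2_module_rep[OF M] coset_not_Nats[OF mu] coset_shift(1)[of _ mu 2] w n C] M
 unfolding verma_sum_def by auto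

lemma tensor_basis_expand:
 assumes B: "finite B" and W: "cs.subspace W" and t: "t \<in> tensor_space (cs.span B) W"
 obtains m where "!!b. m b \<in> W" "t = (\<Sum>b\<in>B. tensor b (m b))"
proof -
 let ?D = "{t. \<exists>m. (\<forall>b. m b \<in> W) & t = (\<Sum>b\<in>B. tensor b (m b))}"
 have "tensor_space (cs.span B) W \<subseteq> ?D"
 proof (rule tensor_space_subset)
  fix v w assume v: "v \<in> cs.span B" and w: "w \<in> W"
  then obtain c where "v = (\<Sum>b\<in>B. cscale (c b) b)" using cs.span_finite[OF B] by auto
  then have "tensor v w = (\<Sum>b\<in>B. tensor b (cscale (c b) w))"
   by (simp only: tensor_sum_left tensor_scale_left tensor_scale_right)
  then show "tensor v w \<in> ?D"
   using w by (intro CollectI exI[of _ "%b. cscale (c b) w"]) (simp add: cs.subspace_scale[OF W])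
 next
  show "cs.subspace ?D"
  proof (rule cs.subspaceI)
   show "0 \<in> ?D" by (rule CollectI, rule exI[of _ "\<lambda>b. 0"]) (simp add: cs.subspace_0[OF W])
  next
   fix x y assume "x \<in> ?D" "y \<in> ?D"
   then obtain m n where "\<forall>b. m b \<in> W" "\<forall>b. n b \<in> W" "x = (\<Sum>b\<in>B. tensor b (m b))" "y = (\<Sum>b\<in>B. tensor b (n b))"
    by auto
   then show "x + y \<in> ?D"
    by (intro CollectI exI[of _ "%b. m b + n b"])
     (auto simp: tensor_add_right sum.distrib cs.subspace_add[OF W])
  next
   fix c x assume "x \<in> ?D"
   then obtain m where "\<forall>b. m b \<in> W" "x = (\<Sum>b\<in>B. tensor b (m b))"
    by auto
   then show "cscale c x \<in> ?D"
    by (intro CollectI exI[of _ "%b. cscale c (m b)"])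
     (auto simp: tensor_scale_right cs.scale_sum_right cs.subspace_scale[OF W])
  qed
 qed
 then show ?thesis using t that by blast
qed

text \<open>Fixing the second index at \<open>j\<close> turns the relation between tensors into a
  scalar relation between the independent vectors \<open>b\<close>.\<close>

lemma tensor_basis_unique:
 assumes B: "finite B" "cs.independent B" and zero: "(\<Sum>b\<in>B. tensor b (m b)) = 0" and b: "b \<in> B"
 shows "m b = 0"
proof
 fix j
 have "(\<Sum>b\<in>B. cscale (m b j) b) = 0"
 proof
  fix i
  have "(\<Sum>b\<in>B. tensor b (m b)) (prod_encode (i, j)) = 0" using zero by simp
  then show "(\<Sum>b\<in>B. cscale (m b j) b) i = 0 i" by (simp add: sum_apply_fun cscale_apply mult.commute)
 qed
 then have "m b j = 0"
  by (rule cs.independentD[OF B(2,1) order_refl _ b])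
 then show "m b j = 0 j" by simp
qed

lemma wt_space_tensor:
 assumes "X \<in> sl2_modules" "M \<in> sl2_modules" "v \<in> wt_space (car X) (act X sl2_h) a" "w \<in> wt_space (car M) (act M sl2_h) b"
 shows "tensor v w \<in> wt_space (car (sl2_tensor X M)) (act (sl2_tensor X M) sl2_h) (a + b)"
 using assms by (simp add: wt_space_def tensor_scale_left tensor_scale_right cs.scale_left_distrib)

lemma weighted_tensor:
 assumes X: "X \<in> sl2_modules" "weighted \<int> (car X) (act X sl2_h)"
  and M: "M \<in> sl2_modules" "weighted (coset mu) (car M) (act M sl2_h)"
 shows "weighted (coset mu) (car (sl2_tensor X M)) (act (sl2_tensor X M) sl2_h)"
 unfolding weighted_def
proof -
 let ?SX = "\<Union>w\<in>\<int>. wt_space (car X) (act X sl2_h) w" and ?SM = "\<Union>w\<in>coset mu. wt_space (car M) (act M sl2_h) w"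
 let ?S = "\<Union>w\<in>coset mu. wt_space (car (sl2_tensor X M)) (act (sl2_tensor X M) sl2_h) w"
 have "{tensor b c | b c. b \<in> ?SX & c \<in> ?SM} \<subseteq> ?S"
 proof
  fix t assume "t \<in> {tensor b c | b c. b \<in> ?SX & c \<in> ?SM}"
  then obtain a b v w where *: "t = tensor v w" "a \<in> \<int>" "v \<in> wt_space (car X) (act X sl2_h) a"
   "b \<in> coset mu" "w \<in> wt_space (car M) (act M sl2_h) b" by blast
  then have "b + a \<in> coset mu" by (intro coset_shift)
  then show "t \<in> ?S" using wt_space_tensor[OF X(1) M(1) *(3,5)] *(1) by (auto simp: add.commute)
 qed
 then have sub: "cs.span {tensor b c | b c. b \<in> ?SX & c \<in> ?SM} \<subseteq> cs.span ?S" by (rule cs.span_mono)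
 have "tensor_space (car X) (car M) \<subseteq> cs.span ?S"
 proof (rule tensor_space_subset)
  fix v w assume "v \<in> car X" "w \<in> car M"
  then have "v \<in> cs.span ?SX" "w \<in> cs.span ?SM" using X(2) M(2) by (auto simp only: weighted_def subset_iff)
  from tensor_in_span[OF this] show "tensor v w \<in> cs.span ?S" by (rule subsetD[OF sub])
 qed simp
 then show "car (sl2_tensor X M) \<subseteq> cs.span ?S" by simp
qed

text \<open>If \<open>e^i\<close> kills \<open>v\<close> and \<open>e^j\<close> kills
  \<open>w\<close>, then \<open>e^(i+j)\<close> kills \<open>v \<otimes> w\<close>, since each
  application to the tensor uses up one of the two exponents.\<close>

lemma nilpotent_tensor:
 assumes X: "X \<in> sl2_modules" "locally_nilpotent (car X) (act X sl2_e)"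
  and M: "M \<in> sl2_modules" "locally_nilpotent (car M) (act M sl2_e)"
 shows "locally_nilpotent (car (sl2_tensor X M)) (act (sl2_tensor X M) sl2_e)"
proof -
 let ?E = "act (sl2_tensor X M) sl2_e"
 interpret X: sl2_rep "car X" "act X sl2_e" "act X sl2_h" "act X sl2_f" by (rule sl2_module_rep[OF X(1)])
 interpret M: sl2_rep "car M" "act M sl2_e" "act M sl2_h" "act M sl2_f" by (rule sl2_module_rep[OF M(1)])
 interpret T: sl2_rep "car (sl2_tensor X M)" ?E "act (sl2_tensor X M) sl2_h" "act (sl2_tensor X M) sl2_f"
  by (rule sl2_module_rep) (simp add: X M)
 have *: "(?E ^^ n) (tensor v w) = 0"
  if "n = i + j" "v \<in> car X" "w \<in> car M" "(act X sl2_e ^^ i) v = 0" "(act M sl2_e ^^ j) w = 0" for n i j v w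
  using that
 proof (induction n arbitrary: i j v w)
  case (Suc n)
  show ?case
  proof (cases "i = 0 \<or> j = 0")
   case True
   then have "tensor v w = 0" using Suc.prems by auto
   then show ?thesis by (simp del: funpow.simps)
  next
   case False
   then obtain i' j' where ij: "i = Suc i'" "j = Suc j'" by (metis not0_implies_Suc)
   have "(?E ^^ n) (tensor (act X sl2_e v) w) = 0"
    by (rule Suc.IH[of i' j]) (use Suc.prems ij in \<open>auto simp: funpow_swap1\<close>)
   moreover have "(?E ^^ n) (tensor v (act M sl2_e w)) = 0"
    by (rule Suc.IH[of i j']) (use Suc.prems ij in \<open>auto simp: funpow_swap1\<close>)
   ultimately have "(?E ^^ n) (tensor (act X sl2_e v) w + tensor v (act M sl2_e w)) = 0"
    using Suc.prems by (subst T.lin_simps) (auto simp del: funpow.simps)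
   moreover have "(?E ^^ Suc n) (tensor v w) = (?E ^^ n) (?E (tensor v w))" by (simp add: funpow_swap1)
   ultimately show ?thesis using Suc.prems X M by simp
  qed
 qed simp
 have "tensor_space (car X) (car M) \<subseteq> {t \<in> car (sl2_tensor X M). \<exists>n. (?E ^^ n) t = 0}"
 proof (rule tensor_space_subset[OF _ T.locally_nilpotent_subspace])
  fix v w assume vw: "v \<in> car X" "w \<in> car M"
  then obtain i j where "(act X sl2_e ^^ i) v = 0" "(act M sl2_e ^^ j) w = 0"
   using X(2) M(2) unfolding locally_nilpotent_def by metis
  then show "tensor v w \<in> {t \<in> car (sl2_tensor X M). \<exists>n. (?E ^^ n) t = 0}"
   using *[OF refl vw] vw by auto
 qed
 then show ?thesis unfolding locally_nilpotent_def by auto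
qed

text \<open>On the kernel of \<open>e \<otimes> 1 + 1 \<otimes> e\<close> the commuting operators \<open>1 \<otimes> e\<close> and \<open>- e \<otimes> 1\<close> agree.\<close>

lemma kernel_tensor_pow:
 assumes X: "X \<in> sl2_modules" and M: "M \<in> sl2_modules"
  and t: "t \<in> tensor_space (car X) (car M)" "act (sl2_tensor X M) sl2_e t = 0"
 shows "tensor_map (car X) (car M) id (act M sl2_e ^^ k) t =
  cscale ((- 1) ^ k) (tensor_map (car X) (car M) (act X sl2_e ^^ k) id t)"
proof (induction k)
 case 0
 then show ?case by (simp add: id_def[symmetric])
next
 case (Suc k)
 let ?T = "tensor_map (car X) (car M)" and ?x = "act X sl2_e" and ?m = "act M sl2_e"
 interpret X: sl2_rep "car X" "act X sl2_e" "act X sl2_h" "act X sl2_f" by (rule sl2_module_rep[OF X(1)])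
 interpret M: sl2_rep "car M" "act M sl2_e" "act M sl2_h" "act M sl2_f" by (rule sl2_module_rep[OF M(1)])
 interpret tensor_pair "car X" "car M" by unfold_locales auto
 have comp: "?T A' B' (?T A B s) = ?T (A' \<circ> A) (B' \<circ> B) s"
  if "linear_on (car X) A" "linear_on (car X) A'" "linear_on (car M) B" "linear_on (car M) B'"
   "A ` car X \<subseteq> car X" "B ` car M \<subseteq> car M" "s \<in> tensor_space (car X) (car M)" for A A' B B' s
  using that by (intro tensor_map_comp) auto
 have in_T: "?T A B s \<in> tensor_space (car X) (car M)"
  if "linear_on (car X) A" "linear_on (car M) B" "A ` car X \<subseteq> car X" "B ` car M \<subseteq> car M" "s \<in> tensor_space (car X) (car M)" for A B s
  using that by (intro tensor_map_in) auto
 have "?T id (?m ^^ Suc k) t = ?T id ?m (?T id (?m ^^ k) t)"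
  by (subst comp) (use t in \<open>auto simp: linear_on_id\<close>)
 also have "... = cscale ((- 1) ^ k) (?T id ?m (?T (?x ^^ k) id t))"
  unfolding Suc.IH using t
  by (intro linear_on_scale[OF linear_on_tensor_map] in_T) (auto simp: linear_on_id)
 also have "?T id ?m (?T (?x ^^ k) id t) = ?T (?x ^^ k) id (?T id ?m t)"
  by (subst (1 2) comp) (use t in \<open>auto simp: linear_on_id\<close>)
 also have "?T id ?m t = - ?T ?x id t"
  using t(2) by (simp add: sl2_tensor_def add_eq_0_iff)
 also have "?T (?x ^^ k) id (- ?T ?x id t) = - ?T (?x ^^ k) id (?T ?x id t)"
  using t by (intro linear_on_minus[OF linear_on_tensor_map] in_T) (auto simp: linear_on_id)
 also have "?T (?x ^^ k) id (?T ?x id t) = ?T (?x ^^ Suc k) id t"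
  unfolding funpow_Suc_right by (subst comp) (use t in \<open>auto simp: linear_on_id\<close>)
 finally show ?case by (simp add: id_def del: funpow.simps)
qed

lemma fd_basis:
 assumes "finite_dimensional X"
 obtains B where "finite B" "cs.independent B" "car X = cs.span B"
proof -
 obtain C where C: "finite C" "car X = cs.span C" using assms by (auto simp: finite_dimensional_def)
 obtain B where B: "B \<subseteq> C" "cs.independent B" "C \<subseteq> cs.span B"
  using cs.maximal_independent_subset[of C] by blast
 have "cs.span C = cs.span B"
  using B cs.span_mono[OF B(1)] cs.span_minimal[OF B(3) cs.subspace_span] by auto
 then show ?thesis using that[of B] B(2) C finite_subset[OF B(1) C(1)] by simp
qed

lemma fd_module:
 assumes X: "X \<in> sl2_modules" "finite_dimensional X"
 shows fd_module_weighted: "weighted \<int> (car X) (act X sl2_h)"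
  and fd_module_nilpotent: "\<exists>N. \<forall>v\<in>car X. (act X sl2_e ^^ N) v = 0"
  and fd_module_nilpotent_f: "\<exists>N. \<forall>v\<in>car X. (act X sl2_f ^^ N) v = 0"
proof -
 interpret X: sl2_rep "car X" "act X sl2_e" "act X sl2_h" "act X sl2_f" by (rule sl2_module_rep[OF X(1)])
 interpret D: sl2_rep "car X" "act X sl2_f" "%v. - act X sl2_h v" "act X sl2_e" by (rule X.dual)
 obtain B where B: "finite B" "car X = cs.span B" using X(2) by (auto simp: finite_dimensional_def)
 show "weighted \<int> (car X) (act X sl2_h)" by (rule X.fd_weighted[OF B])
 show "\<exists>N. \<forall>v\<in>car X. (act X sl2_e ^^ N) v = 0" by (rule X.fd_nilpotent[OF B]) auto
 show "\<exists>N. \<forall>v\<in>car X. (act X sl2_f ^^ N) v = 0" by (rule D.fd_nilpotent[OF B]) auto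
qed

text \<open>Weights and local nilpotency are inherited from the factors; the point is finiteness of
  the kernel of \<open>e\<close>. On that kernel \<open>1 \<otimes> e^r\<close> agrees up to sign
  with \<open>e^r \<otimes> 1 = 0\<close>, so the coordinates of a kernel vector in a basis of
  \<open>X\<close> lie in the kernel of \<open>e^r\<close> on \<open>M\<close>.\<close>

lemma verma_sum_tensor:
 assumes mu: "mu \<notin> \<int>" and X: "X \<in> sl2_modules" "finite_dimensional X" and M: "verma_sum mu M"
 shows "verma_sum mu (sl2_tensor X M)"
proof -
 have M': "M \<in> sl2_modules" by (rule verma_sum_in[OF M])
 interpret X: sl2_rep "car X" "act X sl2_e" "act X sl2_h" "act X sl2_f" by (rule sl2_module_rep[OF X(1)])
 interpret M: sl2_rep "car M" "act M sl2_e" "act M sl2_h" "act M sl2_f" by (rule sl2_module_rep[OF M'])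
 interpret tensor_pair "car X" "car M" by unfold_locales auto
 obtain r where r: "!!v. v \<in> car X ==> (act X sl2_e ^^ r) v = 0" using fd_module_nilpotent[OF X] by auto
 then have nil: "locally_nilpotent (car X) (act X sl2_e)" unfolding locally_nilpotent_def by blast
 obtain B where B: "finite B" "cs.independent B" "car X = cs.span B" using fd_basis[OF X(2)] .
 obtain C where C: "finite C" "C \<subseteq> car M" "{v \<in> car M. (act M sl2_e ^^ r) v = 0} \<subseteq> cs.span C"
  using verma_sum_kernel_pow[OF mu M, of r] by metis
 let ?C = "{tensor b c | b c. b \<in> B & c \<in> C}"
 show ?thesis
 proof (rule verma_sumI[OF mu])
  show "sl2_tensor X M \<in> sl2_modules" using X M' by simp
  show "weighted (coset mu) (car (sl2_tensor X M)) (act (sl2_tensor X M) sl2_h)"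
   by (rule weighted_tensor[OF X(1) fd_module_weighted[OF X] M' verma_sum_weighted[OF M]])
  show "locally_nilpotent (car (sl2_tensor X M)) (act (sl2_tensor X M) sl2_e)"
   by (rule nilpotent_tensor[OF X(1) nil M' verma_sum_nilpotent[OF M]])
  show "finite ?C" using finite_image_set2[of "%b. b \<in> B" "%c. c \<in> C" tensor] B C by simp
  show "{t \<in> car (sl2_tensor X M). act (sl2_tensor X M) sl2_e t = 0} \<subseteq> cs.span ?C"
  proof
   fix t assume "t \<in> {t \<in> car (sl2_tensor X M). act (sl2_tensor X M) sl2_e t = 0}"
   then have t: "t \<in> tensor_space (car X) (car M)" "act (sl2_tensor X M) sl2_e t = 0" by auto
   let ?T = "tensor_map (car X) (car M)"
   have "?T (act X sl2_e ^^ r) id t = (\<lambda>t. 0) t"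
    by (rule tensor_map_eqI) (use t r in \<open>auto simp: linear_on_id linear_on_const_0\<close>)
   then have Tt: "?T id (act M sl2_e ^^ r) t = 0"
    using kernel_tensor_pow[OF X(1) M' t, of r] by simp
   obtain m where m: "!!b. m b \<in> car M" "t = (\<Sum>b\<in>B. tensor b (m b))"
    using tensor_basis_expand[OF B(1) M.subspace_V, of t] t(1) B(3) by auto
   have Bx: "b \<in> car X" if "b \<in> B" for b using that B(3) cs.span_base by auto
   have "?T id (act M sl2_e ^^ r) t = (\<Sum>b\<in>B. ?T id (act M sl2_e ^^ r) (tensor b (m b)))"
    unfolding m(2) by (rule linear_on_sum[OF linear_on_tensor_map]) (use Bx m in \<open>auto simp: linear_on_id\<close>)
   also have "... = (\<Sum>b\<in>B. tensor b ((act M sl2_e ^^ r) (m b)))"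
    by (rule sum.cong[OF refl], subst tensor_map_tensor) (use Bx m in \<open>auto simp: linear_on_id\<close>)
   finally have "(\<Sum>b\<in>B. tensor b ((act M sl2_e ^^ r) (m b))) = 0" using Tt by simp
   then have "(act M sl2_e ^^ r) (m b) = 0" if "b \<in> B" for b
    using tensor_basis_unique[OF B(1,2), of "%b. (act M sl2_e ^^ r) (m b)"] that by simp
   then have mC: "m b \<in> cs.span C" if "b \<in> B" for b using that C(3) m(1) by auto
   show "t \<in> cs.span ?C"
    unfolding m(2) using mC by (intro cs.span_sum tensor_in_span) (auto intro: cs.span_base)
  qed
 qed
qed

section \<open>Submodules generated by highest weight vectors, and the two inclusions for the
  additive closure\<close>

lemma submoduleI:
 assumes M: "M \<in> sl2_modules" and W: "W \<subseteq> car M" "cs.subspace W"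
  and "!!v. v \<in> W ==> act M sl2_e v \<in> W" "!!v. v \<in> W ==> act M sl2_h v \<in> W" "!!v. v \<in> W ==> act M sl2_f v \<in> W"
 shows "submodule W M"
 unfolding submodule_def
proof (intro conjI ballI subsetI)
 fix x y assume x: "x \<in> sl2" and "y \<in> act M x ` W"
 then obtain v where v: "v \<in> W" "y = act M x v" by auto
 have "v \<in> car M" using v(1) W(1) by blast
 then show "y \<in> W"
  unfolding v(2) sl2_module_act[OF M x \<open>v \<in> car M\<close>]
  by (intro cs.subspace_add[OF W(2)] cs.subspace_scale[OF W(2)] assms(4-6) v(1))
qed (use W in auto)

lemma submodule_restrict:
 assumes M: "M \<in> sl2_modules" and W: "submodule W M"
 shows "M\<lparr>car := W\<rparr> \<in> sl2_modules"
proof -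
 have sub: "W \<subseteq> car M" "cs.subspace W" "!!x. x \<in> sl2 ==> act M x ` W \<subseteq> W" using W by (auto simp: submodule_def)
 have "v \<in> car M" if "v \<in> W" for v using that sub(1) by blast
 then show ?thesis
  unfolding sl2_modules_def
  by (simp add: sub linear_on_subset[OF sl2_module_linear[OF M] sub(1)] sl2_module_scale[OF M]
    sl2_module_add[OF M] sl2_module_bracket[OF M])
qed

lemma (in sl2_rep) hw_span_closed:
 assumes b: "b \<in> wt_space V h w" "e b = 0"
 shows "cs.span (range (%k. (f ^^ k) b)) \<subseteq> V"
  and "v \<in> cs.span (range (%k. (f ^^ k) b)) ==> e v \<in> cs.span (range (%k. (f ^^ k) b))"
  and "v \<in> cs.span (range (%k. (f ^^ k) b)) ==> h v \<in> cs.span (range (%k. (f ^^ k) b))"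
  and "v \<in> cs.span (range (%k. (f ^^ k) b)) ==> f v \<in> cs.span (range (%k. (f ^^ k) b))"
proof -
 let ?S = "range (%k. (f ^^ k) b)"
 have bV: "b \<in> V" using b by (auto dest: wt_space_in)
 show sub: "cs.span ?S \<subseteq> V" by (rule span_sub) (use bV in auto)
 have closed: "cs.span ?S \<subseteq> {v \<in> V. T v \<in> cs.span ?S}" if "linear_on V T" "!!k. T ((f ^^ k) b) \<in> cs.span ?S" for T
  by (rule span_sub) (use that bV in \<open>auto intro!: linear_on_vimage_subspace\<close>)
 have "e ((f ^^ k) b) \<in> cs.span ?S" for k
 proof (cases k)
  case (Suc l)
  then show ?thesis using e_f_pow_hw[OF b, of l] by (auto intro!: cs.span_scale intro: cs.span_base simp del: funpow.simps)
 qed (simp add: b cs.span_zero)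
 from closed[OF linear_e this] show "v \<in> cs.span ?S ==> e v \<in> cs.span ?S" by auto
 have "h ((f ^^ k) b) \<in> cs.span ?S" for k
  using wt_space_pow(1)[OF b(1), of k] by (auto simp: wt_space_def intro!: cs.span_scale intro: cs.span_base)
 from closed[OF linear_h this] show "v \<in> cs.span ?S ==> h v \<in> cs.span ?S" by auto
 have "f ((f ^^ k) b) \<in> cs.span ?S" for k
  by (rule cs.span_base, rule range_eqI[of _ _ "Suc k"]) simp
 from closed[OF linear_f this] show "v \<in> cs.span ?S ==> f v \<in> cs.span ?S" by auto
qed

lemma hw_submodule:
 assumes M: "M \<in> sl2_modules" and b: "b \<in> wt_space (car M) (act M sl2_h) w" "act M sl2_e b = 0"
 shows "submodule (cs.span (range (%k. (act M sl2_f ^^ k) b))) M"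
proof -
 interpret sl2_rep "car M" "act M sl2_e" "act M sl2_h" "act M sl2_f" by (rule sl2_module_rep[OF M])
 show ?thesis by (rule submoduleI[OF M hw_span_closed(1)[OF b]]) (use hw_span_closed[OF b] in auto)
qed

lemma submodule_f_pow: "submodule W M ==> v \<in> W ==> (act M sl2_f ^^ k) v \<in> W"
 by (rule funpow_in) (auto simp: submodule_def)

lemma highest_weight_module_span:
 assumes "highest_weight_module \<nu> L"
 obtains v where "v \<in> wt_space (car L) (act L sl2_h) \<nu>" "act L sl2_e v = 0" "v ~= 0"
  "car L = cs.span (range (%k. (act L sl2_f ^^ k) v))"
proof -
 obtain v where L: "L \<in> sl2_modules" and v: "v \<in> car L" "v ~= 0" "act L sl2_e v = 0" "act L sl2_h v = cscale \<nu> v"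
  and gen: "!!W. submodule W L ==> v \<in> W ==> W = car L"
  using assms unfolding highest_weight_module_def by blast
 have w: "v \<in> wt_space (car L) (act L sl2_h) \<nu>" using v by (simp add: wt_space_def)
 have "v \<in> cs.span (range (%k. (act L sl2_f ^^ k) v))"
  by (rule cs.span_base, rule range_eqI[of _ _ 0]) simp
 then show ?thesis using that[OF w v(3,2)] gen[OF hw_submodule[OF L w v(3)]] by simp
qed

text \<open>For non-integral \<open>\<nu>\<close> the Verma module is simple: in a nonzero submodule
  the last nonvanishing \<open>e^m y\<close> is killed by \<open>e\<close>, hence a multiple of the
  generator \<open>b\<close>.\<close>

lemma is_L_hw_span:
 assumes M: "M \<in> sl2_modules" and b: "b \<in> wt_space (car M) (act M sl2_h) \<nu>" "act M sl2_e b = 0" "b ~= 0"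
  and \<nu>: "\<nu> \<notin> \<int>"
 shows "is_L \<nu> (M\<lparr>car := cs.span (range (%k. (act M sl2_f ^^ k) b))\<rparr>)"
proof -
 define W where "W = cs.span (range (%k. (act M sl2_f ^^ k) b))"
 let ?L = "M\<lparr>car := W\<rparr>"
 have sub: "submodule W M" unfolding W_def by (rule hw_submodule[OF M b(1,2)])
 have L: "?L \<in> sl2_modules" by (rule submodule_restrict[OF M sub])
 interpret sl2_rep W "act M sl2_e" "act M sl2_h" "act M sl2_f"
  using sl2_module_rep[OF L] by simp
 have bW: "b \<in> W" unfolding W_def by (rule cs.span_base, rule range_eqI[of _ _ 0]) simp
 have gen: "Y = W" if Y: "submodule Y ?L" "b \<in> Y" for Y
 proof
  show "Y \<subseteq> W" using Y by (auto simp: submodule_def)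
  show "W \<subseteq> Y" unfolding W_def
   by (rule span_sub) (use Y submodule_f_pow[OF Y] in \<open>auto simp: submodule_def\<close>)
 qed
 have hw: "highest_weight_module \<nu> ?L"
  unfolding highest_weight_module_def using L bW b gen by (auto simp: wt_space_def)
 have gen_b: "hw_generated (coset \<nu>) {b}"
  unfolding hw_generated_def using b bW
  by (auto simp: wt_space_def coset_def W_def full_SetCompr_eq intro!: bexI[of _ \<nu>])
 have simple: "Y = {0} \<or> Y = W" if Y: "submodule Y ?L" for Y
 proof (rule disjCI)
  assume ne: "\<not> Y = W"
  have Y': "Y \<subseteq> W" "cs.subspace Y" "act M sl2_e ` Y \<subseteq> Y" using Y by (auto simp: submodule_def)
  have "y = 0" if y: "y \<in> Y" for y
  proof (rule ccontr)
   assume y0: "y ~= 0"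
   obtain n where "(act M sl2_e ^^ n) y = 0"
    using hw_generated_nilpotent[OF gen_b] y Y'(1) unfolding locally_nilpotent_def by auto
   then obtain n where n: "(act M sl2_e ^^ n) y = 0" "!!m. m < n ==> (act M sl2_e ^^ m) y ~= 0"
    using LeastI[of "%n. (act M sl2_e ^^ n) y = 0"] not_less_Least[of _ "%n. (act M sl2_e ^^ n) y = 0"] by metis
   then obtain m where m: "n = Suc m" using y0 by (cases n) auto
   let ?z = "(act M sl2_e ^^ m) y"
   have z: "?z \<in> Y" "?z ~= 0" "act M sl2_e ?z = 0" using n m funpow_in[OF Y'(3) y] by auto
   have "?z \<in> cs.span {b}"
    by (rule hw_generated_kernel[OF gen_b hw_generated_weighted[OF gen_b] coset_not_Nats[OF \<nu>]])
     (use z Y' coset_shift(2)[of _ \<nu> 2] in auto)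
   then obtain c where c: "?z = cscale c b" by (auto simp: cs.span_singleton)
   then have "b = cscale (inverse c) ?z" using z(2) by simp
   then have "b \<in> Y" using z(1) cs.subspace_scale[OF Y'(2)] by metis
   then show False using gen[OF Y] ne by simp
  qed
  then show "Y = {0}" using cs.subspace_0[OF Y'(2)] by auto
 qed
 have "W ~= {0}" using bW b(3) by auto
 then show ?thesis
  unfolding is_L_def simple_module_def W_def[symmetric] using L hw simple by auto
qed

lemma isomorphic_refl: "M \<in> sl2_modules ==> isomorphic M M"
 unfolding isomorphic_def
 by (rule bexI[of _ "sl2_id M"]) (auto simp: Hom_iff_arr bij_betw_def inj_on_def image_iff)

text \<open>A surjective arrow carries generators and their \<open>f\<close>-strings to generators;
  that some of them may become zero is harmless for \<open>hw_generated\<close>.\<close>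

lemma verma_sum_iso:
 assumes N: "verma_sum mu N" and M: "M \<in> sl2_modules" and f: "f \<in> sl2_Hom N M" "fn f ` car N = car M"
 shows "verma_sum mu M"
proof -
 have N': "N \<in> sl2_modules" by (rule verma_sum_in[OF N])
 have f': "arr f" "src f = N" "tgt f = M" using f N' M by (simp_all add: Hom_iff_arr)
 interpret N: sl2_rep "car N" "act N sl2_e" "act N sl2_h" "act N sl2_f" by (rule sl2_module_rep[OF N'])
 interpret M: sl2_rep "car M" "act M sl2_e" "act M sl2_h" "act M sl2_f" by (rule sl2_module_rep[OF M])
 obtain B where B: "N.hw_generated (coset mu) B" using N by (auto simp: verma_sum_def)
 note BD = N.hw_generatedD[OF B]
 have act: "fn f (act N x v) = act M x (fn f v)" if "x \<in> sl2" "v \<in> car N" for x v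
  using arr_act[OF f'(1) that(1)] that f' by simp
 have pow: "fn f ((act N sl2_f ^^ k) v) = (act M sl2_f ^^ k) (fn f v)" if "v \<in> car N" for k v
  using that by (induction k) (simp_all add: act)
 have lin: "linear_on (car N) (fn f)" using arr_linear[OF f'(1)] f' by simp
 have "M.hw_generated (coset mu) (fn f ` B)"
  unfolding M.hw_generated_def
 proof (intro conjI ballI)
  show "finite (fn f ` B)" using BD by simp
  show "fn f ` B \<subseteq> car M" using BD(2) f(2) by blast
  fix y assume "y \<in> fn f ` B"
  then obtain b where b: "b \<in> B" "y = fn f b" by auto
  show "act M sl2_e y = 0" using act[of sl2_e b] BD(4,5)[OF b(1)] b arr_0[OF f'(1)] by simp
  obtain w where w: "w \<in> coset mu" "b \<in> wt_space (car N) (act N sl2_h) w" using BD(6)[OF b(1)] by auto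
  then have "act M sl2_h y = cscale w y"
   using act[of sl2_h b] b linear_on_scale[OF lin] by (simp add: wt_space_def)
  then show "\<exists>w\<in>coset mu. act M sl2_h y = cscale w y" using w by auto
 next
  have eq: "car N = cs.span {(act N sl2_f ^^ k) b | k b. b \<in> B}"
   using BD(3) span_sub[OF _ N.subspace_V, of "{(act N sl2_f ^^ k) b | k b. b \<in> B}"] BD(4) by fastforce
  have "car M = fn f ` cs.span {(act N sl2_f ^^ k) b | k b. b \<in> B}"
   using f(2) eq by simp
  also have "... = cs.span (fn f ` {(act N sl2_f ^^ k) b | k b. b \<in> B})"
   by (rule linear_on_span_image[OF lin N.subspace_V]) (use BD(4) in auto)
  also have "fn f ` {(act N sl2_f ^^ k) b | k b. b \<in> B} \<subseteq> {(act M sl2_f ^^ k) y | k y. y \<in> fn f ` B}"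
   using pow BD(4) by blast
  finally show "car M \<subseteq> cs.span {(act M sl2_f ^^ k) y | k y. y \<in> fn f ` B}"
   using cs.span_mono by blast
 qed
 then show ?thesis using M by (auto simp: verma_sum_def)
qed

lemma isomorphic_sym_arrow:
 assumes "isomorphic M N" "M \<in> sl2_modules" "N \<in> sl2_modules"
 obtains g where "g \<in> sl2_Hom N M" "fn g ` car N = car M"
proof -
 obtain f where f: "f \<in> sl2_Hom M N" "bij_betw (fn f) (car M) (car N)" using assms by (auto simp: isomorphic_def)
 let ?C = "sl2_cat sl2_modules"
 have "f \<in> iso_arrows ?C M N"
  by (rule iso_arrows_bij) (use assms f in \<open>auto simp: Hom_iff_arr\<close>)
 then obtain g where g: "g \<in> sl2_Hom N M" "sl2_comp g f = sl2_id M" by (auto simp: iso_arrows_def)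
 have f': "arr f" "src f = M" "tgt f = N" using f assms by (simp_all add: Hom_iff_arr)
 have g': "arr g" "src g = N" "tgt g = M" using g assms by (simp_all add: Hom_iff_arr)
 have "fn g (fn f v) = v" if "v \<in> car M" for v
  using fn_ops(2)[of v f g] fn_ops(1)[of v M] g(2) that f' by simp
 then have "car M \<subseteq> fn g ` car N" using arr_in'[OF f'] by (metis image_eqI subsetI)
 moreover have "fn g ` car N \<subseteq> car M" using arr_in'[OF g'] by auto
 ultimately have "fn g ` car N = car M" by simp
 then show ?thesis using that g by blast
qed

lemma internal_direct_sumD:
 assumes "internal_direct_sum N n W"
 shows "i < n ==> submodule (W i) N"
  and "v \<in> car N ==> \<exists>w\<in>(\<Pi>\<^sub>E i\<in>{..<n}. W i). v = (\<Sum>i<n. w i)"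
  and "v \<in> car N ==> w \<in> (\<Pi>\<^sub>E i\<in>{..<n}. W i) ==> v = (\<Sum>i<n. w i) ==>
   w' \<in> (\<Pi>\<^sub>E i\<in>{..<n}. W i) ==> v = (\<Sum>i<n. w' i) ==> w = w'"
 using assms unfolding internal_direct_sum_def by (simp, metis, metis)

lemma submodule_act: "submodule W N ==> x \<in> sl2 ==> v \<in> W ==> act N x v \<in> W"
 by (auto simp: submodule_def image_subset_iff)

text \<open>Each \<open>W i\<close> is generated by a highest weight vector \<open>b i\<close>. Its
  component \<open>x i\<close> along \<open>U\<close> is again killed by \<open>e\<close> and has
  the same weight, since a decomposition into submodules is respected by the action, and these
  components generate \<open>U\<close>.\<close>

lemma additive_closure_verma_sum:
 assumes "M \<in> additive_closure {L. \<exists>\<nu>. is_L \<nu> L & \<nu> - mu \<in> \<int>}"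
 shows "verma_sum mu M"
proof -
 obtain N n W U where M: "M \<in> sl2_modules" and N: "N \<in> sl2_modules" and W: "internal_direct_sum N n W"
  and iso: "!!i. i < n ==> \<exists>L. (\<exists>\<nu>. is_L \<nu> L & \<nu> - mu \<in> \<int>) & isomorphic L (N\<lparr>car := W i\<rparr>)"
  and U: "direct_summand U N" and MU: "isomorphic M (N\<lparr>car := U\<rparr>)"
  using assms unfolding additive_closure_def by auto
 interpret N: sl2_rep "car N" "act N sl2_e" "act N sl2_h" "act N sl2_f" by (rule sl2_module_rep[OF N])
 have subW: "submodule (W i) N" if "i < n" for i using W that by (simp add: internal_direct_sum_def)
 have "\<exists>b \<nu>. b \<in> wt_space (car N) (act N sl2_h) \<nu> & act N sl2_e b = 0 & \<nu> \<in> coset mu &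
   W i \<subseteq> cs.span (range (%k. (act N sl2_f ^^ k) b))" if i: "i < n" for i
 proof -
  obtain L \<nu> where L: "is_L \<nu> L" "\<nu> - mu \<in> \<int>" "isomorphic L (N\<lparr>car := W i\<rparr>)" using iso[OF i] by auto
  then have hw: "highest_weight_module \<nu> L" "L \<in> sl2_modules" by (auto simp: is_L_def simple_module_def)
  obtain v where v: "v \<in> wt_space (car L) (act L sl2_h) \<nu>" "act L sl2_e v = 0"
   "car L = cs.span (range (%k. (act L sl2_f ^^ k) v))" using highest_weight_module_span[OF hw(1)] by metis
  have Wi: "N\<lparr>car := W i\<rparr> \<in> sl2_modules" by (rule submodule_restrict[OF N subW[OF i]])
  obtain g where g: "g \<in> sl2_Hom L (N\<lparr>car := W i\<rparr>)" "bij_betw (fn g) (car L) (W i)"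
   using L(3) by (auto simp: isomorphic_def)
  have g': "arr g" "src g = L" "tgt g = N\<lparr>car := W i\<rparr>" using g hw Wi by (simp_all add: Hom_iff_arr)
  have act: "fn g (act L x u) = act N x (fn g u)" if "x \<in> sl2" "u \<in> car L" for x u
   using arr_act[OF g'(1) that(1)] that g' by simp
  interpret L: sl2_rep "car L" "act L sl2_e" "act L sl2_h" "act L sl2_f" by (rule sl2_module_rep[OF hw(2)])
  have pow: "fn g ((act L sl2_f ^^ k) u) = (act N sl2_f ^^ k) (fn g u)" if "u \<in> car L" for k u
   using that by (induction k) (simp_all add: act)
  have lin: "linear_on (car L) (fn g)" using arr_linear[OF g'(1)] g' by simp
  have vL: "v \<in> car L" "act L sl2_h v = cscale \<nu> v" using v(1) by (auto simp: wt_space_def)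
  have gv: "fn g v \<in> W i" using g(2) vL by (auto simp: bij_betw_def)
  have "fn g v \<in> wt_space (car N) (act N sl2_h) \<nu>"
   using act[of sl2_h v] vL gv subW[OF i] linear_on_scale[OF lin vL(1)] by (auto simp: wt_space_def submodule_def)
  moreover have "act N sl2_e (fn g v) = 0" using act[of sl2_e v] vL v(2) arr_0[OF g'(1)] by simp
  moreover have "W i = cs.span (fn g ` range (%k. (act L sl2_f ^^ k) v))"
   using linear_on_span_image[OF lin L.subspace_V, of "range (%k. (act L sl2_f ^^ k) v)"] g(2) v(3) vL
   by (auto simp: bij_betw_def)
  moreover have "fn g ` range (%k. (act L sl2_f ^^ k) v) = range (%k. (act N sl2_f ^^ k) (fn g v))"
   by (simp add: image_image pow[OF vL(1)])
  ultimately show ?thesis using L(2) unfolding coset_def by (intro exI[of _ "fn g v"] exI[of _ \<nu>]) auto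
 qed
 then obtain b \<nu> where b: "!!i. i < n ==> b i \<in> wt_space (car N) (act N sl2_h) (\<nu> i)"
   "!!i. i < n ==> act N sl2_e (b i) = 0" "!!i. i < n ==> \<nu> i \<in> coset mu"
   "!!i. i < n ==> W i \<subseteq> cs.span (range (%k. (act N sl2_f ^^ k) (b i)))" by metis
 obtain D where D0: "D 0 = U" and D: "internal_direct_sum N 2 D" using U by (auto simp: direct_summand_def)
 have subD: "submodule U N" "submodule (D 1) N" using D D0 by (auto simp: internal_direct_sum_def)
 have U': "U \<subseteq> car N" "cs.subspace U" "D 1 \<subseteq> car N" "cs.subspace (D 1)" using subD by (auto simp: submodule_def)
 have split: "\<exists>x\<in>U. \<exists>y\<in>D 1. v = x + y" if v: "v \<in> car N" for v
 proof -
  obtain w where "w \<in> (\<Pi>\<^sub>E i\<in>{..<2}. D i)" "v = (\<Sum>i<2. w i)" using internal_direct_sumD(2)[OF D v] by blast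
  then have "w 0 \<in> U" "w 1 \<in> D 1" "v = w 0 + w 1"
   using D0 PiE_mem[of w "{..<2}" D 0] PiE_mem[of w "{..<2}" D 1] by (simp_all add: numeral_2_eq_2)
  then show ?thesis by blast
 qed
 have uniq: "x = 0" if xy: "x \<in> U" "y \<in> D 1" "x + y = 0" for x y
 proof -
  have 1: "0 \<in> car N" by simp
  \<comment> \<open>Trivial intersection is read off from uniqueness: \<open>p\<close> and
    \<open>q\<close> are two decompositions of \<open>0\<close>.\<close>
  define p :: "nat => cseq" where "p = (\<lambda>i\<in>{..<2}. if i = 0 then x else y)"
  define q :: "nat => cseq" where "q = (\<lambda>i\<in>{..<2}. 0)"
  have two: "i = 0 \<or> i = 1" if "i < 2" for i :: nat using that by auto
  have sum2: "(\<Sum>i<2. r i) = r 0 + r 1" for r :: "nat => cseq" by (simp add: numeral_2_eq_2)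
  have "p \<in> (\<Pi>\<^sub>E i\<in>{..<2}. D i)" "q \<in> (\<Pi>\<^sub>E i\<in>{..<2}. D i)"
   unfolding p_def q_def restrict_PiE_iff using xy D0 U' by (auto dest!: two simp: cs.subspace_0)
  moreover have "0 = (\<Sum>i<2. p i)" "0 = (\<Sum>i<2. q i)"
   unfolding sum2 using xy by (simp_all add: p_def q_def)
  ultimately have "p = q" using internal_direct_sumD(3)[OF D 1] by blast
  then have "p 0 = q 0" by simp
  then show ?thesis by (simp add: p_def q_def)
 qed
 have "\<exists>x y. x \<in> U & y \<in> D 1 & b i = x + y" if "i < n" for i
  using split[OF wt_space_in[OF b(1)[OF that]]] by blast
 then obtain x y where xy: "!!i. i < n ==> x i \<in> U" "!!i. i < n ==> y i \<in> D 1" "!!i. i < n ==> b i = x i + y i" by metis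
 have xyN: "x i \<in> car N" "y i \<in> car N" if "i < n" for i using xy that U' by blast+
 have Um: "N\<lparr>car := U\<rparr> \<in> sl2_modules" by (rule submodule_restrict[OF N subD(1)])
 interpret U: sl2_rep U "act N sl2_e" "act N sl2_h" "act N sl2_f" using sl2_module_rep[OF Um] by simp
 have ex: "act N sl2_e (x i) = 0" if i: "i < n" for i
 proof (rule uniq[of _ "act N sl2_e (y i)"])
  show "act N sl2_e (x i) + act N sl2_e (y i) = 0"
   using b(2)[OF i] xy(3)[OF i] xyN[OF i] by (simp add: N.lin_simps)
 qed (use submodule_act[OF subD(1)] submodule_act[OF subD(2)] xy i in auto)
 have hx: "act N sl2_h (x i) = cscale (\<nu> i) (x i)" if i: "i < n" for i
 proof -
  have "act N sl2_h (x i) - cscale (\<nu> i) (x i) = 0"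
  proof (rule uniq[of _ "act N sl2_h (y i) - cscale (\<nu> i) (y i)"])
   have "act N sl2_h (x i + y i) = cscale (\<nu> i) (x i + y i)" using b(1)[OF i] xy(3)[OF i] by (simp add: wt_space_def)
   then show "act N sl2_h (x i) - cscale (\<nu> i) (x i) + (act N sl2_h (y i) - cscale (\<nu> i) (y i)) = 0"
    using xyN[OF i] by (simp add: N.lin_simps cs.scale_right_distrib algebra_simps)
  qed (intro cs.subspace_diff[OF U'(2)] cs.subspace_diff[OF U'(4)] cs.subspace_scale[OF U'(2)] cs.subspace_scale[OF U'(4)]
    submodule_act[OF subD(1)] submodule_act[OF subD(2)] xy i sl2_basis_in)+
  then show ?thesis by simp
 qed
 let ?S = "{(act N sl2_f ^^ k) c | k c. c \<in> x ` {..<n}}"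
 have "v \<in> cs.span ?S" if v: "v \<in> U" for v
 proof -
  \<comment> \<open>Computation modulo the complement \<open>D 1\<close>, in place of applying the
    projection onto \<open>U\<close>: \<open>?K\<close> contains each \<open>W i\<close>, hence all
    of \<open>U\<close>.\<close>
  let ?K = "{v \<in> car N. \<exists>s\<in>cs.span ?S. \<exists>y\<in>D 1. v = s + y}"
  have K: "cs.subspace ?K"
  proof (rule cs.subspaceI)
   show "0 \<in> ?K" using cs.subspace_0[OF U'(4)] cs.span_zero by force
  next
   fix u v assume "u \<in> ?K" "v \<in> ?K"
   then obtain s y s' y' where *: "u \<in> car N" "v \<in> car N" "s \<in> cs.span ?S" "y \<in> D 1" "s' \<in> cs.span ?S" "y' \<in> D 1" "u = s + y" "v = s' + y'" by auto
   then have "u + v = (s + s') + (y + y')" by simp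
   then show "u + v \<in> ?K" using * cs.span_add[OF *(3,5)] cs.subspace_add[OF U'(4) *(4,6)] N.sums_in(1)[OF *(1,2)] by blast
  next
   fix c u assume "u \<in> ?K"
   then obtain s y where *: "u \<in> car N" "s \<in> cs.span ?S" "y \<in> D 1" "u = s + y" by auto
   then have "cscale c u = cscale c s + cscale c y" by (simp add: cs.scale_right_distrib)
   then show "cscale c u \<in> ?K" using cs.span_scale[OF *(2)] cs.subspace_scale[OF U'(4) *(3)] N.sums_in(3)[OF *(1)] by blast
  qed
  have WK: "W i \<subseteq> ?K" if i: "i < n" for i
  proof -
   have "(act N sl2_f ^^ k) (b i) \<in> ?K" for k
   proof -
    have "(act N sl2_f ^^ k) (b i) = (act N sl2_f ^^ k) (x i) + (act N sl2_f ^^ k) (y i)"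
     using xy(3)[OF i] xyN[OF i] by (simp add: N.lin_simps)
    moreover have "(act N sl2_f ^^ k) (x i) \<in> cs.span ?S" using i by (intro cs.span_base) blast
    moreover have "(act N sl2_f ^^ k) (y i) \<in> D 1" by (rule submodule_f_pow[OF subD(2) xy(2)[OF i]])
    ultimately show ?thesis using N.pow_in(2)[OF wt_space_in[OF b(1)[OF i]]] by blast
   qed
   then have "cs.span (range (%k. (act N sl2_f ^^ k) (b i))) \<subseteq> ?K"
    by (intro span_sub K) auto
   then show ?thesis using b(4)[OF i] by blast
  qed
  obtain w where w: "w \<in> (\<Pi>\<^sub>E i\<in>{..<n}. W i)" "v = (\<Sum>i<n. w i)"
   using internal_direct_sumD(2)[OF W] v U'(1) by blast
  have "w i \<in> ?K" if i: "i \<in> {..<n}" for i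
   by (rule subsetD[OF WK PiE_mem[OF w(1) i]]) (use i in simp)
  then have "v \<in> ?K" unfolding w(2) by (rule cs.subspace_sum[OF K])
  then obtain s y' where s: "s \<in> cs.span ?S" "y' \<in> D 1" "v = s + y'" by auto
  have "cs.span ?S \<subseteq> U"
   using submodule_f_pow[OF subD(1) xy(1)] by (intro span_sub U') auto
  then have "s - v \<in> U" using s v by (intro cs.subspace_diff[OF U'(2)]) auto
  then have "s - v = 0" using uniq[of "s - v" y'] s by simp
  then show ?thesis using s by simp
 qed
 then have "U.hw_generated (coset mu) (x ` {..<n})"
  unfolding U.hw_generated_def using xy(1) ex hx b(3) by (intro conjI) auto
 then have "verma_sum mu (N\<lparr>car := U\<rparr>)" unfolding verma_sum_def using Um by auto
 moreover obtain g where "g \<in> sl2_Hom (N\<lparr>car := U\<rparr>) M" "fn g ` U = car M"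
  using isomorphic_sym_arrow[OF MU M Um] by auto
 ultimately show ?thesis using verma_sum_iso M by (metis sl2_module.select_convs(1) sl2_module.surjective sl2_module.update_convs(1))
qed

text \<open>Independent highest weight generators split \<open>M\<close> into the simple modules
  that they generate. As summand of that direct sum \<open>M\<close> itself is taken, with
  complement zero.\<close>

lemma verma_sum_additive_closure:
 assumes mu: "mu \<notin> \<int>" and M: "verma_sum mu M"
 shows "M \<in> additive_closure {L. \<exists>\<nu>. is_L \<nu> L & \<nu> - mu \<in> \<int>}"
proof -
 have M': "M \<in> sl2_modules" by (rule verma_sum_in[OF M])
 let ?f = "act M sl2_f"
 interpret sl2_rep "car M" "act M sl2_e" "act M sl2_h" ?f by (rule sl2_module_rep[OF M'])
 obtain C where C: "finite C" "{v \<in> car M. (act M sl2_e ^^ 1) v = 0} \<subseteq> cs.span C"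
  using verma_sum_kernel_pow[OF mu M, of 1] by metis
 obtain B where B: "hw_generated (coset mu) B" "cs.independent B"
  using hw_generatedI[OF coset_not_Nats[OF mu] coset_shift(1)[of _ mu 2] verma_sum_weighted[OF M] verma_sum_nilpotent[OF M] C(1)] C(2)
  by auto
 note BD = hw_generatedD[OF B(1)]
 define n where "n = card B"
 obtain b where bij: "bij_betw b {..<n} B"
  using ex_bij_betw_nat_finite[OF BD(1)] unfolding n_def atLeast0LessThan by blast
 have b: "b i \<in> B" if "i < n" for i using bij that by (auto simp: bij_betw_def)
 define W where "W i = cs.span (range (%k. (?f ^^ k) (b i)))" for i
 have bw: "\<exists>\<nu>\<in>coset mu. b i \<in> wt_space (car M) (act M sl2_h) \<nu>" if "i < n" for i
  using BD(6)[OF b[OF that]] .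
 have subW: "submodule (W i) M" if "i < n" for i
  using bw[OF that] hw_submodule[OF M' _ BD(5)[OF b[OF that]]] unfolding W_def by blast
 have W: "W i \<subseteq> car M" "cs.subspace (W i)" if "i < n" for i using subW[OF that] by (auto simp: submodule_def)
 have ind: "c i = 0" if "(\<Sum>i<n. cscale (c i) (b i)) = 0" "i < n" for c i
 proof -
  define u where "u v = c (the_inv_into {..<n} b v)" for v
  have inj: "inj_on b {..<n}" and img: "b ` {..<n} = B" using bij by (auto simp: bij_betw_def)
  have ub: "u (b i) = c i" if "i < n" for i using inj that by (simp add: u_def the_inv_into_f_f)
  have "(\<Sum>v\<in>B. cscale (u v) v) = (\<Sum>i<n. cscale (u (b i)) (b i))"
   unfolding img[symmetric] by (subst sum.reindex[OF inj]) simp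
  also have "... = 0" using that(1) ub by simp
  finally have "u (b i) = 0" by (rule cs.independentD[OF B(2) BD(1) order_refl _ b[OF that(2)]])
  then show ?thesis using ub[OF that(2)] by simp
 qed
 have zero: "d i = 0" if d: "!!i. i < n ==> d i \<in> W i" "(\<Sum>i<n. d i) = 0" and i: "i < n" for d i
 proof -
  have "\<exists>K u. (\<forall>k. u k \<in> cs.span {b i}) & d i = (\<Sum>k<K. (?f ^^ k) (u k))" if i: "i < n" for i
  proof -
   interpret Wi: sl2_rep "W i" "act M sl2_e" "act M sl2_h" ?f
    using sl2_module_rep[OF submodule_restrict[OF M' subW[OF i]]] by simp
   have "b i \<in> W i" unfolding W_def by (rule cs.span_base, rule range_eqI[of _ _ 0]) simp
   then have bi: "{b i} \<subseteq> W i" by simp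
   have gen: "W i \<subseteq> cs.span {(?f ^^ k) c | k c. c \<in> {b i}}"
    unfolding W_def by (rule cs.span_mono) auto
   show ?thesis by (rule Wi.hw_generated_expand[OF gen bi d(1)[OF i]]) blast
  qed
  then obtain K u where u: "!!i k. i < n ==> u i k \<in> cs.span {b i}" "!!i. i < n ==> d i = (\<Sum>k<K i. (?f ^^ k) (u i k))" by metis
  then have "\<exists>c. u i k = cscale c (b i)" if "i < n" for i k using u(1)[OF that, of k] by (auto simp: cs.span_singleton)
  then obtain c where c: "!!i k. i < n ==> u i k = cscale (c i k) (b i)" by metis
  \<comment> \<open>A common length for the finitely many expansions allows the double sum to be
    reordered by powers of \<open>f\<close>, where \<open>f_pow_expansion_unique\<close>
    applies.\<close>
  define K' where "K' = Max (insert 0 (K ` {..<n}))"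
  have K': "K i \<le> K'" if "i < n" for i using that by (auto simp: K'_def)
  define c' where "c' i k = (if k < K i then c i k else 0)" for i k
  have d': "d i = (\<Sum>k<K'. (?f ^^ k) (cscale (c' i k) (b i)))" if i: "i < n" for i
   unfolding u(2)[OF i] using K'[OF i] c[OF i] by (intro sum.mono_neutral_cong_left) (auto simp: c'_def)
  have bV: "b i \<in> car M" "act M sl2_e (b i) = 0" if "i < n" for i using BD(4,5) b[OF that] by auto
  have "0 = (\<Sum>i<n. \<Sum>k<K'. (?f ^^ k) (cscale (c' i k) (b i)))" using d(2) d' by simp
  also have "... = (\<Sum>k<K'. \<Sum>i<n. (?f ^^ k) (cscale (c' i k) (b i)))" by (rule sum.swap)
  also have "... = (\<Sum>k<K'. (?f ^^ k) (\<Sum>i<n. cscale (c' i k) (b i)))"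
   by (intro sum.cong refl linear_on_sum[OF linear_pow(2) subspace_V, symmetric]) (use bV in auto)
  finally have s0: "(\<Sum>k<K'. (?f ^^ k) (\<Sum>i<n. cscale (c' i k) (b i))) = 0" by simp
  have "(\<Sum>i<n. cscale (c' i k) (b i)) = 0" if "k < K'" for k
  proof (rule f_pow_expansion_unique[OF verma_sum_weighted[OF M] coset_not_Nats[OF mu] _ s0 that])
   fix k
   have "(\<Sum>i<n. cscale (c' i k) (b i)) \<in> {v \<in> car M. act M sl2_e v = 0}"
    by (intro cs.subspace_sum[OF kernel_subspace(1)] cs.subspace_scale[OF kernel_subspace(1)]) (use bV in auto)
   then show "(\<Sum>i<n. cscale (c' i k) (b i)) \<in> car M & act M sl2_e (\<Sum>i<n. cscale (c' i k) (b i)) = 0" by auto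
  qed
  then have "c' i k = 0" if "k < K'" for k using ind[of "%i. c' i k"] i that by blast
  then show ?thesis using d'[OF i] by simp
 qed
 have direct: "internal_direct_sum M n W"
  unfolding internal_direct_sum_def
 proof (intro conjI allI impI ballI ex_ex1I)
  fix v assume v: "v \<in> car M"
  let ?D = "{v. \<exists>w. w \<in> (\<Pi>\<^sub>E i\<in>{..<n}. W i) & v = (\<Sum>i<n. w i)}"
  have "cs.subspace ?D"
  proof (rule cs.subspaceI)
   show "0 \<in> ?D" by (intro CollectI exI[of _ "\<lambda>i\<in>{..<n}. 0"]) (use W in \<open>auto simp: cs.subspace_0\<close>)
  next
   fix x y assume "x \<in> ?D" "y \<in> ?D"
   then obtain w w' where *: "w \<in> (\<Pi>\<^sub>E i\<in>{..<n}. W i)" "w' \<in> (\<Pi>\<^sub>E i\<in>{..<n}. W i)" "x = (\<Sum>i<n. w i)" "y = (\<Sum>i<n. w' i)" by auto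
   then show "x + y \<in> ?D" by (intro CollectI exI[of _ "\<lambda>i\<in>{..<n}. w i + w' i"])
     (auto simp: sum.distrib PiE_iff intro!: cs.subspace_add[OF W(2)])
  next
   fix c x assume "x \<in> ?D"
   then obtain w where *: "w \<in> (\<Pi>\<^sub>E i\<in>{..<n}. W i)" "x = (\<Sum>i<n. w i)" by auto
   then show "cscale c x \<in> ?D" by (intro CollectI exI[of _ "\<lambda>i\<in>{..<n}. cscale c (w i)"])
     (auto simp: cs.scale_sum_right PiE_iff intro!: cs.subspace_scale[OF W(2)])
  qed
  moreover have "(?f ^^ k) x \<in> ?D" if x: "x \<in> B" for k x
  proof -
   obtain j where j: "j < n" "x = b j" using bij x by (auto simp: bij_betw_def)
   let ?w = "\<lambda>i\<in>{..<n}. if i = j then (?f ^^ k) x else 0"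
   have "(?f ^^ k) x \<in> W j" unfolding W_def j by (intro cs.span_base) auto
   then have "?w \<in> (\<Pi>\<^sub>E i\<in>{..<n}. W i)" using W by (auto simp: cs.subspace_0)
   moreover have "(\<Sum>i<n. ?w i) = (\<Sum>i<n. if i = j then (?f ^^ k) x else 0)" by (intro sum.cong) auto
   then have "(?f ^^ k) x = (\<Sum>i<n. ?w i)" using j by simp
   ultimately show ?thesis by blast
  qed
  ultimately have "cs.span {(?f ^^ k) b | k b. b \<in> B} \<subseteq> ?D"
   by (intro span_sub) auto
  then show "\<exists>w. w \<in> (\<Pi>\<^sub>E i\<in>{..<n}. W i) & v = (\<Sum>i<n. w i)" using BD(3) v by blast
  fix w w' assume *: "w \<in> (\<Pi>\<^sub>E i\<in>{..<n}. W i) & v = (\<Sum>i<n. w i)" "w' \<in> (\<Pi>\<^sub>E i\<in>{..<n}. W i) & v = (\<Sum>i<n. w' i)"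
  have "w i - w' i = 0" if "i < n" for i
  proof (rule zero[of "%i. w i - w' i"])
   show "(\<Sum>i<n. w i - w' i) = 0" using * by (simp add: sum_subtractf)
  qed (use * that W in \<open>auto simp: PiE_iff intro!: cs.subspace_diff\<close>)
  then show "w = w'" using * by (intro PiE_ext[of w _ _ w']) auto
 qed (use subW in auto)
 have summand: "direct_summand (car M) M"
  unfolding direct_summand_def internal_direct_sum_def
 proof (intro exI[of _ "\<lambda>i. if i = 0 then car M else {0}"] conjI allI impI ballI ex1I)
  fix i :: nat
  have "submodule (car M) M" by (rule submoduleI[OF M']) auto
  moreover have "submodule {0} M" by (rule submoduleI[OF M']) auto
  ultimately show "submodule (if i = 0 then car M else {0}) M" by simp
 next
  fix v assume v: "v \<in> car M"
  let ?w = "\<lambda>i\<in>{..<2::nat}. if i = 0 then v else (0 :: cseq)"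
  show "?w \<in> (\<Pi>\<^sub>E i\<in>{..<2}. if i = 0 then car M else {0})" using v by auto
  show "v = (\<Sum>i<2. ?w i)" by (simp add: numeral_2_eq_2)
  fix w :: "nat => cseq" assume w: "w \<in> (\<Pi>\<^sub>E i\<in>{..<2}. if i = 0 then car M else {0}) & v = (\<Sum>i<2. w i)"
  show "w = ?w"
  proof (rule PiE_ext[of w "{..<2}" "\<lambda>i. if i = 0 then car M else {0}"])
   fix i :: nat assume "i \<in> {..<2}"
   have "w 1 \<in> (if (1::nat) = 0 then car M else {0})" by (rule PiE_mem[OF conjunct1[OF w]]) simp
   then have w1: "w 1 = 0" by simp
   have "v = (\<Sum>i<2. w i)" using w by (rule conjunct2)
   then have "w 0 = v" using w1 by (simp add: numeral_2_eq_2)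
   moreover have "i = 0 \<or> i = 1" using \<open>i \<in> {..<2}\<close> by auto
   ultimately show "w i = ?w i" using w1 by (elim disjE) simp_all
  next
   show "w \<in> (\<Pi>\<^sub>E i\<in>{..<2}. if i = 0 then car M else {0})" using w by (rule conjunct1)
   show "?w \<in> (\<Pi>\<^sub>E i\<in>{..<2}. if i = 0 then car M else {0})" unfolding restrict_PiE_iff using v by simp
  qed
 qed auto
 have "\<exists>L\<in>{L. \<exists>\<nu>. is_L \<nu> L & \<nu> - mu \<in> \<int>}. isomorphic L (M\<lparr>car := W i\<rparr>)" if i: "i < n" for i
 proof -
  obtain \<nu> where \<nu>: "\<nu> \<in> coset mu" "b i \<in> wt_space (car M) (act M sl2_h) \<nu>" using bw[OF i] by auto
  have "b i ~= 0" using B(2) b[OF i] cs.dependent_zero by auto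
  then have "is_L \<nu> (M\<lparr>car := W i\<rparr>)"
   unfolding W_def using \<nu> coset_nonint[OF mu] BD(5)[OF b[OF i]] by (intro is_L_hw_span M') auto
  then show ?thesis using \<nu>(1) isomorphic_refl[OF submodule_restrict[OF M' subW[OF i]]] by (auto simp: coset_def)
 qed
 then show ?thesis
  unfolding additive_closure_def using M' direct summand isomorphic_refl[OF M']
  by (intro CollectI conjI bexI[of _ M] exI[of _ n] exI[of _ W] exI[of _ "car M"]) auto
qed

lemma Obj_N1: "mu \<notin> \<int> ==> Obj (N1 mu) = {M. verma_sum mu M}"
 unfolding N1_def using additive_closure_verma_sum verma_sum_additive_closure by auto

lemma N1_module_category:
 assumes mu: "mu \<notin> \<int>"
 shows "linear_module_category fd_sl2 (N1 mu)"
 unfolding N1_def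
proof (rule sl2_linear_module_category)
 show "additive_closure {L. \<exists>\<nu>. is_L \<nu> L & \<nu> - mu \<in> \<int>} \<subseteq> sl2_modules"
  by (auto simp: additive_closure_def)
 fix X M assume "X \<in> sl2_modules" "finite_dimensional X" "M \<in> additive_closure {L. \<exists>\<nu>. is_L \<nu> L & \<nu> - mu \<in> \<int>}"
 then show "sl2_tensor X M \<in> additive_closure {L. \<exists>\<nu>. is_L \<nu> L & \<nu> - mu \<in> \<int>}"
  using verma_sum_tensor[OF mu] additive_closure_verma_sum verma_sum_additive_closure[OF mu] by blast
qed

lemma N1_cong: "\<nu> - mu \<in> \<int> ==> N1 \<nu> = N1 mu"
proof -
 assume "\<nu> - mu \<in> \<int>"
 then have "x - \<nu> \<in> \<int> \<longleftrightarrow> x - mu \<in> \<int>" for x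
  using coset_eq[of \<nu> mu] by (auto simp: coset_def)
 then show ?thesis unfolding N1_def by simp
qed

section \<open>Exponentials of nilpotent operators and the Weyl element\<close>

text \<open>Cauchy product of finite sums: the square below \<open>N\<close> sits inside the
  triangle \<open>k + l < 2 N\<close>, and \<open>g\<close> vanishes on the rest of the
  triangle.\<close>

lemma diagonal_sum:
 fixes g :: "nat => nat => 'a :: comm_monoid_add"
 assumes "!!k l. k \<ge> N \<or> l \<ge> N ==> g k l = 0"
 shows "(\<Sum>k<N. \<Sum>l<N. g k l) = (\<Sum>m<2*N. \<Sum>k\<le>m. g k (m - k))"
proof -
 have "(\<Sum>k<N. \<Sum>l<N. g k l) = (\<Sum>(k, l)\<in>{..<N} \<times> {..<N}. g k l)"
  by (simp add: sum.cartesian_product)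
 also have "... = (\<Sum>(k, l)\<in>{(i, j). i + j < 2 * N}. g k l)"
 proof (rule sum.mono_neutral_left)
  show "finite {(i, j). i + j < 2 * N}"
   by (rule finite_subset[of _ "{..<2 * N} \<times> {..<2 * N}"]) auto
 next
  have lt: "k < N & l < N" if "g k l ~= 0" for k l using that assms by (meson not_le)
  show "\<forall>i\<in>{(i, j). i + j < 2 * N} - {..<N} \<times> {..<N}. (case i of (k, l) => g k l) = 0"
   using lt by auto
 qed auto
 also have "... = (\<Sum>m<2*N. \<Sum>k\<le>m. g k (m - k))" by (rule sum.triangle_reindex)
 finally show ?thesis .
qed

text \<open>The exponential of a locally nilpotent operator, cut off at \<open>N\<close>; by
  \<open>expo_extend\<close> its value is stable once \<open>T^N v = 0\<close>.\<close>

definition expo :: "nat => (cseq => cseq) => cseq => cseq" where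
 "expo N T v = (\<Sum>k<N. cscale (1 / fact k) ((T ^^ k) v))"

lemma funpow_zero_mono:
 fixes T :: "cseq => cseq"
 assumes "(T ^^ N) v = 0" "T 0 = 0" "N \<le> k"
 shows "(T ^^ k) v = 0"
proof -
 have "(T ^^ i) 0 = 0" for i by (induction i) (simp_all add: assms(2))
 moreover have "(T ^^ k) v = (T ^^ (k - N)) ((T ^^ N) v)"
  using assms(3) by (metis funpow_add o_apply le_add_diff_inverse2)
 ultimately show ?thesis using assms(1) by simp
qed

lemma expo_extend:
 assumes "(T ^^ N) v = 0" "T 0 = 0" "N \<le> N'"
 shows "expo N' T v = expo N T v"
 unfolding expo_def
 by (rule sum.mono_neutral_right) (use assms funpow_zero_mono[OF assms(1,2)] in auto)

lemma expo_linear: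
 assumes "linear_on V T" "T ` V \<subseteq> V"
 shows "linear_on V (expo N T)"
 unfolding expo_def[abs_def] by (intro linear_on_sum_fun linear_on_cscale linear_on_funpow assms)

lemma expo_in:
 assumes "cs.subspace V" "T ` V \<subseteq> V" "v \<in> V"
 shows "expo N T v \<in> V"
 unfolding expo_def by (intro cs.subspace_sum cs.subspace_scale funpow_in assms)

lemma expo_natural:
 assumes "linear_on V ph" "cs.subspace V" "T ` V \<subseteq> V" "!!v. v \<in> V ==> ph (T v) = T' (ph v)" "v \<in> V"
 shows "ph (expo N T v) = expo N T' (ph v)"
proof -
 have pow: "(T ^^ k) v \<in> V" for k using assms by (intro funpow_in)
 have "ph ((T ^^ k) v) = (T' ^^ k) (ph v)" for k
  by (induction k) (simp_all add: assms(4)[OF pow])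
 moreover have "ph (expo N T v) = (\<Sum>k<N. ph (cscale (1 / fact k) ((T ^^ k) v)))"
  unfolding expo_def by (rule linear_on_sum[OF assms(1,2)]) (intro cs.subspace_scale assms(2) pow)
 ultimately show ?thesis by (simp add: expo_def linear_on_scale[OF assms(1) pow])
qed

lemma pow_uminus:
 assumes "linear_on V T" "T ` V \<subseteq> V" "v \<in> V"
 shows "((%v. - T v) ^^ k) v = cscale ((- 1) ^ k) ((T ^^ k) v)"
proof (induction k)
 case (Suc k)
 have "((%v. - T v) ^^ Suc k) v = - T (cscale ((- 1) ^ k) ((T ^^ k) v))" using Suc.IH by simp
 also have "... = - cscale ((- 1) ^ k) (T ((T ^^ k) v))"
  by (simp add: linear_on_scale[OF assms(1) funpow_in[OF assms(2,3)]])
 finally show ?case by simp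
qed simp

lemma expo_inverse:
 assumes T: "linear_on V T" "cs.subspace V" "T ` V \<subseteq> V" and v: "v \<in> V" "(T ^^ N) v = 0"
 shows "expo N (%v. - T v) (expo N T v) = v"
proof (cases N)
 case (Suc N')
 let ?x = "expo N T v"
 have T0: "T 0 = 0" by (rule linear_on_0[OF T(1,2)])
 have pow: "(T ^^ k) v \<in> V" for k using T v by (intro funpow_in)
 have x: "?x \<in> V" using T v by (intro expo_in)
 define g where "g k l = cscale ((- 1) ^ k / (fact k * fact l)) ((T ^^ (k + l)) v)" for k l
 have "expo N (%v. - T v) ?x = (\<Sum>k<N. cscale ((- 1) ^ k / fact k) ((T ^^ k) ?x))"
  unfolding expo_def[of N "%v. - T v"] using pow_uminus[OF T(1,3) x] by simp
 also have "... = (\<Sum>k<N. \<Sum>l<N. g k l)"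
 proof (rule sum.cong[OF refl])
  fix k
  have "(T ^^ k) ?x = (\<Sum>l<N. cscale (1 / fact l) ((T ^^ (k + l)) v))"
   unfolding expo_def
   by (subst linear_on_sum[OF linear_on_funpow[OF T(1,3)] T(2)])
    (auto simp: pow cs.subspace_scale[OF T(2)] linear_on_scale[OF linear_on_funpow[OF T(1,3)] pow] funpow_add)
  then show "cscale ((- 1) ^ k / fact k) ((T ^^ k) ?x) = (\<Sum>l<N. g k l)"
   by (simp add: g_def cs.scale_sum_right)
 qed
 also have "... = (\<Sum>m<2*N. \<Sum>k\<le>m. g k (m - k))"
  by (rule diagonal_sum) (use funpow_zero_mono[OF v(2) T0] in \<open>auto simp: g_def\<close>)
 also have "... = (\<Sum>m<2*N. if m = 0 then v else 0)"
 proof (rule sum.cong[OF refl])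
  fix m
  have "(\<Sum>k\<le>m. g k (m - k)) = (\<Sum>k\<le>m. cscale ((- 1) ^ k / (fact k * fact (m - k))) ((T ^^ m) v))"
   by (rule sum.cong) (auto simp: g_def)
  also have "... = cscale (\<Sum>k\<le>m. (- 1) ^ k / (fact k * fact (m - k))) ((T ^^ m) v)"
   by (simp add: cs.scale_sum_left)
  also have "(\<Sum>k\<le>m. (- 1) ^ k / (fact k * fact (m - k))) = (\<Sum>k\<le>m. (- 1) ^ k * of_nat (m choose k) / fact m :: complex)"
   by (rule sum.cong) (auto simp: binomial_fact)
  also have "... = (\<Sum>k\<le>m. (- 1) ^ k * of_nat (m choose k)) / fact m" by (simp add: sum_divide_distrib)
  also have "... = (if m = 0 then 1 else 0)" using choose_alternating_sum[of m, where 'a = complex] by auto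
  finally show "(\<Sum>k\<le>m. g k (m - k)) = (if m = 0 then v else 0)" by simp
 qed
 also have "... = v" using Suc by simp
 finally show ?thesis .
qed (use v in \<open>simp add: expo_def\<close>)

text \<open>\<open>D\<close> is the derivation \<open>A \<otimes> 1 + 1 \<otimes> B\<close>.\<close>

lemma derivation_pow_tensor:
 assumes D: "linear_on (tensor_space V W) D" "!!v w. v \<in> V ==> w \<in> W ==> D (tensor v w) = tensor (A v) w + tensor v (B w)"
  and AB: "A ` V \<subseteq> V" "B ` W \<subseteq> W" and v: "v \<in> V" "w \<in> W"
 shows "(D ^^ m) (tensor v w) = (\<Sum>k\<le>m. cscale (of_nat (m choose k)) (tensor ((A ^^ k) v) ((B ^^ (m - k)) w)))"
proof (induction m)
 case (Suc m)
 let ?t = "%k l. tensor ((A ^^ k) v) ((B ^^ l) w)"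
 have in_V: "(A ^^ k) v \<in> V" "(B ^^ k) w \<in> W" for k using AB v by (auto intro: funpow_in)
 have "(D ^^ Suc m) (tensor v w) = D (\<Sum>k\<le>m. cscale (of_nat (m choose k)) (?t k (m - k)))" using Suc.IH by simp
 also have "... = (\<Sum>k\<le>m. cscale (of_nat (m choose k)) (?t (Suc k) (m - k) + ?t k (Suc (m - k))))"
  by (subst linear_on_sum[OF D(1)])
   (auto simp: linear_on_scale[OF D(1)] D(2) in_V intro!: cs.subspace_scale)
 also have "... = (\<Sum>k\<le>m. cscale (of_nat (m choose k)) (?t (Suc k) (m - k))) +
   (\<Sum>k\<le>m. cscale (of_nat (m choose k)) (?t k (Suc m - k)))"
  by (simp add: cs.scale_right_distrib sum.distrib Suc_diff_le)
 also have "(\<Sum>k\<le>m. cscale (of_nat (m choose k)) (?t (Suc k) (m - k))) =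
   (\<Sum>k\<le>Suc m. cscale (if k = 0 then 0 else of_nat (m choose (k - 1))) (?t k (Suc m - k)))"
  by (subst sum.atMost_Suc_shift) simp
 also have "(\<Sum>k\<le>m. cscale (of_nat (m choose k)) (?t k (Suc m - k))) =
   (\<Sum>k\<le>Suc m. cscale (of_nat (m choose k)) (?t k (Suc m - k)))"
  by simp
 also have "(\<Sum>k\<le>Suc m. cscale (if k = 0 then 0 else of_nat (m choose (k - 1))) (?t k (Suc m - k))) + ... =
   (\<Sum>k\<le>Suc m. cscale (of_nat (Suc m choose k)) (?t k (Suc m - k)))"
  unfolding sum.distrib[symmetric]
 proof (rule sum.cong[OF refl])
  fix k
  show "cscale (if k = 0 then 0 else of_nat (m choose (k - 1))) (?t k (Suc m - k)) + cscale (of_nat (m choose k)) (?t k (Suc m - k)) =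
    cscale (of_nat (Suc m choose k)) (?t k (Suc m - k))"
   by (cases k) (simp_all add: cs.scale_left_distrib)
 qed
 finally show ?case .
qed simp

text \<open>The exponential of \<open>A \<otimes> 1 + 1 \<otimes> B\<close> is group-like. The bound
  doubles because mixed powers can survive up to total degree \<open>2 N - 2\<close>.\<close>

lemma expo_tensor:
 assumes D: "linear_on (tensor_space V W) D" "!!v w. v \<in> V ==> w \<in> W ==> D (tensor v w) = tensor (A v) w + tensor v (B w)"
  and AB: "A ` V \<subseteq> V" "B ` W \<subseteq> W" "A 0 = 0" "B 0 = 0" and v: "v \<in> V" "w \<in> W"
  and nil: "(A ^^ N) v = 0" "(B ^^ N) w = 0"
 shows "expo (2 * N) D (tensor v w) = tensor (expo N A v) (expo N B w)"
proof -
 define g where "g k l = cscale (1 / (fact k * fact l)) (tensor ((A ^^ k) v) ((B ^^ l) w))" for k l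
 have pow: "(D ^^ m) (tensor v w) = (\<Sum>k\<le>m. cscale (of_nat (m choose k)) (tensor ((A ^^ k) v) ((B ^^ (m - k)) w)))" for m
  by (rule derivation_pow_tensor[OF D AB(1,2) v])
 have "cscale (1 / fact m) ((D ^^ m) (tensor v w)) = (\<Sum>k\<le>m. g k (m - k))" for m
  unfolding pow cs.scale_sum_right by (intro sum.cong refl) (simp add: g_def binomial_fact)
 then have "expo (2 * N) D (tensor v w) = (\<Sum>m<2*N. \<Sum>k\<le>m. g k (m - k))"
  by (simp add: expo_def)
 also have "... = (\<Sum>k<N. \<Sum>l<N. g k l)"
  by (rule diagonal_sum[symmetric])
   (use funpow_zero_mono[OF nil(1) AB(3)] funpow_zero_mono[OF nil(2) AB(4)] in \<open>auto simp: g_def\<close>)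
 also have "... = tensor (expo N A v) (expo N B w)"
  unfolding expo_def tensor_sum_left unfolding tensor_sum_right g_def
  by (intro sum.cong refl) (simp add: tensor_scale_left tensor_scale_right)
 finally show ?thesis .
qed

text \<open>The product \<open>exp(e) exp(- f) exp(e)\<close>, the lift to \<open>SL2\<close> of the
  nontrivial Weyl group element.\<close>

definition weyl :: "nat => (cseq => cseq) => (cseq => cseq) => cseq => cseq" where
 "weyl N e f v = expo N e (expo N (%v. - f v) (expo N e v))"

locale sl2_nilpotent = sl2_rep +
 fixes N :: nat
 assumes e_nil: "v \<in> V ==> (e ^^ N) v = 0" and f_nil: "v \<in> V ==> (f ^^ N) v = 0"
begin

lemma e_image: "e ` V \<subseteq> V" and f_image: "f ` V \<subseteq> V" and uf_image: "(%v. - f v) ` V \<subseteq> V" by auto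

text \<open>Also this triple satisfies the relations, with the same nilpotency bound, so the
  conjugation formulas for \<open>exp(e)\<close> yield those for \<open>exp(- f)\<close>.\<close>

lemma flip: "sl2_nilpotent V (%v. - f v) (%v. - h v) (%v. - e v) N"
 by unfold_locales
  (auto simp: lin_simps h_e h_f e_f e_nil f_nil pow_uminus[OF linear_e e_image] pow_uminus[OF linear_f f_image]
   intro!: linear_on_uminus)

lemma expo_e_in [simp]: "v \<in> V ==> expo N e v \<in> V"
 by (rule expo_in) auto

lemma expo_e_linear: "linear_on V (expo N e)"
 by (rule expo_linear) auto

lemma expo_e_Suc: "v \<in> V ==> expo N e v = (\<Sum>k<Suc N. cscale (1 / fact k) ((e ^^ k) v))"
 by (simp add: expo_def e_nil)

lemma expo_e_e: "v \<in> V ==> expo N e (e v) = e (expo N e v)"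
 by (rule expo_natural[OF linear_e subspace_V e_image, symmetric]) auto

text \<open>The factor \<open>k\<close> turns \<open>1 / k!\<close> into
  \<open>1 / (k - 1)!\<close>, so the series shifts by one power of \<open>e\<close>. This sum
  arises whenever \<open>h\<close> is moved past the exponential.\<close>

lemma expo_e_sum_index:
 assumes "v \<in> V"
 shows "(\<Sum>k<N. cscale (of_nat k / fact k) ((e ^^ k) v)) = e (expo N e v)"
proof -
 have "(\<Sum>k<N. cscale (of_nat k / fact k) ((e ^^ k) v)) = (\<Sum>k<Suc N. cscale (of_nat k / fact k) ((e ^^ k) v))"
  using e_nil[OF assms] by simp
 also have "... = (\<Sum>k<N. cscale (1 / fact k) (e ((e ^^ k) v)))"
  by (subst sum.lessThan_Suc_shift) (simp del: of_nat_Suc)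
 also have "... = e (expo N e v)"
  unfolding expo_def using assms by (subst linear_on_sum[OF linear_e subspace_V]) (auto simp: lin_simps)
 finally show ?thesis .
qed

lemma expo_e_h:
 assumes v: "v \<in> V"
 shows "expo N e (h v) = h (expo N e v) - cscale 2 (e (expo N e v))"
proof -
 have "h (expo N e v) = (\<Sum>k<N. cscale (1 / fact k) (h ((e ^^ k) v)))"
  unfolding expo_def using v by (subst linear_on_sum[OF linear_h subspace_V]) (auto simp: lin_simps)
 also have "... = (\<Sum>k<N. cscale (1 / fact k) ((e ^^ k) (h v)) + cscale 2 (cscale (of_nat k / fact k) ((e ^^ k) v)))"
  using v by (intro sum.cong refl) (simp add: h_e_pow cs.scale_right_distrib)
 also have "... = expo N e (h v) + cscale 2 (e (expo N e v))"
  unfolding sum.distrib cs.scale_sum_right[symmetric] expo_e_sum_index[OF v] by (simp add: expo_def)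
 finally show ?thesis by simp
qed

text \<open>Conjugation by \<open>exp(e)\<close> sends \<open>f\<close> to \<open>f + h - e\<close>,
  the last term coming from the second-order commutator. The term \<open>k = 0\<close> has no
  commutator and is split off by an index shift.\<close>

lemma expo_e_f:
 assumes v: "v \<in> V"
 shows "expo N e (f v) = f (expo N e v) + h (expo N e v) - e (expo N e v)"
proof -
 interpret dual: sl2_rep V f "%v. - h v" e by (rule dual)
 have step: "cscale (1 / fact (Suc k)) ((e ^^ Suc k) (f v)) =
   cscale (1 / fact (Suc k)) (f ((e ^^ Suc k) v)) + (cscale (1 / fact k) (h ((e ^^ k) v)) - cscale (of_nat k / fact k) ((e ^^ k) v))" for k
 proof -
  have "(e ^^ Suc k) (f v) = f ((e ^^ Suc k) v) + cscale (of_nat (Suc k)) ((e ^^ k) (h v + cscale (of_nat k) v))"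
   using dual.e_f_pow[OF v, of k] v
   by (simp add: lin_simps cs.scale_right_distrib cs.scale_right_diff_distrib linear_on_minus[OF linear_pow(1)] del: of_nat_Suc funpow.simps)
  also have "(e ^^ k) (h v + cscale (of_nat k) v) = h ((e ^^ k) v) - cscale (of_nat k) ((e ^^ k) v)"
   using v by (simp add: lin_simps h_e_pow) (simp add: fun_eq_iff cscale_def algebra_simps)
  finally have "(e ^^ Suc k) (f v) = f ((e ^^ Suc k) v) + cscale (of_nat (Suc k)) (h ((e ^^ k) v) - cscale (of_nat k) ((e ^^ k) v))" .
  then show ?thesis
   by (simp only: cs.scale_right_distrib cs.scale_right_diff_distrib cs.scale_scale) (simp del: funpow.simps of_nat_Suc)
 qed
 have "expo N e (f v) = f v + (\<Sum>k<N. cscale (1 / fact (Suc k)) ((e ^^ Suc k) (f v)))"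
  using expo_e_Suc[OF f_in[OF v]] by (subst (asm) sum.lessThan_Suc_shift) simp
 also have "... = f v + (\<Sum>k<N. cscale (1 / fact (Suc k)) (f ((e ^^ Suc k) v))) +
   ((\<Sum>k<N. cscale (1 / fact k) (h ((e ^^ k) v))) - (\<Sum>k<N. cscale (of_nat k / fact k) ((e ^^ k) v)))"
  by (simp only: step sum.distrib sum_subtractf add.assoc)
 also have "f v + (\<Sum>k<N. cscale (1 / fact (Suc k)) (f ((e ^^ Suc k) v))) = (\<Sum>k<Suc N. cscale (1 / fact k) (f ((e ^^ k) v)))"
  by (subst sum.lessThan_Suc_shift) simp
 also have "... = f (expo N e v)"
  unfolding expo_e_Suc[OF v] using v by (subst linear_on_sum[OF linear_f subspace_V]) (auto simp: lin_simps)
 also have "(\<Sum>k<N. cscale (1 / fact k) (h ((e ^^ k) v))) = h (expo N e v)"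
  unfolding expo_def using v by (subst linear_on_sum[OF linear_h subspace_V]) (auto simp: lin_simps)
 also have "(\<Sum>k<N. cscale (of_nat k / fact k) ((e ^^ k) v)) = e (expo N e v)" by (rule expo_e_sum_index[OF v])
 finally show ?thesis by (simp add: algebra_simps)
qed

lemma weyl_in [simp]: "v \<in> V ==> weyl N e f v \<in> V"
 unfolding weyl_def by (intro expo_in) auto

lemma weyl_linear: "linear_on V (weyl N e f)"
proof -
 have "linear_on V (%v. expo N (%v. - f v) (expo N e v))"
  by (rule linear_on_comp(2)[OF expo_e_linear expo_linear[OF linear_on_uminus]]) auto
 moreover have "(%v. expo N (%v. - f v) (expo N e v)) ` V \<subseteq> V" by (auto intro!: expo_in)
 ultimately show ?thesis unfolding weyl_def[abs_def] by (rule linear_on_comp(2)[OF _ expo_e_linear])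
qed

text \<open>The three conjugations compose to the Chevalley involution. For instance
  \<open>exp(e)\<close> fixes \<open>e\<close>, \<open>exp(- f)\<close> takes it to
  \<open>e + h - f\<close>, and the last \<open>exp(e)\<close> turns this into
  \<open>- f\<close>.\<close>

lemma weyl_intertwines:
 assumes v: "v \<in> V"
 shows "weyl N e f (e v) = - f (weyl N e f v)" "weyl N e f (f v) = - e (weyl N e f v)"
  "weyl N e f (h v) = - h (weyl N e f v)"
proof -
 interpret F: sl2_nilpotent V "%v. - f v" "%v. - h v" "%v. - e v" N by (rule flip)
 let ?x = "expo N e" and ?y = "expo N (%v. - f v)"
 note xl = linear_on_add[OF expo_e_linear] linear_on_diff[OF expo_e_linear subspace_V]
  linear_on_minus[OF expo_e_linear] linear_on_scale[OF expo_e_linear]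
 note yl = linear_on_add[OF F.expo_e_linear] linear_on_diff[OF F.expo_e_linear subspace_V]
  linear_on_minus[OF F.expo_e_linear] linear_on_scale[OF F.expo_e_linear]
 have ye: "?y (e u) = e (?y u) + h (?y u) - f (?y u)" and yf: "?y (f u) = f (?y u)"
  and yh: "?y (h u) = h (?y u) - cscale 2 (f (?y u))" if u: "u \<in> V" for u
 proof -
  have "- ?y (e u) = - e (?y u) - h (?y u) + f (?y u)" using F.expo_e_f[OF u] u by (simp add: yl)
  then have "- (- ?y (e u)) = - (- e (?y u) - h (?y u) + f (?y u))" by simp
  then show "?y (e u) = e (?y u) + h (?y u) - f (?y u)" by simp
  show "?y (f u) = f (?y u)" using F.expo_e_e[OF u] u by (simp add: yl)
  have "- ?y (h u) = - h (?y u) + cscale 2 (f (?y u))" using F.expo_e_h[OF u] u by (simp add: yl)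
  then have "- (- ?y (h u)) = - (- h (?y u) + cscale 2 (f (?y u)))" by simp
  then show "?y (h u) = h (?y u) - cscale 2 (f (?y u))" by simp
 qed
 have z: "?x v \<in> V" "?y (?x v) \<in> V" using v by auto
 show "weyl N e f (e v) = - f (weyl N e f v)"
  using v z by (simp add: weyl_def expo_e_e ye xl expo_e_f expo_e_h)
   (simp add: fun_eq_iff cscale_def algebra_simps)
 show "weyl N e f (h v) = - h (weyl N e f v)"
  using v z by (simp add: weyl_def expo_e_e expo_e_h ye yh yl xl expo_e_f)
   (simp add: fun_eq_iff cscale_def algebra_simps)
 have "?y (?x (f v)) = f (?y (?x v)) + (h (?y (?x v)) - cscale 2 (f (?y (?x v)))) - (e (?y (?x v)) + h (?y (?x v)) - f (?y (?x v)))"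
  using v z by (simp add: expo_e_f ye yf yh yl)
 also have "... = - e (?y (?x v))" by (simp add: fun_eq_iff cscale_def algebra_simps)
 finally show "weyl N e f (f v) = - e (weyl N e f v)"
  using z by (simp add: weyl_def xl expo_e_e)
qed

lemma weyl_bij: "bij_betw (weyl N e f) V V"
proof -
 let ?x = "expo N e" and ?x' = "expo N (%v. - e v)" and ?y = "expo N (%v. - f v)" and ?y' = "expo N f"
 have uu: "(%v. - (%v. - T v) v) = T" for T :: "cseq => cseq" by simp
 have nil: "((%v. - e v) ^^ N) v = 0" "((%v. - f v) ^^ N) v = 0" if "v \<in> V" for v
  using that by (simp_all add: pow_uminus[OF linear_e e_image] pow_uminus[OF linear_f f_image] e_nil f_nil)
 have ue: "linear_on V (%v. - e v)" "linear_on V (%v. - f v)" by (auto intro: linear_on_uminus)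
 have xx: "?x' (?x v) = v" "?x (?x' v) = v" "?y' (?y v) = v" "?y (?y' v) = v" if "v \<in> V" for v
  using that expo_inverse[OF linear_e subspace_V e_image, of v N] expo_inverse[OF ue(1) subspace_V, of v N]
   expo_inverse[OF linear_f subspace_V f_image, of v N] expo_inverse[OF ue(2) subspace_V, of v N]
  by (auto simp: e_nil f_nil nil image_subset_iff)
 have mem: "?x v \<in> V" "?x' v \<in> V" "?y v \<in> V" "?y' v \<in> V" if "v \<in> V" for v
  using that by (auto intro!: expo_in)
 show ?thesis
  unfolding weyl_def
  by (rule bij_betw_byWitness[where f' = "%v. ?x' (?y' (?x' v))"]) (auto simp: xx mem)
qed

end

section \<open>Binomial coefficients with negative upper index\<close>

text \<open>The coefficient of \<open>z^k\<close> in \<open>(1 + z)^(- n)\<close>, by which the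
  inverse power \<open>(B + A)^(- n)\<close> expands in powers of \<open>A\<close>.\<close>

definition nbinom :: "nat => nat => complex" where
 "nbinom n k = (- of_nat n) gchoose k"

lemma nbinom_0 [simp]: "nbinom n 0 = 1" "nbinom 0 (Suc k) = 0"
 by (simp_all add: nbinom_def)

text \<open>Comparison of coefficients in \<open>(1 + z) (1 + z)^(- n - 1) = (1 + z)^(- n)\<close>;
  it is the reason why transformed sequences are divisible again.\<close>

lemma nbinom_pascal: "nbinom n (Suc k) = nbinom (Suc n) k + nbinom (Suc n) (Suc k)"
 using gbinomial_Suc_Suc[of "- of_nat (Suc n) :: complex" k] by (simp add: nbinom_def)

lemma nbinom_absorb: "of_nat (Suc k) * nbinom n (Suc k) = - of_nat (n + k) * nbinom n k"
proof -
 have *: "a * x = k * x + s * z ==> a = - n ==> s * z = - (n + k) * x" for a x k s z n :: complex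
  by algebra
 show ?thesis
  using *[OF gbinomial_mult_1[of "- of_nat n :: complex" k] refl] by (simp only: nbinom_def of_nat_add)
qed

lemma nbinom_shift: "of_nat n * nbinom (Suc n) k = of_nat (n + k) * nbinom n k"
proof -
 have *: "(a - k) * x = a * y ==> a = - n ==> n * y = (n + k) * x" for a x k y n :: complex
  by (simp add: algebra_simps)
 have e: "- of_nat (Suc n) = - of_nat n - (1 :: complex)" by simp
 show ?thesis
  using *[OF gbinomial_absorb_comp[of "- of_nat n :: complex" k] refl] by (simp only: nbinom_def of_nat_add e)
qed

text \<open>Expanding to order \<open>k\<close> and then to order \<open>l\<close> equals one
  expansion to order \<open>k + l\<close>, weighted by the number of splittings. Both the inversion
  of binomial transforms and associativity of the structure map rest on this.\<close>

lemma nbinom_trinomial: "nbinom n k * nbinom (n + k) l = nbinom n (k + l) * of_nat ((k + l) choose k)"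
proof -
 have e: "- of_nat (n + k) = - of_nat n - (of_nat k :: complex)" by simp
 show ?thesis
  using gbinomial_trinomial_revision[of k "k + l" "- of_nat n :: complex"]
  by (simp only: nbinom_def e binomial_gbinomial le_add1 add_diff_cancel_left' simp_thms)
qed

section \<open>The module of e-divisible sequences\<close>

text \<open>Keeps sequences of vectors inside the fixed universe of complex sequences;
  \<open>trow\<close> unpacks them.\<close>

definition mk_rows :: "(nat => cseq) => cseq" where
 "mk_rows s = (%p. case prod_decode p of (n, i) => s n i)"

lemma trow_mk_rows [simp]: "trow (mk_rows s) n = s n"
 by (simp add: trow_def mk_rows_def)

lemma trow_map_rows [simp]: "trow (map_rows B t) n = B (trow t n)"
 by (subst trow_def) (simp add: map_rows_def)

lemma trow_ext: "(!!n. trow s n = trow t n) ==> s = t"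
 by (rule cseq_pair_ext) (simp add: trow_def fun_eq_iff)

lemma trow_0 [simp]: "trow 0 n = 0"
 by (simp add: trow_def fun_eq_iff)

lemma trow_uminus: "trow (- t) n = - trow t n"
 and trow_diff: "trow (s - t) n = trow s n - trow t n"
 and trow_sum: "trow (\<Sum>i\<in>I. g i) n = (\<Sum>i\<in>I. trow (g i) n)"
 by (simp_all add: trow_def fun_eq_iff sum_apply_fun)

lemmas trow_simps = trow_add trow_scale trow_uminus trow_diff trow_sum

text \<open>The \<open>n\<close>-th row is the value at \<open>e^(- n)\<close> of a homomorphism on
  \<open>U[e^(- 1)] / U\<close>; row \<open>0\<close> vanishes because \<open>e^0\<close> lies in
  \<open>U\<close>.\<close>

definition seq_space :: "cseq set => (cseq => cseq) => cseq set" where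
 "seq_space V e = {t. (\<forall>n. trow t n \<in> V) & trow t 0 = 0 & (\<forall>n. e (trow t (Suc n)) = trow t n)}"

text \<open>The formulas for \<open>h\<close> and \<open>f\<close> come from moving
  \<open>e^(- n)\<close> to the right in the localisation:
  \<open>e^(- n) h = (h + 2 n) e^(- n)\<close> and
  \<open>e^(- n) f = f e^(- n) - n (h + n + 1) e^(- n - 1)\<close>. The latter explains the row
  \<open>Suc n\<close> in \<open>seq_f\<close>.\<close>

definition seq_h :: "(cseq => cseq) => cseq => cseq" where
 "seq_h h t = mk_rows (%n. h (trow t n) + cscale (2 * of_nat n) (trow t n))"

definition seq_f :: "(cseq => cseq) => (cseq => cseq) => cseq => cseq" where
 "seq_f h f t = mk_rows (%n. f (trow t n) -
  cscale (of_nat n) (h (trow t (Suc n)) + cscale (of_nat (Suc n)) (trow t (Suc n))))"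

lemma trow_seq [simp]:
 "trow (seq_h h t) n = h (trow t n) + cscale (2 * of_nat n) (trow t n)"
 "trow (seq_f h f t) n = f (trow t n) - cscale (of_nat n) (h (trow t (Suc n)) + cscale (of_nat (Suc n)) (trow t (Suc n)))"
 by (simp_all add: seq_h_def seq_f_def)

text \<open>The full space of sequences need not be spanned by weight vectors; only the part that
  is, with weights in \<open>P\<close>, can return to the category.\<close>

definition seq_fin :: "complex set => cseq set => (cseq => cseq) => (cseq => cseq) => cseq set" where
 "seq_fin P V e h = cs.span (\<Union>w\<in>P. wt_space (seq_space V e) (seq_h h) w)"

context sl2_rep
begin

lemma seq_spaceD:
 assumes "t \<in> seq_space V e"
 shows "trow t n \<in> V" "trow t 0 = 0" "e (trow t (Suc n)) = trow t n"
 using assms by (simp_all add: seq_space_def)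

lemma seq_space_subspace: "cs.subspace (seq_space V e)"
 by (rule cs.subspaceI) (auto simp: seq_space_def trow_simps lin_simps)

lemma seq_rep: "sl2_rep (seq_space V e) (map_rows e) (seq_h h) (seq_f h f)"
proof
 show "cs.subspace (seq_space V e)" by (rule seq_space_subspace)
 note D = seq_spaceD
 show "linear_on (seq_space V e) (map_rows e)" "linear_on (seq_space V e) (seq_h h)" "linear_on (seq_space V e) (seq_f h f)"
  by (rule linear_onI; rule trow_ext; simp add: D trow_simps lin_simps del: of_nat_Suc;
    simp add: fun_eq_iff cscale_def algebra_simps)+
 fix t assume t: "t \<in> seq_space V e"
 note D = seq_spaceD[OF t]
 have e_0: "e (trow t 0) = 0" by (simp add: D)
 show "map_rows e t \<in> seq_space V e"
  unfolding seq_space_def using D by simp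
 show "seq_h h t \<in> seq_space V e"
 proof -
  have "e (h (trow t (Suc n)) + cscale (2 * of_nat (Suc n)) (trow t (Suc n))) = h (trow t n) + cscale (2 * of_nat n) (trow t n)" for n
   using D h_e[of "trow t (Suc n)"]
   by (simp add: lin_simps del: of_nat_Suc) (simp add: fun_eq_iff cscale_def algebra_simps)
  then show ?thesis unfolding seq_space_def using D by (simp del: of_nat_Suc)
 qed
 show "seq_f h f t \<in> seq_space V e"
 proof -
  have "e (trow (seq_f h f t) (Suc n)) = trow (seq_f h f t) n" for n
  proof -
   have eh: "e (h (trow t (Suc k))) = h (trow t k) - cscale 2 (trow t k)" for k
    using h_e[of "trow t (Suc k)"] D by simp
   show ?thesis
    using D e_f[of "trow t (Suc n)"]
    by (simp add: lin_simps eh del: of_nat_Suc) (simp add: fun_eq_iff cscale_def algebra_simps)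
  qed
  then show ?thesis unfolding seq_space_def using D by (simp del: trow_seq) (simp add: D)
 qed
 show "seq_h h (map_rows e t) = map_rows e (seq_h h t) + cscale 2 (map_rows e t)"
  by (rule trow_ext) (simp add: trow_simps D lin_simps h_e; simp add: fun_eq_iff cscale_def algebra_simps)
 show "seq_h h (seq_f h f t) = seq_f h f (seq_h h t) - cscale 2 (seq_f h f t)"
  by (rule trow_ext) (simp add: trow_simps D lin_simps h_f del: of_nat_Suc; simp add: fun_eq_iff cscale_def algebra_simps)
 show "map_rows e (seq_f h f t) = seq_f h f (map_rows e t) + seq_h h t"
 proof (rule trow_ext)
  fix n
  have eh: "e (h (trow t (Suc n))) = h (trow t n) - cscale 2 (trow t n)"
   using h_e[of "trow t (Suc n)"] D by simp
  show "trow (map_rows e (seq_f h f t)) n = trow (seq_f h f (map_rows e t) + seq_h h t) n"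
   by (simp add: trow_simps D lin_simps e_f eh del: of_nat_Suc) (simp add: fun_eq_iff cscale_def algebra_simps)
 qed
qed

lemma weight_span_rep:
 assumes shift: "!!w. w \<in> P ==> w + 2 \<in> P" "!!w. w \<in> P ==> w - 2 \<in> P"
 shows "sl2_rep (cs.span (\<Union>w\<in>P. wt_space V h w)) e h f"
  and "weighted P (cs.span (\<Union>w\<in>P. wt_space V h w)) h"
  and "cs.span (\<Union>w\<in>P. wt_space V h w) \<subseteq> V"
proof -
 let ?S = "\<Union>w\<in>P. wt_space V h w"
 show sub: "cs.span ?S \<subseteq> V" by (rule span_sub) (auto dest: wt_space_in)
 have stable: "T v \<in> cs.span ?S" if T: "linear_on V T" "!!v w. w \<in> P ==> v \<in> wt_space V h w ==> T v \<in> cs.span ?S"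
  and v: "v \<in> cs.span ?S" for T v
 proof -
  have "cs.span ?S \<subseteq> {v \<in> V. T v \<in> cs.span ?S}"
   by (rule span_sub) (use T in \<open>auto intro!: linear_on_vimage_subspace dest: wt_space_in\<close>)
  then show ?thesis using v by auto
 qed
 have mem: "v \<in> cs.span ?S" if "w \<in> P" "v \<in> wt_space V h w" for v w
  using that by (intro cs.span_base) blast
 have e: "e v \<in> cs.span ?S" if "v \<in> cs.span ?S" for v
  using that by (rule stable[OF linear_e, rotated]) (rule mem[OF shift(1) wt_space_step(2)])
 have f: "f v \<in> cs.span ?S" if "v \<in> cs.span ?S" for v
  using that by (rule stable[OF linear_f, rotated]) (rule mem[OF shift(2) wt_space_step(1)])
 have h: "h v \<in> cs.span ?S" if "v \<in> cs.span ?S" for v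
  using that
 proof (rule stable[OF linear_h, rotated])
  fix v w assume *: "w \<in> P" "v \<in> wt_space V h w"
  then have "h v = cscale w v" by (simp add: wt_space_def)
  then show "h v \<in> cs.span ?S" using mem[OF *] cs.span_scale by simp
 qed
 show "sl2_rep (cs.span ?S) e h f"
  by unfold_locales (use sub e f h in \<open>auto simp: h_e h_f e_f intro: linear_on_subset[OF _ sub]\<close>)
 have "wt_space V h w \<subseteq> wt_space (cs.span ?S) h w" if "w \<in> P" for w
  using mem[OF that] by (auto simp: wt_space_def)
 then show "weighted P (cs.span ?S) h"
  unfolding weighted_def by (intro cs.span_mono) blast
qed

text \<open>The Chevalley involution, by which \<open>seq_module\<close> turns lowest weight vectors
  into highest weight vectors.\<close>

lemma negate_rep: "sl2_rep V (%v. - f v) (%v. - h v) (%v. - e v)"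
 by unfold_locales (auto simp: lin_simps h_e h_f e_f intro!: linear_on_uminus)

lemma hw_generated_kernel_basis:
 assumes nonint: "!!w. w \<in> P ==> w \<notin> \<nat>" and shift: "!!w. w \<in> P ==> w + 2 \<in> P"
  and P: "weighted P V h" and nil: "locally_nilpotent V e"
  and B: "finite B" "!!b. b \<in> B ==> e b = 0 & (\<exists>w\<in>P. b \<in> wt_space V h w)"
  and K: "!!v. v \<in> V ==> e v = 0 ==> v \<in> cs.span B"
 shows "hw_generated P B"
proof -
 have BV: "B \<subseteq> V" using B(2) wt_space_in by blast
 have "(f ^^ k) u \<in> cs.span {(f ^^ k) b | k b. b \<in> B}" if "u \<in> V" "e u = 0" for k u
 proof -
  have "(f ^^ k) u \<in> cs.span ((f ^^ k) ` B)"
   using linear_on_span_image[OF linear_pow(2) subspace_V BV, of k] K[OF that] by auto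
  also have "... \<subseteq> cs.span {(f ^^ k) b | k b. b \<in> B}" by (rule cs.span_mono) auto
  finally show ?thesis .
 qed
 then have "cs.span {(f ^^ k) u | k u w. w \<in> P & u \<in> wt_space V h w & e u = 0}
   \<subseteq> cs.span {(f ^^ k) b | k b. b \<in> B}"
  by (intro cs.span_minimal) (auto dest: wt_space_in)
 then have "V \<subseteq> cs.span {(f ^^ k) b | k b. b \<in> B}" using decompose[OF nonint shift P nil] by (rule order.trans[rotated])
 then show ?thesis unfolding hw_generated_def using B BV by (auto simp: wt_space_def)
qed

text \<open>The lowest weight vector \<open>(0, b, f b / c\<^sub>1, f\<^sup>2 b / c\<^sub>2, \<dots>)\<close>.\<close>

definition lowest :: "complex => cseq => cseq" where
 "lowest w b = mk_rows (case_nat 0 (%k. cscale (inverse (ef_scalar k w)) ((f ^^ k) b)))"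

lemma trow_lowest [simp]: "trow (lowest w b) 0 = 0"
 "trow (lowest w b) (Suc k) = cscale (inverse (ef_scalar k w)) ((f ^^ k) b)"
 by (simp_all add: lowest_def)

text \<open>Divisibility forces the coefficients, since
  \<open>e f^(k+1) b = (k + 1) (w - k) f^k b\<close>; non-integrality of \<open>w\<close> keeps the
  denominators nonzero. The weight is \<open>w + 2\<close> because \<open>b\<close> stands in row
  \<open>1\<close>, where \<open>seq_h\<close> adds \<open>2\<close>.\<close>

lemma lowest:
 assumes b: "b \<in> wt_space V h w" "e b = 0" and w: "w \<notin> \<int>"
 shows "lowest w b \<in> wt_space (seq_space V e) (seq_h h) (w + 2)" "seq_f h f (lowest w b) = 0"
proof -
 have bV: "b \<in> V" by (rule wt_space_in[OF b(1)])
 have w': "w ~= of_nat j" for j using w by auto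
 then have c0: "ef_scalar k w ~= 0" for k by (rule ef_scalar_nonzero)
 have c: "ef_scalar (Suc k) w = ef_scalar k w * (of_nat (Suc k) * (w - of_nat k))" for k
  by (simp add: ef_scalar_def)
 have s0: "of_nat (Suc k) * (w - of_nat k) ~= 0" for k using w'[of k] by (simp del: of_nat_Suc)
 have inv: "inverse (ef_scalar (Suc k) w) * (of_nat (Suc k) * (w - of_nat k)) = inverse (ef_scalar k w)" for k
  unfolding c using s0[of k] c0[of k] by (simp add: field_simps del: of_nat_Suc)
 have hf: "h ((f ^^ k) b) = cscale (w - 2 * of_nat k) ((f ^^ k) b)" for k
  using wt_space_pow(1)[OF b(1), of k] by (simp add: wt_space_def)
 have e: "e (trow (lowest w b) (Suc n)) = trow (lowest w b) n" for n
 proof (cases n)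
  case (Suc k)
  have "e (cscale (inverse (ef_scalar (Suc k) w)) ((f ^^ Suc k) b)) =
    cscale (inverse (ef_scalar (Suc k) w) * (of_nat (Suc k) * (w - of_nat k))) ((f ^^ k) b)"
   using bV by (simp add: lin_simps e_f_pow_hw[OF b] del: funpow.simps of_nat_Suc)
  then show ?thesis unfolding Suc trow_lowest inv .
 qed (use b bV in \<open>simp add: lin_simps\<close>)
 have "lowest w b \<in> seq_space V e"
  unfolding seq_space_def mem_Collect_eq
 proof (intro conjI allI e)
  fix n show "trow (lowest w b) n \<in> V" using bV by (cases n) auto
 qed simp
 moreover have "seq_h h (lowest w b) = cscale (w + 2) (lowest w b)"
 proof (rule trow_ext)
  fix n show "trow (seq_h h (lowest w b)) n = trow (cscale (w + 2) (lowest w b)) n"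
  proof (cases n)
   case (Suc k)
   show ?thesis
    unfolding Suc trow_seq trow_simps trow_lowest using bV
    by (simp add: lin_simps hf) (simp add: fun_eq_iff cscale_def algebra_simps)
  qed (simp add: trow_simps)
 qed
 ultimately show "lowest w b \<in> wt_space (seq_space V e) (seq_h h) (w + 2)" by (simp add: wt_space_def)
 show "seq_f h f (lowest w b) = 0"
 proof (rule trow_ext)
  fix n show "trow (seq_f h f (lowest w b)) n = trow 0 n"
  proof (cases n)
   case (Suc k)
   have "trow (seq_f h f (lowest w b)) n = cscale (inverse (ef_scalar k w)) ((f ^^ Suc k) b) -
     cscale (of_nat (Suc k)) (cscale (inverse (ef_scalar (Suc k) w) * (w - of_nat k)) ((f ^^ Suc k) b))"
    unfolding Suc trow_seq trow_lowest using bV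
    by (simp add: lin_simps hf del: funpow.simps of_nat_Suc)
     (simp add: fun_eq_iff cscale_def algebra_simps)
   also have "... = cscale (inverse (ef_scalar k w) - inverse (ef_scalar (Suc k) w) * (of_nat (Suc k) * (w - of_nat k))) ((f ^^ Suc k) b)"
    by (simp add: cs.scale_left_diff_distrib mult.left_commute del: funpow.simps of_nat_Suc)
   finally show ?thesis unfolding inv by simp
  qed simp
 qed
qed

end

text \<open>The signs and the exchange of \<open>e\<close> and \<open>f\<close> encode the Chevalley
  twist: a lowest weight vector of weight \<open>w + 2\<close> becomes a highest weight vector of
  weight \<open>- w - 2\<close>.\<close>

definition seq_module :: "complex => sl2_module => sl2_module" where
 "seq_module mu M = mk_module (seq_fin (coset mu) (car M) (act M sl2_e) (act M sl2_h))
  (%t. - seq_f (act M sl2_h) (act M sl2_f) t) (%t. - seq_h (act M sl2_h) t) (%t. - map_rows (act M sl2_e) t)"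

lemma seq_sel [simp]:
 "car (seq_module mu M) = seq_fin (coset mu) (car M) (act M sl2_e) (act M sl2_h)"
 "act (seq_module mu M) sl2_e = (%t. - seq_f (act M sl2_h) (act M sl2_f) t)"
 "act (seq_module mu M) sl2_h = (%t. - seq_h (act M sl2_h) t)"
 "act (seq_module mu M) sl2_f = (%t. - map_rows (act M sl2_e) t)"
 by (simp_all add: seq_module_def)

locale verma = sl2_rep "car M" "act M sl2_e" "act M sl2_h" "act M sl2_f"
 for M :: sl2_module +
 fixes mu :: complex
 assumes nonint: "mu \<notin> \<int>" and verma: "verma_sum mu M"
begin

abbreviation (input) "e \<equiv> act M sl2_e"
abbreviation (input) "h \<equiv> act M sl2_h"
abbreviation (input) "f \<equiv> act M sl2_f"

lemmas module_in = verma_sum_in[OF verma]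
lemmas weighted = verma_sum_weighted[OF verma]
lemmas coset_nat = coset_not_Nats[OF nonint]

lemma coset_2: "w \<in> coset mu ==> w + 2 \<in> coset mu" "w \<in> coset mu ==> w - 2 \<in> coset mu"
 by (auto intro: coset_shift)

lemma basis:
 obtains B where "hw_generated (coset mu) B" "cs.independent B"
proof -
 obtain C where "finite C" "{v \<in> car M. (e ^^ 1) v = 0} \<subseteq> cs.span C"
  using verma_sum_kernel_pow[OF nonint verma, of 1] by metis
 then show ?thesis
  using hw_generatedI[OF coset_nat coset_2(1) weighted verma_sum_nilpotent[OF verma], of C] that by auto
qed

text \<open>This makes \<open>h + k\<close> injective for every integer \<open>k\<close>, the fact
  behind uniqueness of lowest weight sequences.\<close>

lemma no_integral_weight:
 assumes v: "v \<in> car M" "h v = cscale c v" "c \<in> \<int>"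
 shows "v = 0"
proof -
 obtain S u where S: "finite S" "S \<subseteq> coset mu" "!!w. u w \<in> wt_space (car M) h w" "v = (\<Sum>w\<in>S. u w)"
  using weighted_decompose[OF linear_h subspace_V weighted v(1)] by blast
 have u: "u w \<in> car M" "h (u w) = cscale w (u w)" for w using S(3)[of w] by (auto simp: wt_space_def)
 have "h v = (\<Sum>w\<in>S. cscale w (u w))"
  unfolding S(4) using u by (simp add: linear_on_sum[OF linear_h subspace_V])
 then have "0 = (\<Sum>w\<in>S. cscale w (u w)) - (\<Sum>w\<in>S. cscale c (u w))"
  using v(2) S(4) by (simp add: cs.scale_sum_right[symmetric])
 then have s0: "(\<Sum>w\<in>S. cscale (w - c) (u w)) = 0" by (simp add: sum_subtractf cs.scale_left_diff_distrib)
 have "u w = 0" if w: "w \<in> S" for w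
 proof -
  have "cscale (w - c) (u w) \<in> {0}"
   by (rule weight_components[OF linear_h subspace_V, where S = S and w = id])
    (use S(1) u w s0 in \<open>auto simp: lin_simps mult.commute\<close>)
  moreover have "w ~= c" using coset_nonint[OF nonint] S(2) w v(3) by auto
  ultimately show ?thesis by simp
 qed
 then show ?thesis using S(4) by simp
qed

lemma seq_weight_rep: "sl2_rep (car (seq_module mu M)) (map_rows e) (seq_h h) (seq_f h f)"
 and seq_weighted: "weighted (coset mu) (car (seq_module mu M)) (seq_h h)"
 and seq_fin_subset: "car (seq_module mu M) \<subseteq> seq_space (car M) e"
 unfolding seq_sel seq_fin_def
 by (rule sl2_rep.weight_span_rep[OF seq_rep coset_2]; assumption)+

lemma seq_module_in: "seq_module mu M \<in> sl2_modules"
proof -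
 show ?thesis
  using sl2_rep.mk_module_in[OF sl2_rep.negate_rep[OF seq_weight_rep]] by (simp add: seq_module_def)
qed

text \<open>If row \<open>n\<close> vanishes, \<open>seq_f\<close> leaves
  \<open>n (h + n + 1)\<close> applied to row \<open>Suc n\<close>, which is injective for
  \<open>n > 0\<close> because no weight is integral. At \<open>n = 0\<close> the factor
  \<open>n\<close> gives no information, hence the assumption on row \<open>1\<close>.\<close>

lemma seq_kernel_unique:
 assumes t: "t \<in> seq_space (car M) e" "seq_f h f t = 0" "trow t 1 = 0"
 shows "t = 0"
proof (rule trow_ext)
 note D = seq_spaceD[OF t(1)]
 fix n show "trow t n = trow 0 n"
 proof (induction n)
  case (Suc n)
  show ?case
  proof (cases n)
   case (Suc k)
   have "trow (seq_f h f t) n = 0" using t(2) by simp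
   then have "cscale (of_nat n) (h (trow t (Suc n)) + cscale (of_nat (Suc n)) (trow t (Suc n))) = 0"
    using Suc.IH by (simp del: of_nat_Suc)
   then have "h (trow t (Suc n)) = - cscale (of_nat (Suc n)) (trow t (Suc n))"
    using Suc by (simp add: eq_neg_iff_add_eq_0 del: of_nat_Suc)
   then have "h (trow t (Suc n)) = cscale (- of_nat (Suc n)) (trow t (Suc n))"
    by (simp only: cs.scale_minus_left)
   then have "trow t (Suc n) = 0"
    by (rule no_integral_weight[OF D(1)]) (intro Ints_minus Ints_of_nat)
   then show ?thesis by simp
  qed (use t in simp)
 qed (use D in simp)
qed

text \<open>Row \<open>1\<close> of \<open>lowest (w b) b\<close> is \<open>b\<close>, which
  transfers independence from \<open>B\<close>, and by \<open>seq_kernel_unique\<close> these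
  sequences span the kernel of the new \<open>e\<close>. Local nilpotency comes from a lower bound
  on real parts of weights.\<close>

lemma seq_hw:
 assumes B: "hw_generated (coset mu) B" "cs.independent B"
  and w: "!!b. b \<in> B ==> w b \<in> coset mu & b \<in> wt_space (car M) h (w b)"
 shows "verma_sum (- mu) (seq_module mu M)"
  and "sl2_rep.hw_generated (car (seq_module mu M)) (act (seq_module mu M) sl2_e) (act (seq_module mu M) sl2_h)
   (act (seq_module mu M) sl2_f) (coset (- mu)) ((%b. lowest (w b) b) ` B)"
  and "cs.independent ((%b. lowest (w b) b) ` B)" "inj_on (%b. lowest (w b) b) B"
  and "b \<in> B ==> lowest (w b) b \<in> wt_space (car (seq_module mu M)) (act (seq_module mu M) sl2_h) (- w b - 2)"
  and "b \<in> B ==> act (seq_module mu M) sl2_e (lowest (w b) b) = 0"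
proof -
 let ?F = "seq_module mu M"
 let ?J = "%b. lowest (w b) b"
 let ?S = "seq_space (car M) e"
 note BD = hw_generatedD[OF B(1)]
 interpret S: sl2_rep ?S "map_rows e" "seq_h h" "seq_f h f" by (rule seq_rep)
 interpret F: sl2_rep "car ?F" "%t. - seq_f h f t" "%t. - seq_h h t" "%t. - map_rows e t"
  by (rule sl2_rep.negate_rep[OF seq_weight_rep])
 have lowest_b: "?J b \<in> wt_space ?S (seq_h h) (w b + 2)" "seq_f h f (?J b) = 0" if b: "b \<in> B" for b
  using lowest[of b "w b"] BD(5)[OF b] w[OF b] coset_nonint[OF nonint] by auto
 have row1: "trow (?J b) 1 = b" for b by (simp add: ef_scalar_def)
 have J_in: "?J b \<in> car ?F" if b: "b \<in> B" for b
  unfolding seq_sel seq_fin_def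
  using lowest_b[OF b] coset_2(1) w[OF b] by (intro cs.span_base) blast
 show J_w: "?J b \<in> wt_space (car ?F) (act ?F sl2_h) (- w b - 2)" if b: "b \<in> B" for b
  using J_in[OF b] lowest_b[OF b] by (simp add: wt_space_def fun_eq_iff cscale_def algebra_simps)
 show J_e: "act ?F sl2_e (?J b) = 0" if b: "b \<in> B" for b
  using lowest_b[OF b] by simp
 show inj: "inj_on ?J B" by (rule inj_on_inverseI[where g = "%t. trow t 1"]) (rule row1)
 show "cs.independent (?J ` B)"
 proof
  assume "cs.dependent (?J ` B)"
  then obtain u where u: "\<exists>v\<in>?J ` B. u v ~= 0" "(\<Sum>v\<in>?J ` B. cscale (u v) v) = 0"
   using cs.dependent_finite[of "?J ` B"] BD(1) by auto
  have "0 = (\<Sum>b\<in>B. cscale (u (?J b)) (?J b))" using u(2) by (simp add: sum.reindex[OF inj])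
  from arg_cong[OF this, of "%t. trow t 1"]
  have "trow 0 1 = (\<Sum>b\<in>B. cscale (u (?J b)) (trow (?J b) 1))" by (simp only: trow_simps)
  then have "(\<Sum>b\<in>B. cscale (u (?J b)) b) = 0" unfolding row1 by simp
  then have "u (?J b) = 0" if "b \<in> B" for b
   by (rule cs.independentD[OF B(2) BD(1) order_refl, where u = "%b. u (?J b)", OF _ that])
  then show False using u(1) by auto
 qed
 have coset_neg: "x \<in> coset mu ==> - x \<in> coset (- mu)" for x
  unfolding coset_def mem_Collect_eq using Ints_minus[of "x - mu"] by simp
 have nonint': "- mu \<notin> \<int>" using nonint Ints_minus[of "- mu"] by auto
 have wF: "weighted (coset (- mu)) (car ?F) (%t. - seq_h h t)"
 proof -
  have "wt_space (car ?F) (seq_h h) x \<subseteq> wt_space (car ?F) (%t. - seq_h h t) (- x)" for x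
   by (auto simp: wt_space_def)
  then have "(\<Union>x\<in>coset mu. wt_space (car ?F) (seq_h h) x) \<subseteq> (\<Union>x\<in>coset (- mu). wt_space (car ?F) (%t. - seq_h h t) x)"
   using coset_neg by blast
  from seq_weighted[unfolded weighted_def] cs.span_mono[OF this] show ?thesis
   unfolding weighted_def by (rule order.trans)
 qed
 have hw_weight: "\<exists>b\<in>B. x = w b" if v: "v \<in> wt_space (car M) h x" "e v = 0" "v ~= 0" for v x
 proof (rule ccontr)
  assume no: "\<not> (\<exists>b\<in>B. x = w b)"
  have "v \<in> cs.span B"
   by (rule hw_generated_kernel[OF B(1) weighted coset_nat]) (use v in \<open>auto dest: wt_space_in\<close>)
  then obtain c where c: "v = (\<Sum>b\<in>B. cscale (c b) b)" using cs.span_finite[OF BD(1)] by auto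
  have "h v = (\<Sum>b\<in>B. cscale (c b * w b) b)"
   unfolding c using BD(4) w by (simp add: linear_on_sum[OF linear_h subspace_V] lin_simps wt_space_def)
  moreover have "h v = (\<Sum>b\<in>B. cscale (c b * x) b)"
   using v(1) c by (simp add: wt_space_def cs.scale_sum_right mult.commute)
  ultimately have "(\<Sum>b\<in>B. cscale (c b * w b - c b * x) b) = 0" by (simp add: cs.scale_left_diff_distrib sum_subtractf)
  then have *: "c b * w b - c b * x = 0" if "b \<in> B" for b
   by (rule cs.independentD[OF B(2) BD(1) order_refl, where u = "%b. c b * w b - c b * x", OF _ that])
  have "c b = 0" if b: "b \<in> B" for b
  proof -
   have "x ~= w b" using no b by blast
   moreover have "c b * (w b - x) = 0" using *[OF b] by (simp add: right_diff_distrib)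
   ultimately show ?thesis by simp
  qed
  then show False using c v(3) by simp
 qed
 define m where "m = Min (insert 0 ((%b. Re (w b)) ` B))"
 have m: "m \<le> Re (w b)" if "b \<in> B" for b using that BD(1) by (auto simp: m_def)
 have low: "m \<le> Re x" if t: "t \<in> wt_space ?S (seq_h h) x" "t ~= 0" for t x
 proof -
  have tS: "t \<in> ?S" "seq_h h t = cscale x t" using t(1) by (auto simp: wt_space_def)
  \<comment> \<open>The first nonzero row is killed by \<open>e\<close>, since the row before it is
    zero; so it is a highest weight vector of \<open>M\<close> of weight \<open>x - 2 j\<close>,
    which must be one of the finitely many \<open>w b\<close>.\<close>
  obtain j where j: "trow t j ~= 0" "!!i. i < j ==> trow t i = 0"
   using t(2) trow_ext[of t 0] exists_least_iff[of "%j. trow t j ~= 0"] by auto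
  obtain i where i: "j = Suc i" using j(1) seq_spaceD(2)[OF tS(1)] by (cases j) auto
  have "trow (seq_h h t) j = cscale x (trow t j)" using tS(2) by (simp add: trow_simps)
  then have "h (trow t j) = cscale x (trow t j) - cscale (2 * of_nat j) (trow t j)" by (simp add: eq_diff_eq)
  then have "trow t j \<in> wt_space (car M) h (x - 2 * of_nat j)"
   using seq_spaceD(1)[OF tS(1)] by (simp add: wt_space_def cs.scale_left_diff_distrib)
  moreover have "e (trow t j) = 0" using seq_spaceD(3)[OF tS(1), of i] j(2)[of i] i by simp
  ultimately obtain b where "b \<in> B" "x - 2 * of_nat j = w b" using hw_weight j(1) by blast
  then have "m \<le> Re (x - 2 * of_nat j)" using m by simp
  then show ?thesis by simp
 qed
 have nF: "locally_nilpotent (car ?F) (%t. - seq_f h f t)"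
 proof -
  have "wt_space ?S (seq_h h) x \<subseteq> {t \<in> car ?F. \<exists>n. ((%t. - seq_f h f t) ^^ n) t = 0}" if x: "x \<in> coset mu" for x
  proof
   fix t assume t: "t \<in> wt_space ?S (seq_h h) x"
   have tF: "t \<in> car ?F" unfolding seq_sel seq_fin_def using x t by (intro cs.span_base) blast
   \<comment> \<open>\<open>seq_f\<close> lowers the weight by \<open>2\<close>, so a nonzero
     \<open>n\<close>-th image of \<open>t\<close> would have a weight with real part below the
     bound \<open>m\<close>.\<close>
   obtain n :: nat where n: "Re x - m < real n" using reals_Archimedean2 by blast
   have "(seq_f h f ^^ n) t = 0"
   proof (rule ccontr)
    assume "(seq_f h f ^^ n) t ~= 0"
    from low[OF S.wt_space_pow(1)[OF t] this] show False using n by simp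
   qed
   moreover have "((%t. - seq_f h f t) ^^ n) t = cscale ((- 1) ^ n) ((seq_f h f ^^ n) t)"
    by (rule pow_uminus[OF S.linear_f]) (use wt_space_in[OF t] in auto)
   ultimately show "t \<in> {t \<in> car ?F. \<exists>n. ((%t. - seq_f h f t) ^^ n) t = 0}" using tF by auto
  qed
  then have "car ?F \<subseteq> {t \<in> car ?F. \<exists>n. ((%t. - seq_f h f t) ^^ n) t = 0}"
   unfolding seq_sel seq_fin_def
   by (intro span_sub F.locally_nilpotent_subspace[unfolded seq_sel seq_fin_def]) blast
  then show ?thesis unfolding locally_nilpotent_def by blast
 qed
 have ker: "t \<in> cs.span (?J ` B)" if t: "t \<in> car ?F" "- seq_f h f t = 0" for t
 proof -
  have tS: "t \<in> ?S" using t(1) seq_fin_subset by blast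
  have "e (trow t 1) = 0" using seq_spaceD(3)[OF tS, of 0] seq_spaceD(2)[OF tS] by simp
  then have "trow t 1 \<in> cs.span B"
   by (intro hw_generated_kernel[OF B(1) weighted coset_nat]) (use seq_spaceD(1)[OF tS] in auto)
  then obtain c where c: "trow t 1 = (\<Sum>b\<in>B. cscale (c b) b)" using cs.span_finite[OF BD(1)] by auto
  \<comment> \<open>The combination of lowest weight sequences with the same row \<open>1\<close> as
    \<open>t\<close>; the difference vanishes by \<open>seq_kernel_unique\<close>.\<close>
  let ?t = "\<Sum>b\<in>B. cscale (c b) (?J b)"
  have JS: "?J b \<in> ?S" if "b \<in> B" for b using lowest_b[OF that] by (auto dest: wt_space_in)
  then have t'S: "?t \<in> ?S" by (intro cs.subspace_sum S.subspace_V cs.subspace_scale)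
  have "seq_f h f ?t = 0"
   using JS lowest_b by (simp add: linear_on_sum[OF S.linear_f S.subspace_V] S.lin_simps)
  then have "seq_f h f (t - ?t) = 0" using t(2) tS t'S by (simp add: S.lin_simps)
  moreover have "trow (t - ?t) 1 = 0" unfolding trow_simps row1 c by simp
  ultimately have "t - ?t = 0" using seq_kernel_unique[of "t - ?t"] tS t'S by simp
  then have "t = ?t" by simp
  also have "... \<in> cs.span (?J ` B)" by (intro cs.span_sum cs.span_scale cs.span_base) auto
  finally show ?thesis .
 qed
 have "F.hw_generated (coset (- mu)) (?J ` B)"
 proof (rule F.hw_generated_kernel_basis[OF coset_not_Nats[OF nonint'] _ wF nF _ _ ker])
  fix t assume "t \<in> ?J ` B"
  then obtain b where b: "b \<in> B" "t = ?J b" by auto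
  have "- w b - 2 \<in> coset (- mu)" using w[OF b(1)] coset_neg coset_shift(2)[of "- w b" "- mu" 2] by simp
  then show "- seq_f h f t = 0 & (\<exists>x\<in>coset (- mu). t \<in> wt_space (car ?F) (%t. - seq_h h t) x)"
   using b J_w[OF b(1)] J_e[OF b(1)] by auto
 qed (use BD(1) coset_shift(1)[of _ "- mu" 2] in auto)
 then show gen: "sl2_rep.hw_generated (car ?F) (act ?F sl2_e) (act ?F sl2_h) (act ?F sl2_f) (coset (- mu)) (?J ` B)"
  by simp
 show "verma_sum (- mu) ?F" unfolding verma_sum_def using gen seq_module_in by auto
qed

end

lemma vermaI: "mu \<notin> \<int> ==> verma_sum mu M ==> verma M mu"
 using sl2_module_rep[OF verma_sum_in] by (auto simp: verma_def verma_axioms_def)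

section \<open>Arrows determined by highest weight vectors\<close>

lemma arr_f_pow: "arr ph ==> v \<in> car (src ph) ==>
  fn ph ((act (src ph) sl2_f ^^ k) v) = (act (tgt ph) sl2_f ^^ k) (fn ph v)"
proof (induction k)
 case (Suc k)
 interpret sl2_rep "car (src ph)" "act (src ph) sl2_e" "act (src ph) sl2_h" "act (src ph) sl2_f"
  using Suc by (intro sl2_module_rep) simp
 show ?case using Suc by (simp add: arr_act)
qed simp

lemma arr_eq_on_generators:
 assumes gen: "sl2_rep.hw_generated (car M) (act M sl2_e) (act M sl2_h) (act M sl2_f) P B"
  and ph: "arr ph" "src ph = M" and ps: "arr ps" "src ps = M" "tgt ps = tgt ph"
  and eq: "!!b. b \<in> B ==> fn ph b = fn ps b"
 shows "ph = ps"
proof (rule arr_ext)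
 have "M \<in> sl2_modules" using ph by auto
 interpret sl2_rep "car M" "act M sl2_e" "act M sl2_h" "act M sl2_f" by (rule sl2_module_rep) fact
 note BD = hw_generatedD[OF gen]
 fix v assume "v \<in> car (src ps)"
 then have v: "v \<in> cs.span {(act M sl2_f ^^ k) b | k b. b \<in> B}" using BD(3) ps(2) by blast
 show "fn ph v = fn ps v"
 proof (rule linear_on_eq_on_span[OF _ _ subspace_V _ _ v])
  show "linear_on (car M) (fn ph)" "linear_on (car M) (fn ps)"
   using arr_linear[OF ph(1)] arr_linear[OF ps(1)] ph ps by simp_all
  show "{(act M sl2_f ^^ k) b | k b. b \<in> B} \<subseteq> car M" using BD(4) by auto
  fix x assume "x \<in> {(act M sl2_f ^^ k) b | k b. b \<in> B}"
  then obtain k b where b: "x = (act M sl2_f ^^ k) b" "b \<in> B" by auto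
  show "fn ph x = fn ps x"
   using arr_f_pow[OF ph(1), of b k] arr_f_pow[OF ps(1), of b k] b BD(4) eq ph(2) ps(2,3) by simp
 qed
qed (use ph ps in auto)

context verma
begin

lemma f_pow_family_independent:
 assumes B: "hw_generated (coset mu) B" "cs.independent B"
  and sum: "(\<Sum>k<K. \<Sum>b\<in>B. cscale (c k b) ((f ^^ k) b)) = 0" and k: "k < K" "b \<in> B"
 shows "c k b = 0"
proof -
 note BD = hw_generatedD[OF B(1)]
 have eq: "(\<Sum>b\<in>B. cscale (c k b) ((f ^^ k) b)) = (f ^^ k) (\<Sum>b\<in>B. cscale (c k b) b)" for k
  using BD(4) by (simp add: linear_on_sum[OF linear_pow(2) subspace_V] lin_simps)
 have "(\<Sum>b\<in>B. cscale (c k b) b) = 0"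
 proof (rule f_pow_expansion_unique[OF weighted coset_nat _ sum[unfolded eq] k(1)])
  fix k
  have "(\<Sum>b\<in>B. cscale (c k b) b) \<in> {v \<in> car M. e v = 0}"
   by (intro cs.subspace_sum[OF kernel_subspace(1)] cs.subspace_scale[OF kernel_subspace(1)]) (use BD(4,5) in auto)
  then show "(\<Sum>b\<in>B. cscale (c k b) b) \<in> car M & e (\<Sum>b\<in>B. cscale (c k b) b) = 0" by simp
 qed
 then show ?thesis by (rule cs.independentD[OF B(2) BD(1) order_refl _ k(2)])
qed

text \<open>Distinct pairs would give a relation with coefficients \<open>1\<close> and
  \<open>- 1\<close>. Recovering \<open>(k, b)\<close> from \<open>f^k b\<close> is what allows maps
  to be defined on these vectors.\<close>

lemma f_pow_inj:
 assumes B: "hw_generated (coset mu) B" "cs.independent B"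
  and eq: "(f ^^ k) b = (f ^^ l) b'" "b \<in> B" "b' \<in> B"
 shows "k = l & b = b'"
proof (rule ccontr)
 assume ne: "\<not> (k = l & b = b')"
 note BD = hw_generatedD[OF B(1)]
 define c :: "nat => cseq => complex" where "c i x = (if i = k & x = b then 1 else 0) - (if i = l & x = b' then 1 else 0)" for i x
 let ?K = "Suc (max k l)"
 have single: "(\<Sum>i<?K. \<Sum>x\<in>B. cscale (if i = k & x = b then 1 else 0) ((f ^^ i) x)) = (f ^^ k) b"
  if "k \<le> max k' l'" "?K = Suc (max k' l')" "b \<in> B" for k b k' l'
 proof -
  have "(\<Sum>x\<in>B. cscale (if i = k & x = b then 1 else 0) ((f ^^ i) x)) = (if i = k then (f ^^ k) b else 0)" for i
  proof -
   have "(\<Sum>x\<in>B. cscale (if i = k & x = b then 1 else 0) ((f ^^ i) x)) = (\<Sum>x\<in>B. if x = b then (if i = k then (f ^^ k) b else 0) else 0)"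
    by (intro sum.cong) auto
   then show ?thesis using that(3) BD(1) by simp
  qed
  then show ?thesis using that(1,2) by (simp del: sum.lessThan_Suc)
 qed
 have "(\<Sum>i<?K. \<Sum>x\<in>B. cscale (c i x) ((f ^^ i) x)) = (f ^^ k) b - (f ^^ l) b'"
  unfolding c_def cs.scale_left_diff_distrib sum_subtractf
  using single[of k k l b] single[of l k l b'] eq(2,3) by (simp del: sum.lessThan_Suc)
 then have "(\<Sum>i<?K. \<Sum>x\<in>B. cscale (c i x) ((f ^^ i) x)) = 0" using eq by simp
 then have "c k b = 0" by (rule f_pow_family_independent[OF B]) (use eq in auto)
 then show False using ne by (auto simp: c_def split: if_splits)
qed

lemma f_pow_independent:
 assumes B: "hw_generated (coset mu) B" "cs.independent B"
 shows "cs.independent {(f ^^ k) b | k b. b \<in> B}" (is "cs.independent ?S")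
 unfolding cs.independent_explicit_finite_subsets
proof (intro allI impI ballI)
 note BD = hw_generatedD[OF B(1)]
 fix A u v assume A: "A \<subseteq> ?S" "finite A" and u: "(\<Sum>v\<in>A. cscale (u v) v) = 0" and v: "v \<in> A"
 have "\<forall>x\<in>A. \<exists>k. \<exists>b\<in>B. x = (f ^^ k) b" using A(1) by blast
 then obtain ka where ka: "!!x. x \<in> A ==> \<exists>b\<in>B. x = (f ^^ ka x) b" by metis
 define K where "K = Suc (Max (insert 0 (ka ` A)))"
 have K: "ka x < K" if "x \<in> A" for x using that A(2) by (auto simp: K_def less_Suc_eq_le)
 define u' where "u' x = (if x \<in> A then u x else 0)" for x
 let ?p = "\<lambda>(k, b). (f ^^ k) b"
 have inj: "inj_on ?p ({..<K} \<times> B)"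
  by (rule inj_onI) (use f_pow_inj[OF B] in auto)
 have "0 = (\<Sum>x\<in>A. cscale (u' x) x)" using u by (simp add: u'_def)
 also have "... = (\<Sum>x\<in>?p ` ({..<K} \<times> B). cscale (u' x) x)"
  by (rule sum.mono_neutral_left) (use BD(1) K ka in \<open>force simp: u'_def\<close>)+
 also have "... = (\<Sum>y\<in>{..<K} \<times> B. cscale (u' (?p y)) (?p y))" by (subst sum.reindex[OF inj]) simp
 also have "... = (\<Sum>k<K. \<Sum>b\<in>B. cscale (u' ((f ^^ k) b)) ((f ^^ k) b))"
  by (simp add: sum.cartesian_product case_prod_beta)
 finally have s0: "(\<Sum>k<K. \<Sum>b\<in>B. cscale (u' ((f ^^ k) b)) ((f ^^ k) b)) = 0" by simp
 obtain b where b: "b \<in> B" "v = (f ^^ ka v) b" using ka[OF v] by auto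
 have "u' ((f ^^ ka v) b) = 0"
  by (rule f_pow_family_independent[OF B, where c = "%k b. u' ((f ^^ k) b)", OF s0 K[OF v] b(1)])
 then show "u v = 0" using b(2) v by (simp add: u'_def)
qed

text \<open>Freeness of Verma modules: the vectors \<open>f^k b\<close> are independent, so
  \<open>f^k b\<close> may be sent to \<open>f^k (g b)\<close>; compatibility with \<open>e\<close>
  holds because the same scalars \<open>(k + 1) (w - k)\<close> occur on both sides.\<close>

lemma hw_extension:
 assumes B: "hw_generated (coset mu) B" "cs.independent B" and N: "N \<in> sl2_modules"
  and g: "!!b. b \<in> B ==> act N sl2_e (g b) = 0"
   "!!b w. b \<in> B ==> b \<in> wt_space (car M) h w ==> g b \<in> wt_space (car N) (act N sl2_h) w"
 shows "\<exists>ph. arr ph & src ph = M & tgt ph = N & (\<forall>b\<in>B. fn ph b = g b)"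
proof -
 note BD = hw_generatedD[OF B(1)]
 interpret N: sl2_rep "car N" "act N sl2_e" "act N sl2_h" "act N sl2_f" by (rule sl2_module_rep[OF N])
 let ?S = "{(f ^^ k) b | k b. b \<in> B}"
 define G where "G x = (case (SOME (k, b). b \<in> B & x = (f ^^ k) b) of (k, b) => (act N sl2_f ^^ k) (g b))" for x
 have G: "G ((f ^^ k) b) = (act N sl2_f ^^ k) (g b)" if b: "b \<in> B" for k b
 proof -
  have "(SOME (k', b'). b' \<in> B & (f ^^ k) b = (f ^^ k') b') = (k, b)"
   by (rule some_equality) (use b f_pow_inj[OF B] in auto)
  then show ?thesis by (simp add: G_def)
 qed
 have gN: "g b \<in> car N" if b: "b \<in> B" for b using g(2)[OF b] BD(6)[OF b] wt_space_in by blast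
 obtain T where T: "Vector_Spaces.linear cscale cscale T" "!!x. x \<in> ?S ==> T x = G x"
  using vector_space_pair.linear_independent_extend[OF vector_space_pair.intro[OF cs.vector_space_axioms cs.vector_space_axioms]
    f_pow_independent[OF B], of G] by blast
 have lin: "linear_on V T" for V
  using T(1) by (auto simp: linear_on_def Vector_Spaces.linear_iff)
 have Tb: "T ((f ^^ k) b) = (act N sl2_f ^^ k) (g b)" if "b \<in> B" for k b
 proof -
  have "(f ^^ k) b \<in> ?S" using that by blast
  then show ?thesis using T(2) G[OF that] by simp
 qed
 have SV: "?S \<subseteq> car M" using BD(4) by auto
 have into: "T v \<in> car N" if "v \<in> car M" for v
 proof -
  have "cs.span ?S \<subseteq> {v \<in> car M. T v \<in> car N}"
   by (rule span_sub) (use SV Tb gN in \<open>auto intro!: linear_on_vimage_subspace lin\<close>)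
  then show ?thesis using BD(3) that by blast
 qed
 have "arr (sl2_arr M N T)"
 proof (rule arr_sl2_arrI2[OF module_in N lin into])
  fix v assume "v \<in> car M"
  then have v: "v \<in> cs.span ?S" using BD(3) by blast
  have imgs: "e ` car M \<subseteq> car M" "f ` car M \<subseteq> car M" "T ` car M \<subseteq> car N" using into by auto
  show "T (f v) = act N sl2_f (T v)"
  proof (rule linear_on_eq_on_span[OF linear_on_comp(2)[OF linear_f lin imgs(2)] linear_on_comp(2)[OF lin N.linear_f imgs(3)] subspace_V SV _ v])
   fix x assume "x \<in> ?S"
   then obtain k b where x: "x = (f ^^ k) b" "b \<in> B" by auto
   then show "T (f x) = act N sl2_f (T x)" using Tb[of b "Suc k"] Tb[of b k] by simp
  qed
  show "T (e v) = act N sl2_e (T v)"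
  proof (rule linear_on_eq_on_span[OF linear_on_comp(2)[OF linear_e lin imgs(1)] linear_on_comp(2)[OF lin N.linear_e imgs(3)] subspace_V SV _ v])
   fix x assume "x \<in> ?S"
   then obtain k b where x: "x = (f ^^ k) b" "b \<in> B" by auto
   obtain w where w: "b \<in> wt_space (car M) h w" using BD(6)[OF x(2)] by auto
   note gw = g(2)[OF x(2) w] g(1)[OF x(2)]
   have T0: "T 0 = 0" by (rule linear_on_0[OF lin subspace_V])
   show "T (e x) = act N sl2_e (T x)"
   proof (cases k)
    case 0
    then show ?thesis using x BD(5)[OF x(2)] Tb[OF x(2), of 0] gw(2) T0 by simp
   next
    case (Suc l)
    have "T (e x) = cscale (of_nat (Suc l) * (w - of_nat l)) (T ((f ^^ l) b))"
     unfolding x Suc e_f_pow_hw[OF w BD(5)[OF x(2)]] using x(2) BD(4) by (intro linear_on_scale[OF lin[of "car M"]]) auto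
    also have "... = act N sl2_e (T x)"
     unfolding x Suc Tb[OF x(2)] N.e_f_pow_hw[OF gw] ..
    finally show ?thesis .
   qed
  qed
 qed
 moreover have "fn (sl2_arr M N T) b = g b" if "b \<in> B" for b
  using Tb[OF that, of 0] BD(4)[OF that] by simp
 ultimately show ?thesis by (intro exI[of _ "sl2_arr M N T"]) simp
qed

end

text \<open>The bijection of bases and its inverse both extend, and the composites fix the
  generators. A nonzero vector has only one weight, so the weights given by \<open>w\<close> are the
  ones \<open>hw_extension\<close> asks about.\<close>

lemma iso_of_hw_bases:
 assumes M: "verma M mu" and N: "verma N mu"
  and B: "sl2_rep.hw_generated (car M) (act M sl2_e) (act M sl2_h) (act M sl2_f) (coset mu) B" "cs.independent B"
  and B': "sl2_rep.hw_generated (car N) (act N sl2_e) (act N sl2_h) (act N sl2_f) (coset mu) (g ` B)"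
   "cs.independent (g ` B)" "inj_on g B"
  and w: "!!b. b \<in> B ==> b \<in> wt_space (car M) (act M sl2_h) (w b)"
   "!!b. b \<in> B ==> g b \<in> wt_space (car N) (act N sl2_h) (w b)"
  and zero: "0 \<notin> B"
 obtains ph ps where "arr ph" "src ph = M" "tgt ph = N" "arr ps" "src ps = N" "tgt ps = M"
  "sl2_comp ps ph = sl2_id M" "sl2_comp ph ps = sl2_id N"
proof -
 interpret M: verma M mu by (rule M)
 interpret N: verma N mu by (rule N)
 have weq: "x = y" if "v \<in> wt_space V h x" "v \<in> wt_space V h y" "v ~= 0" for v V h x y
  using that by (auto simp: wt_space_def)
 note BD = M.hw_generatedD[OF B(1)] and BD' = N.hw_generatedD[OF B'(1)]
 have zero': "0 \<notin> g ` B" using B'(2) cs.dependent_zero by auto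
 let ?g' = "the_inv_into B g"
 have g': "?g' (g b) = b" if "b \<in> B" for b using the_inv_into_f_f[OF B'(3) that] .
 have "\<exists>ph. arr ph & src ph = M & tgt ph = N & (\<forall>b\<in>B. fn ph b = g b)"
 proof (rule M.hw_extension[OF B N.module_in])
  fix b x assume b: "b \<in> B" "b \<in> wt_space (car M) (act M sl2_h) x"
  have "b ~= 0" using b(1) zero by auto
  then have "x = w b" by (rule weq[OF b(2) w(1)[OF b(1)]])
  then show "g b \<in> wt_space (car N) (act N sl2_h) x" using w(2)[OF b(1)] by simp
 qed (use BD'(5) in auto)
 then obtain ph where ph: "arr ph" "src ph = M" "tgt ph = N" "!!b. b \<in> B ==> fn ph b = g b" by blast
 have "\<exists>ps. arr ps & src ps = N & tgt ps = M & (\<forall>c\<in>g ` B. fn ps c = ?g' c)"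
 proof (rule N.hw_extension[OF B'(1,2) M.module_in, of ?g'])
  fix c assume "c \<in> g ` B"
  then obtain b where b: "b \<in> B" "c = g b" by auto
  show "act M sl2_e (?g' c) = 0" using BD(5)[OF b(1)] g'[OF b(1)] b(2) by simp
  fix x assume "c \<in> wt_space (car N) (act N sl2_h) x"
  then have "g b \<in> wt_space (car N) (act N sl2_h) x" using b(2) by simp
  moreover have "g b ~= 0" using zero' b(1) by (metis imageI)
  ultimately have "x = w b" by (rule weq[OF _ w(2)[OF b(1)]])
  then show "?g' c \<in> wt_space (car M) (act M sl2_h) x" using w(1)[OF b(1)] g'[OF b(1)] b(2) by simp
 qed
 then obtain ps where ps: "arr ps" "src ps = N" "tgt ps = M" "!!c. c \<in> g ` B ==> fn ps c = ?g' c" by blast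
 have "sl2_comp ps ph = sl2_id M"
  by (rule arr_eq_on_generators[OF B(1)]) (use ph ps g' BD(4) M.module_in in auto)
 moreover have "sl2_comp ph ps = sl2_id N"
  by (rule arr_eq_on_generators[OF B'(1)]) (use ph ps g' BD'(4) N.module_in in auto)
 ultimately show ?thesis using that ph ps by blast
qed

section \<open>The sequence functor is an equivalence\<close>

definition seq_arr :: "complex => sl2_arrow => sl2_arrow" where
 "seq_arr mu ph = sl2_arr (seq_module mu (src ph)) (seq_module mu (tgt ph)) (map_rows (fn ph))"

lemma src_tgt_seq_arr [simp]: "src (seq_arr mu ph) = seq_module mu (src ph)" "tgt (seq_arr mu ph) = seq_module mu (tgt ph)"
 by (simp_all add: seq_arr_def)

lemma trow_seq_arr: "t \<in> car (seq_module mu (src ph)) ==> trow (fn (seq_arr mu ph) t) n = fn ph (trow t n)"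
 by (simp add: seq_arr_def del: seq_sel)

lemma trow_seq_module:
 assumes "verma M mu" "t \<in> car (seq_module mu M)"
 shows "trow t n \<in> car M"
proof -
 have "t \<in> seq_space (car M) (act M sl2_e)" by (rule subsetD[OF verma.seq_fin_subset[OF assms(1)] assms(2)])
 then show ?thesis by (simp add: seq_space_def)
qed

lemma linear_map_rows_seq:
 assumes "linear_on V T" "!!t n. t \<in> S ==> trow t n \<in> V"
 shows "linear_on S (map_rows T)"
 by (rule linear_onI; rule trow_ext)
  (simp_all add: trow_simps linear_on_add[OF assms(1)] linear_on_scale[OF assms(1)] assms(2))

lemma arr_seq_arr:
 assumes ph: "arr ph" and M: "verma (src ph) mu" and N: "verma (tgt ph) mu"
 shows "arr (seq_arr mu ph)"
 unfolding seq_arr_def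
proof (rule arr_sl2_arrI2)
 interpret M: verma "src ph" mu by (rule M)
 interpret N: verma "tgt ph" mu by (rule N)
 let ?M = "src ph" and ?N = "tgt ph"
 note lin = arr_linear[OF ph]
 have act: "fn ph (act ?M x v) = act ?N x (fn ph v)" if "x \<in> sl2" "v \<in> car ?M" for x v by (rule arr_act[OF ph that])
 have D: "trow t n \<in> car ?M" if "t \<in> seq_space (car ?M) (act ?M sl2_e)" for t n using that by (simp add: seq_space_def)
 have linS: "linear_on (seq_space (car ?M) (act ?M sl2_e)) (map_rows (fn ph))"
  by (rule linear_map_rows_seq[OF lin D])
 have S: "map_rows (fn ph) t \<in> seq_space (car ?N) (act ?N sl2_e)" if "t \<in> seq_space (car ?M) (act ?M sl2_e)" for t
  unfolding seq_space_def mem_Collect_eq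
 proof (intro conjI allI)
  fix n
  show "trow (map_rows (fn ph) t) n \<in> car ?N" using D[OF that] ph by simp
  show "act ?N sl2_e (trow (map_rows (fn ph) t) (Suc n)) = trow (map_rows (fn ph) t) n"
   using act[of sl2_e "trow t (Suc n)"] D[OF that] M.seq_spaceD(3)[OF that] by simp
  show "trow (map_rows (fn ph) t) 0 = 0" using M.seq_spaceD(2)[OF that] arr_0[OF ph] by simp
 qed
 have h: "map_rows (fn ph) (seq_h (act ?M sl2_h) t) = seq_h (act ?N sl2_h) (map_rows (fn ph) t)"
  if "t \<in> seq_space (car ?M) (act ?M sl2_e)" for t
  by (rule trow_ext) (use D[OF that] in \<open>simp add: linear_on_add[OF lin] linear_on_scale[OF lin] act\<close>)
 show "linear_on (car (seq_module mu ?M)) (map_rows (fn ph))"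
  by (rule linear_on_subset[OF linS M.seq_fin_subset])
 show "map_rows (fn ph) t \<in> car (seq_module mu ?N)" if t: "t \<in> car (seq_module mu ?M)" for t
 proof -
  let ?A = "\<Union>w\<in>coset mu. wt_space (seq_space (car ?M) (act ?M sl2_e)) (seq_h (act ?M sl2_h)) w"
  have "cs.span ?A \<subseteq> {t \<in> seq_space (car ?M) (act ?M sl2_e). map_rows (fn ph) t \<in> car (seq_module mu ?N)}"
  proof (rule span_sub)
   show "cs.subspace {t \<in> seq_space (car ?M) (act ?M sl2_e). map_rows (fn ph) t \<in> car (seq_module mu ?N)}"
    by (intro linear_on_vimage_subspace linS M.seq_space_subspace sl2_module_subspace N.seq_module_in)
   show "?A \<subseteq> {t \<in> seq_space (car ?M) (act ?M sl2_e). map_rows (fn ph) t \<in> car (seq_module mu ?N)}"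
   proof
    fix t assume "t \<in> ?A"
    then obtain w where w: "w \<in> coset mu" and t: "t \<in> seq_space (car ?M) (act ?M sl2_e)" "seq_h (act ?M sl2_h) t = cscale w t"
     by (auto simp: wt_space_def)
    have "map_rows (fn ph) t \<in> wt_space (seq_space (car ?N) (act ?N sl2_e)) (seq_h (act ?N sl2_h)) w"
     unfolding wt_space_def using S[OF t(1)] h[OF t(1)] t linear_on_scale[OF linS t(1)] by simp
    then have "map_rows (fn ph) t \<in> car (seq_module mu ?N)"
     unfolding seq_sel seq_fin_def using w by (intro cs.span_base) blast
    then show "t \<in> {t \<in> seq_space (car ?M) (act ?M sl2_e). map_rows (fn ph) t \<in> car (seq_module mu ?N)}" using t by blast
   qed
  qed
  then show ?thesis using t unfolding seq_sel(1)[of mu ?M] seq_fin_def by blast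
 qed
 fix t assume "t \<in> car (seq_module mu ?M)"
 then have t: "t \<in> seq_space (car ?M) (act ?M sl2_e)" using M.seq_fin_subset by blast
 note Dt = D[OF t]
 show "map_rows (fn ph) (act (seq_module mu ?M) sl2_e t) = act (seq_module mu ?N) sl2_e (map_rows (fn ph) t)"
  by (rule trow_ext) (use Dt in \<open>simp add: trow_simps linear_on_add[OF lin] linear_on_scale[OF lin] linear_on_minus[OF lin]
    linear_on_diff[OF lin M.subspace_V] act del: of_nat_Suc\<close>)
 show "map_rows (fn ph) (act (seq_module mu ?M) sl2_f t) = act (seq_module mu ?N) sl2_f (map_rows (fn ph) t)"
  by (rule trow_ext) (use Dt in \<open>simp add: trow_simps linear_on_minus[OF lin] act\<close>)
qed (use assms verma.seq_module_in in auto)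

lemma seq_arr_ops:
 assumes ph: "arr ph" and M: "verma (src ph) mu" and N: "verma (tgt ph) mu"
 shows "seq_arr mu (sl2_id (src ph)) = sl2_id (seq_module mu (src ph))"
  and "seq_arr mu (sl2_scale c ph) = sl2_scale c (seq_arr mu ph)"
  and "arr ps ==> src ps = src ph ==> tgt ps = tgt ph ==> seq_arr mu (sl2_add ph ps) = sl2_add (seq_arr mu ph) (seq_arr mu ps)"
  and "arr ps ==> src ps = tgt ph ==> verma (tgt ps) mu ==> seq_arr mu (sl2_comp ps ph) = sl2_comp (seq_arr mu ps) (seq_arr mu ph)"
proof -
 note mem = verma.seq_module_in[OF M] and row = trow_seq_module[OF M]
 note simps = trow_simps trow_seq_arr row assms mem arr_seq_arr verma.seq_module_in
 show "seq_arr mu (sl2_id (src ph)) = sl2_id (seq_module mu (src ph))"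
  by (rule arr_ext; (rule trow_ext)?) (simp_all add: simps del: seq_sel)
 show "seq_arr mu (sl2_scale c ph) = sl2_scale c (seq_arr mu ph)"
  by (rule arr_ext; (rule trow_ext)?) (simp_all add: simps del: seq_sel)
 show "seq_arr mu (sl2_add ph ps) = sl2_add (seq_arr mu ph) (seq_arr mu ps)" if "arr ps" "src ps = src ph" "tgt ps = tgt ph"
  by (rule arr_ext; (rule trow_ext)?) (use that in \<open>simp_all add: simps del: seq_sel\<close>)
 show "seq_arr mu (sl2_comp ps ph) = sl2_comp (seq_arr mu ps) (seq_arr mu ph)" if "arr ps" "src ps = tgt ph" "verma (tgt ps) mu"
 proof -
  have "fn (seq_arr mu ph) t \<in> car (seq_module mu (src ps))" if "t \<in> car (seq_module mu (src ph))" for t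
   using arr_in[OF arr_seq_arr[OF assms], of t] that \<open>src ps = tgt ph\<close> by (simp del: seq_sel)
  then show ?thesis
   by - (rule arr_ext; (rule trow_ext)?; use that in \<open>simp_all add: simps del: seq_sel\<close>)
 qed
qed

text \<open>A lowest weight sequence is determined by its first entry, so arrows of sequence modules are
  determined on lowest weight vectors by arrows between the original highest weight vectors.\<close>

lemma seq_arr_fully_faithful:
 assumes M: "verma M mu" and N: "verma N mu"
  and ps: "arr ps" "src ps = seq_module mu M" "tgt ps = seq_module mu N"
 shows "\<exists>!ph. arr ph & src ph = M & tgt ph = N & seq_arr mu ph = ps"
proof -
 interpret M: verma M mu by (rule M)
 interpret N: verma N mu by (rule N)
 obtain B where B: "M.hw_generated (coset mu) B" "cs.independent B" by (rule M.basis)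
 note BD = M.hw_generatedD[OF B(1)]
 have "\<forall>b\<in>B. \<exists>w. w \<in> coset mu & b \<in> wt_space (car M) (act M sl2_h) w" using BD(6) by blast
 then obtain w where w: "!!b. b \<in> B ==> w b \<in> coset mu & b \<in> wt_space (car M) (act M sl2_h) (w b)" by metis
 let ?J = "%b. M.lowest (w b) b"
 note hw = M.seq_hw[OF B w]
 have row1: "trow (?J b) 1 = b" for b by (simp add: ef_scalar_def)
 have J_in: "?J b \<in> car (seq_module mu M)" if "b \<in> B" for b using wt_space_in[OF hw(5)[OF _ that]] by simp
 \<comment> \<open>Row \<open>1\<close> of the image is a highest weight vector of \<open>N\<close>
   of weight \<open>w b\<close>: the candidate for the image of \<open>b\<close> itself.\<close>
 define g where "g b = trow (fn ps (?J b)) 1" for b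
 have psJ: "fn ps (?J b) \<in> car (seq_module mu N)" if "b \<in> B" for b
  using arr_in[OF ps(1)] J_in[OF that] ps(2,3) by (simp del: seq_sel)
 have psS: "fn ps (?J b) \<in> seq_space (car N) (act N sl2_e)" if "b \<in> B" for b
  using psJ[OF that] N.seq_fin_subset by blast
 have pse: "seq_f (act N sl2_h) (act N sl2_f) (fn ps (?J b)) = 0" if "b \<in> B" for b
 proof -
  have "fn ps (act (seq_module mu M) sl2_e (?J b)) = act (seq_module mu N) sl2_e (fn ps (?J b))"
   using arr_act[OF ps(1), of sl2_e "?J b"] J_in[OF that] ps(2,3) by (simp del: seq_sel)
  then show ?thesis using hw(6)[OF _ that] arr_0[OF ps(1)] by simp
 qed
 have psh: "seq_h (act N sl2_h) (fn ps (?J b)) = cscale (w b + 2) (fn ps (?J b))" if "b \<in> B" for b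
 proof -
  have J: "act (seq_module mu M) sl2_h (?J b) = cscale (- w b - 2) (?J b)"
   using hw(5)[OF _ that] by (simp add: wt_space_def del: seq_sel)
  have "fn ps (act (seq_module mu M) sl2_h (?J b)) = act (seq_module mu N) sl2_h (fn ps (?J b))"
   using arr_act[OF ps(1), of sl2_h "?J b"] J_in[OF that] ps(2,3) by (simp del: seq_sel)
  moreover have "fn ps (cscale (- w b - 2) (?J b)) = cscale (- w b - 2) (fn ps (?J b))"
   by (rule arr_cscale[OF ps(1)]) (use J_in[OF that] ps(2) in \<open>simp del: seq_sel\<close>)
  ultimately have "- seq_h (act N sl2_h) (fn ps (?J b)) = cscale (- w b - 2) (fn ps (?J b))"
   unfolding J by simp
  then have "seq_h (act N sl2_h) (fn ps (?J b)) = - cscale (- w b - 2) (fn ps (?J b))" by (metis minus_minus)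
  then show ?thesis by (simp add: fun_eq_iff cscale_def algebra_simps)
 qed
 have ge: "act N sl2_e (g b) = 0" if "b \<in> B" for b
  unfolding g_def using N.seq_spaceD(3)[OF psS[OF that], of 0] N.seq_spaceD(2)[OF psS[OF that]] by simp
 have gw: "g b \<in> wt_space (car N) (act N sl2_h) x" if b: "b \<in> B" "b \<in> wt_space (car M) (act M sl2_h) x" for b x
 proof -
  have "b ~= 0" using b(1) B(2) cs.dependent_zero by auto
  then have x: "x = w b" using b w[OF b(1)] by (auto simp: wt_space_def)
  have "trow (seq_h (act N sl2_h) (fn ps (?J b))) 1 = cscale (w b + 2) (g b)"
   unfolding psh[OF b(1)] by (simp add: trow_simps g_def)
  then have "act N sl2_h (g b) + cscale 2 (g b) = cscale (w b) (g b) + cscale 2 (g b)"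
   by (simp add: g_def cs.scale_left_distrib)
  then show ?thesis
   using N.seq_spaceD(1)[OF psS[OF b(1)]] x by (simp add: wt_space_def g_def)
 qed
 obtain ph where ph: "arr ph" "src ph = M" "tgt ph = N" "!!b. b \<in> B ==> fn ph b = g b"
  using M.hw_extension[OF B N.module_in, where g = g, OF ge gw] by blast
 have Fph: "arr (seq_arr mu ph)" using arr_seq_arr[OF ph(1)] M N ph(2,3) by simp
 have "seq_arr mu ph = ps"
 proof (rule arr_eq_on_generators[OF hw(2) Fph _ ps(1,2)])
  fix c assume "c \<in> ?J ` B"
  then obtain b where b: "b \<in> B" "c = ?J b" by auto
  let ?x = "fn (seq_arr mu ph) (?J b)" and ?y = "fn ps (?J b)"
  have xF: "?x \<in> car (seq_module mu N)" using arr_in[OF Fph] J_in[OF b(1)] ph(2,3) by (simp del: seq_sel)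
  then have xS: "?x \<in> seq_space (car N) (act N sl2_e)" using N.seq_fin_subset by blast
  have "fn (seq_arr mu ph) (act (seq_module mu M) sl2_e (?J b)) = act (seq_module mu N) sl2_e ?x"
   using arr_act[OF Fph, of sl2_e "?J b"] J_in[OF b(1)] ph(2,3) by (simp del: seq_sel)
  then have xe: "seq_f (act N sl2_h) (act N sl2_f) ?x = 0" using hw(6)[OF _ b(1)] arr_0[OF Fph] by simp
  interpret S: sl2_rep "seq_space (car N) (act N sl2_e)" "map_rows (act N sl2_e)" "seq_h (act N sl2_h)" "seq_f (act N sl2_h) (act N sl2_f)"
   by (rule N.seq_rep)
  have "?x - ?y = 0"
  proof (rule N.seq_kernel_unique)
   show "?x - ?y \<in> seq_space (car N) (act N sl2_e)" using xS psS[OF b(1)] by simp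
   show "seq_f (act N sl2_h) (act N sl2_f) (?x - ?y) = 0" using xS psS[OF b(1)] xe pse[OF b(1)] by (simp add: S.lin_simps)
   have "trow ?x 1 = g b" using J_in[OF b(1)] ph(2,4) b(1) row1[of b] by (simp add: trow_seq_arr del: seq_sel M.trow_lowest)
   then show "trow (?x - ?y) 1 = 0" by (simp add: trow_simps g_def)
  qed
  then show "fn (seq_arr mu ph) c = fn ps c" using b(2) by simp
 qed (use ph ps in auto)
 moreover have "ph1 = ph2" if 1: "arr ph1" "src ph1 = M" "tgt ph1 = N" and 2: "arr ph2" "src ph2 = M" "tgt ph2 = N"
  and eq: "seq_arr mu ph1 = seq_arr mu ph2" for ph1 ph2
 proof (rule arr_eq_on_generators[OF B(1) 1(1,2) 2(1,2)])
  fix b assume b: "b \<in> B"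
  have "trow (fn (seq_arr mu ph1) (?J b)) 1 = trow (fn (seq_arr mu ph2) (?J b)) 1" using eq by simp
  then show "fn ph1 b = fn ph2 b"
   using J_in[OF b] 1(2) 2(2) row1[of b] by (simp add: trow_seq_arr del: seq_sel M.trow_lowest)
 qed (use 1 2 in simp)
 ultimately show ?thesis using ph by metis
qed

lemma verma_neg: "verma M mu ==> verma (seq_module mu M) (- mu)"
proof -
 assume "verma M mu"
 then interpret M: verma M mu .
 obtain B where B: "M.hw_generated (coset mu) B" "cs.independent B" by (rule M.basis)
 note BD = M.hw_generatedD[OF B(1)]
 have "\<forall>b\<in>B. \<exists>w. w \<in> coset mu & b \<in> wt_space (car M) (act M sl2_h) w" using BD(6) by blast
 then obtain w where w: "!!b. b \<in> B ==> w b \<in> coset mu & b \<in> wt_space (car M) (act M sl2_h) (w b)" by metis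
 have "- mu \<notin> \<int>" using M.nonint Ints_minus[of "- mu"] by auto
 then show "verma (seq_module mu M) (- mu)" using M.seq_hw(1)[OF B w] by (intro vermaI) auto
qed

text \<open>Applying the construction twice reflects weights twice, \<open>w\<close> to
  \<open>- w - 2\<close> and back to \<open>w\<close>, so \<open>N\<close> and its double sequence
  module have highest weight bases with matching weights.\<close>

lemma seq_essentially_surjective:
 assumes N: "verma N (- mu)"
 obtains M ph ps where "verma M mu" "arr ph" "src ph = N" "tgt ph = seq_module mu M" "arr ps" "src ps = seq_module mu M" "tgt ps = N"
  "sl2_comp ps ph = sl2_id N" "sl2_comp ph ps = sl2_id (seq_module mu M)"
proof -
 interpret N: verma N "- mu" by (rule N)
 define M where "M = seq_module (- mu) N"
 have M: "verma M mu" using verma_neg[OF N] by (simp add: M_def)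
 interpret M: verma M mu by (rule M)
 obtain B where B: "N.hw_generated (coset (- mu)) B" "cs.independent B" by (rule N.basis)
 note BD = N.hw_generatedD[OF B(1)]
 have "\<forall>b\<in>B. \<exists>w. w \<in> coset (- mu) & b \<in> wt_space (car N) (act N sl2_h) w" using BD(6) by blast
 then obtain w where w: "!!b. b \<in> B ==> w b \<in> coset (- mu) & b \<in> wt_space (car N) (act N sl2_h) (w b)" by metis
 let ?J = "%b. N.lowest (w b) b"
 note hw = N.seq_hw[OF B w, folded M_def]
 define w' where "w' c = - w (the_inv_into B ?J c) - 2" for c
 have w'J: "w' (?J b) = - w b - 2" if "b \<in> B" for b using the_inv_into_f_f[OF hw(4) that] by (simp add: w'_def)
 have w': "w' c \<in> coset mu & c \<in> wt_space (car M) (act M sl2_h) (w' c)" if c: "c \<in> ?J ` B" for c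
 proof -
  obtain b where b: "b \<in> B" "c = ?J b" using c by auto
  have "- w b - 2 \<in> coset mu"
  proof -
   have "w b - (- mu) \<in> \<int>" using w[OF b(1)] by (simp add: coset_def)
   from Ints_diff[OF Ints_minus[OF this] Ints_numeral[of "num.Bit0 num.One"]]
   have "- (w b - (- mu)) - 2 \<in> \<int>" .
   moreover have "(- w b - 2) - mu = - (w b - (- mu)) - 2" by simp
   ultimately show ?thesis unfolding coset_def mem_Collect_eq by (simp only:)
  qed
  then show ?thesis using hw(5)[OF _ b(1)] w'J[OF b(1)] b(2) by simp
 qed
 have gen: "M.hw_generated (coset mu) (?J ` B)" using hw(2) by simp
 let ?K = "%c. M.lowest (w' c) c"
 note hw2 = M.seq_hw[OF gen hw(3) w']
 have nn: "verma (seq_module mu M) (- mu)" by (rule verma_neg[OF M])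
 have img: "?K ` ?J ` B = (%b. ?K (?J b)) ` B" by auto
 show ?thesis
 proof (rule iso_of_hw_bases[OF N nn B, of "%b. ?K (?J b)" w])
  show "inj_on (%b. ?K (?J b)) B" using comp_inj_on[OF hw(4) hw2(4)] by (simp add: o_def)
  fix b assume b: "b \<in> B"
  have "- w' (?J b) - 2 = w b" using w'J[OF b] by simp
  then show "?K (?J b) \<in> wt_space (car (seq_module mu M)) (act (seq_module mu M) sl2_h) (w b)"
   using hw2(5)[of "?J b"] b by (simp del: seq_sel)
 next
  show "0 \<notin> B" using B(2) cs.dependent_zero by auto
 next
  fix ph ps assume "arr ph" "src ph = N" "tgt ph = seq_module mu M" "arr ps" "src ps = seq_module mu M" "tgt ps = N"
   "sl2_comp ps ph = sl2_id N" "sl2_comp ph ps = sl2_id (seq_module mu M)"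
  then show thesis by (rule that[OF M])
 qed (use hw2(2,3) w img in \<open>simp_all del: seq_sel\<close>)
qed

lemma sl2_comp_assoc: "arr f ==> arr g ==> arr k ==> src g = tgt f ==> src k = tgt g ==>
  sl2_comp (sl2_comp k g) f = sl2_comp k (sl2_comp g f)"
 by (rule arr_ext) simp_all

lemma sl2_comp_id [simp]: "arr f ==> tgt f = M ==> sl2_comp (sl2_id M) f = f" "arr f ==> src f = M ==> sl2_comp f (sl2_id M) = f"
 by (rule arr_ext; auto)+

text \<open>Fully faithful and essentially surjective functors are equivalences: the quasi-inverse
  is chosen on objects, and an arrow is conjugated with the chosen isomorphisms and then lifted
  uniquely.\<close>

lemma sl2_equivalenceI:
 assumes S: "S \<subseteq> sl2_modules" and T: "T \<subseteq> sl2_modules"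
  and F: "linear_functor (sl2_module_cat S) (sl2_module_cat T) Fo Fa"
  and ff: "!!a b ps. a \<in> S ==> b \<in> S ==> arr ps ==> src ps = Fo a ==> tgt ps = Fo b ==>
   \<exists>!ph. arr ph & src ph = a & tgt ph = b & Fa ph = ps"
  and es: "!!d. d \<in> T ==> \<exists>c ph ps. c \<in> S & arr ph & src ph = Fo c & tgt ph = d & arr ps & src ps = d & tgt ps = Fo c &
   sl2_comp ps ph = sl2_id (Fo c) & sl2_comp ph ps = sl2_id d"
 shows "equivalence_functor (sl2_module_cat S) (sl2_module_cat T) Fo Fa"
proof -
 have S' [simp]: "a \<in> S ==> a \<in> sl2_modules" and T' [simp]: "d \<in> T ==> d \<in> sl2_modules" for a d using S T by auto
 have Fo [simp]: "Fo a \<in> T" "Fo a \<in> sl2_modules" "Fa (sl2_id a) = sl2_id (Fo a)" if "a \<in> S" for a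
  using F that T by (auto simp: linear_functor_def)
 have Fa: "arr (Fa f)" "src (Fa f) = Fo (src f)" "tgt (Fa f) = Fo (tgt f)" "Fa (sl2_scale x f) = sl2_scale x (Fa f)"
  "!!g. arr g ==> src g = src f ==> tgt g = tgt f ==> Fa (sl2_add f g) = sl2_add (Fa f) (Fa g)"
  "!!g. arr g ==> src g = tgt f ==> tgt g \<in> S ==> Fa (sl2_comp g f) = sl2_comp (Fa g) (Fa f)"
  if "arr f" "src f \<in> S" "tgt f \<in> S" for f x
  using F that unfolding linear_functor_def by (auto simp: Hom_iff_arr)
 obtain Go \<epsilon> \<epsilon>' where G: "!!d. d \<in> T ==> Go d \<in> S & arr (\<epsilon> d) & src (\<epsilon> d) = Fo (Go d) & tgt (\<epsilon> d) = d &
   arr (\<epsilon>' d) & src (\<epsilon>' d) = d & tgt (\<epsilon>' d) = Fo (Go d) &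
   sl2_comp (\<epsilon>' d) (\<epsilon> d) = sl2_id (Fo (Go d)) & sl2_comp (\<epsilon> d) (\<epsilon>' d) = sl2_id d"
  using es by metis
 have cancel: "sl2_comp (\<epsilon>' d) (sl2_comp (\<epsilon> d) f) = f" if "d \<in> T" "arr f" "tgt f = Fo (Go d)" for d f
  using that G[of d] by (simp add: sl2_comp_assoc[symmetric])
 have cancel': "sl2_comp (\<epsilon> d) (sl2_comp (\<epsilon>' d) f) = f" if "d \<in> T" "arr f" "tgt f = d" for d f
  using that G[of d] by (simp add: sl2_comp_assoc[symmetric])
 define lift where "lift a b ps = (THE ph. arr ph & src ph = a & tgt ph = b & Fa ph = ps)" for a b ps
 have lift: "arr (lift a b ps)" "src (lift a b ps) = a" "tgt (lift a b ps) = b" "Fa (lift a b ps) = ps"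
  if "a \<in> S" "b \<in> S" "arr ps" "src ps = Fo a" "tgt ps = Fo b" for a b ps
  using theI'[OF ff[OF that]] unfolding lift_def[symmetric] by auto
 have faithful: "ph = ph'" if "arr ph" "arr ph'" "src ph \<in> S" "tgt ph \<in> S" "src ph' = src ph" "tgt ph' = tgt ph" "Fa ph = Fa ph'" for ph ph'
  using ff[of "src ph" "tgt ph" "Fa ph"] Fa[of ph] that by metis
 define Ga where "Ga g = lift (Go (src g)) (Go (tgt g)) (sl2_comp (\<epsilon>' (tgt g)) (sl2_comp g (\<epsilon> (src g))))" for g
 have Ga: "arr (Ga g)" "src (Ga g) = Go (src g)" "tgt (Ga g) = Go (tgt g)"
  "Fa (Ga g) = sl2_comp (\<epsilon>' (tgt g)) (sl2_comp g (\<epsilon> (src g)))" if "arr g" "src g \<in> T" "tgt g \<in> T" for g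
  unfolding Ga_def using that G[of "src g"] G[of "tgt g"] by (intro lift; simp)+
 have GS [simp]: "Go d \<in> S" if "d \<in> T" for d using G[OF that] by simp
 have lin_G: "linear_functor (sl2_module_cat T) (sl2_module_cat S) Go Ga"
  unfolding linear_functor_def sl2_module_cat_sel
 proof (intro conjI ballI allI)
  fix d assume d: "d \<in> T"
  show "Go d \<in> S" using d by simp
  show "Ga (sl2_id d) = sl2_id (Go d)"
   by (rule faithful) (use d G[OF d] Ga[of "sl2_id d"] in simp_all)
  fix d' g assume d': "d' \<in> T" and "g \<in> sl2_Hom d d'"
  then have g: "arr g" "src g = d" "tgt g = d'" using d by (simp_all add: Hom_iff_arr)
  note Gg = Ga[of g, unfolded g(2,3), OF g(1) d d']
  note G' = G[OF d] G[OF d']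
  show "Ga g \<in> sl2_Hom (Go d) (Go d')" using Gg d d' by (simp add: Hom_iff_arr)
  fix x
  note Gx = Ga[of "sl2_scale x g", simplified, unfolded g(2,3), OF arr_scale[OF g(1)] d d']
  show "Ga (sl2_scale x g) = sl2_scale x (Ga g)"
  proof (rule faithful)
   show "Fa (Ga (sl2_scale x g)) = Fa (sl2_scale x (Ga g))"
    unfolding Gx(4) by (subst Fa(4)) (use Gg d d' G' g in \<open>auto intro!: arr_ext simp: arr_cscale\<close>)
  qed (use Gg Gx d d' in simp_all)
 next
  fix d d' g k assume d: "d \<in> T" and d': "d' \<in> T" and "g \<in> sl2_Hom d d'" "k \<in> sl2_Hom d d'"
  then have g: "arr g" "src g = d" "tgt g = d'" and k: "arr k" "src k = d" "tgt k = d'" by (simp_all add: Hom_iff_arr)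
  note Gg = Ga[of g, unfolded g(2,3), OF g(1) d d'] and Gk = Ga[of k, unfolded k(2,3), OF k(1) d d']
  note G' = G[OF d] G[OF d']
  have arr_gk: "arr (sl2_add g k)" using g k by simp
  note Gx = Ga[of "sl2_add g k", simplified, unfolded g(2,3), OF arr_gk d d']
  show "Ga (sl2_add g k) = sl2_add (Ga g) (Ga k)"
  proof (rule faithful)
   show "Fa (Ga (sl2_add g k)) = Fa (sl2_add (Ga g) (Ga k))"
    unfolding Gx(4) by (subst Fa(5)) (use Gg Gk d d' G' g k in \<open>auto intro!: arr_ext simp: arr_plus\<close>)
  qed (use Gg Gk Gx d d' in simp_all)
 next
  fix d d' d'' g k assume d: "d \<in> T" and d': "d' \<in> T" and d'': "d'' \<in> T" and "g \<in> sl2_Hom d d'" "k \<in> sl2_Hom d' d''"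
  then have g: "arr g" "src g = d" "tgt g = d'" and k: "arr k" "src k = d'" "tgt k = d''" by (simp_all add: Hom_iff_arr)
  note Gg = Ga[of g, unfolded g(2,3), OF g(1) d d'] and Gk = Ga[of k, unfolded k(2,3), OF k(1) d' d'']
  note G' = G[OF d] G[OF d'] G[OF d'']
  have arr_gk: "arr (sl2_comp k g)" using g k by simp
  note Gx = Ga[of "sl2_comp k g", simplified, unfolded g(2,3) k(2,3), OF arr_gk d d'']
  show "Ga (sl2_comp k g) = sl2_comp (Ga k) (Ga g)"
  proof (rule faithful)
   have "Fa (sl2_comp (Ga k) (Ga g)) = sl2_comp (sl2_comp (\<epsilon>' d'') (sl2_comp k (\<epsilon> d'))) (sl2_comp (\<epsilon>' d') (sl2_comp g (\<epsilon> d)))"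
    by (subst Fa(6)) (use Gg Gk d d' d'' in simp_all)
   also have "... = sl2_comp (\<epsilon>' d'') (sl2_comp k (sl2_comp g (\<epsilon> d)))"
    using G' g k d d' d'' by (simp add: sl2_comp_assoc cancel')
   finally show "Fa (Ga (sl2_comp k g)) = Fa (sl2_comp (Ga k) (Ga g))"
    unfolding Gx(4) using G' g k by (simp add: sl2_comp_assoc)
  qed (use Gg Gk Gx d d' d'' in simp_all)
 qed
 define \<eta> where "\<eta> a = lift a (Go (Fo a)) (\<epsilon>' (Fo a))" for a
 define \<eta>' where "\<eta>' a = lift (Go (Fo a)) a (\<epsilon> (Fo a))" for a
 have \<eta>: "arr (\<eta> a)" "src (\<eta> a) = a" "tgt (\<eta> a) = Go (Fo a)" "Fa (\<eta> a) = \<epsilon>' (Fo a)" if "a \<in> S" for a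
  unfolding \<eta>_def using that G[of "Fo a"] by (intro lift; simp)+
 have \<eta>': "arr (\<eta>' a)" "src (\<eta>' a) = Go (Fo a)" "tgt (\<eta>' a) = a" "Fa (\<eta>' a) = \<epsilon> (Fo a)" if "a \<in> S" for a
  unfolding \<eta>'_def using that G[of "Fo a"] by (intro lift; simp)+
 have "natural_iso (sl2_module_cat S) (sl2_module_cat S) id id (Go \<circ> Fo) (Ga \<circ> Fa) \<eta>"
  unfolding natural_iso_def sl2_module_cat_sel
 proof (intro conjI ballI)
  fix a assume a: "a \<in> S"
  have "sl2_comp (\<eta>' a) (\<eta> a) = sl2_id a"
   by (rule faithful) (use a \<eta>[OF a] \<eta>'[OF a] G[of "Fo a"] Fa(6)[of "\<eta> a" "\<eta>' a"] in simp_all)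
  moreover have "sl2_comp (\<eta> a) (\<eta>' a) = sl2_id (Go (Fo a))"
   by (rule faithful) (use a \<eta>[OF a] \<eta>'[OF a] G[of "Fo a"] Fa(6)[of "\<eta>' a" "\<eta> a"] in simp_all)
  ultimately show "\<eta> a \<in> iso_arrows (sl2_module_cat S) (id a) ((Go \<circ> Fo) a)"
   unfolding iso_arrows_def using \<eta>[OF a] \<eta>'[OF a] a by (auto simp: Hom_iff_arr intro!: bexI[of _ "\<eta>' a"])
 next
  fix a b f assume a: "a \<in> S" and b: "b \<in> S" and "f \<in> sl2_Hom a b"
  then have f: "arr f" "src f = a" "tgt f = b" by (simp_all add: Hom_iff_arr)
  have Ff: "arr (Fa f)" "src (Fa f) = Fo a" "tgt (Fa f) = Fo b" using Fa[of f] f a b by simp_all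
  note GF = Ga[of "Fa f", unfolded Ff(2,3), OF Ff(1) Fo(1)[OF a] Fo(1)[OF b]]
  show "sl2_comp (\<eta> b) (id f) = sl2_comp ((Ga \<circ> Fa) f) (\<eta> a)"
  proof (rule faithful)
   have "Fa (sl2_comp (Ga (Fa f)) (\<eta> a)) = sl2_comp (sl2_comp (\<epsilon>' (Fo b)) (sl2_comp (Fa f) (\<epsilon> (Fo a)))) (\<epsilon>' (Fo a))"
    by (subst Fa(6)) (use GF \<eta>[OF a] a b in simp_all)
   also have "... = sl2_comp (\<epsilon>' (Fo b)) (Fa f)"
    using G[of "Fo a"] G[of "Fo b"] Ff a b by (simp add: sl2_comp_assoc)
   also have "... = Fa (sl2_comp (\<eta> b) f)"
    by (subst Fa(6)) (use f \<eta>[OF b] a b in simp_all)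
   finally show "Fa (sl2_comp (\<eta> b) (id f)) = Fa (sl2_comp ((Ga \<circ> Fa) f) (\<eta> a))" by simp
  qed (use f \<eta>[OF a] \<eta>[OF b] GF a b in simp_all)
 qed
 moreover have "natural_iso (sl2_module_cat T) (sl2_module_cat T) (Fo \<circ> Go) (Fa \<circ> Ga) id id \<epsilon>"
  unfolding natural_iso_def sl2_module_cat_sel
 proof (intro conjI ballI)
  fix d assume d: "d \<in> T"
  show "\<epsilon> d \<in> iso_arrows (sl2_module_cat T) ((Fo \<circ> Go) d) (id d)"
   unfolding iso_arrows_def using G[OF d] d by (auto simp: Hom_iff_arr intro!: bexI[of _ "\<epsilon>' d"])
 next
  fix d d' g assume d: "d \<in> T" and d': "d' \<in> T" and "g \<in> sl2_Hom d d'"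
  then have g: "arr g" "src g = d" "tgt g = d'" by (simp_all add: Hom_iff_arr)
  show "sl2_comp (\<epsilon> d') ((Fa \<circ> Ga) g) = sl2_comp (id g) (\<epsilon> d)"
   using Ga(4)[of g] g d d' G[OF d] G[OF d'] by (simp add: cancel')
 qed
 ultimately show ?thesis unfolding equivalence_functor_def using F lin_G by blast
qed

lemma seq_equivalence:
 assumes mu: "mu \<notin> \<int>"
 shows "equivalence_functor (N1 mu) (N1 (- mu)) (seq_module mu) (seq_arr mu)"
proof -
 have mu': "- mu \<notin> \<int>" using mu Ints_minus[of "- mu"] by auto
 let ?A = "\<lambda>mu. additive_closure {L. \<exists>\<nu>. is_L \<nu> L & \<nu> - mu \<in> \<int>}"
 have A: "M \<in> ?A mu \<longleftrightarrow> verma M mu" if "mu \<notin> \<int>" for M mu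
  using additive_closure_verma_sum[of M mu] verma_sum_additive_closure[OF that] vermaI[OF that] verma.verma by blast
 have sub: "?A mu \<subseteq> sl2_modules" for mu by (auto simp: additive_closure_def)
 show ?thesis
  unfolding N1_def
 proof (rule sl2_equivalenceI[OF sub sub])
  show "linear_functor (sl2_module_cat (?A mu)) (sl2_module_cat (?A (- mu))) (seq_module mu) (seq_arr mu)"
   unfolding linear_functor_def sl2_module_cat_sel
  proof (intro conjI ballI allI)
   fix M assume "M \<in> ?A mu"
   then have M: "verma M mu" using A[OF mu] by simp
   show "seq_module mu M \<in> ?A (- mu)" using verma_neg[OF M] A[OF mu'] by simp
   show "seq_arr mu (sl2_id M) = sl2_id (seq_module mu M)"
    using seq_arr_ops(1)[of "sl2_id M" mu] M verma.module_in[OF M] by simp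
   fix N ph assume "N \<in> ?A mu" and "ph \<in> sl2_Hom M N"
   then have N: "verma N mu" and ph: "arr ph" "src ph = M" "tgt ph = N"
    using A[OF mu] verma.module_in[OF M] verma.module_in by (auto simp: Hom_iff_arr)
   show "seq_arr mu ph \<in> sl2_Hom (seq_module mu M) (seq_module mu N)"
    using arr_seq_arr[OF ph(1)] ph(2,3) M N by (simp add: Hom_iff_arr verma.seq_module_in del: seq_sel)
   show "seq_arr mu (sl2_scale x ph) = sl2_scale x (seq_arr mu ph)" for x
    using seq_arr_ops(2)[OF ph(1)] ph(2,3) M N by simp
   show "seq_arr mu (sl2_add ph ps) = sl2_add (seq_arr mu ph) (seq_arr mu ps)" if "ps \<in> sl2_Hom M N" for ps
    using seq_arr_ops(3)[OF ph(1)] ph(2,3) M N that verma.module_in[OF M] verma.module_in[OF N] by (simp add: Hom_iff_arr)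
   show "seq_arr mu (sl2_comp ps ph) = sl2_comp (seq_arr mu ps) (seq_arr mu ph)" if "P \<in> ?A mu" "ps \<in> sl2_Hom N P" for P ps
   proof -
    have P: "verma P mu" using that A[OF mu] by simp
    then have "arr ps" "src ps = N" "tgt ps = P" using that verma.module_in[OF N] verma.module_in[OF P] by (auto simp: Hom_iff_arr)
    then show ?thesis using seq_arr_ops(4)[OF ph(1)] ph(2,3) M N P by simp
   qed
  qed
  show "\<exists>!ph. arr ph & src ph = M & tgt ph = N & seq_arr mu ph = ps"
   if "M \<in> ?A mu" "N \<in> ?A mu" "arr ps" "src ps = seq_module mu M" "tgt ps = seq_module mu N" for M N ps
   using that A[OF mu] by (intro seq_arr_fully_faithful) auto
  fix d assume "d \<in> ?A (- mu)"
  then have "verma d (- mu)" using A[OF mu'] by simp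
  then show "\<exists>c ph ps. c \<in> ?A mu & arr ph & src ph = seq_module mu c & tgt ph = d & arr ps & src ps = d &
    tgt ps = seq_module mu c & sl2_comp ps ph = sl2_id (seq_module mu c) & sl2_comp ph ps = sl2_id d"
  proof (rule seq_essentially_surjective)
   fix M ph ps
   assume "verma M mu" "arr ph" "src ph = d" "tgt ph = seq_module mu M" "arr ps" "src ps = seq_module mu M" "tgt ps = d"
    "sl2_comp ps ph = sl2_id d" "sl2_comp ph ps = sl2_id (seq_module mu M)"
   then show ?thesis using A[OF mu, of M] by (intro exI[of _ M] exI[of _ ps] exI[of _ ph]) (simp del: seq_sel)
  qed
 qed
qed

section \<open>Binomial transforms of sequences\<close>

text \<open>For \<open>B\<close>-divisible sequences \<open>T\<close>, i.e. \<open>T\<^sub>n = B\<^sup>-\<^sup>n\<close> in spirit, this is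
  \<open>(B + c A)\<^sup>-\<^sup>n\<close> expanded in powers of the nilpotent operator \<open>A\<close>.\<close>

definition binomial_transform :: "nat => complex => (cseq => cseq) => (nat => cseq) => nat => cseq" where
 "binomial_transform N c A T n = (\<Sum>k<N. cscale (c ^ k * nbinom n k) ((A ^^ k) (T (n + k))))"

locale nilpotent_operator =
 fixes V :: "cseq set" and A :: "cseq => cseq" and N :: nat
 assumes subspace_V [simp]: "cs.subspace V" and linear_A: "linear_on V A"
  and A_in [simp]: "v \<in> V ==> A v \<in> V" and A_nil: "v \<in> V ==> (A ^^ N) v = 0"
begin

lemma A_image: "A ` V \<subseteq> V" by auto

lemma A_pow_in [simp]: "v \<in> V ==> (A ^^ k) v \<in> V"
 by (rule funpow_in[OF A_image])

lemma linear_A_pow: "linear_on V (A ^^ k)"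
 by (rule linear_on_funpow[OF linear_A A_image])

lemma A_pow_zero: "v \<in> V ==> N \<le> k ==> (A ^^ k) v = 0"
 by (rule funpow_zero_mono[OF A_nil linear_on_0[OF linear_A subspace_V]])

lemma transform_in: "(!!n. T n \<in> V) ==> binomial_transform N c A T n \<in> V"
 unfolding binomial_transform_def by (intro cs.subspace_sum cs.subspace_scale) auto

text \<open>In spirit \<open>((B + c A) - c A)^(- n) = B^(- n)\<close>. The coefficient at
  \<open>A^m\<close> is a multiple of an alternating sum of binomial coefficients, which vanishes
  except for \<open>m = 0\<close>.\<close>

lemma transform_inverse:
 assumes T: "!!n. T n \<in> V"
 shows "binomial_transform N (- c) A (binomial_transform N c A T) n = T n"
proof -
 \<comment> \<open>For \<open>N = 0\<close> the transform is an empty sum, but then \<open>V\<close>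
   contains only zero.\<close>
 have N0: "T n = 0" if "N = 0" using A_nil[OF T] that by simp
 define g where "g k l = cscale ((- c) ^ k * c ^ l * (nbinom n k * nbinom (n + k) l)) ((A ^^ (k + l)) (T (n + k + l)))" for k l
 have "binomial_transform N (- c) A (binomial_transform N c A T) n = (\<Sum>k<N. \<Sum>l<N. g k l)"
  unfolding binomial_transform_def[of N "- c"]
 proof (rule sum.cong[OF refl])
  fix k
  have "(A ^^ k) (binomial_transform N c A T (n + k)) =
    (\<Sum>l<N. cscale (c ^ l * nbinom (n + k) l) ((A ^^ k) ((A ^^ l) (T (n + k + l)))))"
   unfolding binomial_transform_def
   by (subst linear_on_sum[OF linear_A_pow subspace_V])
    (auto simp: T cs.subspace_scale linear_on_scale[OF linear_A_pow])
  then show "cscale ((- c) ^ k * nbinom n k) ((A ^^ k) (binomial_transform N c A T (n + k))) = (\<Sum>l<N. g k l)"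
   by (simp add: g_def cs.scale_sum_right funpow_add mult_ac)
 qed
 also have "... = (\<Sum>m<2*N. \<Sum>k\<le>m. g k (m - k))"
  by (rule diagonal_sum) (auto simp: g_def A_pow_zero T)
 also have "... = (\<Sum>m<2*N. if m = 0 then T n else 0)"
 proof (rule sum.cong[OF refl])
  fix m
  have "(\<Sum>k\<le>m. g k (m - k)) = (\<Sum>k\<le>m. cscale ((- 1) ^ k * of_nat (m choose k) * (c ^ m * nbinom n m)) ((A ^^ m) (T (n + m))))"
  proof (rule sum.cong[OF refl])
   fix k assume "k \<in> {..m}"
   then have k: "k + (m - k) = m" by simp
   have "(- c) ^ k * c ^ (m - k) = (- 1) ^ k * c ^ m"
    using power_add[of c k "m - k"] k by (simp add: power_minus[of c])
   then show "g k (m - k) = cscale ((- 1) ^ k * of_nat (m choose k) * (c ^ m * nbinom n m)) ((A ^^ m) (T (n + m)))"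
    using nbinom_trinomial[of n k "m - k"] k by (simp add: g_def mult_ac add.assoc)
  qed
  also have "... = cscale ((\<Sum>k\<le>m. (- 1) ^ k * of_nat (m choose k)) * (c ^ m * nbinom n m)) ((A ^^ m) (T (n + m)))"
   by (simp only: cs.scale_sum_left sum_distrib_right)
  also have "(\<Sum>k\<le>m. (- 1) ^ k * of_nat (m choose k)) = (if m = 0 then 1 else 0 :: complex)"
   using choose_alternating_sum[of m, where 'a = complex] by auto
  finally show "(\<Sum>k\<le>m. g k (m - k)) = (if m = 0 then T n else 0)" by simp
 qed
 also have "... = T n" using N0 by (cases N) auto
 finally show ?thesis .
qed

text \<open>If \<open>E\<close> lowers the index of \<open>T\<close>, then \<open>E + c A\<close>
  lowers that of the transform: \<open>A\<close> shifts the power by one, and the two resulting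
  series combine by \<open>nbinom_pascal\<close>.\<close>

lemma transform_divisible:
 assumes T: "!!n. T n \<in> V" and E: "linear_on V E" "E ` V \<subseteq> V" "!!v. v \<in> V ==> E (A v) = A (E v)"
  and div: "!!n. E (T (Suc n)) = T n"
 shows "E (binomial_transform N c A T (Suc n)) + cscale c (A (binomial_transform N c A T (Suc n))) = binomial_transform N c A T n"
proof -
 define \<tau> where "\<tau> k = cscale (c ^ k) ((A ^^ k) (T (n + k)))" for k
 have \<tau>N: "\<tau> N = 0" by (simp add: \<tau>_def A_nil T)
 have EA: "E ((A ^^ k) v) = (A ^^ k) (E v)" if "v \<in> V" for k v
  using that by (induction k) (simp_all add: E(3))
 have 1: "E (cscale (c ^ k * nbinom (Suc n) k) ((A ^^ k) (T (Suc n + k)))) = cscale (nbinom (Suc n) k) (\<tau> k)" for k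
  by (simp add: linear_on_scale[OF E(1)] EA T div \<tau>_def mult.commute)
 have 2: "cscale c (A (cscale (c ^ k * nbinom (Suc n) k) ((A ^^ k) (T (Suc n + k))))) = cscale (nbinom (Suc n) k) (\<tau> (Suc k))" for k
  by (simp add: linear_on_scale[OF linear_A] T \<tau>_def mult_ac)
 have inV: "cscale a ((A ^^ k) (T m)) \<in> V" for a k m by (simp add: T cs.subspace_scale)
 \<comment> \<open>\<open>\<sigma> m j\<close> is the series starting at order \<open>j\<close>.
   Because \<open>\<tau> N = 0\<close>, moving the start from \<open>0\<close> to \<open>1\<close>
   costs only the term of order \<open>0\<close>, which does not depend on \<open>m\<close>.\<close>
 define \<sigma> where "\<sigma> m j = (\<Sum>k<N. cscale (nbinom m (k + j)) (\<tau> (k + j)))" for m j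
 define \<rho> where "\<rho> = (\<Sum>k<N. cscale (nbinom (Suc n) k) (\<tau> (k + 1)))"
 have split: "\<sigma> m 0 = \<tau> 0 + \<sigma> m 1" for m
 proof -
  have "\<sigma> m 0 = (\<Sum>k<Suc N. cscale (nbinom m k) (\<tau> k))" by (simp add: \<sigma>_def \<tau>N)
  then show ?thesis by (simp only: sum.lessThan_Suc_shift nbinom_0 cs.scale_one \<sigma>_def add_0_right Suc_eq_plus1[symmetric])
 qed
 have pascal: "\<rho> + \<sigma> (Suc n) 1 = \<sigma> n 1"
  unfolding \<sigma>_def \<rho>_def Suc_eq_plus1[symmetric] sum.distrib[symmetric] cs.scale_left_distrib[symmetric] nbinom_pascal[of n] ..
 have "E (binomial_transform N c A T (Suc n)) + cscale c (A (binomial_transform N c A T (Suc n))) = \<sigma> (Suc n) 0 + \<rho>"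
  unfolding binomial_transform_def \<sigma>_def \<rho>_def
  by (simp only: linear_on_sum[OF E(1) subspace_V inV] linear_on_sum[OF linear_A subspace_V inV] cs.scale_sum_right 1 2 add_0_right Suc_eq_plus1[symmetric])
 also have "... = \<sigma> n 0" unfolding split pascal[symmetric] by (simp add: add_ac)
 also have "... = binomial_transform N c A T n"
  unfolding binomial_transform_def \<sigma>_def by (simp add: \<tau>_def mult.commute)
 finally show ?thesis .
qed

text \<open>The weight of \<open>T (n + k)\<close> is lower by \<open>2 k\<close> than that of
  \<open>T n\<close>, and \<open>A^k\<close> raises weights by \<open>2 k\<close>, so all terms
  share one weight.\<close>

lemma transform_weight:
 assumes T: "!!n. T n \<in> V" and H: "linear_on V H" "!!v. v \<in> V ==> H (A v) = A (H v) + cscale 2 (A v)" "!!v. v \<in> V ==> H v \<in> V"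
  and w: "!!n. H (T n) = cscale (\<gamma> - 2 * of_nat n) (T n)"
 shows "H (binomial_transform N c A T n) = cscale (\<gamma> - 2 * of_nat n) (binomial_transform N c A T n)"
proof -
 have HA: "H ((A ^^ k) v) = (A ^^ k) (H v) + cscale (2 * of_nat k) ((A ^^ k) v)" if v: "v \<in> V" for k v
 proof (induction k)
  case (Suc k)
  have "H ((A ^^ Suc k) v) = A (H ((A ^^ k) v)) + cscale 2 ((A ^^ Suc k) v)" using H(2)[of "(A ^^ k) v"] v by simp
  also have "A (H ((A ^^ k) v)) = (A ^^ Suc k) (H v) + cscale (2 * of_nat k) ((A ^^ Suc k) v)"
   unfolding Suc.IH using v H(3)[OF v] by (simp add: linear_on_add[OF linear_A] linear_on_scale[OF linear_A] cs.subspace_scale)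
  also have "... + cscale 2 ((A ^^ Suc k) v) = (A ^^ Suc k) (H v) + cscale (2 * of_nat (Suc k)) ((A ^^ Suc k) v)"
   by (simp add: fun_eq_iff cscale_def algebra_simps)
  finally show ?case .
 qed simp
 have inV: "cscale a ((A ^^ k) (T m)) \<in> V" for a k m by (simp add: T cs.subspace_scale)
 have "H (cscale a ((A ^^ k) (T (n + k)))) = cscale (\<gamma> - 2 * of_nat n) (cscale a ((A ^^ k) (T (n + k))))" for a k
  by (simp add: linear_on_scale[OF H(1)] HA T w linear_on_scale[OF linear_A_pow])
   (simp add: fun_eq_iff cscale_def algebra_simps)
 then show ?thesis
  unfolding binomial_transform_def by (simp only: linear_on_sum[OF H(1) subspace_V inV] cs.scale_sum_right)
qed

end

section \<open>The structure isomorphism\<close>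

text \<open>Some common nilpotency bound for \<open>e\<close> and \<open>f\<close>. Any larger bound
  gives the same Weyl element and the same expansion, by \<open>weyl_extend\<close> and
  \<open>spread_extend\<close>.\<close>

definition nil_degree :: "sl2_module => nat" where
 "nil_degree X = (SOME N. \<forall>v\<in>car X. (act X sl2_e ^^ N) v = 0 & (act X sl2_f ^^ N) v = 0)"

lemma fd_nilpotent_rep:
 assumes X: "X \<in> sl2_modules" "finite_dimensional X"
 shows "sl2_nilpotent (car X) (act X sl2_e) (act X sl2_h) (act X sl2_f) (nil_degree X)"
proof -
 interpret X: sl2_rep "car X" "act X sl2_e" "act X sl2_h" "act X sl2_f" by (rule sl2_module_rep[OF X(1)])
 obtain N N' where N: "!!v. v \<in> car X ==> (act X sl2_e ^^ N) v = 0" "!!v. v \<in> car X ==> (act X sl2_f ^^ N') v = 0"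
  using fd_module_nilpotent[OF X] fd_module_nilpotent_f[OF X] by blast
 have "(act X sl2_e ^^ max N N') v = 0 & (act X sl2_f ^^ max N N') v = 0" if "v \<in> car X" for v
  using funpow_zero_mono[OF N(1)[OF that] X.zero_simps(1)] funpow_zero_mono[OF N(2)[OF that] X.zero_simps(2)] by simp
 then have "\<exists>N. \<forall>v\<in>car X. (act X sl2_e ^^ N) v = 0 & (act X sl2_f ^^ N) v = 0" by blast
 from someI_ex[OF this] show ?thesis unfolding nil_degree_def[symmetric] by unfold_locales auto
qed

definition twist :: "sl2_module => cseq => cseq" where
 "twist X = weyl (nil_degree X) (act X sl2_e) (act X sl2_f)"

text \<open>The map \<open>1 \<otimes> trow m\<close>, which takes the \<open>m\<close>-th entry of
  the sequences in the right factor.\<close>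

definition slice :: "nat => cseq => cseq" where
 "slice m t = (%p. case prod_decode p of (i, j) => t (prod_encode (i, prod_encode (m, j))))"

lemma slice_tensor [simp]: "slice m (tensor x s) = tensor x (trow s m)"
 by (rule cseq_pair_ext) (simp add: slice_def trow_def)

lemma slice_add: "slice m (s + t) = slice m s + slice m t"
 and slice_scale: "slice m (cscale c t) = cscale c (slice m t)"
 by (simp_all add: slice_def fun_eq_iff cscale_def split: prod.split)

lemma linear_slice: "linear_on V (slice m)"
 by (simp add: linear_on_def slice_add slice_scale)

lemma slice_in:
 assumes "t \<in> tensor_space V S" "!!s. s \<in> S ==> trow s m \<in> W"
 shows "slice m t \<in> tensor_space V W"
proof -
 have "tensor_space V S \<subseteq> {t \<in> tensor_space V S. slice m t \<in> tensor_space V W}"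
  by (rule tensor_space_subset) (use assms(2) in \<open>auto intro!: linear_on_vimage_subspace linear_slice\<close>)
 then show ?thesis using assms(1) by auto
qed

text \<open>A map from \<open>X \<otimes> F M\<close> to \<open>F (X \<otimes> M)\<close> for the
  sequence functor \<open>F\<close>. This direction has an explicit formula; the structure
  isomorphism of the module functor is its inverse.\<close>

definition seq_tensor :: "sl2_module => sl2_module => cseq => cseq" where
 "seq_tensor X M t = mk_rows (binomial_transform (nil_degree X) 1 (tensor_map (car X) (car M) (act X sl2_e) id)
  (%m. tensor_map (car X) (car M) (twist X) id (slice m t)))"

text \<open>The value of \<open>seq_tensor\<close> on a pure tensor whose left factor is already
  twisted. The bound is a parameter, so that bounds belonging to different modules can be
  compared.\<close>

definition spread :: "nat => (cseq => cseq) => cseq => cseq => cseq" where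
 "spread N e y s = mk_rows (%n. \<Sum>k<N. cscale (nbinom n k) (tensor ((e ^^ k) y) (trow s (n + k))))"

lemma trow_spread: "trow (spread N e y s) n = (\<Sum>k<N. cscale (nbinom n k) (tensor ((e ^^ k) y) (trow s (n + k))))"
 by (simp add: spread_def)

lemma spread_extend:
 assumes "(e ^^ N) y = 0" "e 0 = 0" "N \<le> N'"
 shows "spread N' e y s = spread N e y s"
 unfolding spread_def
 by (rule arg_cong[where f = mk_rows], rule ext, rule sum.mono_neutral_right)
  (use assms funpow_zero_mono[OF assms(1,2)] in auto)

locale fd_verma = X: sl2_nilpotent "car X" "act X sl2_e" "act X sl2_h" "act X sl2_f" "nil_degree X" + M: verma M mu
 for X M :: sl2_module and mu :: complex +
 assumes X_in: "X \<in> sl2_modules" and X_fd: "finite_dimensional X"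
begin

abbreviation (input) "T \<equiv> tensor_space (car X) (car M)"
abbreviation (input) "XM \<equiv> sl2_tensor X M"
abbreviation (input) "N \<equiv> nil_degree X"
abbreviation (input) "eX \<equiv> act X sl2_e"
abbreviation (input) "A \<equiv> tensor_map (car X) (car M) eX id"

sublocale P: tensor_pair "car X" "car M"
 by unfold_locales auto

sublocale Q: verma XM mu
 by (rule vermaI[OF M.nonint verma_sum_tensor[OF M.nonint X_in X_fd M.verma]])

lemma A_tensor: "v \<in> car X ==> m \<in> car M ==> A (tensor v m) = tensor (eX v) m"
 by (simp add: P.tensor_map_tensor linear_on_id)

lemma A_pow_tensor: "v \<in> car X ==> m \<in> car M ==> (A ^^ k) (tensor v m) = tensor ((eX ^^ k) v) m"
 by (induction k) (simp_all add: A_tensor)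

lemma A_linear: "linear_on T A" by (simp add: P.linear_on_tensor_map linear_on_id)

lemma A_in_T: "t \<in> T ==> A t \<in> T"
 by (rule P.tensor_map_in) (auto simp: linear_on_id)

sublocale A: nilpotent_operator T A N
proof
 fix t assume t: "t \<in> T"
 then show "A t \<in> T" by (rule A_in_T)
 have "(A ^^ N) t = (\<lambda>t. 0) t"
  by (rule tensor_ext[OF t linear_on_funpow[OF A_linear] linear_on_const_0])
   (auto simp: A_in_T A_pow_tensor X.e_nil)
 then show "(A ^^ N) t = 0" by simp
qed (auto simp: A_linear)

lemma twist_in [simp]: "x \<in> car X ==> twist X x \<in> car X"
 by (simp add: twist_def)

lemma twist_linear: "linear_on (car X) (twist X)"
 by (simp add: twist_def X.weyl_linear)

lemma twist_intertwines: "x \<in> car X ==> twist X (eX x) = - act X sl2_f (twist X x)"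
 "x \<in> car X ==> twist X (act X sl2_f x) = - eX (twist X x)"
 "x \<in> car X ==> twist X (act X sl2_h x) = - act X sl2_h (twist X x)"
 by (simp_all add: twist_def X.weyl_intertwines)

lemma seq_row: "s \<in> car (seq_module mu M) ==> trow s n \<in> car M"
 using M.seq_fin_subset M.seq_spaceD(1) by blast

lemma twisted_slice_in: "t \<in> tensor_space (car X) (car (seq_module mu M)) ==>
  tensor_map (car X) (car M) (twist X) id (slice m t) \<in> T"
 by (rule P.tensor_map_in[OF twist_linear linear_on_id(1)])
  (auto intro!: slice_in seq_row simp del: seq_sel)

lemma seq_tensor_tensor:
 assumes x: "x \<in> car X" and s: "s \<in> car (seq_module mu M)"
 shows "seq_tensor X M (tensor x s) = spread N eX (twist X x) s"
 unfolding seq_tensor_def spread_def binomial_transform_def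
 using x seq_row[OF s] by (simp add: P.tensor_map_tensor twist_linear linear_on_id A_pow_tensor)

lemma seq_tensor_linear: "linear_on (tensor_space (car X) (car (seq_module mu M))) (seq_tensor X M)"
proof -
 let ?D = "tensor_space (car X) (car (seq_module mu M))" and ?W = "tensor_map (car X) (car M) (twist X) id"
 have W: "linear_on ?D (%t. ?W (slice m t))" for m
  by (rule linear_on_comp(2)[OF linear_slice P.linear_on_tensor_map[OF twist_linear linear_on_id(1)]])
   (auto intro!: slice_in seq_row simp del: seq_sel)
 have A: "linear_on ?D (%t. (A ^^ k) (?W (slice m t)))" for k m
  by (rule linear_on_comp(2)[OF W A.linear_A_pow]) (auto intro: twisted_slice_in simp del: seq_sel)
 have row: "linear_on ?D (%t. trow (seq_tensor X M t) n)" for n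
  unfolding seq_tensor_def trow_mk_rows binomial_transform_def
  by (intro linear_on_sum_fun linear_on_cscale A)
 show ?thesis
 proof (rule linear_onI)
  fix s t assume "s \<in> ?D" "t \<in> ?D"
  then show "seq_tensor X M (s + t) = seq_tensor X M s + seq_tensor X M t"
   by (intro trow_ext[of "seq_tensor X M (s + t)"]) (simp only: trow_simps linear_on_add[OF row])
 next
  fix c t assume "t \<in> ?D"
  then show "seq_tensor X M (cscale c t) = cscale c (seq_tensor X M t)"
   by (intro trow_ext[of "seq_tensor X M (cscale c t)"]) (simp only: trow_simps linear_on_scale[OF row])
 qed
qed

context
 fixes y s assumes y: "y \<in> car X" and s: "s \<in> seq_space (car M) (act M sl2_e)"
begin

lemma s_row [simp]: "trow s n \<in> car M" "act M sl2_e (trow s (Suc n)) = trow s n"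
 using M.seq_spaceD[OF s] by auto

lemma term_in: "cscale a (tensor ((eX ^^ k) y) (trow s n)) \<in> T"
 using y by (intro cs.subspace_scale) auto

lemma spread_act:
 assumes x: "x \<in> sl2"
 shows "act XM x (trow (spread N eX y s) n) =
  (\<Sum>k<N. cscale (nbinom n k) (tensor (act X x ((eX ^^ k) y)) (trow s (n + k)) + tensor ((eX ^^ k) y) (act M x (trow s (n + k)))))"
 unfolding trow_spread
 using y x X_in M.module_in
 by (subst linear_on_sum[OF linear_act_tensor[OF X_in M.module_in x] subspace_tensor_space term_in])
  (simp add: linear_on_scale[OF linear_act_tensor[OF X_in M.module_in x]])

lemma spread_e: "map_rows (act XM sl2_e) (spread N eX y s) = spread N eX (eX y) s + spread N eX y (map_rows (act M sl2_e) s)"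
proof (rule trow_ext)
 fix n
 show "trow (map_rows (act XM sl2_e) (spread N eX y s)) n = trow (spread N eX (eX y) s + spread N eX y (map_rows (act M sl2_e) s)) n"
  unfolding trow_map_rows spread_act[OF sl2_basis_in(1)] trow_simps
  unfolding trow_spread trow_map_rows cs.scale_right_distrib sum.distrib funpow_swap1 ..
qed

lemma spread_h: "seq_h (act XM sl2_h) (spread N eX y s) = spread N eX (act X sl2_h y) s + spread N eX y (seq_h (act M sl2_h) s)"
proof (rule trow_ext)
 fix n
 have *: "cscale (nbinom n k) (tensor (act X sl2_h ((eX ^^ k) y)) (trow s (n + k)) + tensor ((eX ^^ k) y) (act M sl2_h (trow s (n + k)))) +
   cscale (2 * of_nat n) (cscale (nbinom n k) (tensor ((eX ^^ k) y) (trow s (n + k)))) =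
   cscale (nbinom n k) (tensor ((eX ^^ k) (act X sl2_h y)) (trow s (n + k))) +
   cscale (nbinom n k) (tensor ((eX ^^ k) y) (act M sl2_h (trow s (n + k)) + cscale (2 * of_nat (n + k)) (trow s (n + k))))" for k
  unfolding X.h_e_pow[OF y] tensor_add_left tensor_add_right tensor_scale_left tensor_scale_right
  by (simp add: fun_eq_iff cscale_def algebra_simps)
 show "trow (seq_h (act XM sl2_h) (spread N eX y s)) n =
   trow (spread N eX (act X sl2_h y) s + spread N eX y (seq_h (act M sl2_h) s)) n"
  unfolding trow_seq spread_act[OF sl2_basis_in(2)] trow_simps
  unfolding trow_spread cs.scale_sum_right sum.distrib[symmetric] * trow_seq ..
qed

text \<open>Moving \<open>f\<close> past \<open>e^k\<close> on \<open>y\<close> produces commutators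
  of order \<open>k - 1\<close>, which must cancel against the part of \<open>seq_f\<close> that
  uses row \<open>n + 1\<close>. By \<open>nbinom_absorb\<close> and \<open>nbinom_shift\<close>
  both acquire the coefficient \<open>(n + k) nbinom n k\<close>.\<close>

lemma spread_f: "seq_f (act XM sl2_h) (act XM sl2_f) (spread N eX y s) =
  spread N eX (act X sl2_f y) s + spread N eX y (seq_f (act M sl2_h) (act M sl2_f) s)"
proof (rule trow_ext)
 fix n
 let ?f = "act X sl2_f" and ?h = "act X sl2_h"
 \<comment> \<open>\<open>R k\<close> is the commutator term, and \<open>Q k\<close> is what the
   shifted row in \<open>seq_f\<close> contributes beyond the expected sum; the two weighted series
   agree after moving the index by one.\<close>
 define Q where "Q k = tensor (?h ((eX ^^ k) y) - cscale (of_nat k) ((eX ^^ k) y)) (trow s (Suc n + k))" for k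
 define R where "R k = tensor (?f ((eX ^^ k) y) - (eX ^^ k) (?f y)) (trow s (n + k))" for k
 interpret D: sl2_rep "car X" ?f "%v. - ?h v" eX by (rule X.dual)
 \<comment> \<open>The added term is zero because \<open>e^N\<close> kills both \<open>y\<close> and
   \<open>f y\<close>; it makes room for the index shift, as \<open>R 0\<close> is zero too.\<close>
 have "(\<Sum>k<N. cscale (nbinom n k) (R k)) = (\<Sum>k<Suc N. cscale (nbinom n k) (R k))"
  using y X.e_nil[OF y] X.e_nil[of "?f y"] by (simp add: R_def)
 also have "... = (\<Sum>k<N. cscale (nbinom n (Suc k)) (R (Suc k)))"
  by (subst sum.lessThan_Suc_shift) (simp add: R_def)
 also have "... = (\<Sum>k<N. cscale (of_nat (n + k) * nbinom n k) (Q k))"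
 proof (rule sum.cong[OF refl])
  fix k
  have "?f ((eX ^^ Suc k) y) - (eX ^^ Suc k) (?f y) = cscale (- of_nat (Suc k)) ((eX ^^ k) (?h y) + cscale (of_nat k) ((eX ^^ k) y))"
   using D.e_f_pow[OF y, of k] y
   by (simp add: X.lin_simps linear_on_minus[OF X.linear_pow(1)] del: of_nat_Suc funpow.simps)
    (simp add: fun_eq_iff cscale_def algebra_simps del: of_nat_Suc funpow.simps)
  also have "(eX ^^ k) (?h y) = ?h ((eX ^^ k) y) - cscale (2 * of_nat k) ((eX ^^ k) y)"
   using X.h_e_pow[OF y, of k] by simp
  also have "?h ((eX ^^ k) y) - cscale (2 * of_nat k) ((eX ^^ k) y) + cscale (of_nat k) ((eX ^^ k) y) =
    ?h ((eX ^^ k) y) - cscale (of_nat k) ((eX ^^ k) y)"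
   by (simp add: fun_eq_iff cscale_def algebra_simps)
  finally have "R (Suc k) = cscale (- of_nat (Suc k)) (Q k)"
   unfolding R_def Q_def by (simp only: tensor_scale_left add_Suc_right add_Suc)
  moreover have "nbinom n (Suc k) * - of_nat (Suc k) = of_nat (n + k) * nbinom n k"
   using nbinom_absorb[of k n] by (simp add: mult.commute del: of_nat_Suc of_nat_add)
  ultimately show "cscale (nbinom n (Suc k)) (R (Suc k)) = cscale (of_nat (n + k) * nbinom n k) (Q k)"
   by (simp only: cs.scale_scale)
 qed
 finally have RQ: "(\<Sum>k<N. cscale (nbinom n k) (R k)) = (\<Sum>k<N. cscale (of_nat (n + k) * nbinom n k) (Q k))" .
 let ?t = "%k. tensor ((eX ^^ k) y)"
 have step: "cscale (nbinom n k) (tensor (?f ((eX ^^ k) y)) (trow s (n + k)) + ?t k (act M sl2_f (trow s (n + k)))) -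
   (cscale (of_nat n) (cscale (nbinom (Suc n) k) (tensor (?h ((eX ^^ k) y)) (trow s (Suc n + k)) + ?t k (act M sl2_h (trow s (Suc n + k))))) +
   cscale (of_nat n * of_nat (Suc n)) (cscale (nbinom (Suc n) k) (?t k (trow s (Suc n + k))))) =
   cscale (nbinom n k) (tensor ((eX ^^ k) (?f y)) (trow s (n + k))) +
   cscale (nbinom n k) (?t k (trow (seq_f (act M sl2_h) (act M sl2_f) s) (n + k))) +
   (cscale (nbinom n k) (R k) - cscale (of_nat (n + k) * nbinom n k) (Q k))" for k
 proof -
  have sh: "of_nat n * nbinom (Suc n) k = of_nat (n + k) * nbinom n k" by (rule nbinom_shift)
  have "cscale (of_nat n) (cscale (nbinom (Suc n) k) v) = cscale (of_nat (n + k) * nbinom n k) v"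
   "cscale (of_nat n * of_nat (Suc n)) (cscale (nbinom (Suc n) k) v) = cscale (of_nat (Suc n) * (of_nat (n + k) * nbinom n k)) v" for v
   using sh by (simp_all add: mult_ac)
  then show ?thesis
   unfolding R_def Q_def trow_seq
   by (simp only: tensor_add_left tensor_add_right tensor_diff_left tensor_diff_right tensor_scale_left tensor_scale_right add_Suc)
    (simp add: fun_eq_iff cscale_def algebra_simps)
 qed
 have "trow (seq_f (act XM sl2_h) (act XM sl2_f) (spread N eX y s)) n =
   (\<Sum>k<N. cscale (nbinom n k) (tensor (?f ((eX ^^ k) y)) (trow s (n + k)) + ?t k (act M sl2_f (trow s (n + k)))) -
   (cscale (of_nat n) (cscale (nbinom (Suc n) k) (tensor (?h ((eX ^^ k) y)) (trow s (Suc n + k)) + ?t k (act M sl2_h (trow s (Suc n + k))))) +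
   cscale (of_nat n * of_nat (Suc n)) (cscale (nbinom (Suc n) k) (?t k (trow s (Suc n + k))))))"
  unfolding trow_seq spread_act[OF sl2_basis_in(3)] spread_act[OF sl2_basis_in(2)]
  unfolding trow_spread cs.scale_right_distrib[of "of_nat n"] cs.scale_scale[symmetric] sum_subtractf sum.distrib cs.scale_sum_right ..
 also have "... = (\<Sum>k<N. cscale (nbinom n k) (tensor ((eX ^^ k) (?f y)) (trow s (n + k)))) +
   (\<Sum>k<N. cscale (nbinom n k) (?t k (trow (seq_f (act M sl2_h) (act M sl2_f) s) (n + k)))) +
   ((\<Sum>k<N. cscale (nbinom n k) (R k)) - (\<Sum>k<N. cscale (of_nat (n + k) * nbinom n k) (Q k)))"
  unfolding step sum.distrib sum_subtractf ..
 also have "... = trow (spread N eX (?f y) s + spread N eX y (seq_f (act M sl2_h) (act M sl2_f) s)) n"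
  unfolding RQ trow_simps trow_spread by simp
 finally show "trow (seq_f (act XM sl2_h) (act XM sl2_f) (spread N eX y s)) n =
   trow (spread N eX (?f y) s + spread N eX y (seq_f (act M sl2_h) (act M sl2_f) s)) n" .
qed

lemma spread_eq_transform: "trow (spread N eX y s) n = binomial_transform N 1 A (%m. tensor y (trow s m)) n"
 unfolding trow_spread binomial_transform_def using y by (simp add: A_pow_tensor)

text \<open>\<open>transform_divisible\<close> with \<open>1 \<otimes> e\<close> lowering the rows
  and \<open>e \<otimes> 1\<close> as nilpotent operator. Row \<open>0\<close> vanishes since
  \<open>nbinom 0 k\<close> is nonzero only for \<open>k = 0\<close>, where the entry of
  \<open>s\<close> is zero.\<close>

lemma spread_in_seq_space: "spread N eX y s \<in> seq_space T (act XM sl2_e)"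
 unfolding seq_space_def mem_Collect_eq
proof (intro conjI allI)
 fix n
 let ?E = "tensor_map (car X) (car M) id (act M sl2_e)"
 show "trow (spread N eX y s) n \<in> T"
  unfolding trow_spread by (intro cs.subspace_sum term_in) auto
 have E: "linear_on T ?E" by (simp add: P.linear_on_tensor_map linear_on_id)
 have E_T: "?E t \<in> T" if "t \<in> T" for t using that by (intro P.tensor_map_in) (auto simp: linear_on_id)
 have comm: "?E (A t) = A (?E t)" if t: "t \<in> T" for t
 proof (rule tensor_ext[OF t])
  show "linear_on T (%t. ?E (A t))" "linear_on T (%t. A (?E t))"
   by (rule linear_on_comp(2)[OF A_linear E], use A_in_T in auto) (rule linear_on_comp(2)[OF E A_linear], use E_T in auto)
 qed (simp add: A_tensor P.tensor_map_tensor linear_on_id)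
 have "?E (binomial_transform N 1 A (%m. tensor y (trow s m)) (Suc n)) + cscale 1 (A (binomial_transform N 1 A (%m. tensor y (trow s m)) (Suc n))) =
   binomial_transform N 1 A (%m. tensor y (trow s m)) n"
 proof (rule A.transform_divisible[where E = "?E", OF _ E image_subsetI[OF E_T] comm])
  fix m
  show "tensor y (trow s m) \<in> T" using y by simp
  show "?E (tensor y (trow s (Suc m))) = tensor y (trow s m)" using y by (simp add: P.tensor_map_tensor linear_on_id)
 qed
 then show "act XM sl2_e (trow (spread N eX y s) (Suc n)) = trow (spread N eX y s) n"
  unfolding spread_eq_transform by (simp add: sl2_tensor_def add.commute)
 show "trow (spread N eX y s) 0 = 0"
 proof -
  have "(\<Sum>k<N. cscale (nbinom 0 k) (tensor ((eX ^^ k) y) (trow s (0 + k)))) = (\<Sum>k<N. 0)"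
  proof (rule sum.cong[OF refl])
   fix k show "cscale (nbinom 0 k) (tensor ((eX ^^ k) y) (trow s (0 + k))) = 0"
    using M.seq_spaceD(2)[OF s] by (cases k) simp_all
  qed
  then show ?thesis by (simp add: trow_spread)
 qed
qed

end

lemma seq_domain_span: "tensor_space (car X) (car (seq_module mu M)) =
  cs.span {tensor x s | x s. (\<exists>a\<in>\<int>. x \<in> wt_space (car X) (act X sl2_h) a) &
   (\<exists>c\<in>coset mu. s \<in> wt_space (seq_space (car M) (act M sl2_e)) (seq_h (act M sl2_h)) c)}" (is "_ = cs.span ?S")
proof
 let ?SX = "\<Union>a\<in>\<int>. wt_space (car X) (act X sl2_h) a"
 let ?SM = "\<Union>c\<in>coset mu. wt_space (seq_space (car M) (act M sl2_e)) (seq_h (act M sl2_h)) c"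
 have S: "?S = {tensor b c | b c. b \<in> ?SX & c \<in> ?SM}" by auto
 show "tensor_space (car X) (car (seq_module mu M)) \<subseteq> cs.span ?S"
 proof (rule tensor_space_subset)
  fix x s assume x: "x \<in> car X" and s: "s \<in> car (seq_module mu M)"
  have "x \<in> cs.span ?SX" using fd_module_weighted[OF X_in X_fd] x unfolding weighted_def by blast
  moreover have "s \<in> cs.span ?SM" using s unfolding seq_sel seq_fin_def .
  ultimately show "tensor x s \<in> cs.span ?S" unfolding S by (rule tensor_in_span)
 qed simp
 show "cs.span ?S \<subseteq> tensor_space (car X) (car (seq_module mu M))"
 proof (rule span_sub)
  have "?SM \<subseteq> car (seq_module mu M)" unfolding seq_sel seq_fin_def by (rule cs.span_superset)
  then show "?S \<subseteq> tensor_space (car X) (car (seq_module mu M))" unfolding S by (auto dest: wt_space_in simp del: seq_sel)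
 qed simp
qed

text \<open>The Weyl element replaces \<open>e\<close> by \<open>- f\<close> and \<open>f\<close> by
  \<open>- e\<close> on \<open>X\<close>, just as the twist does on sequences; with both factors
  twisted alike, \<open>spread_e\<close> and \<open>spread_f\<close> become equivariance. That the
  image stays in the weight part is checked on weight vectors.\<close>

lemma arr_seq_tensor: "arr (sl2_arr (sl2_tensor X (seq_module mu M)) (seq_module mu XM) (seq_tensor X M))"
proof (rule arr_sl2_arrI2)
 let ?D = "tensor_space (car X) (car (seq_module mu M))" and ?F = "seq_module mu M"
 have subF: "cs.subspace (car (seq_module mu XM))" by (rule sl2_module_subspace[OF Q.seq_module_in])
 show lin: "linear_on (car (sl2_tensor X ?F)) (seq_tensor X M)" unfolding car_tensor by (rule seq_tensor_linear)
 have "?D \<subseteq> {t \<in> ?D. seq_tensor X M t \<in> car (seq_module mu XM)}"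
 proof -
  have "seq_tensor X M (tensor x s) \<in> car (seq_module mu XM)"
   if a: "a \<in> \<int>" "x \<in> wt_space (car X) (act X sl2_h) a"
    and c: "c \<in> coset mu" "s \<in> wt_space (seq_space (car M) (act M sl2_e)) (seq_h (act M sl2_h)) c" for a x c s
  proof -
   have x: "x \<in> car X" "act X sl2_h x = cscale a x" using a by (auto simp: wt_space_def)
   have s: "s \<in> seq_space (car M) (act M sl2_e)" "seq_h (act M sl2_h) s = cscale c s" using c by (auto simp: wt_space_def)
   have sF: "s \<in> car ?F" unfolding seq_sel seq_fin_def using c by (intro cs.span_base) blast
   let ?y = "twist X x"
   have "act X sl2_h ?y = - twist X (act X sl2_h x)" using twist_intertwines(3)[OF x(1)] by simp
   then have hy: "act X sl2_h ?y = cscale (- a) ?y" using x linear_on_scale[OF twist_linear x(1)] by simp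
   have "seq_h (act XM sl2_h) (spread N eX ?y s) = cscale (c - a) (spread N eX ?y s)"
   proof (rule trow_ext)
    fix n
    have y: "?y \<in> car X" using x by simp
    have "trow (seq_h (act XM sl2_h) (spread N eX ?y s)) n = trow (spread N eX (cscale (- a) ?y) s) n + trow (spread N eX ?y (cscale c s)) n"
     unfolding spread_h[OF y s(1)] hy s(2) trow_simps ..
    also have "... = (\<Sum>k<N. cscale (- a) (cscale (nbinom n k) (tensor ((eX ^^ k) ?y) (trow s (n + k))))) +
      (\<Sum>k<N. cscale c (cscale (nbinom n k) (tensor ((eX ^^ k) ?y) (trow s (n + k)))))"
     unfolding trow_spread trow_simps tensor_scale_right linear_on_scale[OF X.linear_pow(1) y] tensor_scale_left
     by (simp add: mult.commute)
    also have "... = trow (cscale (c - a) (spread N eX ?y s)) n"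
     unfolding trow_simps trow_spread cs.scale_sum_right[symmetric] cs.scale_left_distrib[symmetric] by simp
    finally show "trow (seq_h (act XM sl2_h) (spread N eX ?y s)) n = trow (cscale (c - a) (spread N eX ?y s)) n" .
   qed
   then have "spread N eX ?y s \<in> wt_space (seq_space T (act XM sl2_e)) (seq_h (act XM sl2_h)) (c - a)"
    using spread_in_seq_space[of ?y s] x s by (simp add: wt_space_def)
   moreover have "c - a \<in> coset mu" using coset_shift(2) a c by auto
   ultimately have "spread N eX ?y s \<in> car (seq_module mu XM)"
    unfolding seq_sel seq_fin_def car_tensor by (intro cs.span_base) blast
   then show ?thesis using seq_tensor_tensor[OF x(1) sF] by simp
  qed
  moreover have "cs.subspace {t \<in> ?D. seq_tensor X M t \<in> car (seq_module mu XM)}"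
   by (rule linear_on_vimage_subspace[OF seq_tensor_linear subspace_tensor_space subF])
  ultimately have "cs.span {tensor x s | x s. (\<exists>a\<in>\<int>. x \<in> wt_space (car X) (act X sl2_h) a) &
   (\<exists>c\<in>coset mu. s \<in> wt_space (seq_space (car M) (act M sl2_e)) (seq_h (act M sl2_h)) c)} \<subseteq>
   {t \<in> ?D. seq_tensor X M t \<in> car (seq_module mu XM)}"
   unfolding seq_domain_span[symmetric]
   by (subst seq_domain_span, intro span_sub) (auto simp: seq_domain_span intro: cs.span_base simp del: seq_sel)
  then show ?thesis unfolding seq_domain_span .
 qed
 then show into: "seq_tensor X M t \<in> car (seq_module mu XM)" if "t \<in> car (sl2_tensor X ?F)" for t using that by auto
 have F: "?F \<in> sl2_modules" by (rule M.seq_module_in)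
 then interpret F: sl2_rep "car ?F" "act ?F sl2_e" "act ?F sl2_h" "act ?F sl2_f" by (rule sl2_module_rep)
 interpret G: sl2_rep "car (seq_module mu XM)" "act (seq_module mu XM) sl2_e" "act (seq_module mu XM) sl2_h" "act (seq_module mu XM) sl2_f"
  by (rule sl2_module_rep[OF Q.seq_module_in])
 have cl: "seq_tensor X M (tensor x s + tensor x' s') = spread N eX (twist X x) s + spread N eX (twist X x') s'"
  if "x \<in> car X" "x' \<in> car X" "s \<in> car ?F" "s' \<in> car ?F" for x x' s s'
  using that by (simp add: linear_on_add[OF seq_tensor_linear] seq_tensor_tensor del: seq_sel)
 have neg: "spread N eX (- y) s = - spread N eX y s" "spread N eX y (- s) = - spread N eX y s" if "y \<in> car X" for y s
  by (rule trow_ext; simp add: trow_simps trow_spread linear_on_minus[OF X.linear_pow(1) that] tensor_minus_left tensor_minus_right sum_negf)+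
 fix t assume t: "t \<in> car (sl2_tensor X ?F)"
 note actX = linear_act_tensor[OF X_in F]
 show "seq_tensor X M (act (sl2_tensor X ?F) sl2_e t) = act (seq_module mu XM) sl2_e (seq_tensor X M t)"
 proof (rule tensor_ext[OF t[unfolded car_tensor]])
  show "linear_on ?D (%t. seq_tensor X M (act (sl2_tensor X ?F) sl2_e t))"
   by (rule linear_on_comp(2)[OF actX seq_tensor_linear]) (use act_tensor_in[OF X_in F] in auto)
  show "linear_on ?D (%t. act (seq_module mu XM) sl2_e (seq_tensor X M t))"
   by (rule linear_on_comp(2)[OF seq_tensor_linear G.linear_e]) (use into in \<open>auto simp del: seq_sel\<close>)
  fix x s assume x: "x \<in> car X" and s: "s \<in> car ?F"
  have sS: "s \<in> seq_space (car M) (act M sl2_e)" using s M.seq_fin_subset by blast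
  have y: "twist X x \<in> car X" using x by simp
  have "seq_tensor X M (act (sl2_tensor X ?F) sl2_e (tensor x s)) =
    spread N eX (twist X (eX x)) s + spread N eX (twist X x) (act ?F sl2_e s)"
   unfolding act_tensor[OF X_in F sl2_basis_in(1) x s] by (rule cl[OF X.e_in[OF x] x s F.e_in[OF s]])
  also have "... = - (spread N eX (act X sl2_f (twist X x)) s + spread N eX (twist X x) (seq_f (act M sl2_h) (act M sl2_f) s))"
   using x y by (simp add: twist_intertwines neg)
  also have "... = act (seq_module mu XM) sl2_e (seq_tensor X M (tensor x s))"
   by (simp add: spread_f[OF y sS] seq_tensor_tensor[OF x s])
  finally show "seq_tensor X M (act (sl2_tensor X ?F) sl2_e (tensor x s)) = act (seq_module mu XM) sl2_e (seq_tensor X M (tensor x s))" .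
 qed
 show "seq_tensor X M (act (sl2_tensor X ?F) sl2_f t) = act (seq_module mu XM) sl2_f (seq_tensor X M t)"
 proof (rule tensor_ext[OF t[unfolded car_tensor]])
  show "linear_on ?D (%t. seq_tensor X M (act (sl2_tensor X ?F) sl2_f t))"
   by (rule linear_on_comp(2)[OF actX seq_tensor_linear]) (use act_tensor_in[OF X_in F] in auto)
  show "linear_on ?D (%t. act (seq_module mu XM) sl2_f (seq_tensor X M t))"
   by (rule linear_on_comp(2)[OF seq_tensor_linear G.linear_f]) (use into in \<open>auto simp del: seq_sel\<close>)
  fix x s assume x: "x \<in> car X" and s: "s \<in> car ?F"
  have sS: "s \<in> seq_space (car M) (act M sl2_e)" using s M.seq_fin_subset by blast
  have y: "twist X x \<in> car X" using x by simp
  have "seq_tensor X M (act (sl2_tensor X ?F) sl2_f (tensor x s)) =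
    spread N eX (twist X (act X sl2_f x)) s + spread N eX (twist X x) (act ?F sl2_f s)"
   unfolding act_tensor[OF X_in F sl2_basis_in(3) x s] by (rule cl[OF X.f_in[OF x] x s F.f_in[OF s]])
  also have "... = - (spread N eX (eX (twist X x)) s + spread N eX (twist X x) (map_rows (act M sl2_e) s))"
   using x y by (simp add: twist_intertwines neg)
  also have "... = act (seq_module mu XM) sl2_f (seq_tensor X M (tensor x s))"
   by (simp add: spread_e[OF y sS] seq_tensor_tensor[OF x s])
  finally show "seq_tensor X M (act (sl2_tensor X ?F) sl2_f (tensor x s)) = act (seq_module mu XM) sl2_f (seq_tensor X M (tensor x s))" .
 qed
qed (simp_all add: X_in M.seq_module_in Q.seq_module_in)

end

lemma inv_linear:
 assumes T: "linear_on V T" "cs.subspace V" "bij_betw T V W"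
 shows "linear_on W (inv_into V T)"
proof -
 have inj: "inj_on T V" and W: "W = T ` V" using T(3) by (auto simp: bij_betw_def)
 show ?thesis
 proof (rule linear_onI)
  fix a b assume "a \<in> W" "b \<in> W"
  then obtain v w where v: "v \<in> V" "w \<in> V" "a = T v" "b = T w" using W by auto
  have "a + b = T (v + w)" using v T(1) by (simp add: linear_on_add[OF T(1)])
  then show "inv_into V T (a + b) = inv_into V T a + inv_into V T b"
   using v inj T(2) by (simp add: cs.subspace_add)
 next
  fix c a assume "a \<in> W"
  then obtain v where v: "v \<in> V" "a = T v" using W by auto
  have "cscale c a = T (cscale c v)" using v by (simp add: linear_on_scale[OF T(1)])
  then show "inv_into V T (cscale c a) = cscale c (inv_into V T a)"
   using v inj T(2) by (simp add: cs.subspace_scale)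
 qed
qed

lemma slice_ext: "(!!m. slice m s = slice m t) ==> s = t"
proof (rule cseq_pair_ext)
 fix i p assume eq: "!!m. slice m s = slice m t"
 obtain m j where p: "p = prod_encode (m, j)" by (metis prod.exhaust prod_decode_inverse)
 show "s (prod_encode (i, p)) = t (prod_encode (i, p))"
  using fun_cong[OF eq[of m], of "prod_encode (i, j)"] by (simp add: slice_def p)
qed

lemma weight_basis:
 assumes X: "X \<in> sl2_modules" "finite_dimensional X"
 obtains B where "finite B" "cs.independent B" "car X = cs.span B"
  "!!b. b \<in> B ==> \<exists>a\<in>\<int>. b \<in> wt_space (car X) (act X sl2_h) a"
proof -
 let ?S = "\<Union>a\<in>\<int>. wt_space (car X) (act X sl2_h) a"
 obtain B where B: "B \<subseteq> ?S" "cs.independent B" "?S \<subseteq> cs.span B" by (rule cs.maximal_independent_subset)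
 have SX: "?S \<subseteq> car X" by (auto dest: wt_space_in)
 have "car X \<subseteq> cs.span ?S" using fd_module_weighted[OF X] unfolding weighted_def .
 also have "... \<subseteq> cs.span B" by (rule span_sub[OF B(3)]) simp
 finally have "car X \<subseteq> cs.span B" .
 moreover have BX: "B \<subseteq> car X" using B(1) SX by (rule order_trans)
 ultimately have span: "car X = cs.span B"
  using span_sub[OF BX sl2_module_subspace[OF X(1)]] by (intro equalityI)
 obtain C where C: "finite C" "car X = cs.span C" using X(2) unfolding finite_dimensional_def by (elim exE conjE)
 have "finite B" using cs.independent_span_bound[OF C(1) B(2)] BX unfolding C(2) by simp
 moreover have "\<exists>a\<in>\<int>. b \<in> wt_space (car X) (act X sl2_h) a" if b: "b \<in> B" for b using subsetD[OF B(1) b] by (simp add: Bex_def)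
 ultimately show thesis using that[OF _ B(2) span] by simp
qed

context fd_verma
begin

abbreviation (input) "D \<equiv> tensor_space (car X) (car (seq_module mu M))"

lemma seq_tensor_in: "t \<in> D ==> seq_tensor X M t \<in> car (seq_module mu XM)"
 using arr_in[OF arr_seq_tensor] by (simp del: seq_sel)

lemma twist_map_inj:
 assumes t: "t \<in> T" "tensor_map (car X) (car M) (twist X) id t = 0"
 shows "t = 0"
proof -
 let ?W' = "inv_into (car X) (twist X)"
 have bij: "bij_betw (twist X) (car X) (car X)" unfolding twist_def by (rule X.weyl_bij)
 have lin: "linear_on (car X) ?W'" by (rule inv_linear[OF twist_linear X.subspace_V bij])
 have inj: "inj_on (twist X) (car X)" using bij by (simp add: bij_betw_def)
 have "t = tensor_map (car X) (car M) id id t" by (simp add: P.tensor_map_id t(1))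
 also have "... = tensor_map (car X) (car M) (?W' \<circ> twist X) (id \<circ> id) t"
  by (rule fun_cong[OF tensor_map_cong]) (use inj in \<open>auto simp: linear_on_id\<close>)
 also have "... = tensor_map (car X) (car M) ?W' id (tensor_map (car X) (car M) (twist X) id t)"
  by (rule tensor_map_comp[symmetric]) (use t(1) in \<open>auto simp: linear_on_id lin twist_linear\<close>)
 also have "... = 0" unfolding t(2)
  by (rule linear_on_0[OF P.linear_on_tensor_map[OF lin linear_on_id(1)]]) simp
 finally show ?thesis .
qed

text \<open>Both ingredients are invertible: the binomial transform by
  \<open>transform_inverse\<close>, the twist by bijectivity of the Weyl element.\<close>

lemma seq_tensor_inj:
 assumes t: "t \<in> D" "seq_tensor X M t = 0"
 shows "t = 0"
proof (rule slice_ext)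
 fix m
 let ?W = "%m. tensor_map (car X) (car M) (twist X) id (slice m t)"
 have "binomial_transform N 1 A ?W n = trow (seq_tensor X M t) n" for n
  unfolding seq_tensor_def by simp
 then have 0: "binomial_transform N 1 A ?W = (\<lambda>n. 0)" unfolding t(2) by (intro ext) simp
 have "?W m = binomial_transform N (- 1) A (\<lambda>n. 0) m"
  using A.transform_inverse[of ?W 1 m, OF twisted_slice_in[OF t(1)]] unfolding 0 by simp
 also have "... = 0"
  unfolding binomial_transform_def using linear_on_0[OF A.linear_A_pow subspace_tensor_space] by simp
 finally have "slice m t = 0"
  by (rule twist_map_inj[rotated]) (use t(1) in \<open>auto intro!: slice_in seq_row simp del: seq_sel\<close>)
 then show "slice m t = slice m 0" using linear_on_0[OF linear_slice[of UNIV m]] by simp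
qed

lemma transform_sum:
 assumes "!!b n. b \<in> B ==> g b n \<in> T"
 shows "binomial_transform N c A (%m. \<Sum>b\<in>B. g b m) n = (\<Sum>b\<in>B. binomial_transform N c A (g b) n)"
 unfolding binomial_transform_def
 by (subst sum.swap) (simp add: linear_on_sum[OF A.linear_A_pow subspace_tensor_space assms] cs.scale_sum_right)

text \<open>The inverse transform turns a sequence divisible by
  \<open>e \<otimes> 1 + 1 \<otimes> e\<close> into one divisible by \<open>1 \<otimes> e\<close>.
  Its coordinates in a weight basis of \<open>X\<close> are weight sequences in \<open>M\<close>,
  and undoing the twist on that basis gives a preimage.\<close>

lemma seq_tensor_surj_weight:
 assumes \<gamma>: "\<gamma> \<in> coset mu" and s: "s \<in> wt_space (seq_space T (act XM sl2_e)) (seq_h (act XM sl2_h)) \<gamma>"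
 shows "s \<in> seq_tensor X M ` D"
proof -
 obtain B where B: "finite B" "cs.independent B" "car X = cs.span B"
  "!!b. b \<in> B ==> \<exists>a\<in>\<int>. b \<in> wt_space (car X) (act X sl2_h) a"
  using weight_basis[OF X_in X_fd] by blast
 have BX: "b \<in> car X" if "b \<in> B" for b using that B(3) cs.span_base by auto
 obtain a where a: "!!b. b \<in> B ==> a b \<in> \<int>" "!!b. b \<in> B ==> act X sl2_h b = cscale (a b) b"
  using B(4) unfolding wt_space_def by (auto simp: Bex_def) metis
 have sS: "trow s n \<in> T" "trow s 0 = 0" "act XM sl2_e (trow s (Suc n)) = trow s n" for n
  using s Q.seq_spaceD(1)[of s n] Q.seq_spaceD(2)[of s] Q.seq_spaceD(3)[of s n] by (auto simp: wt_space_def)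
 have sh: "act XM sl2_h (trow s n) = cscale (\<gamma> - 2 * of_nat n) (trow s n)" for n
 proof -
  have "trow (seq_h (act XM sl2_h) s) n = trow (cscale \<gamma> s) n" using s by (simp add: wt_space_def)
  then show ?thesis by (simp add: trow_simps cs.scale_left_diff_distrib eq_diff_eq)
 qed
 define U where "U = binomial_transform N (- 1) A (trow s)"
 have UT: "U n \<in> T" for n unfolding U_def by (rule A.transform_in[OF sS(1)])
 have "\<forall>n. \<exists>m. (\<forall>b. m b \<in> car M) & U n = (\<Sum>b\<in>B. tensor b (m b))"
  using tensor_basis_expand[OF B(1) M.subspace_V] UT unfolding B(3) by metis
 then obtain m where m: "!!n b. m n b \<in> car M" "!!n. U n = (\<Sum>b\<in>B. tensor b (m n b))" by metis
 have uniq: "u b = v b" if "(\<Sum>b\<in>B. tensor b (u b)) = (\<Sum>b\<in>B. tensor b (v b))" "b \<in> B" for u v b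
  using tensor_basis_unique[OF B(1,2), of "%b. u b - v b" b] that by (simp add: tensor_diff_right sum_subtractf)
 have comm: "act XM sl2_e (A t) = A (act XM sl2_e t)" and hA: "act XM sl2_h (A t) = A (act XM sl2_h t) + cscale 2 (A t)"
  if t: "t \<in> T" for t
 proof -
  note lin = linear_act_tensor[OF X_in M.module_in]
  have c: "linear_on T (%t. act XM x (A t))" "linear_on T (%t. A (act XM x t))" if "x \<in> sl2" for x
   by (rule linear_on_comp(2)[OF A_linear lin[OF that]], use A_in_T in auto)
    (rule linear_on_comp(2)[OF lin[OF that] A_linear], use act_tensor_in[OF X_in M.module_in that] in auto)
  show "act XM sl2_e (A t) = A (act XM sl2_e t)"
   by (rule tensor_ext[OF t c[OF sl2_basis_in(1)]])
    (simp add: A_tensor X_in M.module_in linear_on_add[OF A_linear])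
  show "act XM sl2_h (A t) = A (act XM sl2_h t) + cscale 2 (A t)"
   by (rule tensor_ext[OF t c(1)[OF sl2_basis_in(2)] linear_on_plus[OF c(2)[OF sl2_basis_in(2)] linear_on_cscale[OF A_linear]]])
    (simp add: A_tensor X_in M.module_in linear_on_add[OF A_linear] X.h_e tensor_add_left tensor_scale_left)
 qed
 have div: "act XM sl2_e (U (Suc n)) - A (U (Suc n)) = U n" for n
  using A.transform_divisible[of "trow s" "act XM sl2_e" "- 1" n, OF sS(1) linear_act_tensor[OF X_in M.module_in sl2_basis_in(1)]
    image_subsetI[OF act_tensor_in[OF X_in M.module_in sl2_basis_in(1)]] comm sS(3)]
  by (simp add: U_def)
 have wt: "act XM sl2_h (U n) = cscale (\<gamma> - 2 * of_nat n) (U n)" for n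
  unfolding U_def
  by (rule A.transform_weight[OF sS(1) linear_act_tensor[OF X_in M.module_in sl2_basis_in(2)] hA _ sh])
   (auto intro: act_tensor_in[OF X_in M.module_in sl2_basis_in(2)])
 have "U 0 = 0"
 proof -
  have "cscale ((- 1) ^ k * nbinom 0 k) ((A ^^ k) (trow s (0 + k))) = 0" for k
   using sS(2) by (cases k) simp_all
  then show ?thesis unfolding U_def binomial_transform_def by (intro sum.neutral) simp
 qed
 then have m0: "m 0 b = 0" if "b \<in> B" for b using uniq[of "m 0" "\<lambda>b. 0"] m(2)[of 0] that by simp
 have aU: "act XM x (U n) = (\<Sum>b\<in>B. tensor (act X x b) (m n b) + tensor b (act M x (m n b)))" if x: "x \<in> sl2" for x n
  unfolding m(2)
  by (subst linear_on_sum[OF linear_act_tensor[OF X_in M.module_in x] subspace_tensor_space])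
   (use BX m(1) x in \<open>auto simp: X_in M.module_in intro!: sum.cong\<close>)
 have AU: "A (U n) = (\<Sum>b\<in>B. tensor (eX b) (m n b))" for n
  unfolding m(2) by (subst linear_on_sum[OF A_linear subspace_tensor_space]) (use BX m(1) in \<open>auto simp: A_tensor intro!: sum.cong\<close>)
 \<comment> \<open>The part of the action of \<open>e\<close> that comes from \<open>X\<close> is
   \<open>A\<close>, which \<open>div\<close> subtracts; in coordinates only \<open>e\<close> on
   \<open>M\<close> is left.\<close>
 have me: "act M sl2_e (m (Suc n) b) = m n b" if "b \<in> B" for n b
 proof (rule uniq[OF _ that])
  show "(\<Sum>b\<in>B. tensor b (act M sl2_e (m (Suc n) b))) = (\<Sum>b\<in>B. tensor b (m n b))"
   using div[of n] unfolding aU[OF sl2_basis_in(1)] AU m(2)[of n] by (simp add: sum.distrib)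
 qed
 have mh: "act M sl2_h (m n b) = cscale (\<gamma> - a b - 2 * of_nat n) (m n b)" if "b \<in> B" for n b
 proof -
  have "(\<Sum>b\<in>B. tensor b (cscale (a b) (m n b) + act M sl2_h (m n b))) = (\<Sum>b\<in>B. tensor b (cscale (\<gamma> - 2 * of_nat n) (m n b)))"
   using wt[of n] unfolding aU[OF sl2_basis_in(2)] unfolding m(2)[of n] cs.scale_sum_right
   by (simp add: a(2) tensor_scale_left tensor_scale_right tensor_add_right)
  from uniq[OF this that] have eq: "cscale (a b) (m n b) + act M sl2_h (m n b) = cscale (\<gamma> - 2 * of_nat n) (m n b)" .
  have "act M sl2_h (m n b) = cscale (\<gamma> - 2 * of_nat n) (m n b) - cscale (a b) (m n b)" unfolding eq[symmetric] by simp
  then show ?thesis by (simp add: fun_eq_iff cscale_def algebra_simps)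
 qed
 define \<sigma> where "\<sigma> b = mk_rows (%n. m n b)" for b
 have \<sigma>F: "\<sigma> b \<in> car (seq_module mu M)" if b: "b \<in> B" for b
 proof -
  have "seq_h (act M sl2_h) (\<sigma> b) = cscale (\<gamma> - a b) (\<sigma> b)"
  proof (rule trow_ext)
   fix n show "trow (seq_h (act M sl2_h) (\<sigma> b)) n = trow (cscale (\<gamma> - a b) (\<sigma> b)) n"
    by (simp add: \<sigma>_def trow_simps mh[OF b]) (simp add: fun_eq_iff cscale_def algebra_simps)
  qed
  then have "\<sigma> b \<in> wt_space (seq_space (car M) (act M sl2_e)) (seq_h (act M sl2_h)) (\<gamma> - a b)"
   using m(1) m0[OF b] me[OF b] by (simp add: wt_space_def seq_space_def \<sigma>_def)
  moreover have "\<gamma> - a b \<in> coset mu" using coset_shift(2) \<gamma> a(1)[OF b] by auto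
  ultimately show ?thesis unfolding seq_sel seq_fin_def by (intro cs.span_base) blast
 qed
 let ?W' = "inv_into (car X) (twist X)"
 have bij: "bij_betw (twist X) (car X) (car X)" unfolding twist_def by (rule X.weyl_bij)
 have W': "?W' b \<in> car X" "twist X (?W' b) = b" if "b \<in> B" for b
  using bij_betw_inv_into[OF bij] BX[OF that] bij by (auto simp: bij_betw_def f_inv_into_f inv_into_into)
 define t where "t = (\<Sum>b\<in>B. tensor (?W' b) (\<sigma> b))"
 have tD: "t \<in> D" unfolding t_def by (intro cs.subspace_sum subspace_tensor_space tensor_in W' \<sigma>F)
 have "seq_tensor X M t = s"
 proof (rule trow_ext)
  fix n
  have "seq_tensor X M t = (\<Sum>b\<in>B. spread N eX b (\<sigma> b))"
   unfolding t_def
   by (subst linear_on_sum[OF seq_tensor_linear subspace_tensor_space])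
    (use W' \<sigma>F in \<open>auto simp: seq_tensor_tensor intro!: sum.cong simp del: seq_sel\<close>)
  then have "trow (seq_tensor X M t) n = (\<Sum>b\<in>B. binomial_transform N 1 A (%k. tensor b (m k b)) n)"
   using BX \<sigma>F M.seq_fin_subset by (simp add: trow_simps spread_eq_transform subset_iff \<sigma>_def del: seq_sel)
  also have "... = binomial_transform N (- (- 1)) A U n"
   unfolding minus_minus m(2)[abs_def] by (rule transform_sum[symmetric]) (use BX m(1) in auto)
  also have "... = trow s n" unfolding U_def by (rule A.transform_inverse[OF sS(1)])
  finally show "trow (seq_tensor X M t) n = trow s n" .
 qed
 with tD show ?thesis by blast
qed

lemma seq_tensor_bij: "bij_betw (seq_tensor X M) D (car (seq_module mu XM))"
 unfolding bij_betw_def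
proof
 show "inj_on (seq_tensor X M) D" by (rule linear_on_inj[OF seq_tensor_linear subspace_tensor_space seq_tensor_inj])
 show "seq_tensor X M ` D = car (seq_module mu XM)"
 proof
  show "seq_tensor X M ` D \<subseteq> car (seq_module mu XM)" using seq_tensor_in by blast
  show "car (seq_module mu XM) \<subseteq> seq_tensor X M ` D"
   unfolding seq_sel(1)[of mu XM] seq_fin_def car_tensor
   by (rule span_sub[OF UN_least])
    (auto intro: seq_tensor_surj_weight linear_on_image_subspace[OF seq_tensor_linear] simp del: seq_sel)
 qed
qed

end

section \<open>Naturality, unit law and associativity of the map from \<open>X \<otimes> F M\<close>
  to \<open>F (X \<otimes> M)\<close>\<close>

lemma (in sl2_nilpotent) weyl_extend:
 assumes "N \<le> N'" "v \<in> V"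
 shows "weyl N' e f v = weyl N e f v"
proof -
 have f: "expo N' (%v. - f v) v = expo N (%v. - f v) v" if "v \<in> V" for v
  by (rule expo_extend) (use that assms(1) pow_uminus[OF linear_f f_image that, of N] f_nil[OF that] in auto)
 have e: "expo N' e v = expo N e v" if "v \<in> V" for v
  by (rule expo_extend) (use that assms(1) e_nil in auto)
 have "expo N (%v. - f v) (expo N e v) \<in> V"
  using assms(2) by (intro expo_in[OF subspace_V uf_image]) simp
 then show ?thesis unfolding weyl_def using assms(2) by (simp add: e f)
qed

lemma fd_vermaI:
 assumes "X \<in> sl2_modules" "finite_dimensional X" "verma M mu"
 shows "fd_verma X M mu"
 unfolding fd_verma_def fd_verma_axioms_def using assms fd_nilpotent_rep by blast

context fd_verma
begin

text \<open>Arrows and tensor products relate modules with different bounds; allowing any larger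
  bound lets both sides of an equation be written over a common one.\<close>

lemma seq_tensor_extend:
 assumes N': "N \<le> N'" and x: "x \<in> car X" and s: "s \<in> car (seq_module mu M)"
 shows "trow (seq_tensor X M (tensor x s)) n =
  (\<Sum>k<N'. cscale (nbinom n k) (tensor ((eX ^^ k) (weyl N' eX (act X sl2_f) x)) (trow s (n + k))))"
proof -
 have w: "weyl N' eX (act X sl2_f) x = twist X x" unfolding twist_def by (rule X.weyl_extend[OF N' x])
 have "spread N' eX (twist X x) s = spread N eX (twist X x) s"
  by (rule spread_extend) (use x N' X.e_nil in auto)
 then show ?thesis unfolding w seq_tensor_tensor[OF x s] by (metis trow_spread)
qed

end

lemma arr_pow:
 assumes "arr ph" "x \<in> sl2" "v \<in> car (src ph)"
 shows "fn ph ((act (src ph) x ^^ k) v) = (act (tgt ph) x ^^ k) (fn ph v)"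
proof (induction k)
 case (Suc k)
 have "(act (src ph) x ^^ k) v \<in> car (src ph)"
  by (rule funpow_in) (use assms sl2_module_in in auto)
 then show ?case using Suc arr_act[OF assms(1,2)] by simp
qed simp

text \<open>At a fixed cut-off the Weyl element is a polynomial in \<open>e\<close> and
  \<open>f\<close>, hence commutes with homomorphisms.\<close>

lemma arr_weyl:
 assumes ph: "arr ph" and v: "v \<in> car (src ph)"
 shows "fn ph (weyl N (act (src ph) sl2_e) (act (src ph) sl2_f) v) = weyl N (act (tgt ph) sl2_e) (act (tgt ph) sl2_f) (fn ph v)"
proof -
 interpret S: sl2_rep "car (src ph)" "act (src ph) sl2_e" "act (src ph) sl2_h" "act (src ph) sl2_f"
  by (rule sl2_module_rep[OF arr_src[OF ph]])
 have im: "act (src ph) sl2_e ` car (src ph) \<subseteq> car (src ph)" "(%v. - act (src ph) sl2_f v) ` car (src ph) \<subseteq> car (src ph)" by auto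
 have e: "fn ph (expo N (act (src ph) sl2_e) v) = expo N (act (tgt ph) sl2_e) (fn ph v)" if "v \<in> car (src ph)" for v
  by (rule expo_natural[OF arr_linear[OF ph] S.subspace_V im(1) _ that]) (simp add: arr_act[OF ph])
 have f: "fn ph (expo N (%v. - act (src ph) sl2_f v) v) = expo N (%v. - act (tgt ph) sl2_f v) (fn ph v)" if "v \<in> car (src ph)" for v
  by (rule expo_natural[OF arr_linear[OF ph] S.subspace_V im(2) _ that])
   (simp add: linear_on_minus[OF arr_linear[OF ph]] arr_act[OF ph])
 show ?thesis unfolding weyl_def
  using v expo_in[OF S.subspace_V im(1)] expo_in[OF S.subspace_V im(2)] by (simp add: e f)
qed

definition seq_tensor_arr :: "complex => sl2_module => sl2_module => sl2_arrow" where
 "seq_tensor_arr mu X M = sl2_arr (sl2_tensor X (seq_module mu M)) (seq_module mu (sl2_tensor X M)) (seq_tensor X M)"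

lemma src_tgt_seq_tensor_arr [simp]: "src (seq_tensor_arr mu X M) = sl2_tensor X (seq_module mu M)"
 "tgt (seq_tensor_arr mu X M) = seq_module mu (sl2_tensor X M)"
 by (simp_all add: seq_tensor_arr_def)

context
 fixes mu :: complex
 assumes mu: "mu \<notin> \<int>"
begin

abbreviation (input) "fd X \<equiv> X \<in> sl2_modules & finite_dimensional X"

lemma arr_seq_tensor_arr:
 assumes "fd X" "verma M mu"
 shows "arr (seq_tensor_arr mu X M)" and "verma (sl2_tensor X M) mu" and "M \<in> sl2_modules" "seq_module mu M \<in> sl2_modules"
  and "bij_betw (fn (seq_tensor_arr mu X M)) (car (sl2_tensor X (seq_module mu M))) (car (seq_module mu (sl2_tensor X M)))"
  and "!!t. t \<in> tensor_space (car X) (car (seq_module mu M)) ==> fn (seq_tensor_arr mu X M) t = seq_tensor X M t"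
proof -
 interpret fd_verma X M mu using assms by (intro fd_vermaI) auto
 show "arr (seq_tensor_arr mu X M)" unfolding seq_tensor_arr_def by (rule arr_seq_tensor)
 show "verma (sl2_tensor X M) mu" by (rule Q.verma_axioms)
 show "M \<in> sl2_modules" "seq_module mu M \<in> sl2_modules" by (rule M.module_in, rule M.seq_module_in)
 show *: "!!t. t \<in> D ==> fn (seq_tensor_arr mu X M) t = seq_tensor X M t"
  unfolding seq_tensor_arr_def by (subst sl2_arr_sel(3)) (simp_all del: seq_sel)
 show "bij_betw (fn (seq_tensor_arr mu X M)) (car (sl2_tensor X (seq_module mu M))) (car (seq_module mu (sl2_tensor X M)))"
  using seq_tensor_bij bij_betw_cong[of D "fn (seq_tensor_arr mu X M)", OF *] unfolding car_tensor by blast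
qed

lemma seq_tensor_natural:
 assumes ph: "arr ph" "fd (src ph)" "fd (tgt ph)" and ps: "arr ps" "verma (src ps) mu" "verma (tgt ps) mu"
 shows "sl2_comp (seq_arr mu (sl2_tensor_arr ph ps)) (seq_tensor_arr mu (src ph) (src ps)) =
  sl2_comp (seq_tensor_arr mu (tgt ph) (tgt ps)) (sl2_tensor_arr ph (seq_arr mu ps))"
proof -
 let ?X = "src ph" and ?Y = "tgt ph" and ?M = "src ps" and ?N = "tgt ps"
 interpret XM: fd_verma ?X ?M mu using assms by (intro fd_vermaI) auto
 interpret YN: fd_verma ?Y ?N mu using assms by (intro fd_vermaI) auto
 note KX = arr_seq_tensor_arr[OF ph(2) ps(2)] and KY = arr_seq_tensor_arr[OF ph(3) ps(3)]
 have F: "arr (seq_arr mu ps)" by (rule arr_seq_arr[OF ps])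
 have G: "arr (seq_arr mu (sl2_tensor_arr ph ps))" by (rule arr_seq_arr) (simp_all add: ph ps KX(2) KY(2))
 show ?thesis
 proof (rule arr_ext_tensor[of _ _ ?X "seq_module mu ?M"])
  fix x s assume x: "x \<in> car ?X" and s: "s \<in> car (seq_module mu ?M)"
  let ?N' = "max (nil_degree ?X) (nil_degree ?Y)"
  have xs: "tensor x s \<in> tensor_space (car ?X) (car (seq_module mu ?M))" using x s by (rule tensor_in)
  have fs: "fn (seq_arr mu ps) s \<in> car (seq_module mu ?N)" using arr_in[OF F] s by (simp del: seq_sel)
  have fx: "fn ph x \<in> car ?Y" using ph(1) x by simp
  let ?w = "weyl ?N' (act ?X sl2_e) (act ?X sl2_f) x"
  have wx: "?w \<in> car ?X" using XM.X.weyl_extend[of ?N' x] x XM.X.weyl_in by simp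
  have row: "trow s n \<in> car ?M" for n by (rule XM.seq_row[OF s])
  have "fn (seq_arr mu (sl2_tensor_arr ph ps)) (seq_tensor ?X ?M (tensor x s)) = seq_tensor ?Y ?N (tensor (fn ph x) (fn (seq_arr mu ps) s))"
  proof (rule trow_ext)
   fix n
   have "trow (fn (seq_arr mu (sl2_tensor_arr ph ps)) (seq_tensor ?X ?M (tensor x s))) n =
     fn (sl2_tensor_arr ph ps) (\<Sum>k<?N'. cscale (nbinom n k) (tensor ((act ?X sl2_e ^^ k) ?w) (trow s (n + k))))"
    using XM.seq_tensor_in[OF xs] by (simp add: trow_seq_arr XM.seq_tensor_extend[OF max.cobounded1[of _ "nil_degree ?Y"] x s] del: seq_sel)
   also have "... = (\<Sum>k<?N'. cscale (nbinom n k) (tensor (fn ph ((act ?X sl2_e ^^ k) ?w)) (fn ps (trow s (n + k)))))"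
    by (subst linear_on_sum[OF arr_linear[OF arr_tensor_arr[OF ph(1) ps(1)]]])
     (use wx row in \<open>auto intro!: sum.cong cs.subspace_scale simp: linear_on_scale[OF arr_linear[OF arr_tensor_arr[OF ph(1) ps(1)], simplified]] ph(1) ps(1)\<close>)
   also have "... = (\<Sum>k<?N'. cscale (nbinom n k) (tensor ((act ?Y sl2_e ^^ k) (weyl ?N' (act ?Y sl2_e) (act ?Y sl2_f) (fn ph x))) (trow (fn (seq_arr mu ps) s) (n + k))))"
    using arr_pow[OF ph(1) sl2_basis_in(1) wx] arr_weyl[OF ph(1) x] s by (simp add: trow_seq_arr del: seq_sel)
   also have "... = trow (seq_tensor ?Y ?N (tensor (fn ph x) (fn (seq_arr mu ps) s))) n"
    by (rule YN.seq_tensor_extend[OF max.cobounded2 fx fs, symmetric])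
   finally show "trow (fn (seq_arr mu (sl2_tensor_arr ph ps)) (seq_tensor ?X ?M (tensor x s))) n = trow (seq_tensor ?Y ?N (tensor (fn ph x) (fn (seq_arr mu ps) s))) n" .
  qed
  then show "fn (sl2_comp (seq_arr mu (sl2_tensor_arr ph ps)) (seq_tensor_arr mu ?X ?M)) (tensor x s) =
    fn (sl2_comp (seq_tensor_arr mu ?Y ?N) (sl2_tensor_arr ph (seq_arr mu ps))) (tensor x s)"
   using x s xs fx fs by (simp add: KX(6) KY(6) ph(1) F del: seq_sel)
 qed (use KX(1) KY(1) F G ph ps in \<open>simp_all del: seq_sel\<close>)
qed

lemma seq_tensor_unit:
 assumes M: "verma M mu"
 shows "sl2_comp (seq_arr mu (sl2_lunit M)) (seq_tensor_arr mu sl2_trivial M) = sl2_lunit (seq_module mu M)"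
proof -
 have X: "fd sl2_trivial" by simp
 interpret fd_verma sl2_trivial M mu using M by (intro fd_vermaI) auto
 note K = arr_seq_tensor_arr[OF X M]
 have G: "arr (seq_arr mu (sl2_lunit M))" by (rule arr_seq_arr) (simp_all add: K M)
 \<comment> \<open>With bound \<open>0\<close> the truncated exponential would be zero; the bound is
   positive because the trivial module is nonzero.\<close>
 have N: "1 \<le> N"
 proof (rule ccontr)
  assume "\<not> 1 \<le> N"
  then have "N = 0" by simp
  then have "sl2_unit_vector = 0" using X.e_nil[of sl2_unit_vector] by simp
  moreover have "sl2_unit_vector 0 = 1" by (simp add: sl2_unit_vector_def)
  ultimately show False by simp
 qed
 show ?thesis
 proof (rule arr_ext_tensor[of _ _ sl2_trivial "seq_module mu M"])
  fix x s assume x: "x \<in> car sl2_trivial" and s: "s \<in> car (seq_module mu M)"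
  have xs: "tensor x s \<in> D" using x s by (rule tensor_in)
  have ex: "expo N T v = v" if "!!v. T v = 0" for T v
   using expo_extend[where T = T and N = 1 and N' = N and v = v] N that by (simp add: expo_def)
  have w: "twist sl2_trivial x = x" unfolding twist_def weyl_def by (simp add: ex)
  have "fn (seq_arr mu (sl2_lunit M)) (seq_tensor sl2_trivial M (tensor x s)) = cscale (x 0) s"
  proof (rule trow_ext)
   fix n
   have "spread N eX x s = spread 1 eX x s" by (rule spread_extend) (use N in auto)
   then have "trow (seq_tensor sl2_trivial M (tensor x s)) n = tensor x (trow s n)"
    unfolding seq_tensor_tensor[OF x s] w by (simp add: trow_spread)
   then show "trow (fn (seq_arr mu (sl2_lunit M)) (seq_tensor sl2_trivial M (tensor x s))) n = trow (cscale (x 0) s) n"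
    using seq_tensor_in[OF xs] x seq_row[OF s] by (simp add: trow_seq_arr trow_simps del: seq_sel)
  qed
  then show "fn (sl2_comp (seq_arr mu (sl2_lunit M)) (seq_tensor_arr mu sl2_trivial M)) (tensor x s) = fn (sl2_lunit (seq_module mu M)) (tensor x s)"
   using x s xs by (simp add: K(6) del: seq_sel)
 qed (use K(1,4) G in \<open>simp_all del: seq_sel\<close>)
qed

text \<open>Three facts match the two sides: the Weyl element is group-like, powers of
  \<open>e\<close> on \<open>X \<otimes> Y\<close> expand binomially, and
  \<open>nbinom_trinomial\<close> turns the single series over \<open>X \<otimes> Y\<close> into the
  iterated one.\<close>

lemma seq_tensor_assoc:
 assumes X: "fd X" and Y: "fd Y" and M: "verma M mu"
 shows "sl2_comp (seq_arr mu (sl2_assoc X Y M)) (seq_tensor_arr mu (sl2_tensor X Y) M) =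
  sl2_comp (seq_tensor_arr mu X (sl2_tensor Y M))
   (sl2_comp (sl2_tensor_arr (sl2_id X) (seq_tensor_arr mu Y M)) (sl2_assoc X Y (seq_module mu M)))"
proof -
 let ?XY = "sl2_tensor X Y" and ?YM = "sl2_tensor Y M" and ?F = "seq_module mu M"
 have XY: "fd ?XY" using X Y by (simp add: finite_dimensional_tensor)
 interpret Y: fd_verma Y M mu using Y M by (intro fd_vermaI) auto
 interpret XY: fd_verma ?XY M mu using XY M by (intro fd_vermaI) auto
 note KY = arr_seq_tensor_arr[OF Y M] and KXY = arr_seq_tensor_arr[OF XY M]
 note YM = KY(2)
 note KX = arr_seq_tensor_arr[OF X YM]
 interpret X: fd_verma X ?YM mu using X YM by (intro fd_vermaI) auto
 have M_in: "M \<in> sl2_modules" and F_in: "?F \<in> sl2_modules" and Xm: "X \<in> sl2_modules" and Ym: "Y \<in> sl2_modules" using KY X Y by auto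
 have as: "arr (sl2_assoc X Y M)" using Xm Ym M_in by simp
 have G: "arr (seq_arr mu (sl2_assoc X Y M))" by (rule arr_seq_arr) (simp_all add: as KXY(2) KX(2))
 \<comment> \<open>A bound for \<open>X\<close> and \<open>Y\<close> whose double serves
   \<open>X \<otimes> Y\<close>, since \<open>expo_tensor\<close> works with the doubled bound on
   the product.\<close>
 define Q where "Q = max (nil_degree X) (max (nil_degree Y) (nil_degree ?XY))"
 have Q: "nil_degree X \<le> Q" "nil_degree Y \<le> Q" "nil_degree ?XY \<le> 2 * Q" unfolding Q_def by auto
 let ?eX = "act X sl2_e" and ?eY = "act Y sl2_e" and ?eXY = "act ?XY sl2_e"
 let ?fX = "act X sl2_f" and ?fY = "act Y sl2_f" and ?fXY = "act ?XY sl2_f"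
 note eXY = linear_act_tensor[OF Xm Ym sl2_basis_in(1)] act_tensor[OF Xm Ym sl2_basis_in(1)]
 show ?thesis
 proof (rule arr_ext_left[of _ _ X Y ?F])
  fix x y s assume x: "x \<in> car X" and y: "y \<in> car Y" and s: "s \<in> car ?F"
  have xy: "tensor x y \<in> car ?XY" using x y by simp
  have ys: "tensor y s \<in> tensor_space (car Y) (car ?F)" using y s by (rule tensor_in)
  have xys: "tensor (tensor x y) s \<in> tensor_space (car ?XY) (car ?F)" using xy s by (rule tensor_in)
  let ?wx = "weyl Q ?eX ?fX x" and ?wy = "weyl Q ?eY ?fY y"
  have Xnil: "(?eX ^^ Q) v = 0" "(?fX ^^ Q) v = 0" if "v \<in> car X" for v
   using funpow_zero_mono[OF X.X.e_nil[OF that] X.X.zero_simps(1) Q(1)] funpow_zero_mono[OF X.X.f_nil[OF that] X.X.zero_simps(2) Q(1)] by auto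
  have Ynil: "(?eY ^^ Q) v = 0" "(?fY ^^ Q) v = 0" if "v \<in> car Y" for v
   using funpow_zero_mono[OF Y.X.e_nil[OF that] Y.X.zero_simps(1) Q(2)] funpow_zero_mono[OF Y.X.f_nil[OF that] Y.X.zero_simps(2) Q(2)] by auto
  interpret XQ: sl2_nilpotent "car X" ?eX "act X sl2_h" ?fX Q by unfold_locales (use Xnil in auto)
  interpret YQ: sl2_nilpotent "car Y" ?eY "act Y sl2_h" ?fY Q by unfold_locales (use Ynil in auto)
  have wx: "?wx \<in> car X" and wy: "?wy \<in> car Y" using x y by simp_all
  have exp_e: "expo (2 * Q) ?eXY (tensor a b) = tensor (expo Q ?eX a) (expo Q ?eY b)" if "a \<in> car X" "b \<in> car Y" for a b
   by (rule expo_tensor[OF eXY]) (use that Xnil Ynil in auto)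
  have exp_f: "expo (2 * Q) (%v. - ?fXY v) (tensor a b) = tensor (expo Q (%v. - ?fX v) a) (expo Q (%v. - ?fY v) b)"
   if ab: "a \<in> car X" "b \<in> car Y" for a b
  proof (rule expo_tensor[where V = "car X" and W = "car Y"])
   show "linear_on (tensor_space (car X) (car Y)) (%v. - ?fXY v)" by (rule linear_on_uminus[OF linear_act_tensor[OF Xm Ym sl2_basis_in(3)]])
   show "- ?fXY (tensor v w) = tensor (- ?fX v) w + tensor v (- ?fY w)" if "v \<in> car X" "w \<in> car Y" for v w
    using that by (simp add: act_tensor[OF Xm Ym sl2_basis_in(3)] tensor_minus_left tensor_minus_right)
   show "((%v. - ?fX v) ^^ Q) a = 0" "((%v. - ?fY v) ^^ Q) b = 0"
    using pow_uminus[OF X.X.linear_f XQ.f_image ab(1), of Q] pow_uminus[OF Y.X.linear_f YQ.f_image ab(2), of Q] Xnil Ynil ab by simp_all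
  qed (use ab in auto)
  have W: "weyl (2 * Q) ?eXY ?fXY (tensor x y) = tensor ?wx ?wy"
   unfolding weyl_def using x y expo_in[OF X.X.subspace_V XQ.uf_image, of "expo Q ?eX x" Q] expo_in[OF Y.X.subspace_V YQ.uf_image, of "expo Q ?eY y" Q]
   by (simp add: exp_e exp_f)
  define \<tau> where "\<tau> n k l = tensor ((?eX ^^ k) ?wx) (tensor ((?eY ^^ l) ?wy) (trow s (n + k + l)))" for n k l
  define g where "g n k l = cscale (nbinom n k * nbinom (n + k) l) (\<tau> n k l)" for n k l
  have row: "trow s n \<in> car M" for n by (rule Y.seq_row[OF s])
  let ?K = "seq_tensor X ?YM (tensor x (seq_tensor Y M (tensor y s)))"
  have left: "trow (fn (seq_arr mu (sl2_assoc X Y M)) (seq_tensor ?XY M (tensor (tensor x y) s))) n = (\<Sum>m<2*Q. \<Sum>k\<le>m. g n k (m - k))" for n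
  proof -
   have pow: "tensor ((?eXY ^^ m) (tensor ?wx ?wy)) (trow s (n + m)) \<in> tensor_space (tensor_space (car X) (car Y)) (car M)" for m
    by (rule tensor_in[OF funpow_in[OF image_subsetI[OF act_tensor_in[OF Xm Ym sl2_basis_in(1)]] tensor_in[OF wx wy]] row])
   have "trow (fn (seq_arr mu (sl2_assoc X Y M)) (seq_tensor ?XY M (tensor (tensor x y) s))) n =
     fn (sl2_assoc X Y M) (\<Sum>m<2*Q. cscale (nbinom n m) (tensor ((?eXY ^^ m) (tensor ?wx ?wy)) (trow s (n + m))))"
    using XY.seq_tensor_in[OF xys] by (simp add: trow_seq_arr XY.seq_tensor_extend[OF Q(3) xy s] W del: seq_sel)
   also have "... = (\<Sum>m<2*Q. cscale (nbinom n m) (assoc_map (tensor ((?eXY ^^ m) (tensor ?wx ?wy)) (trow s (n + m)))))"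
    by (subst fn_assoc, intro cs.subspace_sum cs.subspace_scale subspace_tensor_space pow)
     (simp add: linear_on_sum[OF linear_on_assoc(1)[of UNIV]] linear_on_scale[OF linear_on_assoc(1)[of UNIV]])
   also have "... = (\<Sum>m<2*Q. \<Sum>k\<le>m. g n k (m - k))"
   proof (rule sum.cong[OF refl])
    fix m
    have "(?eXY ^^ m) (tensor ?wx ?wy) = (\<Sum>k\<le>m. cscale (of_nat (m choose k)) (tensor ((?eX ^^ k) ?wx) ((?eY ^^ (m - k)) ?wy)))"
     by (rule derivation_pow_tensor[OF eXY XQ.e_image YQ.e_image wx wy])
    then have "cscale (nbinom n m) (assoc_map (tensor ((?eXY ^^ m) (tensor ?wx ?wy)) (trow s (n + m)))) =
      (\<Sum>k\<le>m. cscale (nbinom n m * of_nat (m choose k)) (\<tau> n k (m - k)))"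
     by (simp add: tensor_sum_left linear_on_sum[OF linear_on_assoc(1)[of UNIV]] tensor_scale_left
       linear_on_scale[OF linear_on_assoc(1)[of UNIV]] cs.scale_sum_right \<tau>_def add.assoc)
    also have "... = (\<Sum>k\<le>m. g n k (m - k))"
     by (rule sum.cong[OF refl]) (simp add: g_def nbinom_trinomial)
    finally show "cscale (nbinom n m) (assoc_map (tensor ((?eXY ^^ m) (tensor ?wx ?wy)) (trow s (n + m)))) = (\<Sum>k\<le>m. g n k (m - k))" .
   qed
   finally show ?thesis .
  qed
  have right: "trow ?K n = (\<Sum>k<Q. \<Sum>l<Q. g n k l)" for n
  proof -
   have "trow ?K n = (\<Sum>k<Q. cscale (nbinom n k) (tensor ((?eX ^^ k) ?wx) (trow (seq_tensor Y M (tensor y s)) (n + k))))"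
    by (rule X.seq_tensor_extend[OF Q(1) x Y.seq_tensor_in[OF ys]])
   also have "... = (\<Sum>k<Q. \<Sum>l<Q. g n k l)"
    unfolding Y.seq_tensor_extend[OF Q(2) y s]
    by (simp add: tensor_sum_right tensor_scale_right cs.scale_sum_right g_def \<tau>_def)
   finally show ?thesis .
  qed
  have "fn (seq_arr mu (sl2_assoc X Y M)) (seq_tensor ?XY M (tensor (tensor x y) s)) = ?K"
  proof (rule trow_ext)
   fix n
   have "g n k l = 0" if "k \<ge> Q \<or> l \<ge> Q" for k l
    using that funpow_zero_mono[OF Xnil(1)[OF wx] X.X.zero_simps(1), of k] funpow_zero_mono[OF Ynil(1)[OF wy] Y.X.zero_simps(1), of l]
    by (auto simp: g_def \<tau>_def)
   then show "trow (fn (seq_arr mu (sl2_assoc X Y M)) (seq_tensor ?XY M (tensor (tensor x y) s))) n = trow ?K n"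
    unfolding left right by (rule diagonal_sum[symmetric])
  qed
  moreover have "fn (sl2_tensor_arr (sl2_id X) (seq_tensor_arr mu Y M)) (tensor x (tensor y s)) = tensor x (seq_tensor Y M (tensor y s))"
   using x ys by (subst fn_tensor_arr) (simp_all add: Xm KY(1,6) del: seq_sel)
  moreover have "tensor x (seq_tensor Y M (tensor y s)) \<in> tensor_space (car X) (car (seq_module mu ?YM))"
   by (rule tensor_in[OF x Y.seq_tensor_in[OF ys]])
  ultimately show "fn (sl2_comp (seq_arr mu (sl2_assoc X Y M)) (seq_tensor_arr mu ?XY M)) (tensor (tensor x y) s) =
   fn (sl2_comp (seq_tensor_arr mu X ?YM) (sl2_comp (sl2_tensor_arr (sl2_id X) (seq_tensor_arr mu Y M)) (sl2_assoc X Y ?F))) (tensor (tensor x y) s)"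
   using x y s xys by (simp add: KXY(6) KX(6) del: seq_sel)
 qed (use KXY(1) KX(1) KY(1) G Xm Ym F_in in \<open>simp_all del: seq_sel\<close>)
qed

end

text \<open>The inverse of \<open>seq_tensor_arr\<close>, because structure morphisms run from
  \<open>F (X \<otimes> M)\<close> to \<open>X \<otimes> F M\<close>.\<close>

definition seq_struct :: "complex => sl2_module => sl2_module => sl2_arrow" where
 "seq_struct mu X M = (SOME g. arr g & src g = tgt (seq_tensor_arr mu X M) & tgt g = src (seq_tensor_arr mu X M) &
  sl2_comp g (seq_tensor_arr mu X M) = sl2_id (src (seq_tensor_arr mu X M)) &
  sl2_comp (seq_tensor_arr mu X M) g = sl2_id (tgt (seq_tensor_arr mu X M)))"

text \<open>Naturality, associativity and the unit law are known for \<open>seq_tensor_arr\<close>;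
  composing with inverses on both sides moves each of them to \<open>seq_struct\<close>.\<close>

lemma seq_module_equivalent:
 assumes mu: "mu \<notin> \<int>"
 shows "module_equivalent fd_sl2 (N1 mu) (N1 (- mu))"
proof -
 let ?F = "seq_module mu" and ?K = "seq_tensor_arr mu" and ?s = "seq_struct mu"
 have mu': "- mu \<notin> \<int>" using mu by simp
 have obj: "M \<in> Obj (N1 mu) \<longleftrightarrow> verma M mu" for M
  using Obj_N1[OF mu] vermaI[OF mu] verma.verma by auto
 have sel: "Hom (N1 \<nu>) = sl2_Hom" "Idn (N1 \<nu>) = sl2_id" "Comp (N1 \<nu>) = sl2_comp" "ActO (N1 \<nu>) = sl2_tensor"
  "ActA (N1 \<nu>) = sl2_tensor_arr" "MAssoc (N1 \<nu>) = sl2_assoc" "MUnit (N1 \<nu>) = sl2_lunit" for \<nu> by (simp_all add: N1_def)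
 have mod: "X \<in> sl2_modules" if "X \<in> Obj fd_sl2" for X using that by simp
 have s: "arr (?s X M)" "src (?s X M) = tgt (?K X M)" "tgt (?s X M) = src (?K X M)"
   "sl2_comp (?s X M) (?K X M) = sl2_id (src (?K X M))" "sl2_comp (?K X M) (?s X M) = sl2_id (tgt (?K X M))"
   "?s X M \<in> iso_arrows (N1 (- mu)) (?F (sl2_tensor X M)) (sl2_tensor X (?F M))"
  if X: "X \<in> Obj fd_sl2" and M: "verma M mu" for X M
 proof -
  have fX: "X \<in> sl2_modules & finite_dimensional X" using X by simp
  note K = arr_seq_tensor_arr[OF mu fX M]
  have "?K X M \<in> iso_arrows (N1 mu) (src (?K X M)) (tgt (?K X M))"
   by (rule iso_arrows_bij[OF arr_src[OF K(1)] arr_tgt[OF K(1)] sel(1-3) K(1) refl refl])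
    (use K(5) in \<open>simp del: seq_sel\<close>)
  then have "\<exists>g. arr g & src g = tgt (?K X M) & tgt g = src (?K X M) &
   sl2_comp g (?K X M) = sl2_id (src (?K X M)) & sl2_comp (?K X M) g = sl2_id (tgt (?K X M))"
   unfolding iso_arrows_def sel using Hom_iff_arr[OF arr_tgt[OF K(1)] arr_src[OF K(1)]] by blast
  from someI_ex[OF this] have "arr (?s X M) & src (?s X M) = tgt (?K X M) & tgt (?s X M) = src (?K X M) &
   sl2_comp (?s X M) (?K X M) = sl2_id (src (?K X M)) & sl2_comp (?K X M) (?s X M) = sl2_id (tgt (?K X M))"
   unfolding seq_struct_def .
  then show s: "arr (?s X M)" "src (?s X M) = tgt (?K X M)" "tgt (?s X M) = src (?K X M)"
   "sl2_comp (?s X M) (?K X M) = sl2_id (src (?K X M))" "sl2_comp (?K X M) (?s X M) = sl2_id (tgt (?K X M))" by auto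
  have "?K X M \<in> sl2_Hom (src (?K X M)) (tgt (?K X M))" "?s X M \<in> sl2_Hom (tgt (?K X M)) (src (?K X M))"
   using K(1) s(1-3) unfolding arr_def by auto
  then show "?s X M \<in> iso_arrows (N1 (- mu)) (?F (sl2_tensor X M)) (sl2_tensor X (?F M))"
   unfolding iso_arrows_def sel using s(4,5) by auto
 qed
 have mf: "module_functor fd_sl2 (N1 mu) (N1 (- mu)) ?F (seq_arr mu) ?s"
  unfolding module_functor_def sel fd_sl2_sel(3) fd_sl2_sel(7-)
 proof (intro conjI ballI)
  show "linear_functor (N1 mu) (N1 (- mu)) ?F (seq_arr mu)"
   using seq_equivalence[OF mu] unfolding equivalence_functor_def by blast
 next
  fix X M assume "X \<in> Obj fd_sl2" "M \<in> Obj (N1 mu)"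
  then show "?s X M \<in> iso_arrows (N1 (- mu)) (?F (sl2_tensor X M)) (sl2_tensor X (?F M))" by (intro s(6)) (auto simp: obj)
 next
  fix X Y M N f g assume X: "X \<in> Obj fd_sl2" and Y: "Y \<in> Obj fd_sl2" and M: "M \<in> Obj (N1 mu)" and N: "N \<in> Obj (N1 mu)"
   and f: "f \<in> Hom fd_sl2 X Y" and g: "g \<in> sl2_Hom M N"
  have MN: "verma M mu" "verma N mu" using M N by (simp_all add: obj)
  have XY: "X \<in> sl2_modules & finite_dimensional X" "Y \<in> sl2_modules & finite_dimensional Y" using X Y by simp_all
  note KX = arr_seq_tensor_arr[OF mu XY(1) MN(1)] and KY = arr_seq_tensor_arr[OF mu XY(2) MN(2)]
  have f: "arr f" "src f = X" "tgt f = Y" using f Hom_iff_arr XY by auto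
  have g: "arr g" "src g = M" "tgt g = N" using g Hom_iff_arr KX(3) KY(3) by auto
  have F: "arr (seq_arr mu g)" "arr (seq_arr mu (sl2_tensor_arr f g))"
   by (rule arr_seq_arr; simp add: f g MN KX(2) KY(2))+
  have nat: "sl2_comp (seq_arr mu (sl2_tensor_arr f g)) (?K X M) = sl2_comp (?K Y N) (sl2_tensor_arr f (seq_arr mu g))"
   using seq_tensor_natural[OF mu, of f g] f g MN XY by simp
  note sX = s[OF X MN(1)] and sY = s[OF Y MN(2)]
  have "sl2_comp (?s Y N) (seq_arr mu (sl2_tensor_arr f g)) =
    sl2_comp (?s Y N) (sl2_comp (sl2_comp (seq_arr mu (sl2_tensor_arr f g)) (?K X M)) (?s X M))"
   using sX sY KX(1) F f g by (simp add: sl2_comp_assoc del: seq_sel)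
  also have "... = sl2_comp (sl2_comp (?s Y N) (?K Y N)) (sl2_comp (sl2_tensor_arr f (seq_arr mu g)) (?s X M))"
   unfolding nat using sX(1-3) sY(1-3) KY(1) F f g by (simp add: sl2_comp_assoc del: seq_sel)
  also have "... = sl2_comp (sl2_tensor_arr f (seq_arr mu g)) (?s X M)"
   using sX(1-3) sY F f g by (simp del: seq_sel)
  finally show "sl2_comp (?s Y N) (seq_arr mu (sl2_tensor_arr f g)) = sl2_comp (sl2_tensor_arr f (seq_arr mu g)) (?s X M)" .
 next
  fix X Y M assume X: "X \<in> Obj fd_sl2" and Y: "Y \<in> Obj fd_sl2" and M: "M \<in> Obj (N1 mu)"
  have M: "verma M mu" using M by (simp add: obj)
  have XY: "X \<in> sl2_modules & finite_dimensional X" "Y \<in> sl2_modules & finite_dimensional Y" using X Y by simp_all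
  have XYO: "sl2_tensor X Y \<in> Obj fd_sl2" and XY2: "sl2_tensor X Y \<in> sl2_modules & finite_dimensional (sl2_tensor X Y)"
   using XY by (simp_all add: finite_dimensional_tensor)
  note KY = arr_seq_tensor_arr[OF mu XY(2) M] and KXY = arr_seq_tensor_arr[OF mu XY2 M]
  note KX = arr_seq_tensor_arr[OF mu XY(1) KY(2)]
  note sY = s[OF Y M] and sX = s[OF X KY(2)] and sXY = s[OF XYO M]
  have as: "arr (sl2_assoc X Y M)" "arr (sl2_assoc X Y (?F M))" using XY KY by (simp_all del: seq_sel)
  have F: "arr (seq_arr mu (sl2_assoc X Y M))" by (rule arr_seq_arr) (use as KXY(2) KX(2) in auto)
  let ?T = "%k. sl2_tensor_arr (sl2_id X) k"
  have inv: "sl2_comp (?T (?s Y M)) (?T (?K Y M)) = sl2_id (sl2_tensor X (sl2_tensor Y (?F M)))"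
   using sl2_tensor_arr_functorial(1)[of "sl2_id X" "?K Y M" "sl2_id X" "?s Y M"] XY KY(1,4) sY
   by (simp add: sl2_tensor_arr_id del: seq_sel)
  have "sl2_comp (?T (?s Y M)) (sl2_comp (?s X (sl2_tensor Y M)) (seq_arr mu (sl2_assoc X Y M))) =
    sl2_comp (?T (?s Y M)) (sl2_comp (?s X (sl2_tensor Y M)) (sl2_comp (sl2_comp (seq_arr mu (sl2_assoc X Y M)) (?K (sl2_tensor X Y) M)) (?s (sl2_tensor X Y) M)))"
   using sX(1-3) sY(1-3) sXY KXY(1) F XY by (simp add: sl2_comp_assoc del: seq_sel)
  also have "... = sl2_comp (?T (?s Y M)) (sl2_comp (sl2_comp (?s X (sl2_tensor Y M)) (?K X (sl2_tensor Y M)))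
    (sl2_comp (?T (?K Y M)) (sl2_comp (sl2_assoc X Y (?F M)) (?s (sl2_tensor X Y) M))))"
   unfolding seq_tensor_assoc[OF mu XY M] using sX(1-3) sY(1-3) sXY(1-3) KX(1) KY(1) as XY by (simp add: sl2_comp_assoc del: seq_sel)
  also have "... = sl2_comp (sl2_comp (?T (?s Y M)) (?T (?K Y M))) (sl2_comp (sl2_assoc X Y (?F M)) (?s (sl2_tensor X Y) M))"
   unfolding sX(4) using sY(1-3) sXY(1-3) KY(1) as XY by (simp add: sl2_comp_assoc del: seq_sel)
  also have "... = sl2_comp (sl2_assoc X Y (?F M)) (?s (sl2_tensor X Y) M)"
   unfolding inv using sXY(1-3) as by (simp del: seq_sel)
  finally show "sl2_comp (?T (?s Y M)) (sl2_comp (?s X (sl2_tensor Y M)) (seq_arr mu (sl2_assoc X Y M))) =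
    sl2_comp (sl2_assoc X Y (?F M)) (?s (sl2_tensor X Y) M)" .
 next
  fix M assume M: "M \<in> Obj (N1 mu)"
  have M: "verma M mu" using M by (simp add: obj)
  have U: "sl2_trivial \<in> Obj fd_sl2" "sl2_trivial \<in> sl2_modules & finite_dimensional sl2_trivial" by simp_all
  note K = arr_seq_tensor_arr[OF mu U(2) M] and sU = s[OF U(1) M]
  have F: "arr (seq_arr mu (sl2_lunit M))" by (rule arr_seq_arr) (simp_all add: K M)
  have "sl2_comp (sl2_lunit (?F M)) (?s sl2_trivial M) = sl2_comp (seq_arr mu (sl2_lunit M)) (sl2_comp (?K sl2_trivial M) (?s sl2_trivial M))"
   unfolding seq_tensor_unit[OF mu M, symmetric] using sU(1-3) K(1) F by (simp add: sl2_comp_assoc del: seq_sel)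
  also have "... = seq_arr mu (sl2_lunit M)" unfolding sU(5) using F by (simp del: seq_sel)
  finally show "sl2_comp (sl2_lunit (?F M)) (?s sl2_trivial M) = seq_arr mu (sl2_lunit M)" .
 qed
 show ?thesis
  unfolding module_equivalent_def
  using N1_module_category[OF mu] N1_module_category[OF mu'] mf seq_equivalence[OF mu] by blast
qed

section \<open>The natural two-dimensional module and the split Casimir operator\<close>

definition unit_vec :: "nat => cseq" where
 "unit_vec k = (\<lambda>n. if n = k then 1 else 0)"

lemma unit_vec_apply [simp]: "unit_vec k n = (if n = k then 1 else 0)"
 by (simp add: unit_vec_def)

definition std :: sl2_module where
 "std = mk_module {t. \<forall>n\<ge>2. t n = 0} (%t. cscale (t 1) (unit_vec 0))
  (%t. cscale (t 0) (unit_vec 0) - cscale (t 1) (unit_vec 1)) (%t. cscale (t 0) (unit_vec 1))"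

lemma car_std: "car std = {t. \<forall>n\<ge>2. t n = 0}"
 and act_std [simp]: "act std sl2_e t = cscale (t 1) (unit_vec 0)" "act std sl2_f t = cscale (t 0) (unit_vec 1)"
  "act std sl2_h t = cscale (t 0) (unit_vec 0) - cscale (t 1) (unit_vec 1)"
 by (simp_all add: std_def)

lemma std_unit_vec [simp]: "unit_vec 0 \<in> car std" "unit_vec (Suc 0) \<in> car std"
 by (simp_all add: car_std)

lemma std_expand: "t \<in> car std ==> t = cscale (t 0) (unit_vec 0) + cscale (t 1) (unit_vec 1)"
proof (rule ext)
 fix n assume "t \<in> car std"
 then show "t n = (cscale (t 0) (unit_vec 0) + cscale (t 1) (unit_vec 1)) n"
  by (cases n; cases "n - 1") (auto simp: car_std cscale_def)
qed

lemma std_in [simp]: "std \<in> sl2_modules"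
proof -
 have "sl2_rep {t. \<forall>n\<ge>2. t n = 0} (%t. cscale (t 1) (unit_vec 0))
  (%t. cscale (t 0) (unit_vec 0) - cscale (t 1) (unit_vec 1)) (%t. cscale (t 0) (unit_vec 1))"
  by unfold_locales
   (auto simp: cs.subspace_def linear_on_def cscale_def fun_eq_iff algebra_simps)
 then show ?thesis unfolding std_def by (rule sl2_rep.mk_module_in)
qed

lemma std_fd [simp]: "finite_dimensional std"
 unfolding finite_dimensional_def
proof (intro exI conjI)
 show "car std = cs.span {unit_vec 0, unit_vec 1}"
 proof
  show "car std \<subseteq> cs.span {unit_vec 0, unit_vec 1}"
  proof
   fix t assume "t \<in> car std"
   from std_expand[OF this] show "t \<in> cs.span {unit_vec 0, unit_vec 1}"
    by (metis cs.span_add cs.span_scale cs.span_base insertI1 insertI2)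
  qed
  show "cs.span {unit_vec 0, unit_vec 1} \<subseteq> car std"
   by (rule span_sub) (auto simp: sl2_module_subspace)
 qed
qed simp

text \<open>Column vectors over \<open>M\<close>, so that operators on
  \<open>\<complex>^2 \<otimes> M\<close> become two by two blocks.\<close>

definition std_pair :: "cseq => cseq => cseq" where
 "std_pair a b = tensor (unit_vec 0) a + tensor (unit_vec 1) b"

lemma trow_std_pair [simp]: "trow (std_pair a b) 0 = a" "trow (std_pair a b) (Suc 0) = b"
 by (simp_all add: std_pair_def trow_simps trow_tensor cscale_def)

lemma std_pair_eq_iff [simp]: "std_pair a b = std_pair c d \<longleftrightarrow> a = c & b = d"
 by (metis trow_std_pair)

lemma std_pair_ops: "std_pair a b + std_pair c d = std_pair (a + c) (b + d)" "cscale z (std_pair a b) = std_pair (cscale z a) (cscale z b)"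
 "std_pair 0 0 = 0"
 by (simp_all add: std_pair_def tensor_add_right tensor_scale_right cs.scale_right_distrib add_ac)

lemma std_tensor: "v \<in> car std ==> tensor v m = std_pair (cscale (v 0) m) (cscale (v 1) m)"
 by (subst std_expand) (simp_all add: std_pair_def tensor_add_left tensor_scale_left tensor_scale_right)

lemma tensor_unit_vec: "tensor (unit_vec 0) m = std_pair m 0" "tensor (unit_vec (Suc 0)) m = std_pair 0 m"
 by (simp_all add: std_pair_def)

lemma std_tensor_expand:
 assumes M: "cs.subspace (car M)" and t: "t \<in> tensor_space (car std) (car M)"
 shows "t = std_pair (trow t 0) (trow t 1)" "trow t 0 \<in> car M" "trow t 1 \<in> car M"
proof -
 have lin: "linear_on UNIV (%t. std_pair (trow t 0) (trow t 1))"
  by (rule linear_onI) (simp_all add: trow_simps std_pair_ops)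
 show "t = std_pair (trow t 0) (trow t 1)"
  by (rule tensor_ext[OF t linear_on_id(2) linear_on_subset[OF lin]]) (auto simp: std_tensor)
 show "trow t 0 \<in> car M" "trow t 1 \<in> car M" by (rule trow_in[OF M t])+
qed

lemma std_pair_in [simp]: "a \<in> car M ==> b \<in> car M ==> std_pair a b \<in> tensor_space (car std) (car M)"
 unfolding std_pair_def by (intro cs.subspace_add) auto

lemma act_std_pair:
 assumes M: "M \<in> sl2_modules" and ab: "a \<in> car M" "b \<in> car M"
 shows "act (sl2_tensor std M) sl2_e (std_pair a b) = std_pair (act M sl2_e a + b) (act M sl2_e b)"
  and "act (sl2_tensor std M) sl2_h (std_pair a b) = std_pair (act M sl2_h a + a) (act M sl2_h b - b)"
  and "act (sl2_tensor std M) sl2_f (std_pair a b) = std_pair (act M sl2_f a) (act M sl2_f b + a)"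
proof -
 have "act (sl2_tensor std M) x (std_pair a b) = tensor (act std x (unit_vec 0)) a + tensor (unit_vec 0) (act M x a) +
   (tensor (act std x (unit_vec 1)) b + tensor (unit_vec 1) (act M x b))" if x: "x \<in> sl2" for x
  unfolding std_pair_def using ab M
  by (subst linear_on_add[OF linear_act_tensor[OF std_in M x]]) (simp_all add: x)
 then show "act (sl2_tensor std M) sl2_e (std_pair a b) = std_pair (act M sl2_e a + b) (act M sl2_e b)"
  "act (sl2_tensor std M) sl2_h (std_pair a b) = std_pair (act M sl2_h a + a) (act M sl2_h b - b)"
  "act (sl2_tensor std M) sl2_f (std_pair a b) = std_pair (act M sl2_f a) (act M sl2_f b + a)"
  by (simp_all add: std_pair_def tensor_add_right tensor_diff_right tensor_minus_left)
qed

lemma arr_std_ext: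
 assumes "arr f" "arr g" "src f = sl2_tensor std M" "src g = sl2_tensor std M" "tgt f = tgt g"
  and M: "M \<in> sl2_modules"
  and "!!a b. a \<in> car M ==> b \<in> car M ==> fn f (std_pair a b) = fn g (std_pair a b)"
 shows "f = g"
proof (rule arr_ext)
 fix t assume "t \<in> car (src g)"
 then have t: "t \<in> tensor_space (car std) (car M)" using assms(4) by simp
 note * = std_tensor_expand[OF sl2_module_subspace[OF M] t]
 show "fn f t = fn g t" using assms(7)[OF *(2,3)] *(1) by simp
qed (use assms in auto)

text \<open>\<open>std_casimir M\<close> is \<open>h \<otimes> h + 2 e \<otimes> f + 2 f \<otimes> e\<close> on \<open>\<complex>\<^sup>2 \<otimes> M\<close>, in block form \<open>((h, 2f), (2e, -h))\<close>.\<close>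

definition std_casimir :: "sl2_module => sl2_arrow" where
 "std_casimir M = sl2_arr (sl2_tensor std M) (sl2_tensor std M)
  (%t. std_pair (act M sl2_h (trow t 0) + cscale 2 (act M sl2_f (trow t 1)))
   (cscale 2 (act M sl2_e (trow t 0)) - act M sl2_h (trow t 1)))"

text \<open>The Casimir element normalised so that on a highest weight vector of weight
  \<open>w\<close> its value is \<open>w^2 + 2 w = (w + 1)^2 - 1\<close>.\<close>

definition casimir :: "sl2_module => sl2_arrow" where
 "casimir M = sl2_arr M M (%m. act M sl2_h (act M sl2_h m) + cscale 2 (act M sl2_h m) +
  cscale 4 (act M sl2_f (act M sl2_e m)))"

lemma casimir_sel [simp]: "src (std_casimir M) = sl2_tensor std M" "tgt (std_casimir M) = sl2_tensor std M"
 "src (casimir M) = M" "tgt (casimir M) = M"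
 by (simp_all add: std_casimir_def casimir_def)

lemma fn_std_casimir:
 "a \<in> car M ==> b \<in> car M ==> fn (std_casimir M) (std_pair a b) =
  std_pair (act M sl2_h a + cscale 2 (act M sl2_f b)) (cscale 2 (act M sl2_e a) - act M sl2_h b)"
 by (simp add: std_casimir_def)

lemma arr_casimir:
 assumes M: "M \<in> sl2_modules"
 shows "arr (std_casimir M)" and "arr (casimir M)"
proof -
 interpret sl2_rep "car M" "act M sl2_e" "act M sl2_h" "act M sl2_f" by (rule sl2_module_rep[OF M])
 let ?T = "%t. std_pair (act M sl2_h (trow t 0) + cscale 2 (act M sl2_f (trow t 1)))
   (cscale 2 (act M sl2_e (trow t 0)) - act M sl2_h (trow t 1))"
 show "arr (std_casimir M)" unfolding std_casimir_def
 proof (rule arr_sl2_arrI2)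
  show "linear_on (car (sl2_tensor std M)) ?T"
  proof (rule linear_onI)
   fix s t assume "s \<in> car (sl2_tensor std M)" "t \<in> car (sl2_tensor std M)"
   then have "trow s 0 \<in> car M" "trow s 1 \<in> car M" "trow t 0 \<in> car M" "trow t 1 \<in> car M"
    using std_tensor_expand(2,3)[OF subspace_V] by simp_all
   then show "?T (s + t) = ?T s + ?T t" by (simp add: std_pair_ops trow_simps lin_simps) (simp add: algebra_simps cs.scale_right_distrib)
  next
   fix c t assume "t \<in> car (sl2_tensor std M)"
   then have "trow t 0 \<in> car M" "trow t 1 \<in> car M" using std_tensor_expand(2,3)[OF subspace_V] by simp_all
   then show "?T (cscale c t) = cscale c (?T t)"
    by (simp add: std_pair_ops trow_simps lin_simps) (simp add: fun_eq_iff cscale_def algebra_simps)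
  qed
  fix t assume t: "t \<in> car (sl2_tensor std M)"
  then obtain a b where ab: "a \<in> car M" "b \<in> car M" and t: "t = std_pair a b"
   using std_tensor_expand[OF subspace_V, of t] by auto
  show "?T t \<in> car (sl2_tensor std M)" unfolding t using ab by simp
  show "?T (act (sl2_tensor std M) sl2_e t) = act (sl2_tensor std M) sl2_e (?T t)"
   unfolding t using ab
   by (simp add: act_std_pair[OF M] lin_simps h_e e_f) (simp add: fun_eq_iff cscale_def algebra_simps)
  show "?T (act (sl2_tensor std M) sl2_f t) = act (sl2_tensor std M) sl2_f (?T t)"
   unfolding t using ab
   by (simp add: act_std_pair[OF M] lin_simps h_f e_f) (simp add: fun_eq_iff cscale_def algebra_simps)
 qed (simp_all add: M)
 show "arr (casimir M)" unfolding casimir_def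
 proof (rule arr_sl2_arrI2[OF M M])
  show "linear_on (car M) (%m. act M sl2_h (act M sl2_h m) + cscale 2 (act M sl2_h m) + cscale 4 (act M sl2_f (act M sl2_e m)))"
   by (intro linear_on_plus linear_on_cscale linear_h linear_on_comp(2)[OF linear_h linear_h] linear_on_comp(2)[OF linear_e linear_f]) auto
 qed (simp_all add: lin_simps h_e h_f e_f, simp_all add: fun_eq_iff cscale_def algebra_simps)
qed

text \<open>For generic \<open>w\<close>, over a Verma module of highest weight \<open>w\<close>,
  the operator has the eigenvalues \<open>w\<close> and \<open>- w - 2\<close>, on the parts of
  highest weight \<open>w + 1\<close> and \<open>w - 1\<close>. Their sum \<open>- 2\<close> and
  product \<open>- (w^2 + 2 w)\<close> give the quadratic relation.\<close>

lemma std_casimir_square: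
 assumes M: "M \<in> sl2_modules" and ab: "a \<in> car M" "b \<in> car M"
 shows "fn (std_casimir M) (fn (std_casimir M) (std_pair a b)) + cscale 2 (fn (std_casimir M) (std_pair a b)) =
  std_pair (fn (casimir M) a) (fn (casimir M) b)"
proof -
 interpret sl2_rep "car M" "act M sl2_e" "act M sl2_h" "act M sl2_f" by (rule sl2_module_rep[OF M])
 show ?thesis using ab
  by (simp add: fn_std_casimir std_pair_ops casimir_def lin_simps h_e h_f e_f) (simp add: fun_eq_iff cscale_def algebra_simps)
qed

section \<open>Partial traces over the natural module\<close>

text \<open>The invariant symplectic form, by which the natural module is its own dual, so that
  traces can be formed without dual modules; \<open>std_coev\<close> is the matching invariant
  tensor.\<close>

definition std_ev :: sl2_arrow where
 "std_ev = sl2_arr (sl2_tensor std std) sl2_trivial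
  (%t. cscale (t (prod_encode (0, 1)) - t (prod_encode (1, 0))) sl2_unit_vector)"

definition std_coev :: sl2_arrow where
 "std_coev = sl2_arr sl2_trivial (sl2_tensor std std)
  (%t. cscale (t 0) (tensor (unit_vec 0) (unit_vec 1) - tensor (unit_vec 1) (unit_vec 0)))"

text \<open>The partial trace as a composite of constraints and arrows of the acting category with
  \<open>ph\<close>, the form in which a module functor can transport it.\<close>

definition std_trace :: "sl2_module => sl2_arrow => sl2_arrow" where
 "std_trace M ph = sl2_comp (sl2_tensor_arr std_ev (sl2_id M)) (sl2_comp (sl2_assoc_inv std std M)
  (sl2_comp (sl2_tensor_arr (sl2_id std) ph) (sl2_comp (sl2_assoc std std M) (sl2_tensor_arr std_coev (sl2_id M)))))"

lemma std_duality_sel [simp]: "src std_ev = sl2_tensor std std" "tgt std_ev = sl2_trivial"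
 "src std_coev = sl2_trivial" "tgt std_coev = sl2_tensor std std"
 by (simp_all add: std_ev_def std_coev_def)

lemma arr_std_duality [simp]: "arr std_ev" "arr std_coev"
proof -
 have act: "act std x t = cscale (x $ 1 $ 1) (act std sl2_h t) + cscale (x $ 1 $ 2) (act std sl2_e t) + cscale (x $ 2 $ 1) (act std sl2_f t)" for x t
  by (simp add: std_def mk_module_def sl2_nth)
 show "arr std_ev" unfolding std_ev_def
 proof (rule arr_tensorI)
  show "linear_on (tensor_space (car std) (car std)) (%t. cscale (t (prod_encode (0, 1)) - t (prod_encode (1, 0))) sl2_unit_vector)"
   by (rule linear_onI) (simp_all add: cscale_def fun_eq_iff algebra_simps)
  fix x v w assume "x \<in> sl2" "v \<in> car std" "w \<in> car std"
  show "cscale ((tensor (act std x v) w + tensor v (act std x w)) (prod_encode (0, 1)) -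
    (tensor (act std x v) w + tensor v (act std x w)) (prod_encode (1, 0))) sl2_unit_vector =
   act sl2_trivial x (cscale (tensor v w (prod_encode (0, 1)) - tensor v w (prod_encode (1, 0))) sl2_unit_vector)"
   unfolding act[of x] by (simp add: cscale_def algebra_simps)
 qed (simp_all add: sl2_module_scale_in)
 show "arr std_coev" unfolding std_coev_def
 proof (rule arr_sl2_arrI2)
  show "linear_on (car sl2_trivial) (%t. cscale (t 0) (tensor (unit_vec 0) (unit_vec 1) - tensor (unit_vec 1) (unit_vec 0)))"
   by (rule linear_onI) (simp_all add: cscale_def fun_eq_iff algebra_simps)
  note lin = linear_act_tensor[OF std_in std_in]
  have tin: "tensor (unit_vec 0) (unit_vec 1) - tensor (unit_vec 1) (unit_vec 0) \<in> tensor_space (car std) (car std)"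
   by (intro cs.subspace_diff) auto
  fix t :: cseq
  show "cscale (t 0) (tensor (unit_vec 0) (unit_vec 1) - tensor (unit_vec 1) (unit_vec 0)) \<in> car (sl2_tensor std std)"
   unfolding car_tensor by (rule cs.subspace_scale[OF subspace_tensor_space tin])
  have act0: "act (sl2_tensor std std) x (tensor (unit_vec 0) (unit_vec 1) - tensor (unit_vec 1) (unit_vec 0)) = 0"
   if x: "x = sl2_e \<or> x = sl2_f" for x
  proof -
   have xs: "x \<in> sl2" using x by auto
   show ?thesis
    by (subst linear_on_diff[OF lin[OF xs] subspace_tensor_space])
     (use x in \<open>auto simp: xs tensor_scale_left tensor_scale_right\<close>)
  qed
  show "cscale ((act sl2_trivial sl2_e t) 0) (tensor (unit_vec 0) (unit_vec 1) - tensor (unit_vec 1) (unit_vec 0)) =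
    act (sl2_tensor std std) sl2_e (cscale (t 0) (tensor (unit_vec 0) (unit_vec 1) - tensor (unit_vec 1) (unit_vec 0)))"
   by (subst linear_on_scale[OF lin[OF sl2_basis_in(1)] tin], subst act0) simp_all
  show "cscale ((act sl2_trivial sl2_f t) 0) (tensor (unit_vec 0) (unit_vec 1) - tensor (unit_vec 1) (unit_vec 0)) =
    act (sl2_tensor std std) sl2_f (cscale (t 0) (tensor (unit_vec 0) (unit_vec 1) - tensor (unit_vec 1) (unit_vec 0)))"
   by (subst linear_on_scale[OF lin[OF sl2_basis_in(3)] tin], subst act0) simp_all
 qed simp_all
qed

text \<open>The signs in \<open>std_ev\<close> and \<open>std_coev\<close> cancel, so the
  categorical trace is the ordinary sum of the diagonal blocks.\<close>

lemma fn_std_trace: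
 assumes M: "M \<in> sl2_modules" and ph: "arr ph" "src ph = sl2_tensor std M" "tgt ph = sl2_tensor std M" and m: "m \<in> car M"
 shows "fn (std_trace M ph) (tensor sl2_unit_vector m) =
  tensor sl2_unit_vector (trow (fn ph (tensor (unit_vec 1) m)) 1 + trow (fn ph (tensor (unit_vec 0) m)) 0)"
proof -
 let ?v = "unit_vec 0" and ?w = "unit_vec 1" and ?u = sl2_unit_vector
 note sub = sl2_module_subspace[OF M]
 have in1: "tensor ?v m \<in> car (sl2_tensor std M)" "tensor ?w m \<in> car (sl2_tensor std M)" using m by simp_all
 obtain a b c d where abcd: "a \<in> car M" "b \<in> car M" "c \<in> car M" "d \<in> car M"
  and ab: "fn ph (tensor ?w m) = tensor ?v a + tensor ?w b" and cd: "fn ph (tensor ?v m) = tensor ?v c + tensor ?w d"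
  using std_tensor_expand[OF sub, of "fn ph (tensor ?w m)"] std_tensor_expand[OF sub, of "fn ph (tensor ?v m)"]
   arr_in'[OF ph in1(1)] arr_in'[OF ph in1(2)] unfolding std_pair_def car_tensor by metis
 have u0: "?u 0 = 1" by (simp add: sl2_unit_vector_def)
 have coev: "fn std_coev ?u = tensor ?v ?w - tensor ?w ?v" by (simp add: std_coev_def u0)
 have ev: "fn std_ev (tensor x y) = cscale (x 0 * y 1 - x 1 * y 0) ?u" if "x \<in> car std" "y \<in> car std" for x y
  using that by (simp add: std_ev_def)
 have 1: "fn (sl2_comp (sl2_assoc std std M) (sl2_tensor_arr std_coev (sl2_id M))) (tensor ?u m) =
   tensor ?v (tensor ?w m) - tensor ?w (tensor ?v m)"
 proof -
  have "tensor (tensor ?v ?w) m - tensor (tensor ?w ?v) m \<in> tensor_space (tensor_space (car std) (car std)) (car M)"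
   using m by (intro cs.subspace_diff) auto
  then show ?thesis using m M
   by (simp add: coev tensor_diff_left fn_assoc) (simp add: linear_on_diff[OF linear_on_assoc(1)[of UNIV]])
 qed
 have 2: "fn (sl2_tensor_arr (sl2_id std) ph) (tensor ?v (tensor ?w m) - tensor ?w (tensor ?v m)) =
   tensor ?v (fn ph (tensor ?w m)) - tensor ?w (fn ph (tensor ?v m))"
  by (subst linear_on_diff[OF arr_linear[OF arr_tensor_arr[OF arr_id[OF std_in] ph(1)]]])
   (use m ph in auto)
 have 3: "fn (sl2_comp (sl2_tensor_arr std_ev (sl2_id M)) (sl2_assoc_inv std std M))
   (tensor ?v (tensor ?v a + tensor ?w b) - tensor ?w (tensor ?v c + tensor ?w d)) = tensor ?u (b + c)"
 proof -
  have in3: "tensor ?v (tensor ?v a + tensor ?w b) - tensor ?w (tensor ?v c + tensor ?w d) \<in> tensor_space (car std) (tensor_space (car std) (car M))"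
   using abcd by (intro cs.subspace_diff tensor_in cs.subspace_add) auto
  have E: "fn (sl2_tensor_arr std_ev (sl2_id M)) (tensor (tensor x y) z) = tensor (cscale (x 0 * y 1 - x 1 * y 0) ?u) z"
   if "x \<in> car std" "y \<in> car std" "z \<in> car M" for x y z
   using that M by (subst fn_tensor_arr) (simp_all add: ev)
  have "fn (sl2_tensor_arr std_ev (sl2_id M)) ((tensor (tensor ?v ?v) a + tensor (tensor ?v ?w) b) - (tensor (tensor ?w ?v) c + tensor (tensor ?w ?w) d)) =
   tensor ?u (b + c)"
  proof -
   note lin = arr_linear[OF arr_tensor_arr[OF arr_std_duality(1) arr_id[OF M]], simplified]
   have ins: "tensor (tensor x y) z \<in> tensor_space (tensor_space (car std) (car std)) (car M)" if "x \<in> car std" "y \<in> car std" "z \<in> car M" for x y z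
    using that by auto
   show ?thesis
    using abcd by (simp add: linear_on_diff[OF lin subspace_tensor_space] linear_on_add[OF lin] ins cs.subspace_add E tensor_scale_left tensor_add_right tensor_minus_left)
  qed
  then show ?thesis using in3 M
   by (simp add: fn_assoc linear_on_diff[OF linear_on_assoc(2)[of UNIV]] linear_on_add[OF linear_on_assoc(2)[of UNIV]] tensor_add_right)
 qed
 have mu: "tensor ?u m \<in> tensor_space (car sl2_trivial) (car M)" using m by simp
 have "fn (std_trace M ph) (tensor ?u m) = fn (sl2_comp (sl2_tensor_arr std_ev (sl2_id M)) (sl2_assoc_inv std std M))
   (fn (sl2_tensor_arr (sl2_id std) ph) (fn (sl2_comp (sl2_assoc std std M) (sl2_tensor_arr std_coev (sl2_id M))) (tensor ?u m)))"
 proof -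
  have "fn (sl2_tensor_arr (sl2_id std) ph) (tensor ?v (tensor ?w m) - tensor ?w (tensor ?v m)) \<in> tensor_space (car std) (tensor_space (car std) (car M))"
   unfolding 2 using m ph in1 by (intro cs.subspace_diff tensor_in) (auto intro: arr_in'[OF ph, unfolded car_tensor])
  then show ?thesis using mu 1 by (simp add: std_trace_def)
 qed
 also have "... = tensor ?u (b + c)" unfolding 1 2 ab cd 3 ..
 finally show ?thesis unfolding ab cd unfolding std_pair_def[symmetric] unfolding One_nat_def trow_std_pair .
qed

section \<open>Verma modules in coordinates\<close>

text \<open>Coordinates with respect to the vectors \<open>f^k v\<close>, which explains the
  coefficients of \<open>e\<close>. On all sequences the relations are plain identities;
  \<open>verma_mod\<close> restricts to finitely supported ones.\<close>

definition verma_univ :: "complex => sl2_module" where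
 "verma_univ ka = mk_module UNIV (%t k. of_nat (Suc k) * (ka - of_nat k) * t (Suc k))
  (%t k. (ka - 2 * of_nat k) * t k) (%t. case_nat 0 t)"

definition verma_mod :: "complex => sl2_module" where
 "verma_mod ka = (verma_univ ka)\<lparr>car := cs.span (range unit_vec)\<rparr>"

lemma verma_mod_sel [simp]: "car (verma_mod ka) = cs.span (range unit_vec)"
 "act (verma_mod ka) sl2_e t = (%k. of_nat (Suc k) * (ka - of_nat k) * t (Suc k))"
 "act (verma_mod ka) sl2_h t = (%k. (ka - 2 * of_nat k) * t k)"
 "act (verma_mod ka) sl2_f t = case_nat 0 t"
 by (simp_all add: verma_mod_def verma_univ_def)

lemma unit_vec_in [simp]: "unit_vec k \<in> cs.span (range unit_vec)"
 by (rule cs.span_base) simp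

lemma verma_act:
 "act (verma_mod ka) sl2_f (unit_vec k) = unit_vec (Suc k)"
 "act (verma_mod ka) sl2_e (unit_vec 0) = 0"
 "act (verma_mod ka) sl2_h (unit_vec k) = cscale (ka - 2 * of_nat k) (unit_vec k)"
 by (auto simp: fun_eq_iff cscale_def split: nat.split)

lemma verma_weight_vector:
 assumes "act (verma_mod ka) sl2_h t = cscale (ka - 2 * of_nat k) t"
 shows "t = cscale (t k) (unit_vec k)"
proof
 fix n
 have "(ka - 2 * of_nat n) * t n = (ka - 2 * of_nat k) * t n"
  using fun_cong[OF assms, of n] by (simp add: cscale_def)
 then show "t n = cscale (t k) (unit_vec k) n" by (auto simp: cscale_def)
qed

lemma verma_f_pow: "(act (verma_mod ka) sl2_f ^^ k) (unit_vec 0) = unit_vec k"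
 by (induction k) (simp_all only: funpow.simps comp_apply id_apply verma_act)

lemma verma_mod:
 shows verma_mod_in: "verma_mod ka \<in> sl2_modules"
  and verma_mod_generated: "sl2_rep.hw_generated (car (verma_mod ka)) (act (verma_mod ka) sl2_e) (act (verma_mod ka) sl2_h)
   (act (verma_mod ka) sl2_f) (coset ka) {unit_vec 0}"
  and verma_mod_sum: "verma_sum ka (verma_mod ka)"
proof -
 have "sl2_rep UNIV (%t k. of_nat (Suc k) * (ka - of_nat k) * t (Suc k))
  (%t k. (ka - 2 * of_nat k) * t k) (%t. case_nat 0 t)"
  by unfold_locales (auto simp: linear_on_def cscale_def fun_eq_iff algebra_simps split: nat.split)
 then have U: "verma_univ ka \<in> sl2_modules" unfolding verma_univ_def by (rule sl2_rep.mk_module_in)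
 have act: "act (verma_mod ka) = act (verma_univ ka)" by (simp add: verma_mod_def)
 have pow: "(%k. (act (verma_univ ka) sl2_f ^^ k) (unit_vec 0)) = unit_vec"
  unfolding act[symmetric] by (rule ext) (rule verma_f_pow)
 have "submodule (cs.span (range (%k. (act (verma_univ ka) sl2_f ^^ k) (unit_vec 0)))) (verma_univ ka)"
  by (rule hw_submodule[OF U, of _ ka])
   (use verma_act(2) verma_act(3)[of ka 0] in \<open>simp_all add: act[symmetric] wt_space_def del: verma_mod_sel, simp add: verma_univ_def\<close>)
 then show M: "verma_mod ka \<in> sl2_modules"
  unfolding pow using submodule_restrict[OF U] by (simp add: verma_mod_def)
 interpret sl2_rep "car (verma_mod ka)" "act (verma_mod ka) sl2_e" "act (verma_mod ka) sl2_h" "act (verma_mod ka) sl2_f"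
  by (rule sl2_module_rep[OF M])
 have "ka \<in> coset ka" by (simp add: coset_def)
 moreover have "{(act (verma_mod ka) sl2_f ^^ k) b | k b. b \<in> {unit_vec 0}} = range unit_vec"
  using verma_f_pow by (auto simp del: verma_mod_sel)
 ultimately show "hw_generated (coset ka) {unit_vec 0}"
  unfolding hw_generated_def using verma_act(2) verma_act(3)[of ka 0] by (auto simp del: verma_mod_sel(2-))
 with M show "verma_sum ka (verma_mod ka)" unfolding verma_sum_def by blast
qed

text \<open>The weight space of the generator is a line, and an endomorphism is determined by its
  value there.\<close>

lemma verma_mod_End:
 assumes ph: "arr ph" "src ph = verma_mod ka" "tgt ph = verma_mod ka"
 obtains c where "ph = sl2_scale c (sl2_id (verma_mod ka))"
proof
 let ?L = "verma_mod ka" and ?c = "fn ph (unit_vec 0) 0"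
 have v: "unit_vec 0 \<in> car ?L" by simp
 have "act ?L sl2_h (fn ph (unit_vec 0)) = fn ph (act ?L sl2_h (unit_vec 0))"
  using arr_act[OF ph(1) sl2_basis_in(2), of "unit_vec 0"] v ph(2,3) by simp
 also have "... = cscale (ka - 2 * of_nat 0) (fn ph (unit_vec 0))"
  unfolding verma_act(3) by (rule arr_cscale[OF ph(1)]) (use v ph(2) in simp)
 finally have *: "fn ph (unit_vec 0) = cscale ?c (unit_vec 0)" by (rule verma_weight_vector)
 show "ph = sl2_scale ?c (sl2_id ?L)"
  by (rule arr_eq_on_generators[OF verma_mod_generated ph(1,2)])
   (use * v ph(3) verma_mod_in in \<open>simp_all del: verma_mod_sel\<close>)
qed

text \<open>The pair \<open>0\<close>, \<open>unit_vec 0\<close> generates the tensor product, and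
  its weight \<open>ka - 1\<close> has multiplicity two; so an endomorphism has at most two
  parameters, and \<open>std_casimir\<close> and the identity realise all of them.\<close>

lemma verma_mod_std_End:
 assumes ph: "arr ph" "src ph = sl2_tensor std (verma_mod ka)" "tgt ph = sl2_tensor std (verma_mod ka)"
 obtains x y where "ph = sl2_add (sl2_scale x (std_casimir (verma_mod ka))) (sl2_scale y (sl2_id (sl2_tensor std (verma_mod ka))))"
proof -
 let ?L = "verma_mod ka" and ?VL = "sl2_tensor std (verma_mod ka)"
 have L: "?L \<in> sl2_modules" by (rule verma_mod_in)
 interpret sl2_rep "car ?L" "act ?L sl2_e" "act ?L sl2_h" "act ?L sl2_f" by (rule sl2_module_rep[OF L])
 have v: "unit_vec k \<in> car ?L" for k by simp
 let ?u = "std_pair 0 (unit_vec 0)"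
 have u: "?u \<in> tensor_space (car std) (car ?L)" by (rule std_pair_in[OF sums_in(4) v])
 define a b where "a = trow (fn ph ?u) 0" and "b = trow (fn ph ?u) 1"
 have ab: "fn ph ?u = std_pair a b" "a \<in> car ?L" "b \<in> car ?L"
  using std_tensor_expand[OF subspace_V arr_in'[OF ph, of ?u, unfolded car_tensor, OF u]] unfolding a_def b_def by auto
 have "std_pair (act ?L sl2_h a + a) (act ?L sl2_h b - b) = fn ph (act ?VL sl2_h ?u)"
  using arr_act[OF ph(1) sl2_basis_in(2), of ?u] u unfolding ph(2,3) ab(1) act_std_pair(2)[OF L ab(2,3)] by simp
 also have "act ?VL sl2_h ?u = cscale (ka - 1) ?u"
  unfolding act_std_pair(2)[OF L sums_in(4) v] verma_act(3) by (simp add: std_pair_ops cs.scale_left_diff_distrib del: verma_mod_sel)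
 also have "fn ph (cscale (ka - 1) ?u) = std_pair (cscale (ka - 1) a) (cscale (ka - 1) b)"
  using arr_cscale[OF ph(1), of ?u] u ph(2) ab(1) by (simp add: std_pair_ops)
 finally have "act ?L sl2_h a + a = cscale (ka - 1) a" "act ?L sl2_h b - b = cscale (ka - 1) b" by simp_all
 then have "act ?L sl2_h a = cscale (ka - 2 * of_nat 1) a" "act ?L sl2_h b = cscale (ka - 2 * of_nat 0) b"
  by (simp_all add: fun_eq_iff cscale_def algebra_simps)
 then have ab': "a = cscale (a 1) (unit_vec 1)" "b = cscale (b 0) (unit_vec 0)" by (simp_all only: verma_weight_vector[symmetric])
 \<comment> \<open>\<open>\<Omega>\<close> sends the generator to the pair \<open>2 f v\<close>,
   \<open>- ka v\<close> with \<open>v = unit_vec 0\<close>; matching the two coordinates of the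
   image determines \<open>x\<close> and \<open>y\<close>.\<close>
 define x y where "x = a 1 / 2" and "y = b 0 + x * ka"
 define ps where "ps = sl2_add (sl2_scale x (std_casimir ?L)) (sl2_scale y (sl2_id ?VL))"
 have ps: "arr ps" "src ps = ?VL" "tgt ps = ?VL" unfolding ps_def using L arr_casimir(1)[OF L] by simp_all
 have "fn ps ?u = std_pair (cscale (2 * x) (unit_vec 1)) (cscale (y - x * ka) (unit_vec 0))"
  using u fn_std_casimir[OF sums_in(4) v, of 0] unfolding ps_def
  by (simp add: verma_act std_pair_ops del: verma_mod_sel) (simp add: fun_eq_iff cscale_def algebra_simps)
 also have "... = fn ph ?u" unfolding ab(1) using ab' by (simp add: x_def y_def)
 finally have eq_u: "fn ph ?u = fn ps ?u" ..
 \<comment> \<open>The vectors on which the two endomorphisms agree form a submodule; as it contains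
   the generator, it is everything.\<close>
 define W where "W = {t \<in> tensor_space (car std) (car ?L). fn ph t = fn ps t}"
 have lin: "linear_on (tensor_space (car std) (car ?L)) (fn ph)" "linear_on (tensor_space (car std) (car ?L)) (fn ps)"
  using arr_linear[OF ph(1)] arr_linear[OF ps(1)] unfolding ph(2) ps(2) car_tensor .
 have W: "cs.subspace W" unfolding W_def by (rule linear_on_equalizer_subspace[OF lin subspace_tensor_space])
 have Wact: "act ?VL z t \<in> W" if "t \<in> W" "z \<in> sl2" for z t
  using that arr_act[OF ph(1) that(2), of t] arr_act[OF ps(1) that(2), of t] act_tensor_in[OF std_in L that(2), of t]
  unfolding W_def ph(2,3) ps(2,3) car_tensor by simp
 have W1: "std_pair 0 (unit_vec k) \<in> W" for k
 proof (induction k)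
  case 0 then show ?case unfolding W_def using u eq_u by (simp del: unit_vec_apply verma_mod_sel)
 next
  case (Suc k)
  have "act ?VL sl2_f (std_pair 0 (unit_vec k)) = std_pair 0 (unit_vec (Suc k))"
   unfolding act_std_pair(3)[OF L sums_in(4) v] verma_act by (simp del: verma_mod_sel)
  then show ?case using Wact[OF Suc sl2_basis_in(3)] by (simp del: verma_mod_sel unit_vec_apply)
 qed
 have W0: "std_pair (unit_vec k) 0 \<in> W" for k
 proof (induction k)
  case 0
  have "act ?VL sl2_e ?u = std_pair (unit_vec 0) 0"
   unfolding act_std_pair(1)[OF L sums_in(4) v] verma_act by (simp del: verma_mod_sel)
  then show ?case using Wact[OF W1 sl2_basis_in(1), of 0] by (simp del: verma_mod_sel unit_vec_apply)
 next
  case (Suc k)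
  have "act ?VL sl2_f (std_pair (unit_vec k) 0) = std_pair (unit_vec (Suc k)) 0 + std_pair 0 (unit_vec k)"
   unfolding act_std_pair(3)[OF L v sums_in(4)] verma_act by (simp add: std_pair_ops del: verma_mod_sel)
  then show ?case using cs.subspace_diff[OF W Wact[OF Suc sl2_basis_in(3)] W1[of k]] by (simp del: verma_mod_sel unit_vec_apply)
 qed
 have pair: "linear_on UNIV (%a. std_pair a 0)" "linear_on UNIV (%b. std_pair 0 b)"
  by (rule linear_onI; simp add: std_pair_ops)+
 have "{a. std_pair a 0 \<in> W} = {a \<in> UNIV. std_pair a 0 \<in> W}" "{b. std_pair 0 b \<in> W} = {b \<in> UNIV. std_pair 0 b \<in> W}" by simp_all
 then have "cs.subspace {a. std_pair a 0 \<in> W}" "cs.subspace {b. std_pair 0 b \<in> W}"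
  using linear_on_vimage_subspace[OF pair(1) cs.subspace_UNIV W] linear_on_vimage_subspace[OF pair(2) cs.subspace_UNIV W] by simp_all
 then have "car ?L \<subseteq> {a. std_pair a 0 \<in> W}" "car ?L \<subseteq> {b. std_pair 0 b \<in> W}"
  unfolding verma_mod_sel(1) using W0 W1 by (intro span_sub; auto)+
 then have all: "std_pair a b \<in> W" if "a \<in> car ?L" "b \<in> car ?L" for a b
 proof -
  have "std_pair a b = std_pair a 0 + std_pair 0 b" by (simp add: std_pair_ops)
  then show ?thesis using cs.subspace_add[OF W] that \<open>car ?L \<subseteq> {a. std_pair a 0 \<in> W}\<close> \<open>car ?L \<subseteq> {b. std_pair 0 b \<in> W}\<close> by auto
 qed
 have "ph = ps"
  by (rule arr_std_ext[OF ph(1) ps(1) ph(2) ps(2) _ L]) (use all ph(3) ps(3) in \<open>auto simp: W_def simp del: verma_mod_sel\<close>)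
 then show thesis using that unfolding ps_def by blast
qed

section \<open>Equivalences of module categories\<close>

lemma sl2_comp_linear:
 assumes "arr f" "arr g" "src f = tgt g"
 shows "sl2_comp f (sl2_scale c g) = sl2_scale c (sl2_comp f g)" "sl2_comp (sl2_scale c f) g = sl2_scale c (sl2_comp f g)"
  and "arr g' ==> src g' = src g ==> tgt g' = tgt g ==> sl2_comp f (sl2_add g g') = sl2_add (sl2_comp f g) (sl2_comp f g')"
  and "arr f' ==> src f' = src f ==> tgt f' = tgt f ==> sl2_comp (sl2_add f f') g = sl2_add (sl2_comp f g) (sl2_comp f' g)"
 using assms by (auto intro!: arr_ext simp: arr_cscale arr_plus arr_in)

lemma sl2_assoc_inverse:
 assumes "K \<in> sl2_modules" "M \<in> sl2_modules" "N \<in> sl2_modules"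
 shows "sl2_comp (sl2_assoc_inv K M N) (sl2_assoc K M N) = sl2_id (sl2_tensor (sl2_tensor K M) N)"
  and "sl2_comp (sl2_assoc K M N) (sl2_assoc_inv K M N) = sl2_id (sl2_tensor K (sl2_tensor M N))"
 using assms by (auto intro!: arr_ext simp: fn_assoc assoc_in_tensor_space)

lemma arr_std_trace:
 assumes M: "M \<in> sl2_modules" and ph: "arr ph" "src ph = sl2_tensor std M" "tgt ph = sl2_tensor std M"
 shows "arr (std_trace M ph)" "src (std_trace M ph) = sl2_tensor sl2_trivial M" "tgt (std_trace M ph) = sl2_tensor sl2_trivial M"
 using assms by (simp_all add: std_trace_def)

locale N1_equivalence =
 fixes mu \<nu> :: complex and Fo Fa s
 assumes mu: "mu \<notin> \<int>" and \<nu>: "\<nu> \<notin> \<int>"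
  and module_functor: "module_functor fd_sl2 (N1 mu) (N1 \<nu>) Fo Fa s"
  and equivalence: "equivalence_functor (N1 mu) (N1 \<nu>) Fo Fa"
begin

lemma sel: "Hom (N1 z) = sl2_Hom" "Idn (N1 z) = sl2_id" "Comp (N1 z) = sl2_comp" "Add (N1 z) = sl2_add" "Scale (N1 z) = sl2_scale"
 "ActO (N1 z) = sl2_tensor" "ActA (N1 z) = sl2_tensor_arr" "MAssoc (N1 z) = sl2_assoc" "MUnit (N1 z) = sl2_lunit"
 by (simp_all add: N1_def)

lemma obj: "Obj (N1 mu) = {M. verma_sum mu M}" "Obj (N1 \<nu>) = {M. verma_sum \<nu> M}"
 using Obj_N1 mu \<nu> by auto

definition hom :: "complex => sl2_module => sl2_module => sl2_arrow => bool" where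
 "hom z M N f \<longleftrightarrow> verma_sum z M & verma_sum z N & arr f & src f = M & tgt f = N"

lemma Hom_hom: "verma_sum z M ==> verma_sum z N ==> f \<in> sl2_Hom M N \<longleftrightarrow> hom z M N f"
 using Hom_iff_arr verma_sum_in unfolding hom_def by blast

lemma homD: "hom z M N f ==> arr f" "hom z M N f ==> src f = M" "hom z M N f ==> tgt f = N"
 "hom z M N f ==> verma_sum z M" "hom z M N f ==> verma_sum z N" "hom z M N f ==> M \<in> sl2_modules"  "hom z M N f ==> N \<in> sl2_modules"
 by (auto simp: hom_def verma_sum_in)

lemma linear_functorD:
 assumes F: "linear_functor (N1 a) (N1 b) G Ga" and ab: "Obj (N1 a) = {M. verma_sum a M}" "Obj (N1 b) = {M. verma_sum b M}"
 shows "verma_sum a M ==> verma_sum b (G M)" "verma_sum a M ==> Ga (sl2_id M) = sl2_id (G M)"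
  and "hom a M N f ==> hom b (G M) (G N) (Ga f)" "hom a M N f ==> Ga (sl2_scale c f) = sl2_scale c (Ga f)"
  and "hom a M N f ==> hom a M N f' ==> Ga (sl2_add f f') = sl2_add (Ga f) (Ga f')"
  and "hom a M N f ==> hom a N P g ==> Ga (sl2_comp g f) = sl2_comp (Ga g) (Ga f)"
proof -
 note Fu = F[unfolded linear_functor_def ab sel]
 have 1: "G M \<in> {M. verma_sum b M} & Ga (sl2_id M) = sl2_id (G M)" if "verma_sum a M" for M
  by (rule bspec[OF conjunct1[OF Fu]]) (simp add: that)
 then show G: "verma_sum a M ==> verma_sum b (G M)" "verma_sum a M ==> Ga (sl2_id M) = sl2_id (G M)" for M by auto
 have 2: "Ga f \<in> sl2_Hom (G M) (G N) & (\<forall>x. Ga (sl2_scale x f) = sl2_scale x (Ga f)) &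
   (\<forall>g\<in>sl2_Hom M N. Ga (sl2_add f g) = sl2_add (Ga f) (Ga g)) &
   (\<forall>P\<in>{M. verma_sum a M}. \<forall>g\<in>sl2_Hom N P. Ga (sl2_comp g f) = sl2_comp (Ga g) (Ga f))" if "hom a M N f" for M N f
  by (rule bspec[OF bspec[OF bspec[OF conjunct2[OF Fu]]]])
   (use that homD(4,5)[OF that] Hom_hom[OF homD(4,5)[OF that]] in simp_all)
 show "hom b (G M) (G N) (Ga f)" if f: "hom a M N f"
  using 2[OF f] Hom_hom[OF G(1)[OF homD(4)[OF f]] G(1)[OF homD(5)[OF f]]] by simp
 show "Ga (sl2_scale c f) = sl2_scale c (Ga f)" if f: "hom a M N f" using 2[OF f] by simp
 show "Ga (sl2_add f f') = sl2_add (Ga f) (Ga f')" if f: "hom a M N f" and f': "hom a M N f'"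
  using 2[OF f] f' Hom_hom[OF homD(4,5)[OF f]] by simp
 show "Ga (sl2_comp g f) = sl2_comp (Ga g) (Ga f)" if f: "hom a M N f" and g: "hom a N P g"
  using 2[OF f] g homD(5)[OF g] Hom_hom[OF homD(4,5)[OF g]] by simp
qed

lemma Fa_functor: "linear_functor (N1 mu) (N1 \<nu>) Fo Fa"
 using module_functor unfolding module_functor_def by blast

lemmas F = linear_functorD[OF Fa_functor obj]

lemma natural_isoD:
 assumes "natural_iso (N1 a) (N1 a) Go Ga Ho Ha \<eta>" "Obj (N1 a) = {M. verma_sum a M}"
  "!!M. verma_sum a M ==> verma_sum a (Go M) & verma_sum a (Ho M)"
 shows "hom a M N f ==> sl2_comp (\<eta> N) (Ga f) = sl2_comp (Ha f) (\<eta> M)"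
  and "verma_sum a M ==> \<exists>g. hom a (Go M) (Ho M) (\<eta> M) & hom a (Ho M) (Go M) g &
   sl2_comp g (\<eta> M) = sl2_id (Go M) & sl2_comp (\<eta> M) g = sl2_id (Ho M)"
proof -
 show "sl2_comp (\<eta> N) (Ga f) = sl2_comp (Ha f) (\<eta> M)" if "hom a M N f"
  by (rule bspec[OF bspec[OF bspec[OF conjunct2[OF assms(1)[unfolded natural_iso_def assms(2) sel]]]]])
   (use that homD(4,5)[OF that] Hom_hom[OF homD(4,5)[OF that]] in simp_all)
 assume M: "verma_sum a M"
 then have "\<eta> M \<in> iso_arrows (N1 a) (Go M) (Ho M)"
  by (intro bspec[OF conjunct1[OF assms(1)[unfolded natural_iso_def assms(2)]]]) simp
 then show "\<exists>g. hom a (Go M) (Ho M) (\<eta> M) & hom a (Ho M) (Go M) g &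
   sl2_comp g (\<eta> M) = sl2_id (Go M) & sl2_comp (\<eta> M) g = sl2_id (Ho M)"
  unfolding iso_arrows_def sel using Hom_hom[of a "Go M" "Ho M"] Hom_hom[of a "Ho M" "Go M"] assms(3)[OF M] by auto
qed

text \<open>Naturality of the unit makes \<open>Fa\<close> faithful, that of the counit makes
  \<open>Ga\<close> faithful. For fullness a preimage is built from the unit; it is correct because
  \<open>Ga\<close> cannot tell its image from \<open>ps\<close>.\<close>

lemma full_faithful:
 shows faithful: "hom mu M N f ==> hom mu M N g ==> Fa f = Fa g ==> f = g"
  and full: "verma_sum mu M ==> verma_sum mu N ==> hom \<nu> (Fo M) (Fo N) ps ==> \<exists>ph. hom mu M N ph & Fa ph = ps"
proof -
 obtain Go Ga \<eta> \<epsilon> where G: "linear_functor (N1 \<nu>) (N1 mu) Go Ga"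
  and \<eta>: "natural_iso (N1 mu) (N1 mu) id id (Go \<circ> Fo) (Ga \<circ> Fa) \<eta>"
  and \<epsilon>: "natural_iso (N1 \<nu>) (N1 \<nu>) (Fo \<circ> Go) (Fa \<circ> Ga) id id \<epsilon>"
  using equivalence unfolding equivalence_functor_def by (elim conjE exE) (rule that)
 note G = linear_functorD[OF G obj(2,1)]
 have \<eta>n: "sl2_comp (\<eta> N) f = sl2_comp (Ga (Fa f)) (\<eta> M)" if "hom mu M N f" for M N f
  using natural_isoD(1)[OF \<eta> obj(1) _ that] F(1) G(1) by simp
 have \<eta>i: "\<exists>g. hom mu M (Go (Fo M)) (\<eta> M) & hom mu (Go (Fo M)) M g &
   sl2_comp g (\<eta> M) = sl2_id M & sl2_comp (\<eta> M) g = sl2_id (Go (Fo M))" if "verma_sum mu M" for M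
  using natural_isoD(2)[OF \<eta> obj(1) _ that] F(1) G(1) by simp
 have \<epsilon>n: "sl2_comp (\<epsilon> N) (Fa (Ga f)) = sl2_comp f (\<epsilon> M)" if "hom \<nu> M N f" for M N f
  using natural_isoD(1)[OF \<epsilon> obj(2) _ that] F(1) G(1) by simp
 have \<epsilon>i: "\<exists>g. hom \<nu> (Fo (Go M)) M (\<epsilon> M) & hom \<nu> M (Fo (Go M)) g &
   sl2_comp g (\<epsilon> M) = sl2_id (Fo (Go M)) & sl2_comp (\<epsilon> M) g = sl2_id M" if "verma_sum \<nu> M" for M
  using natural_isoD(2)[OF \<epsilon> obj(2) _ that] F(1) G(1) by simp
 show "f = g" if f: "hom mu M N f" and g: "hom mu M N g" and eq: "Fa f = Fa g" for M N f g
 proof -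
  obtain k where k: "hom mu N (Go (Fo N)) (\<eta> N)" "hom mu (Go (Fo N)) N k" "sl2_comp k (\<eta> N) = sl2_id N"
   using \<eta>i[OF homD(5)[OF f]] by blast
  have "sl2_comp k (sl2_comp (\<eta> N) f) = sl2_comp k (sl2_comp (\<eta> N) g)" unfolding \<eta>n[OF f] \<eta>n[OF g] eq ..
  then show ?thesis using k f g homD(1-3)[OF f] homD(1-3)[OF g] homD(1-3)[OF k(1)] homD(1-3)[OF k(2)]
   by (simp add: sl2_comp_assoc[symmetric])
 qed
 have Gf: "f = g" if f: "hom \<nu> M N f" and g: "hom \<nu> M N g" and eq: "Ga f = Ga g" for M N f g
 proof -
  obtain k where k: "hom \<nu> (Fo (Go M)) M (\<epsilon> M)" "hom \<nu> M (Fo (Go M)) k" "sl2_comp (\<epsilon> M) k = sl2_id M"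
   using \<epsilon>i[OF homD(4)[OF f]] by blast
  have "sl2_comp (sl2_comp f (\<epsilon> M)) k = sl2_comp (sl2_comp g (\<epsilon> M)) k" unfolding \<epsilon>n[OF f, symmetric] \<epsilon>n[OF g, symmetric] eq ..
  then show ?thesis using k f g homD(1-3)[OF f] homD(1-3)[OF g] homD(1-3)[OF k(1)] homD(1-3)[OF k(2)]
   by (simp add: sl2_comp_assoc)
 qed
 assume M: "verma_sum mu M" and N: "verma_sum mu N" and ps: "hom \<nu> (Fo M) (Fo N) ps"
 obtain k where k: "hom mu M (Go (Fo M)) (\<eta> M)" "hom mu (Go (Fo M)) M k" "sl2_comp (\<eta> M) k = sl2_id (Go (Fo M))"
  using \<eta>i[OF M] by blast
 obtain l where l: "hom mu N (Go (Fo N)) (\<eta> N)" "hom mu (Go (Fo N)) N l" "sl2_comp (\<eta> N) l = sl2_id (Go (Fo N))"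
  using \<eta>i[OF N] by blast
 note Gps = G(3)[OF ps]
 note hs = homD(1-3)[OF k(1)] homD(1-3)[OF k(2)] homD(1-3)[OF l(1)] homD(1-3)[OF l(2)] homD(1-3)[OF Gps]
 define ph where "ph = sl2_comp l (sl2_comp (Ga ps) (\<eta> M))"
 have ph: "hom mu M N ph" unfolding ph_def hom_def using hs M N by simp
 note Fph = F(3)[OF ph]
 have "Ga (Fa ph) = sl2_comp (sl2_comp (Ga (Fa ph)) (\<eta> M)) k"
  using hs homD(1-3)[OF G(3)[OF Fph]] k(3) by (simp add: sl2_comp_assoc)
 also have "... = sl2_comp (sl2_comp (sl2_comp (\<eta> N) l) (sl2_comp (Ga ps) (\<eta> M))) k"
  unfolding \<eta>n[OF ph, symmetric] unfolding ph_def using hs by (simp add: sl2_comp_assoc)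
 also have "... = Ga ps" unfolding l(3) using hs k(3) by (simp add: sl2_comp_assoc)
 finally show "\<exists>ph. hom mu M N ph & Fa ph = ps" using ph Gf[OF Fph ps] by blast
qed

lemma tensor_obj: "fd X ==> verma_sum mu M ==> verma_sum mu (sl2_tensor X M)"
 "fd X ==> verma_sum \<nu> N ==> verma_sum \<nu> (sl2_tensor X N)"
 using verma_sum_tensor mu \<nu> by auto

lemmas module_functor_conds = module_functor[unfolded module_functor_def obj sel fd_sl2_sel, THEN conjunct2]

lemma structure_iso:
 assumes X: "fd X" and M: "verma_sum mu M"
 shows structure_hom: "hom \<nu> (Fo (sl2_tensor X M)) (sl2_tensor X (Fo M)) (s X M)"
  and structure_inv: "\<exists>g. hom \<nu> (sl2_tensor X (Fo M)) (Fo (sl2_tensor X M)) g &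
   sl2_comp g (s X M) = sl2_id (Fo (sl2_tensor X M)) & sl2_comp (s X M) g = sl2_id (sl2_tensor X (Fo M))"
proof -
 have "s X M \<in> iso_arrows (N1 \<nu>) (Fo (sl2_tensor X M)) (sl2_tensor X (Fo M))"
  by (rule bspec[OF bspec[OF conjunct1[OF module_functor_conds]]]) (simp_all add: X M)
 moreover have "verma_sum \<nu> (Fo (sl2_tensor X M))" "verma_sum \<nu> (sl2_tensor X (Fo M))"
  using F(1) tensor_obj X M by blast+
 ultimately show "hom \<nu> (Fo (sl2_tensor X M)) (sl2_tensor X (Fo M)) (s X M)"
  "\<exists>g. hom \<nu> (sl2_tensor X (Fo M)) (Fo (sl2_tensor X M)) g &
   sl2_comp g (s X M) = sl2_id (Fo (sl2_tensor X M)) & sl2_comp (s X M) g = sl2_id (sl2_tensor X (Fo M))"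
  unfolding iso_arrows_def sel
  using Hom_hom[of \<nu> "Fo (sl2_tensor X M)" "sl2_tensor X (Fo M)"] Hom_hom[of \<nu> "sl2_tensor X (Fo M)" "Fo (sl2_tensor X M)"] by auto
qed

lemma structure_natural:
 assumes "fd X" "fd Y" "arr f" "src f = X" "tgt f = Y" "hom mu M N g"
 shows "sl2_comp (s Y N) (Fa (sl2_tensor_arr f g)) = sl2_comp (sl2_tensor_arr f (Fa g)) (s X M)"
proof -
 have "f \<in> sl2_Hom X Y" "g \<in> sl2_Hom M N" using assms Hom_iff_arr homD[OF assms(6)] by auto
 then show ?thesis
  by (intro bspec[OF bspec[OF bspec[OF bspec[OF bspec[OF bspec[OF conjunct1[OF conjunct2[OF module_functor_conds]]]]]]]])
   (use assms(1,2) homD(4,5)[OF assms(6)] in simp_all)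
qed

lemma structure_assoc:
 assumes "fd X" "fd Y" "verma_sum mu M"
 shows "sl2_comp (sl2_tensor_arr (sl2_id X) (s Y M)) (sl2_comp (s X (sl2_tensor Y M)) (Fa (sl2_assoc X Y M))) =
  sl2_comp (sl2_assoc X Y (Fo M)) (s (sl2_tensor X Y) M)"
 by (rule bspec[OF bspec[OF bspec[OF conjunct1[OF conjunct2[OF conjunct2[OF module_functor_conds]]]]]]) (simp_all add: assms)

text \<open>The structure isomorphism is moved through the composite factor by factor: by naturality
  past \<open>std_coev\<close>, \<open>ph\<close> and \<open>std_ev\<close>, and by the
  associativity axiom past the associators.\<close>

lemma trace_transport:
 assumes M: "verma_sum mu M" and ph: "hom mu (sl2_tensor std M) (sl2_tensor std M) ph"
  and ps: "hom \<nu> (sl2_tensor std (Fo M)) (sl2_tensor std (Fo M)) ps" and eq: "sl2_comp (s std M) (Fa ph) = sl2_comp ps (s std M)"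
 shows "sl2_comp (s sl2_trivial M) (Fa (std_trace M ph)) = sl2_comp (std_trace (Fo M) ps) (s sl2_trivial M)"
proof -
 have V: "fd std" and I: "fd sl2_trivial" and VV: "fd (sl2_tensor std std)" by (simp_all add: finite_dimensional_tensor)
 have objs: "verma_sum mu (sl2_tensor std M)" "verma_sum mu (sl2_tensor std (sl2_tensor std M))"
  "verma_sum mu (sl2_tensor (sl2_tensor std std) M)" "verma_sum mu (sl2_tensor sl2_trivial M)"
  using tensor_obj V I VV M by blast+
 have Mi: "M \<in> sl2_modules" "Fo M \<in> sl2_modules" using verma_sum_in M F(1) by blast+
 let ?ev = "sl2_tensor_arr std_ev (sl2_id M)" and ?co = "sl2_tensor_arr std_coev (sl2_id M)"
 let ?ai = "sl2_assoc_inv std std M" and ?as = "sl2_assoc std std M" and ?t = "\<lambda>ph. sl2_tensor_arr (sl2_id std) ph"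
 let ?ev' = "sl2_tensor_arr std_ev (sl2_id (Fo M))" and ?co' = "sl2_tensor_arr std_coev (sl2_id (Fo M))"
 let ?ai' = "sl2_assoc_inv std std (Fo M)" and ?as' = "sl2_assoc std std (Fo M)"
 let ?sV = "s std M" and ?sVV = "s (sl2_tensor std std) M" and ?sVm = "s std (sl2_tensor std M)" and ?sI = "s sl2_trivial M"
 have h: "hom mu (sl2_tensor (sl2_tensor std std) M) (sl2_tensor sl2_trivial M) ?ev"
  "hom mu (sl2_tensor sl2_trivial M) (sl2_tensor (sl2_tensor std std) M) ?co"
  "hom mu (sl2_tensor (sl2_tensor std std) M) (sl2_tensor std (sl2_tensor std M)) ?as"
  "hom mu (sl2_tensor std (sl2_tensor std M)) (sl2_tensor (sl2_tensor std std) M) ?ai"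
  "hom mu (sl2_tensor std (sl2_tensor std M)) (sl2_tensor std (sl2_tensor std M)) (?t ph)"
  and idM: "hom mu M M (sl2_id M)"
  unfolding hom_def using objs Mi M homD(1-3)[OF ph] by simp_all
 have hc: "hom z A C (sl2_comp g f)" if "hom z A B f" "hom z B C g" for z A B C f g using that by (simp add: hom_def)
 note Fh = homD(1-3)[OF F(3)[OF h(1)]] homD(1-3)[OF F(3)[OF h(2)]] homD(1-3)[OF F(3)[OF h(3)]] homD(1-3)[OF F(3)[OF h(4)]]
  homD(1-3)[OF F(3)[OF h(5)]] homD(1-3)[OF F(3)[OF ph]]
 note sh = homD(1-3)[OF structure_hom[OF V M]] homD(1-3)[OF structure_hom[OF VV M]] homD(1-3)[OF structure_hom[OF V objs(1)]]
  homD(1-3)[OF structure_hom[OF I M]]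
 note ar = Fh sh Mi homD(1-3)[OF ps]
 have N1: "sl2_comp ?sI (Fa ?ev) = sl2_comp ?ev' ?sVV" and N2: "sl2_comp ?sVV (Fa ?co) = sl2_comp ?co' ?sI"
  using structure_natural[OF VV I _ _ _ idM, of std_ev] structure_natural[OF I VV _ _ _ idM, of std_coev] F(2)[OF M] by simp_all
 have N3: "sl2_comp ?sVm (Fa (?t ph)) = sl2_comp (?t (Fa ph)) ?sVm"
  using structure_natural[OF V V _ _ _ ph, of "sl2_id std"] by simp
 have A: "sl2_comp (?t ?sV) (sl2_comp ?sVm (Fa ?as)) = sl2_comp ?as' ?sVV" by (rule structure_assoc[OF V V M])
 have P: "sl2_comp (?t ?sV) (?t (Fa ph)) = sl2_comp (?t ps) (?t ?sV)"
  using sl2_tensor_arr_functorial(1)[of "sl2_id std" "Fa ph" "sl2_id std" ?sV] sl2_tensor_arr_functorial(1)[of "sl2_id std" ?sV "sl2_id std" ps]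
   ar eq by simp
 have Fas: "sl2_comp (Fa ?as) (Fa ?ai) = sl2_id (Fo (sl2_tensor std (sl2_tensor std M)))"
  using F(6)[OF h(4,3)] F(2)[OF objs(2)] sl2_assoc_inverse(2)[OF std_in std_in Mi(1)] by simp
 \<comment> \<open>The axiom speaks of the associator itself; the statement for its inverse follows
   by cancelling on both sides.\<close>
 have A': "sl2_comp ?sVV (Fa ?ai) = sl2_comp ?ai' (sl2_comp (?t ?sV) ?sVm)"
 proof -
  have "sl2_comp ?sVV (Fa ?ai) = sl2_comp (sl2_comp ?ai' ?as') (sl2_comp ?sVV (Fa ?ai))"
   using ar by (simp add: sl2_assoc_inverse)
  also have "... = sl2_comp ?ai' (sl2_comp (sl2_comp ?as' ?sVV) (Fa ?ai))" using ar by (simp add: sl2_comp_assoc)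
  also have "... = sl2_comp ?ai' (sl2_comp (?t ?sV) (sl2_comp ?sVm (sl2_comp (Fa ?as) (Fa ?ai))))"
   unfolding A[symmetric] using ar by (simp add: sl2_comp_assoc)
  also have "... = sl2_comp ?ai' (sl2_comp (?t ?sV) ?sVm)" unfolding Fas using ar by simp
  finally show ?thesis .
 qed
 note c1 = hc[OF h(2,3)]
 note c2 = hc[OF c1 h(5)]
 note c3 = hc[OF c2 h(4)]
 have "Fa (std_trace M ph) = sl2_comp (Fa ?ev) (sl2_comp (Fa ?ai) (sl2_comp (Fa (?t ph)) (sl2_comp (Fa ?as) (Fa ?co))))"
  unfolding std_trace_def F(6)[OF c3 h(1)] F(6)[OF c2 h(4)] F(6)[OF c1 h(5)] F(6)[OF h(2,3)] ..
 then have "sl2_comp ?sI (Fa (std_trace M ph)) =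
   sl2_comp (sl2_comp ?sI (Fa ?ev)) (sl2_comp (Fa ?ai) (sl2_comp (Fa (?t ph)) (sl2_comp (Fa ?as) (Fa ?co))))"
  using ar by (simp add: sl2_comp_assoc)
 also have "... = sl2_comp ?ev' (sl2_comp (sl2_comp ?sVV (Fa ?ai)) (sl2_comp (Fa (?t ph)) (sl2_comp (Fa ?as) (Fa ?co))))"
  unfolding N1 using ar by (simp add: sl2_comp_assoc)
 also have "... = sl2_comp ?ev' (sl2_comp ?ai' (sl2_comp (?t ?sV) (sl2_comp (sl2_comp ?sVm (Fa (?t ph))) (sl2_comp (Fa ?as) (Fa ?co)))))"
  unfolding A' using ar by (simp add: sl2_comp_assoc)
 also have "... = sl2_comp ?ev' (sl2_comp ?ai' (sl2_comp (sl2_comp (?t ?sV) (?t (Fa ph))) (sl2_comp ?sVm (sl2_comp (Fa ?as) (Fa ?co)))))"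
  unfolding N3 using ar by (simp add: sl2_comp_assoc)
 also have "... = sl2_comp ?ev' (sl2_comp ?ai' (sl2_comp (?t ps) (sl2_comp (sl2_comp (?t ?sV) (sl2_comp ?sVm (Fa ?as))) (Fa ?co))))"
  unfolding P using ar by (simp add: sl2_comp_assoc)
 also have "... = sl2_comp ?ev' (sl2_comp ?ai' (sl2_comp (?t ps) (sl2_comp ?as' (sl2_comp ?sVV (Fa ?co)))))"
  unfolding A using ar by (simp add: sl2_comp_assoc)
 also have "... = sl2_comp (std_trace (Fo M) ps) ?sI"
  unfolding N2 std_trace_def using ar by (simp add: sl2_comp_assoc)
 finally show ?thesis .
qed

end

text \<open>The diagonal blocks are \<open>h\<close> and \<open>- h\<close>.\<close>

lemma std_trace_casimir:
 assumes M: "M \<in> sl2_modules"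
 shows "std_trace M (std_casimir M) = sl2_scale 0 (sl2_id (sl2_tensor sl2_trivial M))"
proof -
 interpret sl2_rep "car M" "act M sl2_e" "act M sl2_h" "act M sl2_f" by (rule sl2_module_rep[OF M])
 note tr = arr_std_trace[OF M arr_casimir(1)[OF M] casimir_sel(1,2)]
 show ?thesis
 proof (rule arr_ext_tensor[of _ _ sl2_trivial M])
  fix u m assume u: "u \<in> car sl2_trivial" and m: "m \<in> car M"
  have um: "tensor sl2_unit_vector m \<in> car (sl2_tensor sl2_trivial M)" using m by simp
  have "tensor u m = cscale (u 0) (tensor sl2_unit_vector m)"
   using u by (subst (asm) car_trivial_iff) (metis tensor_scale_left)
  moreover have "fn (std_trace M (std_casimir M)) (tensor sl2_unit_vector m) = 0"
   unfolding fn_std_trace[OF M arr_casimir(1)[OF M] casimir_sel(1,2) m]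
   using m by (simp add: tensor_unit_vec fn_std_casimir)
  ultimately have "fn (std_trace M (std_casimir M)) (tensor u m) = 0"
   using um arr_cscale[OF tr(1), of "tensor sl2_unit_vector m" "u 0"] tr(2) by simp
  then show "fn (std_trace M (std_casimir M)) (tensor u m) = fn (sl2_scale 0 (sl2_id (sl2_tensor sl2_trivial M))) (tensor u m)"
   using u m by simp
 qed (use tr M in simp_all)
qed

context N1_equivalence
begin

text \<open>The image is nonzero because a faithful functor cannot identify the identity with zero;
  a nonzero sum of Verma modules has a highest weight generator, on which the Casimir is read
  off.\<close>

lemma highest_weight:
 obtains w m where "w \<in> coset \<nu>" "m \<in> car (Fo (verma_mod mu))" "m ~= 0" "fn (casimir (Fo (verma_mod mu))) m = cscale (w * w + 2 * w) m"
proof -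
 let ?L = "verma_mod mu" and ?M = "Fo (verma_mod mu)"
 note L = verma_mod_in[of mu] and LS = verma_mod_sum[of mu]
 have MS: "verma_sum \<nu> ?M" by (rule F(1)[OF LS])
 interpret M: verma ?M \<nu> by (rule vermaI[OF \<nu> MS])
 obtain B where B: "M.hw_generated (coset \<nu>) B" "cs.independent B" by (rule M.basis)
 have idL: "hom mu ?L ?L (sl2_id ?L)" "hom mu ?L ?L (sl2_scale 0 (sl2_id ?L))" using LS L by (simp_all add: hom_def)
 note idL0 = idL(2) and idL = idL(1)
 have "B ~= {}"
 proof
  assume "B = {}"
  then have "car ?M \<subseteq> {0}" using M.hw_generatedD(3)[OF B(1)] by simp
  then have "v = 0" if "v \<in> car ?M" for v using that by auto
  then have "sl2_id ?M = sl2_scale 0 (sl2_id ?M)"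
   by (intro arr_ext) (use verma_sum_in[OF MS] in auto)
  then have "Fa (sl2_id ?L) = Fa (sl2_scale 0 (sl2_id ?L))"
   unfolding F(2)[OF LS] F(4)[OF idL] .
  then have "sl2_id ?L = sl2_scale 0 (sl2_id ?L)"
   by (rule faithful[OF idL idL0])
  then have "fn (sl2_id ?L) (unit_vec 0) = fn (sl2_scale 0 (sl2_id ?L)) (unit_vec 0)" by simp
  then have "unit_vec 0 = 0" by (simp del: unit_vec_apply)
  then have "unit_vec 0 0 = 0" by (simp only: zero_fun_def)
  then show False by simp
 qed
 then obtain b where b: "b \<in> B" by blast
 obtain w where w: "w \<in> coset \<nu>" "b \<in> wt_space (car ?M) (act ?M sl2_h) w" using M.hw_generatedD(6)[OF B(1) b] by blast
 have bM: "b \<in> car ?M" and eb: "act ?M sl2_e b = 0" using M.hw_generatedD(4,5)[OF B(1) b] by auto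
 have "fn (casimir ?M) b = cscale (w * w + 2 * w) b"
  using w(2) bM eb unfolding casimir_def by (simp add: wt_space_def M.lin_simps cs.scale_left_distrib)
 moreover have "b ~= 0" using b B(2) cs.dependent_zero by blast
 ultimately show thesis using that w(1) bM by blast
qed

text \<open>By fullness every endomorphism of the image comes from an endomorphism of
  \<open>verma_mod mu\<close>, hence from a scalar.\<close>

lemma casimir_scalar:
 obtains c where "casimir (Fo (verma_mod mu)) = sl2_scale c (sl2_id (Fo (verma_mod mu)))"
proof -
 let ?L = "verma_mod mu" and ?M = "Fo (verma_mod mu)"
 note L = verma_mod_in[of mu] and LS = verma_mod_sum[of mu]
 have MS: "verma_sum \<nu> ?M" by (rule F(1)[OF LS])
 have "hom \<nu> ?M ?M (casimir ?M)" by (simp add: hom_def MS arr_casimir[OF verma_sum_in[OF MS]])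
 then obtain ph where ph: "hom mu ?L ?L ph" "Fa ph = casimir ?M" using full[OF LS LS] by blast
 obtain c where "ph = sl2_scale c (sl2_id ?L)" by (rule verma_mod_End[OF homD(1-3)[OF ph(1)]])
 then have "casimir ?M = sl2_scale c (sl2_id ?M)"
  using ph(2) F(4)[of ?L ?L "sl2_id ?L" c] F(2)[OF LS] LS L by (simp add: hom_def del: verma_mod_sel)
 then show thesis by (rule that)
qed

lemma weights_related: "\<nu> - mu \<in> \<int> \<or> \<nu> + mu \<in> \<int>"
proof -
 let ?L = "verma_mod mu" and ?M = "Fo (verma_mod mu)"
 let ?VL = "sl2_tensor std ?L" and ?VM = "sl2_tensor std ?M" and ?s = "s std ?L" and ?T = "std_casimir ?M"
 note L = verma_mod_in[of mu] and LS = verma_mod_sum[of mu]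
 have V: "fd std" and I: "fd sl2_trivial" by simp_all
 note MS = F(1)[OF LS]
 note M = verma_sum_in[OF MS]
 note VLS = tensor_obj(1)[OF V LS] and VMS = tensor_obj(2)[OF V MS] and ILS = tensor_obj(1)[OF I LS] and IMS = tensor_obj(2)[OF I MS]
 obtain w m where w: "w \<in> coset \<nu>" and m: "m \<in> car ?M" "m ~= 0" "fn (casimir ?M) m = cscale (w * w + 2 * w) m"
  by (rule highest_weight)
 obtain c where c: "casimir ?M = sl2_scale c (sl2_id ?M)" by (rule casimir_scalar)
 have cw: "c = w * w + 2 * w" using m unfolding c by simp
 have T: "hom \<nu> ?VM ?VM ?T" by (simp add: hom_def VMS arr_casimir[OF M])
 have T2: "sl2_add (sl2_comp ?T ?T) (sl2_scale 2 ?T) = sl2_scale c (sl2_id ?VM)"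
 proof (rule arr_std_ext[of _ _ ?M])
  fix a b assume ab: "a \<in> car ?M" "b \<in> car ?M"
  then have "std_pair a b \<in> tensor_space (car std) (car ?M)" by simp
  then show "fn (sl2_add (sl2_comp ?T ?T) (sl2_scale 2 ?T)) (std_pair a b) = fn (sl2_scale c (sl2_id ?VM)) (std_pair a b)"
   using std_casimir_square[OF M ab] ab unfolding c by (simp add: std_pair_ops)
 qed (use homD(1-3)[OF T] M in simp_all)
 note sh = homD(1-3)[OF structure_hom[OF V LS]] and sI = homD(1-3)[OF structure_hom[OF I LS]]
 obtain r where r: "hom \<nu> ?VM (Fo ?VL) r" "sl2_comp r ?s = sl2_id (Fo ?VL)" "sl2_comp ?s r = sl2_id ?VM"
  using structure_inv[OF V LS] by blast
 obtain rI where rI: "hom \<nu> (sl2_tensor sl2_trivial ?M) (Fo (sl2_tensor sl2_trivial ?L)) rI"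
  "sl2_comp rI (s sl2_trivial ?L) = sl2_id (Fo (sl2_tensor sl2_trivial ?L))"
  using structure_inv[OF I LS] by blast
 note rs = homD(1-3)[OF r(1)] and Ts = homD(1-3)[OF T]
 have FVL: "verma_sum \<nu> (Fo ?VL)" by (rule F(1)[OF VLS])
 \<comment> \<open>\<open>\<Omega>\<close> over the image is transported through the structure
   isomorphism and, by fullness, lifted to an endomorphism \<open>ph\<close> of
   \<open>V \<otimes> L\<close>.\<close>
 have "hom \<nu> (Fo ?VL) (Fo ?VL) (sl2_comp r (sl2_comp ?T ?s))"
  using rs sh Ts FVL by (simp add: hom_def)
 then obtain ph where ph: "hom mu ?VL ?VL ph" and Fph: "Fa ph = sl2_comp r (sl2_comp ?T ?s)" using full[OF VLS VLS] by blast
 note phs = homD(1-3)[OF ph]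
 obtain x y where xy: "ph = sl2_add (sl2_scale x (std_casimir ?L)) (sl2_scale y (sl2_id ?VL))"
  by (rule verma_mod_std_End[OF phs])
 have "sl2_comp ?s (Fa ph) = sl2_comp (sl2_comp ?s r) (sl2_comp ?T ?s)" unfolding Fph using rs sh Ts by (simp add: sl2_comp_assoc)
 then have sph: "sl2_comp ?s (Fa ph) = sl2_comp ?T ?s" unfolding r(3) using rs sh Ts by simp
 let ?IL = "sl2_tensor sl2_trivial ?L" and ?IM = "sl2_tensor sl2_trivial ?M"
 have tr: "hom mu ?IL ?IL (std_trace ?L ph)" using arr_std_trace[OF L phs] ILS by (simp add: hom_def)
 have idI: "hom mu ?IL ?IL (sl2_id ?IL)" "hom mu ?IL ?IL (sl2_scale 0 (sl2_id ?IL))" using ILS L by (simp_all add: hom_def)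
 note trs = homD(1-3)[OF F(3)[OF tr]] and rIs = homD(1-3)[OF rI(1)]
 \<comment> \<open>The partial trace of \<open>ph\<close> vanishes together with that of
   \<open>\<Omega>\<close> over the image. As the trace of \<open>x \<Omega> + y\<close> is
   \<open>2 y\<close>, this will give \<open>y = 0\<close>.\<close>
 have "Fa (std_trace ?L ph) = sl2_comp rI (sl2_comp (s sl2_trivial ?L) (Fa (std_trace ?L ph)))"
  using rI(2) sI trs rIs by (simp add: sl2_comp_assoc[symmetric])
 also have "... = sl2_scale 0 (sl2_id (Fo ?IL))"
  unfolding trace_transport[OF LS ph T sph] std_trace_casimir[OF M]
  using rI(2) sI rIs M by (simp add: sl2_comp_linear)
 also have "... = Fa (sl2_scale 0 (sl2_id ?IL))" using F(4)[OF idI(1)] F(2)[OF ILS] by simp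
 finally have trace0: "std_trace ?L ph = sl2_scale 0 (sl2_id ?IL)" by (rule faithful[OF tr idI(2)])
 interpret L: sl2_rep "car ?L" "act ?L sl2_e" "act ?L sl2_h" "act ?L sl2_f" by (rule sl2_module_rep[OF L])
 have v: "unit_vec k \<in> car ?L" for k by simp
 have fnph: "fn ph (std_pair a b) = cscale x (fn (std_casimir ?L) (std_pair a b)) + cscale y (std_pair a b)"
  if "a \<in> car ?L" "b \<in> car ?L" for a b
  using std_pair_in[OF that] unfolding xy by (simp del: verma_mod_sel)
 have Tv: "fn (std_casimir ?L) (std_pair 0 (unit_vec 0)) = std_pair (cscale 2 (unit_vec 1)) (cscale (- mu) (unit_vec 0))"
  "fn (std_casimir ?L) (std_pair (unit_vec 0) 0) = std_pair (cscale mu (unit_vec 0)) 0"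
  unfolding fn_std_casimir[OF L.sums_in(4) v] fn_std_casimir[OF v L.sums_in(4)] verma_act by (simp_all del: verma_mod_sel unit_vec_apply)
 have phv: "fn ph (std_pair 0 (unit_vec 0)) = std_pair (cscale (2 * x) (unit_vec 1)) (cscale (y - x * mu) (unit_vec 0))"
  "fn ph (std_pair (unit_vec 0) 0) = std_pair (cscale (x * mu + y) (unit_vec 0)) 0"
  unfolding fnph[OF L.sums_in(4) v] fnph[OF v L.sums_in(4)] Tv
  by (simp_all add: std_pair_ops cs.scale_left_distrib cs.scale_left_diff_distrib mult.commute del: unit_vec_apply)
 have "tensor sl2_unit_vector (cscale (2 * y) (unit_vec 0)) = fn (std_trace ?L ph) (tensor sl2_unit_vector (unit_vec 0))"
  unfolding fn_std_trace[OF L phs v] tensor_unit_vec One_nat_def phv trow_std_pair cs.scale_left_distrib[symmetric] by simp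
 also have "... = 0" unfolding trace0 using tensor_in[OF unit_vector_in v, of 0] by (simp del: verma_mod_sel)
 finally have "tensor sl2_unit_vector (cscale (2 * y) (unit_vec 0)) (prod_encode (0, 0)) = 0" by (simp only: zero_fun_def)
 then have y: "y = 0" by (simp add: sl2_unit_vector_def cscale_def)
 have Fs: "hom mu ?VL ?VL (sl2_comp ph ph)" "hom mu ?VL ?VL (sl2_scale 2 ph)" "hom mu ?VL ?VL (sl2_id ?VL)"
  "hom mu ?VL ?VL (sl2_add (sl2_comp ph ph) (sl2_scale 2 ph))" "hom mu ?VL ?VL (sl2_scale c (sl2_id ?VL))"
  using VLS phs L by (simp_all add: hom_def)
 \<comment> \<open>The relation \<open>\<Omega>^2 + 2 \<Omega> = c\<close> over the image survives
   conjugation by the structure isomorphism and is reflected by faithfulness, so \<open>ph\<close>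
   satisfies it with the same \<open>c\<close>.\<close>
 have "Fa (sl2_add (sl2_comp ph ph) (sl2_scale 2 ph)) = sl2_add (sl2_comp (Fa ph) (Fa ph)) (sl2_scale 2 (Fa ph))"
  using F(5)[OF Fs(1,2)] F(6)[OF ph ph] F(4)[OF ph] by simp
 also have "sl2_comp (Fa ph) (Fa ph) = sl2_comp r (sl2_comp ?T (sl2_comp (sl2_comp ?s r) (sl2_comp ?T ?s)))"
  unfolding Fph using rs sh Ts by (simp add: sl2_comp_assoc)
 also have "... = sl2_comp r (sl2_comp (sl2_comp ?T ?T) ?s)" unfolding r(3) using rs sh Ts by (simp add: sl2_comp_assoc)
 also have "sl2_add (sl2_comp r (sl2_comp (sl2_comp ?T ?T) ?s)) (sl2_scale 2 (Fa ph)) =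
   sl2_comp r (sl2_comp (sl2_add (sl2_comp ?T ?T) (sl2_scale 2 ?T)) ?s)"
  unfolding Fph using rs sh Ts by (simp add: sl2_comp_linear)
 also have "... = sl2_scale c (sl2_id (Fo ?VL))"
  unfolding T2 using rs sh r(2) M by (simp add: sl2_comp_linear)
 also have "... = Fa (sl2_scale c (sl2_id ?VL))" using F(4)[OF Fs(3)] F(2)[OF VLS] by simp
 finally have quad: "sl2_add (sl2_comp ph ph) (sl2_scale 2 ph) = sl2_scale c (sl2_id ?VL)" by (rule faithful[OF Fs(4,5)])
 let ?u = "std_pair 0 (unit_vec 0)"
 have u: "?u \<in> tensor_space (car std) (car ?L)" by (rule std_pair_in[OF L.sums_in(4) v])
 note TL = arr_casimir(1)[OF L]
 have "fn ph (fn ph ?u) + cscale 2 (fn ph ?u) = cscale c ?u"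
  using arg_cong[OF quad, of "%g. fn g ?u"] u phs by (simp del: verma_mod_sel)
 moreover have "fn ph (fn ph ?u) = cscale (x * x) (std_pair 0 (cscale (mu * mu + 2 * mu) (unit_vec 0)) - cscale 2 (fn (std_casimir ?L) ?u))"
 proof -
  have Tu: "fn (std_casimir ?L) ?u \<in> tensor_space (car std) (car ?L)" using arr_in'[OF TL casimir_sel(1,2)] u by (simp del: verma_mod_sel)
  have "fn ph t = cscale x (fn (std_casimir ?L) t)" if "t \<in> tensor_space (car std) (car ?L)" for t
   using that unfolding xy y by (simp del: verma_mod_sel)
  then have "fn ph (fn ph ?u) = cscale (x * x) (fn (std_casimir ?L) (fn (std_casimir ?L) ?u))"
   using u Tu arr_cscale[OF TL, of "fn (std_casimir ?L) ?u" x] cs.subspace_scale[OF subspace_tensor_space Tu, of x] by (simp del: verma_mod_sel)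
  moreover have "fn (std_casimir ?L) (fn (std_casimir ?L) ?u) + cscale 2 (fn (std_casimir ?L) ?u) = std_pair 0 (cscale (mu * mu + 2 * mu) (unit_vec 0))"
  proof -
   have "act ?L sl2_h (unit_vec 0) = cscale mu (unit_vec 0)" using verma_act(3)[of mu 0] by simp
   then have "fn (casimir ?L) (unit_vec 0) = cscale (mu * mu + 2 * mu) (unit_vec 0)"
    using v[of 0] verma_act(2)[of mu] unfolding casimir_def
    by (simp add: L.lin_simps cs.scale_left_distrib del: verma_mod_sel unit_vec_apply)
   moreover have "fn (casimir ?L) 0 = 0" by (rule arr_0[OF arr_casimir(2)[OF L]])
   ultimately show ?thesis unfolding std_casimir_square[OF L L.sums_in(4) v] by simp
  qed
  ultimately show ?thesis by (simp add: eq_diff_eq[symmetric])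
 qed
 ultimately have "cscale (x * x) (std_pair 0 (cscale (mu * mu + 2 * mu) (unit_vec 0)) - cscale 2 (std_pair (cscale 2 (unit_vec 1)) (cscale (- mu) (unit_vec 0)))) +
   cscale 2 (std_pair (cscale (2 * x) (unit_vec 1)) (cscale (- x * mu) (unit_vec 0))) = cscale c ?u"
  unfolding Tv phv y by simp
 then have rows: "trow (cscale (x * x) (std_pair 0 (cscale (mu * mu + 2 * mu) (unit_vec 0)) - cscale 2 (std_pair (cscale 2 (unit_vec 1)) (cscale (- mu) (unit_vec 0)))) +
   cscale 2 (std_pair (cscale (2 * x) (unit_vec 1)) (cscale (- x * mu) (unit_vec 0)))) n k = trow (cscale c ?u) n k" for n k by simp
 \<comment> \<open>In the upper row the coordinate at \<open>unit_vec 1\<close> forces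
   \<open>x^2 = x\<close>; in the lower row the coordinate at \<open>unit_vec 0\<close> evaluates
   \<open>c\<close>.\<close>
 have x: "x * x * 4 = 4 * x" and cx: "x * x * (mu * mu + 2 * mu + 2 * mu) - 2 * x * mu = c"
  using rows[of 0 1, unfolded trow_simps trow_std_pair] rows[of 1 0, unfolded One_nat_def trow_simps trow_std_pair]
  by (simp_all add: cscale_def algebra_simps)
 have "x = 0 \<or> x = 1" using x by (simp add: mult.commute)
 moreover have "x ~= 0"
 proof
  assume "x = 0"
  \<comment> \<open>\<open>x = 0\<close> would give \<open>c = 0\<close> and hence an integral
    \<open>w\<close>, which the coset of \<open>\<nu>\<close> excludes.\<close>
  then have "w * (w + 2) = 0" using cx cw by (simp add: algebra_simps)
  then have "w = 0 \<or> w = - 2" by (simp add: eq_neg_iff_add_eq_0)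
  then have "w \<in> \<int>" by auto
  then show False using coset_nonint[OF \<nu> w] by blast
 qed
 ultimately have "x = 1" by simp
 then have "w * w + 2 * w = mu * mu + 2 * mu" using cx unfolding cw by (simp add: add.commute)
 \<comment> \<open>Equality of the Casimir scalars is \<open>(w + 1)^2 = (mu + 1)^2\<close>; the two
   factors are the two alternatives of the conclusion.\<close>
 then have zero: "(w - mu) * (w + mu + 2) = 0" by algebra
 have w\<nu>: "w - \<nu> \<in> \<int>" using w by (simp add: coset_def)
 consider "w - mu = 0" | "w + mu + 2 = 0" using zero mult_eq_0_iff by blast
 then show ?thesis
 proof cases
  case 1
  have "- (w - \<nu>) \<in> \<int>" by (rule Ints_minus[OF w\<nu>])
  moreover have "- (w - \<nu>) = \<nu> - mu - (w - mu)" by simp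
  ultimately have "\<nu> - mu \<in> \<int>" unfolding 1 by (simp only: diff_zero)
  then show ?thesis by (rule disjI1)
 next
  case 2
  have "- (w - \<nu>) - 2 \<in> \<int>" by (rule Ints_diff[OF Ints_minus[OF w\<nu>] Ints_numeral])
  moreover have "- (w - \<nu>) - 2 = \<nu> + mu - (w + mu + 2)" by (simp add: algebra_simps)
  ultimately have "\<nu> + mu \<in> \<int>" unfolding 2 by (simp only: diff_zero)
  then show ?thesis by (rule disjI2)
 qed
qed

end

lemma module_equivalent_refl:
 assumes mu: "mu \<notin> \<int>"
 shows "module_equivalent fd_sl2 (N1 mu) (N1 mu)"
proof -
 note cat = N1_module_category[OF mu]
 have sub: "Obj (N1 mu) \<subseteq> sl2_modules" using Obj_N1[OF mu] verma_sum_in by auto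
 have sel: "Hom (N1 mu) = sl2_Hom" "Idn (N1 mu) = sl2_id" "Comp (N1 mu) = sl2_comp" "ActO (N1 mu) = sl2_tensor"
  "ActA (N1 mu) = sl2_tensor_arr" "MAssoc (N1 mu) = sl2_assoc" "MUnit (N1 mu) = sl2_lunit" by (simp_all add: N1_def)
 have lin: "linear_functor (N1 mu) (N1 mu) id id" unfolding linear_functor_def by simp
 have iso: "sl2_id M \<in> iso_arrows (N1 mu) M M" if "M \<in> sl2_modules" for M
  by (rule iso_arrowsI[of _ _ _ _ "sl2_id M"]) (use that in \<open>simp_all add: sel\<close>)
 have arr: "arr f & src f = M & tgt f = N" if "f \<in> sl2_Hom M N" "M \<in> sl2_modules" "N \<in> sl2_modules" for f M N
  using that Hom_iff_arr by blast
 have nat: "natural_iso (N1 mu) (N1 mu) id id id id sl2_id"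
  unfolding natural_iso_def sel
 proof (intro conjI ballI)
  fix M N f assume "M \<in> Obj (N1 mu)" "N \<in> Obj (N1 mu)" "f \<in> sl2_Hom M N"
  then have "arr f & src f = M & tgt f = N" using arr sub by blast
  then show "sl2_comp (sl2_id N) (id f) = sl2_comp (id f) (sl2_id M)" by simp
 qed (use iso sub in auto)
 have "equivalence_functor (N1 mu) (N1 mu) id id"
  unfolding equivalence_functor_def
  by (rule conjI[OF lin], intro exI[of _ id] exI[of _ sl2_id]) (simp add: lin nat)
 moreover have "module_functor fd_sl2 (N1 mu) (N1 mu) id id (\<lambda>X M. sl2_id (sl2_tensor X M))"
  unfolding module_functor_def sel fd_sl2_sel
 proof (intro conjI ballI)
  fix X Y M N f g assume a: "X \<in> {M \<in> sl2_modules. finite_dimensional M}" "Y \<in> {M \<in> sl2_modules. finite_dimensional M}"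
   "M \<in> Obj (N1 mu)" "N \<in> Obj (N1 mu)" "f \<in> sl2_Hom X Y" "g \<in> sl2_Hom M N"
  then have "arr f & src f = X & tgt f = Y" "arr g & src g = M & tgt g = N" using arr sub by auto
  then show "sl2_comp (sl2_id (sl2_tensor Y N)) (id (sl2_tensor_arr f g)) = sl2_comp (sl2_tensor_arr f (id g)) (sl2_id (sl2_tensor X M))"
   by simp
 next
  fix X Y M assume "X \<in> {M \<in> sl2_modules. finite_dimensional M}" "Y \<in> {M \<in> sl2_modules. finite_dimensional M}" "M \<in> Obj (N1 mu)"
  then show "sl2_comp (sl2_tensor_arr (sl2_id X) (sl2_id (sl2_tensor Y M))) (sl2_comp (sl2_id (sl2_tensor X (sl2_tensor Y M))) (id (sl2_assoc X Y M))) =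
    sl2_comp (sl2_assoc X Y (id M)) (sl2_id (sl2_tensor (sl2_tensor X Y) M))"
   using sub by (auto simp: sl2_tensor_arr_id subset_iff)
 qed (use lin iso sub in \<open>auto simp: subset_iff\<close>)
 ultimately show ?thesis unfolding module_equivalent_def using cat by blast
qed

theorem proposition11:
  fixes \<mu>1 \<mu>2 :: complex
  assumes "\<mu>1 \<notin> \<int>" and "\<mu>2 \<notin> \<int>"
  shows "module_equivalent fd_sl2 (N1 \<mu>1) (N1 \<mu>2) \<longleftrightarrow>
    (\<exists>k::int. \<mu>2 = \<mu>1 + of_int k \<or> \<mu>2 = - \<mu>1 + of_int k)"
proof
 assume "module_equivalent fd_sl2 (N1 \<mu>1) (N1 \<mu>2)"
 then obtain Fo Fa s where "module_functor fd_sl2 (N1 \<mu>1) (N1 \<mu>2) Fo Fa s" "equivalence_functor (N1 \<mu>1) (N1 \<mu>2) Fo Fa"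
  unfolding module_equivalent_def by (elim conjE exE)
 then interpret N1_equivalence \<mu>1 \<mu>2 Fo Fa s by (rule N1_equivalence.intro[OF assms])
 from weights_related show "\<exists>k::int. \<mu>2 = \<mu>1 + of_int k \<or> \<mu>2 = - \<mu>1 + of_int k"
 proof
  assume "\<mu>2 - \<mu>1 \<in> \<int>"
  then obtain k where "\<mu>2 - \<mu>1 = of_int k" by (rule Ints_cases)
  then show ?thesis by (intro exI[of _ k] disjI1) (simp add: diff_eq_eq add.commute)
 next
  assume "\<mu>2 + \<mu>1 \<in> \<int>"
  then obtain k where "\<mu>2 + \<mu>1 = of_int k" by (rule Ints_cases)
  then show ?thesis by (intro exI[of _ k] disjI2) (simp add: eq_diff_eq add.commute)
 qed
next
 assume "\<exists>k::int. \<mu>2 = \<mu>1 + of_int k \<or> \<mu>2 = - \<mu>1 + of_int k"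
 then consider k where "\<mu>2 - \<mu>1 = of_int k" | k where "\<mu>2 - (- \<mu>1) = of_int k" by auto
 then show "module_equivalent fd_sl2 (N1 \<mu>1) (N1 \<mu>2)"
 proof cases
  case 1
  then have "N1 \<mu>2 = N1 \<mu>1" by (intro N1_cong) simp
  then show ?thesis using module_equivalent_refl[OF assms(1)] by simp
 next
  case 2
  have "N1 \<mu>2 = N1 (- \<mu>1)" by (rule N1_cong) (simp only: 2 Ints_of_int)
  then show ?thesis using seq_module_equivalent[OF assms(1)] by simp
 qed
qed

end
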